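(* Let $\Omega\subseteq\mathbb{R}^N$ be a nonempty open subset, $0<m\le1$, $a\in\mathbb{C}$ with $\Im(a)>0$, and if $m<1$ assume further $2\sqrt m\,\Im(a)\ge(1-m)|\Re(a)|$ and $|\Omega|<\infty$. Let $u_0\in L^2(\Omega)$, $f\in L^1((0,\infty);L^2(\Omega))$, and let $u$ be the unique weak solution of $\mathrm{i}u_t+\Delta u+a|u|^{-(1-m)}u=f$ in $(0,\infty)\times\Omega$, $u=0$ on $(0,\infty)\times\partial\Omega$, $u(0)=u_0$. Then $\lim_{t\to\infty}\|u(t)\|_{L^p(\Omega)}=0$ for every $p\in(0,2]$ (only for $p=2$ if $m=1$ and $|\Omega|=\infty$).
   Context: Convention: $|z|^{-(1-m)}z:=0$ for $z=0$. $L^2(\Omega)$ is identified with its dual. An $H^2$-solution with right-hand side $g\in L^1_{\mathrm{loc}}([0,\infty);L^2(\Omega))$ is a function $v\in L^{m+1}_{\mathrm{loc}}([0,\infty);H^1_0(\Omega)\cap L^{m+1}(\Omega))\cap W^{1,\frac{m+1}{m}}_{\mathrm{loc}}([0,\infty);L^2(\Omega)+L^{\frac{m+1}{m}}(\Omega))$ with $\Delta v(t)\in L^2(\Omega)$ for a.e. $t>0$ and $\mathrm{i}v_t+\Delta v+a|v|^{-(1-m)}v=g$ in $\mathscr{D}'((0,\infty)\times\Omega)$. A weak solution is a $u$ for which there exist $f_n\in L^1_{\mathrm{loc}}([0,\infty);L^2(\Omega))$ and $H^2$-solutions $u_n\in C([0,\infty);L^2(\Omega))$ with right-hand side $f_n$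 such that for all $T>0$, $f_n\to f$ in $L^1((0,T);L^2(\Omega))$ and $u_n\to u$ in $C([0,T];L^2(\Omega))$, and $u(0)=u_0$. *)

theory Defs
  imports "HOL-Analysis.Analysis"
begin

definition nl :: "real \<Rightarrow> complex \<Rightarrow> complex" where
  "nl m z = (if z = 0 then 0 else complex_of_real (cmod z powr (m - 1)) * z)"

definition epow :: "ennreal \<Rightarrow> real \<Rightarrow> ennreal" where
  "epow x r = (if x = \<infinity> then \<infinity> else ennreal (enn2real x powr r))"

definition Lpow :: "'b::euclidean_space set \<Rightarrow> real \<Rightarrow> ('b \<Rightarrow> complex) \<Rightarrow> ennreal" where
  "Lpow S p w = (\<integral>\<^sup>+ x\<in>S. ennreal (cmod (w x) powr p) \<partial>lebesgue)"

definition Lnorm :: "'b::euclidean_space set \<Rightarrow> real \<Rightarrow> ('b \<Rightarrow> complex) \<Rightarrow> ennreal" where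
  "Lnorm S p w = epow (Lpow S p w) (1 / p)"

definition memL :: "'b::euclidean_space set \<Rightarrow> real \<Rightarrow> ('b \<Rightarrow> complex) \<Rightarrow> bool" where
  "memL S p w \<longleftrightarrow> w \<in> borel_measurable lebesgue \<and> Lpow S p w < \<infinity>"

definition dderiv :: "'b::real_normed_vector \<Rightarrow> ('b \<Rightarrow> complex) \<Rightarrow> 'b \<Rightarrow> complex" where
  "dderiv v f x = vector_derivative (\<lambda>s::real. f (x + s *\<^sub>R v)) (at 0)"

fun diter :: "'b::real_normed_vector list \<Rightarrow> ('b \<Rightarrow> complex) \<Rightarrow> 'b \<Rightarrow> complex" where
  "diter [] f = f"
| "diter (v # vs) f = dderiv v (diter vs f)"

definition smooth_fun :: "('b::real_normed_vector \<Rightarrow> complex) \<Rightarrow> bool" where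
  "smooth_fun f \<longleftrightarrow>
     (\<forall>vs. continuous_on UNIV (diter vs f)) \<and>
     (\<forall>vs v x. (\<lambda>s::real. diter vs f (x + s *\<^sub>R v)) differentiable (at 0))"

definition test_fun :: "'b::real_normed_vector set \<Rightarrow> ('b \<Rightarrow> complex) \<Rightarrow> bool" where
  "test_fun U \<phi> \<longleftrightarrow> smooth_fun \<phi> \<and> compact (closure {x. \<phi> x \<noteq> 0})
                     \<and> closure {x. \<phi> x \<noteq> 0} \<subseteq> U"

definition lap :: "('a::euclidean_space \<Rightarrow> complex) \<Rightarrow> 'a \<Rightarrow> complex" where
  "lap \<phi> x = (\<Sum>i\<in>Basis. dderiv i (dderiv i \<phi>) x)"

definition dt :: "(real \<times> 'a::euclidean_space \<Rightarrow> complex) \<Rightarrow> real \<times> 'a \<Rightarrow> complex" where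
  "dt \<Phi> = dderiv (1, 0) \<Phi>"

definition lapx :: "(real \<times> 'a::euclidean_space \<Rightarrow> complex) \<Rightarrow> real \<times> 'a \<Rightarrow> complex" where
  "lapx \<Phi> z = (\<Sum>i\<in>Basis. dderiv (0, i) (dderiv (0, i) \<Phi>) z)"

text \<open>w \<in> H^1_0(\<Omega>) with (weak) gradient G (components G i, i \<in> Basis):
  w is the H^1-limit of C_c^\<infinity>(\<Omega>) functions.\<close>
definition H10 :: "'a::euclidean_space set \<Rightarrow> ('a \<Rightarrow> complex) \<Rightarrow> ('a \<Rightarrow> 'a \<Rightarrow> complex) \<Rightarrow> bool" where
  "H10 \<Omega> w G \<longleftrightarrow> memL \<Omega> 2 w \<and> (\<forall>i\<in>Basis. memL \<Omega> 2 (\<lambda>x. G x i)) \<and>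
     (\<exists>\<phi>. (\<forall>k. test_fun \<Omega> (\<phi> k)) \<and>
          (\<lambda>k. Lnorm \<Omega> 2 (\<lambda>x. \<phi> k x - w x)) \<longlonglongrightarrow> 0 \<and>
          (\<forall>i\<in>Basis. (\<lambda>k. Lnorm \<Omega> 2 (\<lambda>x. dderiv i (\<phi> k) x - G x i)) \<longlonglongrightarrow> 0))"

definition H1norm :: "'a::euclidean_space set \<Rightarrow> ('a \<Rightarrow> complex) \<Rightarrow> ('a \<Rightarrow> 'a \<Rightarrow> complex) \<Rightarrow> ennreal" where
  "H1norm \<Omega> w G = epow (Lpow \<Omega> 2 w + (\<Sum>i\<in>Basis. Lpow \<Omega> 2 (\<lambda>x. G x i))) (1/2)"

section \<open>Time-dependent functions (represented jointly in (t,x))\<close>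

definition jmeas :: "(real \<Rightarrow> 'a::euclidean_space \<Rightarrow> complex) \<Rightarrow> bool" where
  "jmeas v \<longleftrightarrow> (\<lambda>z. v (fst z) (snd z)) \<in> borel_measurable borel"

definition L1loc_L2 :: "'a::euclidean_space set \<Rightarrow> (real \<Rightarrow> 'a \<Rightarrow> complex) \<Rightarrow> bool" where
  "L1loc_L2 \<Omega> g \<longleftrightarrow> jmeas g \<and> (\<forall>T>0. (\<integral>\<^sup>+ t\<in>{0<..<T}. Lnorm \<Omega> 2 (g t) \<partial>lborel) < \<infinity>)"

definition L1_L2 :: "'a::euclidean_space set \<Rightarrow> (real \<Rightarrow> 'a \<Rightarrow> complex) \<Rightarrow> bool" where
  "L1_L2 \<Omega> g \<longleftrightarrow> jmeas g \<and> (\<integral>\<^sup>+ t\<in>{0<..}. Lnorm \<Omega> 2 (g t) \<partial>lborel) < \<infinity>"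

definition C_L2 :: "'a::euclidean_space set \<Rightarrow> (real \<Rightarrow> 'a \<Rightarrow> complex) \<Rightarrow> bool" where
  "C_L2 \<Omega> v \<longleftrightarrow> (\<forall>t\<ge>0. memL \<Omega> 2 (v t)) \<and>
     (\<forall>t\<ge>0. ((\<lambda>s. Lnorm \<Omega> 2 (\<lambda>x. v s x - v t x)) \<longlongrightarrow> 0) (at t within {0..}))"

text \<open>v \<in> L^q_loc([0,\<infinity>); L^2(\<Omega>) + L^q(\<Omega>)), via a measurable splitting v = v1 + v2\<close>
definition Lqloc_sum :: "'a::euclidean_space set \<Rightarrow> real \<Rightarrow> (real \<Rightarrow> 'a \<Rightarrow> complex) \<Rightarrow> bool" where
  "Lqloc_sum \<Omega> q v \<longleftrightarrow> (\<exists>v1 v2. jmeas v1 \<and> jmeas v2 \<and> (\<forall>t x. v t x = v1 t x + v2 t x) \<and>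
     (\<forall>T>0. (\<integral>\<^sup>+ t\<in>{0<..<T}. epow (Lnorm \<Omega> 2 (v1 t) + Lnorm \<Omega> q (v2 t)) q \<partial>lborel) < \<infinity>))"

definition H2_solution :: "real \<Rightarrow> complex \<Rightarrow> 'a::euclidean_space set \<Rightarrow>
    (real \<Rightarrow> 'a \<Rightarrow> complex) \<Rightarrow> (real \<Rightarrow> 'a \<Rightarrow> complex) \<Rightarrow> bool" where
  "H2_solution m a \<Omega> g v \<longleftrightarrow>
     jmeas v \<and>
     \<comment> \<open>v \<in> L^{m+1}_loc([0,\<infinity>); H^1_0(\<Omega>) \<inter> L^{m+1}(\<Omega>))\<close>
     (\<exists>G. (\<forall>i\<in>Basis. jmeas (\<lambda>t x. G t x i)) \<and>
          (AE t in lborel. t > 0 \<longrightarrow> H10 \<Omega> (v t) (G t) \<and> memL \<Omega> (m + 1) (v t)) \<and>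
          (\<forall>T>0. (\<integral>\<^sup>+ t\<in>{0<..<T}. epow (H1norm \<Omega> (v t) (G t) + Lnorm \<Omega> (m + 1) (v t)) (m + 1)
                     \<partial>lborel) < \<infinity>)) \<and>
     \<comment> \<open>v \<in> W^{1,(m+1)/m}_loc([0,\<infinity>); L^2(\<Omega>) + L^{(m+1)/m}(\<Omega>))\<close>
     Lqloc_sum \<Omega> ((m + 1) / m) v \<and>
     (\<exists>w. Lqloc_sum \<Omega> ((m + 1) / m) w \<and>
          (\<forall>\<Phi>. test_fun ({0<..} \<times> \<Omega>) \<Phi> \<longrightarrow>
             (LINT z:{0<..} \<times> \<Omega>|lebesgue. v (fst z) (snd z) * dt \<Phi> z)
               = - (LINT z:{0<..} \<times> \<Omega>|lebesgue. w (fst z) (snd z) * \<Phi> z))) \<and>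
     \<comment> \<open>\<Delta>v(t) \<in> L^2(\<Omega>) for a.e. t > 0\<close>
     (AE t in lborel. t > 0 \<longrightarrow>
        (\<exists>h. memL \<Omega> 2 h \<and> (\<forall>\<phi>. test_fun \<Omega> \<phi> \<longrightarrow>
            (LINT x:\<Omega>|lebesgue. v t x * lap \<phi> x) = (LINT x:\<Omega>|lebesgue. h x * \<phi> x)))) \<and>
     \<comment> \<open>i v_t + \<Delta>v + a |v|^{-(1-m)} v = g in D'((0,\<infinity>) \<times> \<Omega>)\<close>
     (\<forall>\<Phi>. test_fun ({0<..} \<times> \<Omega>) \<Phi> \<longrightarrow>
        (LINT z:{0<..} \<times> \<Omega>|lebesgue.
            - \<i> * v (fst z) (snd z) * dt \<Phi> z + v (fst z) (snd z) * lapx \<Phi> z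
            + a * nl m (v (fst z) (snd z)) * \<Phi> z - g (fst z) (snd z) * \<Phi> z) = 0)"

definition weak_solution :: "real \<Rightarrow> complex \<Rightarrow> 'a::euclidean_space set \<Rightarrow>
    (real \<Rightarrow> 'a \<Rightarrow> complex) \<Rightarrow> ('a \<Rightarrow> complex) \<Rightarrow> (real \<Rightarrow> 'a \<Rightarrow> complex) \<Rightarrow> bool" where
  "weak_solution m a \<Omega> f u0 u \<longleftrightarrow>
     (\<forall>t\<ge>0. u t \<in> borel_measurable lebesgue) \<and>
     (\<exists>fn un. (\<forall>n. L1loc_L2 \<Omega> (fn n) \<and> C_L2 \<Omega> (un n) \<and> H2_solution m a \<Omega> (fn n) (un n)) \<and>
        (\<forall>T>0. (\<lambda>n. \<integral>\<^sup>+ t\<in>{0<..<T}. Lnorm \<Omega> 2 (\<lambda>x. fn n t x - f t x) \<partial>lborel) \<longlonglongrightarrow> 0 \<and>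
               (\<lambda>n. SUP t\<in>{0..T}. Lnorm \<Omega> 2 (\<lambda>x. un n t x - u t x)) \<longlonglongrightarrow> 0)) \<and>
     Lnorm \<Omega> 2 (\<lambda>x. u 0 x - u0 x) = 0"

end

theory Submission
  imports Defs
begin

text \<open>
  For two solutions \<open>u\<close>, \<open>v\<close> with right-hand sides \<open>f\<close>, \<open>g\<close>, monotonicity of the damping gives
  \<open>d/dt \<parallel>u - v\<parallel>\<^sup>2 \<le> 2 \<parallel>f - g\<parallel> \<parallel>u - v\<parallel>\<close>. Comparing \<open>u\<close> with \<open>0\<close> shows that \<open>\<integral> \<parallel>u\<parallel>\<^sub>m\<^sub>+\<^sub>1 ^ (m + 1) dt\<close> is bounded and
  that a small norm stays small once the tail of \<open>f\<close> is small; comparing \<open>u\<close> with its time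
  translates shows that increments \<open>u (t + h) - u t\<close> with \<open>h\<close> small stay small for all later \<open>t\<close>.
  The average \<open>z\<close> of \<open>u\<close> over a window of length \<open>h\<close> is therefore close to \<open>u\<close>, and the equation, integrated
  over the window, bounds \<open>\<Delta>z\<close> and hence \<open>\<nabla>z\<close> in \<open>L\<^sup>2\<close>. A Nash inequality then turns smallness of
  the dissipation on one window into smallness of \<open>z\<close>, and so of \<open>u\<close>, in \<open>L\<^sup>2\<close>. All bounds are uniform in the
  approximating solutions.
\<close>

section \<open>Square-integrable functions\<close>

text \<open>Weak solutions are only limits of approximating solutions, so the equation is never
  available for \<open>u\<close> itself and every constant has to be fixed before an approximation
  is chosen. Two further obstacles shape the proof. The forcing is only \<open>L^1\<close> in time,
  so the approximating solutions have no uniform gradient bound at individual times; and their time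
  derivative is only a distribution, so the equation cannot be paired with the solution. The average
  over a window cures both: it is differentiable in time, its derivative being a difference
  quotient, and it satisfies \<open>- Delta z = l\<close> with \<open>l\<close> in
  \<open>L^2\<close>. The imaginary part of the pairing of \<open>l\<close> with \<open>z\<close>
  vanishes, which gives the energy inequality as the window shrinks; the real part controls the
  gradient for a fixed window. For \<open>m < 1\<close> the dissipation yields only an
  \<open>L^1\<close> bound, through the finite measure of the domain. The domain may be unbounded
  and irregular, so translations on the whole space take the place of compactness. For
  \<open>m = 1\<close> the dissipation is the squared \<open>L^2\<close> norm itself.\<close>

definition sq_integrable :: "'b measure \<Rightarrow> ('b \<Rightarrow> complex) \<Rightarrow> bool" where
  "sq_integrable M f \<longleftrightarrow> f \<in> borel_measurable M \<and> integrable M (\<lambda>x. (cmod (f x))\<^sup>2)"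

definition l2norm :: "'b measure \<Rightarrow> ('b \<Rightarrow> complex) \<Rightarrow> real" where
  "l2norm M f = sqrt (LINT x|M. (cmod (f x))\<^sup>2)"

definition l2inner :: "'b measure \<Rightarrow> ('b \<Rightarrow> complex) \<Rightarrow> ('b \<Rightarrow> complex) \<Rightarrow> complex" where
  "l2inner M f g = (LINT x|M. f x * cnj (g x))"

lemma borel_measurable_cnj [measurable]: "cnj \<in> borel_measurable borel"
  by (intro borel_measurable_continuous_onI continuous_intros)

lemma sq_integrable_measurable: "sq_integrable M f \<Longrightarrow> f \<in> borel_measurable M"
  by (simp add: sq_integrable_def)

lemma sq_integrableI:
  assumes "f \<in> borel_measurable M" "(\<integral>\<^sup>+x. ennreal ((cmod (f x))\<^sup>2) \<partial>M) < \<infinity>"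
  shows "sq_integrable M f"
  unfolding sq_integrable_def using assms by (auto intro!: integrableI_bounded)

lemma sq_integrable_nn: "sq_integrable M f \<Longrightarrow>
    (\<integral>\<^sup>+x. ennreal ((cmod (f x))\<^sup>2) \<partial>M) = ennreal ((l2norm M f)\<^sup>2)"
  unfolding sq_integrable_def l2norm_def by (subst nn_integral_eq_integral) auto

lemma l2norm_nonneg [simp]: "0 \<le> l2norm M f"
  by (simp add: l2norm_def)

lemma l2norm_power2: "(l2norm M f)\<^sup>2 = (LINT x|M. (cmod (f x))\<^sup>2)"
  by (simp add: l2norm_def)

lemma sq_integrable_bound:
  assumes "sq_integrable M g" "f \<in> borel_measurable M" "\<And>x. cmod (f x) \<le> c * cmod (g x)"
  shows "sq_integrable M f"
proof -
  have "integrable M (\<lambda>x. c\<^sup>2 * (cmod (g x))\<^sup>2)" using assms(1) by (simp add: sq_integrable_def)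
  then have "integrable M (\<lambda>x. (cmod (f x))\<^sup>2)"
  proof (rule Bochner_Integration.integrable_bound)
    show "(\<lambda>x. (cmod (f x))\<^sup>2) \<in> borel_measurable M" using assms(2) by measurable
    have "(cmod (f x))\<^sup>2 \<le> (c * cmod (g x))\<^sup>2" for x using assms(3) by (intro power_mono) auto
    then show "AE x in M. norm ((cmod (f x))\<^sup>2) \<le> norm (c\<^sup>2 * (cmod (g x))\<^sup>2)"
      by (simp add: power_mult_distrib)
  qed
  then show ?thesis using assms by (simp add: sq_integrable_def)
qed

lemma sq_integrable_norm_mult:
  assumes "sq_integrable M f" "sq_integrable M g"
  shows "integrable M (\<lambda>x. cmod (f x) * cmod (g x))"
proof (rule Bochner_Integration.integrable_bound)
  show "integrable M (\<lambda>x. (cmod (f x))\<^sup>2 + (cmod (g x))\<^sup>2)" using assms by (simp add: sq_integrable_def)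
  have "norm (cmod (f x) * cmod (g x)) \<le> norm ((cmod (f x))\<^sup>2 + (cmod (g x))\<^sup>2)" for x
  proof -
    have "0 \<le> cmod (f x) * cmod (g x)" by simp
    then have "cmod (f x) * cmod (g x) \<le> (cmod (f x))\<^sup>2 + (cmod (g x))\<^sup>2"
      using sum_squares_bound[of "cmod (f x)" "cmod (g x)"] by linarith
    then show ?thesis by simp
  qed
  then show "AE x in M. norm (cmod (f x) * cmod (g x)) \<le> norm ((cmod (f x))\<^sup>2 + (cmod (g x))\<^sup>2)"
    by (rule AE_I2)
  show "(\<lambda>x. cmod (f x) * cmod (g x)) \<in> borel_measurable M"
    using assms[THEN sq_integrable_measurable] by measurable
qed

lemma sq_integrable_inner:
  assumes "sq_integrable M f" "sq_integrable M g"
  shows "integrable M (\<lambda>x. f x * cnj (g x))"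
proof (rule Bochner_Integration.integrable_bound[OF sq_integrable_norm_mult[OF assms]])
  show "(\<lambda>x. f x * cnj (g x)) \<in> borel_measurable M"
    using assms[THEN sq_integrable_measurable] by measurable
qed (simp add: norm_mult)

lemma sq_integrable_mult:
  assumes "sq_integrable M f" "sq_integrable M g"
  shows "integrable M (\<lambda>x. f x * g x)"
proof (rule Bochner_Integration.integrable_bound[OF sq_integrable_norm_mult[OF assms]])
  show "(\<lambda>x. f x * g x) \<in> borel_measurable M"
    using assms[THEN sq_integrable_measurable] by measurable
qed (simp add: norm_mult)

lemma sq_integrable_add:
  assumes "sq_integrable M f" "sq_integrable M g"
  shows "sq_integrable M (\<lambda>x. f x + g x)"
  unfolding sq_integrable_def
proof
  show m: "(\<lambda>x. f x + g x) \<in> borel_measurable M"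
    using assms[THEN sq_integrable_measurable] by measurable
  show "integrable M (\<lambda>x. (cmod (f x + g x))\<^sup>2)"
  proof (rule Bochner_Integration.integrable_bound)
    show "integrable M (\<lambda>x. 2 * (cmod (f x))\<^sup>2 + 2 * (cmod (g x))\<^sup>2)" using assms by (simp add: sq_integrable_def)
    show "(\<lambda>x. (cmod (f x + g x))\<^sup>2) \<in> borel_measurable M" using m by measurable
    have "norm ((cmod (f x + g x))\<^sup>2) \<le> norm (2 * (cmod (f x))\<^sup>2 + 2 * (cmod (g x))\<^sup>2)" for x
    proof -
      have "(cmod (f x + g x))\<^sup>2 \<le> (cmod (f x) + cmod (g x))\<^sup>2"
        by (intro power_mono norm_triangle_ineq) auto
      also have "\<dots> \<le> 2 * (cmod (f x))\<^sup>2 + 2 * (cmod (g x))\<^sup>2"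
        using sum_squares_bound[of "cmod (f x)" "cmod (g x)"] by (simp add: power2_sum)
      finally show ?thesis by simp
    qed
    then show "AE x in M. norm ((cmod (f x + g x))\<^sup>2) \<le> norm (2 * (cmod (f x))\<^sup>2 + 2 * (cmod (g x))\<^sup>2)"
      by (rule AE_I2)
  qed
qed

lemma sq_integrable_scale:
  assumes "sq_integrable M f" shows "sq_integrable M (\<lambda>x. c * f x)"
proof (rule sq_integrable_bound[OF assms, where c="cmod c"])
  show "(\<lambda>x. c * f x) \<in> borel_measurable M"
    using assms[THEN sq_integrable_measurable] by measurable
qed (simp add: norm_mult)

lemma sq_integrable_uminus:
  assumes "sq_integrable M f" shows "sq_integrable M (\<lambda>x. - f x)"
  using sq_integrable_scale[OF assms, of "-1"] by simp

lemma sq_integrable_diff: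
  assumes "sq_integrable M f" "sq_integrable M g"
  shows "sq_integrable M (\<lambda>x. f x - g x)"
  using sq_integrable_add[OF assms(1) sq_integrable_uminus[OF assms(2)]] by simp

lemma sq_integrable_cnj:
  assumes "sq_integrable M f" shows "sq_integrable M (\<lambda>x. cnj (f x))"
proof (rule sq_integrable_bound[OF assms, where c=1])
  show "(\<lambda>x. cnj (f x)) \<in> borel_measurable M"
    using assms[THEN sq_integrable_measurable] by measurable
qed simp

lemma sq_integrable_zero [simp]: "sq_integrable M (\<lambda>x. 0)"
  by (simp add: sq_integrable_def)

lemma sq_integrable_sum:
  assumes "\<And>i. i \<in> A \<Longrightarrow> sq_integrable M (f i)"
  shows "sq_integrable M (\<lambda>x. \<Sum>i\<in>A. f i x)"
  using assms by (induct A rule: infinite_finite_induct) (auto intro: sq_integrable_add)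

lemma l2norm_uminus [simp]: "l2norm M (\<lambda>x. - f x) = l2norm M f"
  by (simp add: l2norm_def)

lemma l2norm_zero [simp]: "l2norm M (\<lambda>x. 0) = 0"
  by (simp add: l2norm_def)

lemma l2norm_minus_commute: "l2norm M (\<lambda>x. f x - g x) = l2norm M (\<lambda>x. g x - f x)"
  by (simp add: l2norm_def norm_minus_commute)

lemma l2norm_scale: "l2norm M (\<lambda>x. c * f x) = cmod c * l2norm M f"
  by (simp add: l2norm_def norm_mult power_mult_distrib real_sqrt_mult)

lemma l2inner_add_left:
  "\<lbrakk>sq_integrable M f; sq_integrable M g; sq_integrable M h\<rbrakk> \<Longrightarrow>
    l2inner M (\<lambda>x. f x + g x) h = l2inner M f h + l2inner M g h"
  unfolding l2inner_def by (simp add: distrib_right sq_integrable_inner)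

lemma l2inner_diff_left:
  "\<lbrakk>sq_integrable M f; sq_integrable M g; sq_integrable M h\<rbrakk> \<Longrightarrow>
    l2inner M (\<lambda>x. f x - g x) h = l2inner M f h - l2inner M g h"
  unfolding l2inner_def by (simp add: left_diff_distrib sq_integrable_inner)

lemma l2inner_scale_left: "l2inner M (\<lambda>x. c * f x) h = c * l2inner M f h"
  unfolding l2inner_def by (simp add: mult.assoc)

lemma l2inner_commute: "l2inner M g f = cnj (l2inner M f g)"
proof -
  have "cnj (l2inner M f g) = (LINT x|M. cnj (f x * cnj (g x)))"
    unfolding l2inner_def by (rule Bochner_Integration.integral_cnj[symmetric])
  then show ?thesis by (simp add: l2inner_def mult.commute)
qed

lemma l2inner_add_right:
  "\<lbrakk>sq_integrable M f; sq_integrable M g; sq_integrable M h\<rbrakk> \<Longrightarrow>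
    l2inner M f (\<lambda>x. g x + h x) = l2inner M f g + l2inner M f h"
  unfolding l2inner_def by (simp add: distrib_left sq_integrable_inner)

lemma l2inner_diff_right:
  "\<lbrakk>sq_integrable M f; sq_integrable M g; sq_integrable M h\<rbrakk> \<Longrightarrow>
    l2inner M f (\<lambda>x. g x - h x) = l2inner M f g - l2inner M f h"
  unfolding l2inner_def by (simp add: right_diff_distrib sq_integrable_inner)

lemma l2inner_self: "l2inner M f f = of_real ((l2norm M f)\<^sup>2)"
proof -
  have "l2inner M f f = (LINT x|M. complex_of_real ((cmod (f x))\<^sup>2))"
    unfolding l2inner_def complex_norm_square ..
  also have "\<dots> = of_real (LINT x|M. (cmod (f x))\<^sup>2)" by (rule integral_complex_of_real)
  finally show ?thesis by (simp add: l2norm_power2)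
qed

lemma Re_l2inner_self: "Re (l2inner M f f) = (l2norm M f)\<^sup>2"
  by (simp add: l2inner_self)

lemma l2_Cauchy_Schwarz_norm:
  assumes "sq_integrable M f" "sq_integrable M g"
  shows "(LINT x|M. cmod (f x) * cmod (g x)) \<le> l2norm M f * l2norm M g"
proof -
  have [measurable]: "f \<in> borel_measurable M" "g \<in> borel_measurable M"
    using assms by (auto simp: sq_integrable_def)
  let ?I = "LINT x|M. cmod (f x) * cmod (g x)"
  have nn: "0 \<le> ?I" by (intro integral_nonneg_AE) auto
  have "(\<integral>\<^sup>+x. ennreal (cmod (f x)) * ennreal (cmod (g x)) \<partial>M)\<^sup>2
      \<le> (\<integral>\<^sup>+x. (ennreal (cmod (f x)))\<^sup>2 \<partial>M) * (\<integral>\<^sup>+x. (ennreal (cmod (g x)))\<^sup>2 \<partial>M)"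
    by (rule Cauchy_Schwarz_nn_integral) auto
  also have "(\<integral>\<^sup>+x. ennreal (cmod (f x)) * ennreal (cmod (g x)) \<partial>M) = ennreal ?I"
    using nn_integral_eq_integral[OF sq_integrable_norm_mult[OF assms]] by (simp add: ennreal_mult')
  also have "(\<integral>\<^sup>+x. (ennreal (cmod (f x)))\<^sup>2 \<partial>M) = ennreal ((l2norm M f)\<^sup>2)"
    using sq_integrable_nn[OF assms(1)] by (simp add: ennreal_power)
  also have "(\<integral>\<^sup>+x. (ennreal (cmod (g x)))\<^sup>2 \<partial>M) = ennreal ((l2norm M g)\<^sup>2)"
    using sq_integrable_nn[OF assms(2)] by (simp add: ennreal_power)
  finally have "?I\<^sup>2 \<le> (l2norm M f * l2norm M g)\<^sup>2"
    using nn by (simp add: ennreal_power power_mult_distrib flip: ennreal_mult)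
  then show ?thesis by (rule power2_le_imp_le) simp
qed

lemma l2_Cauchy_Schwarz:
  assumes "sq_integrable M f" "sq_integrable M g"
  shows "cmod (l2inner M f g) \<le> l2norm M f * l2norm M g"
proof -
  have "cmod (l2inner M f g) \<le> (LINT x|M. cmod (f x * cnj (g x)))"
    unfolding l2inner_def by (rule integral_norm_bound)
  also have "\<dots> = (LINT x|M. cmod (f x) * cmod (g x))" by (simp add: norm_mult)
  finally show ?thesis using l2_Cauchy_Schwarz_norm[OF assms] by simp
qed

lemma l2norm_add_power2:
  assumes "sq_integrable M f" "sq_integrable M g"
  shows "(l2norm M (\<lambda>x. f x + g x))\<^sup>2 = (l2norm M f)\<^sup>2 + 2 * Re (l2inner M f g) + (l2norm M g)\<^sup>2"
proof -
  have "l2inner M (\<lambda>x. f x + g x) (\<lambda>x. f x + g x)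
    = l2inner M f f + l2inner M f g + l2inner M g f + l2inner M g g"
    using assms by (simp add: l2inner_add_left l2inner_add_right sq_integrable_add)
  then have "Re (l2inner M (\<lambda>x. f x + g x) (\<lambda>x. f x + g x))
    = Re (l2inner M f f) + Re (l2inner M f g) + Re (l2inner M g f) + Re (l2inner M g g)" by simp
  moreover have "Re (l2inner M g f) = Re (l2inner M f g)"
    by (subst l2inner_commute) simp
  ultimately show ?thesis by (simp add: Re_l2inner_self)
qed

lemma l2norm_diff_power2:
  assumes "sq_integrable M f" "sq_integrable M g"
  shows "(l2norm M (\<lambda>x. f x - g x))\<^sup>2 = (l2norm M f)\<^sup>2 - 2 * Re (l2inner M f g) + (l2norm M g)\<^sup>2"
proof -
  have "l2inner M (\<lambda>x. f x - g x) (\<lambda>x. f x - g x)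
    = l2inner M f f - l2inner M f g - l2inner M g f + l2inner M g g"
    using assms by (simp add: l2inner_diff_left l2inner_diff_right sq_integrable_diff)
  then have "Re (l2inner M (\<lambda>x. f x - g x) (\<lambda>x. f x - g x))
    = Re (l2inner M f f) - Re (l2inner M f g) - Re (l2inner M g f) + Re (l2inner M g g)" by simp
  moreover have "Re (l2inner M g f) = Re (l2inner M f g)"
    by (subst l2inner_commute) simp
  ultimately show ?thesis by (simp add: Re_l2inner_self)
qed

lemma l2norm_triangle:
  assumes "sq_integrable M f" "sq_integrable M g"
  shows "l2norm M (\<lambda>x. f x + g x) \<le> l2norm M f + l2norm M g"
proof (rule power2_le_imp_le)
  have "Re (l2inner M f g) \<le> l2norm M f * l2norm M g"
    using l2_Cauchy_Schwarz[OF assms] complex_Re_le_cmod order_trans by blast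
  then show "(l2norm M (\<lambda>x. f x + g x))\<^sup>2 \<le> (l2norm M f + l2norm M g)\<^sup>2"
    by (simp add: l2norm_add_power2[OF assms] power2_sum)
qed simp

lemma l2norm_triangle_diff:
  assumes "sq_integrable M f" "sq_integrable M g"
  shows "l2norm M (\<lambda>x. f x - g x) \<le> l2norm M f + l2norm M g"
  using l2norm_triangle[OF assms(1) sq_integrable_uminus[OF assms(2)]] by simp

lemma l2norm_triangle3:
  assumes "sq_integrable M f" "sq_integrable M g" "sq_integrable M h"
  shows "l2norm M (\<lambda>x. f x - h x) \<le> l2norm M (\<lambda>x. f x - g x) + l2norm M (\<lambda>x. g x - h x)"
  using l2norm_triangle[OF sq_integrable_diff[OF assms(1,2)] sq_integrable_diff[OF assms(2,3)]]
  by simp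

lemma l2norm_le_add_diff:
  assumes "sq_integrable M f" "sq_integrable M g"
  shows "l2norm M f \<le> l2norm M g + l2norm M (\<lambda>x. f x - g x)"
  using l2norm_triangle[OF assms(2) sq_integrable_diff[OF assms]] by simp

lemma l2norm_abs_diff_le:
  assumes "sq_integrable M f" "sq_integrable M g"
  shows "\<bar>l2norm M f - l2norm M g\<bar> \<le> l2norm M (\<lambda>x. f x - g x)"
  using l2norm_le_add_diff[OF assms] l2norm_le_add_diff[OF assms(2,1)]
  by (simp add: l2norm_minus_commute[of M f g] abs_le_iff)

lemma l2inner_tendsto_left:
  assumes "\<And>k. sq_integrable M (f k)" "sq_integrable M g" "sq_integrable M h"
    "(\<lambda>k. l2norm M (\<lambda>x. f k x - g x)) \<longlonglongrightarrow> 0"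
  shows "(\<lambda>k. l2inner M (f k) h) \<longlonglongrightarrow> l2inner M g h"
proof (rule LIM_zero_cancel, rule Lim_null_comparison)
  show "\<forall>\<^sub>F k in sequentially. norm (l2inner M (f k) h - l2inner M g h) \<le> l2norm M (\<lambda>x. f k x - g x) * l2norm M h"
    using l2_Cauchy_Schwarz[OF sq_integrable_diff[OF assms(1,2)] assms(3)] assms
    by (simp add: l2inner_diff_left)
  show "(\<lambda>k. l2norm M (\<lambda>x. f k x - g x) * l2norm M h) \<longlonglongrightarrow> 0"
    using tendsto_mult_left_zero[OF assms(4)] by simp
qed

lemma l2inner_tendsto_right:
  assumes "\<And>k. sq_integrable M (f k)" "sq_integrable M g" "sq_integrable M h"
    "(\<lambda>k. l2norm M (\<lambda>x. f k x - g x)) \<longlonglongrightarrow> 0"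
  shows "(\<lambda>k. l2inner M h (f k)) \<longlonglongrightarrow> l2inner M h g"
  using tendsto_cnj[OF l2inner_tendsto_left[OF assms]] by (simp flip: l2inner_commute)

text \<open>Minkowski's integral inequality in squared form. The square of the time integral is a
  double integral over two times; Tonelli moves the space integral inside, and Cauchy-Schwarz
  applies to each pair of times. Nonnegative integrals are used because integrability of
  \<open>\<lambda>s. v s x\<close> is only deduced from this bound.\<close>

lemma (in pair_sigma_finite) l2_Bochner_aux:
  fixes v :: "'a \<Rightarrow> 'b \<Rightarrow> complex"
  assumes v [measurable]: "(\<lambda>(s, x). v s x) \<in> borel_measurable (M1 \<Otimes>\<^sub>M M2)"
    and sq: "AE s in M1. sq_integrable M2 (v s)"
    and int: "integrable M1 (\<lambda>s. l2norm M2 (v s))"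
  shows "(\<integral>\<^sup>+x. (\<integral>\<^sup>+s. cmod (v s x) \<partial>M1)\<^sup>2 \<partial>M2) \<le> (ennreal (LINT s|M1. l2norm M2 (v s)))\<^sup>2"
proof -
  define W where "W x = (\<integral>\<^sup>+s. cmod (v s x) \<partial>M1)" for x
  have [measurable]: "W \<in> borel_measurable M2" unfolding W_def by measurable
  have nn: "(\<integral>\<^sup>+s. ennreal (l2norm M2 (v s)) \<partial>M1) = ennreal (LINT s|M1. l2norm M2 (v s))"
    by (rule nn_integral_eq_integral[OF int]) simp
  have key: "AE s' in M1. AE s in M1. (\<integral>\<^sup>+x. ennreal (cmod (v s' x)) * ennreal (cmod (v s x)) \<partial>M2)
      \<le> ennreal (l2norm M2 (v s')) * ennreal (l2norm M2 (v s))"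
    using sq
  proof eventually_elim
    case (elim s')
    show ?case using sq
    proof eventually_elim
      fix s assume s: "sq_integrable M2 (v s)"
      have "(\<integral>\<^sup>+x. ennreal (cmod (v s' x)) * ennreal (cmod (v s x)) \<partial>M2)
          = (\<integral>\<^sup>+x. ennreal (cmod (v s' x) * cmod (v s x)) \<partial>M2)"
        by (simp add: ennreal_mult)
      also have "\<dots> = ennreal (LINT x|M2. cmod (v s' x) * cmod (v s x))"
        by (rule nn_integral_eq_integral[OF sq_integrable_norm_mult[OF elim s]]) simp
      also have "\<dots> \<le> ennreal (l2norm M2 (v s') * l2norm M2 (v s))"
        by (intro ennreal_leI l2_Cauchy_Schwarz_norm elim s)
      finally show "(\<integral>\<^sup>+x. ennreal (cmod (v s' x)) * ennreal (cmod (v s x)) \<partial>M2)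
          \<le> ennreal (l2norm M2 (v s')) * ennreal (l2norm M2 (v s))" by (simp add: ennreal_mult)
    qed
  qed
  \<comment> \<open>One factor of the square is opened at a time, so that each exchange of integrals
    involves a single time variable.\<close>
  have "(\<integral>\<^sup>+x. (W x)\<^sup>2 \<partial>M2) = (\<integral>\<^sup>+x. (\<integral>\<^sup>+s'. ennreal (cmod (v s' x)) * W x \<partial>M1) \<partial>M2)"
    by (intro nn_integral_cong) (simp add: nn_integral_multc power2_eq_square W_def)
  also have "\<dots> = (\<integral>\<^sup>+s'. (\<integral>\<^sup>+x. ennreal (cmod (v s' x)) * W x \<partial>M2) \<partial>M1)"
    by (rule Fubini') measurable
  also have "\<dots> = (\<integral>\<^sup>+s'. (\<integral>\<^sup>+s. (\<integral>\<^sup>+x. ennreal (cmod (v s' x)) * ennreal (cmod (v s x)) \<partial>M2) \<partial>M1) \<partial>M1)"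
  proof (rule nn_integral_cong)
    fix s' assume [measurable]: "s' \<in> space M1"
    have "(\<integral>\<^sup>+x. ennreal (cmod (v s' x)) * W x \<partial>M2)
        = (\<integral>\<^sup>+x. (\<integral>\<^sup>+s. ennreal (cmod (v s' x)) * ennreal (cmod (v s x)) \<partial>M1) \<partial>M2)"
      unfolding W_def by (intro nn_integral_cong) (simp add: nn_integral_cmult)
    also have "\<dots> = (\<integral>\<^sup>+s. (\<integral>\<^sup>+x. ennreal (cmod (v s' x)) * ennreal (cmod (v s x)) \<partial>M2) \<partial>M1)"
      by (rule Fubini') measurable
    finally show "(\<integral>\<^sup>+x. ennreal (cmod (v s' x)) * W x \<partial>M2)
        = (\<integral>\<^sup>+s. (\<integral>\<^sup>+x. ennreal (cmod (v s' x)) * ennreal (cmod (v s x)) \<partial>M2) \<partial>M1)" .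
  qed
  also have "\<dots> \<le> (\<integral>\<^sup>+s'. (\<integral>\<^sup>+s. ennreal (l2norm M2 (v s')) * ennreal (l2norm M2 (v s)) \<partial>M1) \<partial>M1)"
    by (rule nn_integral_mono_AE, use key in eventually_elim, rule nn_integral_mono_AE) auto
  also have "\<dots> = (\<integral>\<^sup>+s'. ennreal (l2norm M2 (v s')) * ennreal (LINT s|M1. l2norm M2 (v s)) \<partial>M1)"
    using int by (intro nn_integral_cong) (simp add: nn_integral_cmult nn)
  also have "\<dots> = (ennreal (LINT s|M1. l2norm M2 (v s)))\<^sup>2"
    using int by (simp add: nn_integral_multc nn power2_eq_square)
  finally show ?thesis by (simp add: W_def)
qed

context pair_sigma_finite
begin

context
  fixes v :: "'a \<Rightarrow> 'b \<Rightarrow> complex"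
  assumes v [measurable]: "(\<lambda>(s, x). v s x) \<in> borel_measurable (M1 \<Otimes>\<^sub>M M2)"
    and sq: "AE s in M1. sq_integrable M2 (v s)"
    and int: "integrable M1 (\<lambda>s. l2norm M2 (v s))"
begin

text \<open>The time integral of \<open>cmod (v s x)\<close> has a finite square integral in
  \<open>x\<close>, hence is finite for almost every \<open>x\<close>.\<close>

lemma l2_Bochner_AE_integrable: "AE x in M2. integrable M1 (\<lambda>s. v s x)"
proof -
  have "(\<integral>\<^sup>+x. (\<integral>\<^sup>+s. cmod (v s x) \<partial>M1)\<^sup>2 \<partial>M2) \<noteq> \<infinity>"
    using l2_Bochner_aux[OF v sq int] by (auto simp: top_unique ennreal_power)
  then have "AE x in M2. (\<integral>\<^sup>+s. cmod (v s x) \<partial>M1)\<^sup>2 \<noteq> \<infinity>"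
    by (rule nn_integral_PInf_AE[rotated]) measurable
  with AE_space show ?thesis
  proof eventually_elim
    case (elim x)
    have [measurable]: "x \<in> space M2" by fact
    show ?case
      by (rule integrableI_bounded) (use elim(2) in \<open>auto simp: power2_eq_square less_top ennreal_mult_eq_top_iff\<close>)
  qed
qed

lemma l2_Bochner_measurable: "(\<lambda>x. LINT s|M1. v s x) \<in> borel_measurable M2"
  by measurable

lemma l2_Bochner_nn: "(\<integral>\<^sup>+x. ennreal ((cmod (LINT s|M1. v s x))\<^sup>2) \<partial>M2)
    \<le> (ennreal (LINT s|M1. l2norm M2 (v s)))\<^sup>2"
proof -
  have "(\<integral>\<^sup>+x. ennreal ((cmod (LINT s|M1. v s x))\<^sup>2) \<partial>M2)
      \<le> (\<integral>\<^sup>+x. (\<integral>\<^sup>+s. cmod (v s x) \<partial>M1)\<^sup>2 \<partial>M2)"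
  proof (rule nn_integral_mono_AE, use l2_Bochner_AE_integrable in eventually_elim)
    case (elim x)
    have "(ennreal (cmod (LINT s|M1. v s x)))\<^sup>2 \<le> (\<integral>\<^sup>+s. cmod (v s x) \<partial>M1)\<^sup>2"
      by (intro power_mono integral_norm_bound_ennreal elim) simp
    then show ?case by (simp add: ennreal_power)
  qed
  also note l2_Bochner_aux[OF v sq int]
  finally show ?thesis .
qed

lemma l2_Bochner_sq_integrable: "sq_integrable M2 (\<lambda>x. LINT s|M1. v s x)"
  using l2_Bochner_measurable le_less_trans[OF l2_Bochner_nn]
  by (intro sq_integrableI) (auto simp: ennreal_power less_top)

lemma l2_Bochner_norm_le: "l2norm M2 (\<lambda>x. LINT s|M1. v s x) \<le> (LINT s|M1. l2norm M2 (v s))"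
proof (rule power2_le_imp_le)
  show 0: "0 \<le> (LINT s|M1. l2norm M2 (v s))" by (intro integral_nonneg_AE) simp
  show "(l2norm M2 (\<lambda>x. LINT s|M1. v s x))\<^sup>2 \<le> (LINT s|M1. l2norm M2 (v s))\<^sup>2"
    using l2_Bochner_nn 0 by (simp add: sq_integrable_nn[OF l2_Bochner_sq_integrable] ennreal_power)
qed

lemma l2_Bochner_joint_integrable:
  assumes g: "sq_integrable M2 g"
  shows "integrable (M1 \<Otimes>\<^sub>M M2) (\<lambda>(s, x). v s x * cnj (g x))"
proof (rule integrableI_bounded)
  have [measurable]: "g \<in> borel_measurable M2" using g by (rule sq_integrable_measurable)
  show "(\<lambda>(s, x). v s x * cnj (g x)) \<in> borel_measurable (M1 \<Otimes>\<^sub>M M2)" by measurable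
  have "(\<integral>\<^sup>+z. ennreal (norm (case z of (s, x) \<Rightarrow> v s x * cnj (g x))) \<partial>(M1 \<Otimes>\<^sub>M M2))
     = (\<integral>\<^sup>+s. (\<integral>\<^sup>+x. ennreal (norm (v s x * cnj (g x))) \<partial>M2) \<partial>M1)"
    by (subst M2.nn_integral_fst[symmetric]) (auto simp: split_beta')
  also have "\<dots> \<le> (\<integral>\<^sup>+s. ennreal (l2norm M2 (v s) * l2norm M2 g) \<partial>M1)"
  proof (rule nn_integral_mono_AE, use sq in eventually_elim)
    case (elim s)
    have "(\<integral>\<^sup>+x. ennreal (norm (v s x * cnj (g x))) \<partial>M2) = (\<integral>\<^sup>+x. ennreal (cmod (v s x) * cmod (g x)) \<partial>M2)"
      by (simp add: norm_mult)
    also have "\<dots> = ennreal (LINT x|M2. cmod (v s x) * cmod (g x))"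
      by (rule nn_integral_eq_integral[OF sq_integrable_norm_mult[OF elim g]]) simp
    also have "\<dots> \<le> ennreal (l2norm M2 (v s) * l2norm M2 g)"
      by (intro ennreal_leI l2_Cauchy_Schwarz_norm elim g)
    finally show ?case .
  qed
  also have "\<dots> = ennreal (LINT s|M1. l2norm M2 (v s) * l2norm M2 g)"
    using int by (intro nn_integral_eq_integral) auto
  finally show "(\<integral>\<^sup>+z. ennreal (norm (case z of (s, x) \<Rightarrow> v s x * cnj (g x))) \<partial>(M1 \<Otimes>\<^sub>M M2)) < \<infinity>"
    by (rule le_less_trans) simp
qed

lemma l2_Bochner_inner_integrable:
  assumes g: "sq_integrable M2 g"
  shows "integrable M1 (\<lambda>s. l2inner M2 (v s) g)"
  using integrable_fst'[OF l2_Bochner_joint_integrable[OF g]] by (simp add: l2inner_def)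

text \<open>By Fubini, the integral taken pointwise in \<open>x\<close> is also the weak integral in
  \<open>L^2\<close>. Vector-valued integrals can therefore be estimated by testing them with a
  fixed function.\<close>

lemma l2_Bochner_inner:
  assumes g: "sq_integrable M2 g"
  shows "l2inner M2 (\<lambda>x. LINT s|M1. v s x) g = (LINT s|M1. l2inner M2 (v s) g)"
  unfolding l2inner_def
  using Fubini_integral[OF l2_Bochner_joint_integrable[OF g]] by simp

end

end

section \<open>The damping nonlinearity\<close>

lemma le_sinh_real:
  fixes y :: real assumes "0 \<le> y" shows "y \<le> sinh y"
proof -
  have "sinh 0 - 0 \<le> sinh y - y"
    by (rule DERIV_nonneg_imp_nondecreasing[OF assms])
       (auto intro!: exI derivative_eq_intros simp: cosh_real_ge_1)
  then show ?thesis by simp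
qed

lemma sinh_le_mult_cosh_real:
  fixes y :: real assumes "0 \<le> y" shows "sinh y \<le> y * cosh y"
proof -
  have "0 * cosh 0 - sinh 0 \<le> y * cosh y - sinh y"
  proof (rule DERIV_nonneg_imp_nondecreasing[OF assms])
    fix x :: real assume "0 \<le> x"
    have "((\<lambda>x. x * cosh x - sinh x) has_real_derivative (x * sinh x)) (at x)"
      by (auto intro!: derivative_eq_intros)
    moreover have "0 \<le> x * sinh x" using \<open>0 \<le> x\<close> by simp
    ultimately show "\<exists>y. ((\<lambda>x. x * cosh x - sinh x) has_real_derivative y) (at x) \<and> 0 \<le> y" by blast
  qed
  then show ?thesis by simp
qed

lemma sinh_mult_le_real:
  fixes y c :: real assumes "0 \<le> y" "0 \<le> c" "c \<le> 1" shows "sinh (c * y) \<le> c * sinh y"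
proof -
  have "c * sinh 0 - sinh (c * 0) \<le> c * sinh y - sinh (c * y)"
  proof (rule DERIV_nonneg_imp_nondecreasing[OF assms(1)])
    fix x :: real assume x: "0 \<le> x"
    have "((\<lambda>x. c * sinh x - sinh (c * x)) has_real_derivative (c * cosh x - c * cosh (c * x))) (at x)"
      by (auto intro!: derivative_eq_intros)
    moreover have "cosh (c * x) \<le> cosh x"
      using x assms by (subst cosh_real_nonneg_le_iff) (auto simp: mult_left_le_one_le)
    then have "0 \<le> c * cosh x - c * cosh (c * x)" using assms by (simp add: mult_left_mono)
    ultimately show "\<exists>y. ((\<lambda>x. c * sinh x - sinh (c * x)) has_real_derivative y) (at x) \<and> 0 \<le> y" by blast
  qed
  then show ?thesis by simp
qed

text \<open>The scalar core of the monotonicity estimate, with \<open>y\<close> half the logarithm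
  of the ratio of two moduli. The factor \<open>y\<close> serves as intermediary:
  \<open>sinh y \<le> y * cosh y\<close> is applied to one factor of the square, and
  \<open>2 * m * y \<le> sinh (2 * m * y)\<close> then absorbs the \<open>y\<close>.\<close>

lemma sinh_power2_le_sinh_mult_sinh:
  fixes y m :: real assumes m: "0 < m" "m \<le> 1"
  shows "4 * m * (sinh ((1 - m) * y))\<^sup>2 \<le> (1 - m)\<^sup>2 * (sinh (2 * y) * sinh (2 * m * y))"
proof -
  have pos: "4 * m * (sinh ((1 - m) * y))\<^sup>2 \<le> (1 - m)\<^sup>2 * (sinh (2 * y) * sinh (2 * m * y))"
    if y: "0 \<le> y" for y
  proof -
    have "(sinh ((1 - m) * y))\<^sup>2 \<le> ((1 - m) * sinh y)\<^sup>2"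
      using sinh_mult_le_real[OF y, of "1 - m"] m y by (intro power_mono) auto
    also have "\<dots> = (1 - m)\<^sup>2 * (sinh y * sinh y)" by (simp add: power2_eq_square)
    also have "\<dots> \<le> (1 - m)\<^sup>2 * (sinh y * (y * cosh y))"
      using sinh_le_mult_cosh_real[OF y] y by (intro mult_left_mono) auto
    finally have "4 * m * (sinh ((1 - m) * y))\<^sup>2 \<le> 4 * m * ((1 - m)\<^sup>2 * (sinh y * (y * cosh y)))"
      using m by (intro mult_left_mono) auto
    also have "\<dots> = (1 - m)\<^sup>2 * (sinh (2 * y) * (2 * m * y))" by (simp add: sinh_double)
    also have "\<dots> \<le> (1 - m)\<^sup>2 * (sinh (2 * y) * sinh (2 * m * y))"
      using le_sinh_real[of "2 * m * y"] m y by (intro mult_left_mono) auto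
    finally show ?thesis .
  qed
  \<comment> \<open>Both sides are even in \<open>y\<close>.\<close>
  show ?thesis
  proof (cases "0 \<le> y")
    case True then show ?thesis by (rule pos)
  next
    case False
    then show ?thesis using pos[of "- y"] by simp
  qed
qed

text \<open>Both sides are homogeneous of the same degree in \<open>(r, s)\<close>. In terms of the
  half sum \<open>u\<close> and the half difference \<open>y\<close> of the logarithms, all powers
  of \<open>exp u\<close> split off as a common factor and a statement about \<open>y\<close> alone
  remains.\<close>

lemma powr_quadratic_inequality:
  fixes r s m :: real assumes m: "0 < m" "m \<le> 1" and r: "0 < r" and s: "0 < s"
  shows "4 * m * ((r powr (m - 1) - s powr (m - 1))\<^sup>2 * (r * s)\<^sup>2)
    \<le> (1 - m)\<^sup>2 * ((r\<^sup>2 - s\<^sup>2) * ((r powr (m - 1) * r)\<^sup>2 - (s powr (m - 1) * s)\<^sup>2))"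
proof -
  define u y where "u = (ln r + ln s) / 2" and "y = (ln r - ln s) / 2"
  have r': "r = exp u * exp y" and s': "s = exp u * exp (- y)"
    using r s by (simp_all add: u_def y_def add_divide_distrib diff_divide_distrib flip: exp_add)
  have ra: "r powr (m - 1) = exp ((m - 1) * u) * exp ((m - 1) * y)"
    and sa: "s powr (m - 1) = exp ((m - 1) * u) * exp (- ((m - 1) * y))"
    using r s by (simp_all add: powr_def u_def y_def algebra_simps add_divide_distrib diff_divide_distrib flip: exp_add)
  have rm: "r powr (m - 1) * r = exp (m * u) * exp (m * y)"
    and sm: "s powr (m - 1) * s = exp (m * u) * exp (- (m * y))"
  proof -
    have "r powr (m - 1) * r = (exp ((m - 1) * u) * exp ((m - 1) * y)) * (exp u * exp y)"
      unfolding ra by (simp add: r')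
    then show "r powr (m - 1) * r = exp (m * u) * exp (m * y)"
      by (simp add: algebra_simps flip: exp_add)
    have "s powr (m - 1) * s = (exp ((m - 1) * u) * exp (- ((m - 1) * y))) * (exp u * exp (- y))"
      unfolding sa by (simp add: s')
    then show "s powr (m - 1) * s = exp (m * u) * exp (- (m * y))"
      by (simp add: algebra_simps flip: exp_add)
  qed
  have sh: "exp x - exp (- x) = 2 * sinh x" for x :: real by (simp add: sinh_field_def)
  have "r powr (m - 1) - s powr (m - 1) = exp ((m - 1) * u) * (2 * sinh ((m - 1) * y))"
    unfolding ra sa sh[symmetric] by (simp add: right_diff_distrib)
  moreover have "r * s = (exp u)\<^sup>2"
    by (simp add: r' s' power2_eq_square flip: exp_add)
  moreover have e: "exp (m * u) = exp ((m - 1) * u) * exp u" by (simp add: algebra_simps flip: exp_add)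
  ultimately have L: "(r powr (m - 1) - s powr (m - 1))\<^sup>2 * (r * s)\<^sup>2
      = 4 * ((exp (m * u))\<^sup>2 * (exp u)\<^sup>2) * (sinh ((m - 1) * y))\<^sup>2"
    by (simp only: e power_mult_distrib) (simp add: power2_eq_square)
  have "r\<^sup>2 - s\<^sup>2 = (exp u)\<^sup>2 * (2 * sinh (2 * y))"
    unfolding sh[symmetric] by (simp add: r' s' power_mult_distrib right_diff_distrib flip: exp_double)
  moreover have "(r powr (m - 1) * r)\<^sup>2 - (s powr (m - 1) * s)\<^sup>2 = (exp (m * u))\<^sup>2 * (2 * sinh (2 * m * y))"
    unfolding sh[symmetric] rm sm by (simp add: power_mult_distrib right_diff_distrib mult.assoc flip: exp_double)
  ultimately have R: "(r\<^sup>2 - s\<^sup>2) * ((r powr (m - 1) * r)\<^sup>2 - (s powr (m - 1) * s)\<^sup>2)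
      = 4 * ((exp (m * u))\<^sup>2 * (exp u)\<^sup>2) * (sinh (2 * y) * sinh (2 * m * y))"
    by simp
  have e: "(sinh ((m - 1) * y))\<^sup>2 = (sinh ((1 - m) * y))\<^sup>2"
    using sinh_minus[of "(1 - m) * y"] by (simp add: algebra_simps power2_eq_square)
  have "4 * ((exp (m * u))\<^sup>2 * (exp u)\<^sup>2) * (4 * m * (sinh ((1 - m) * y))\<^sup>2)
     \<le> 4 * ((exp (m * u))\<^sup>2 * (exp u)\<^sup>2) * ((1 - m)\<^sup>2 * (sinh (2 * y) * sinh (2 * m * y)))"
    by (intro mult_left_mono sinh_power2_le_sinh_mult_sinh m) simp
  then show ?thesis unfolding L R e by (simp add: algebra_simps)
qed

section \<open>The power nonlinearity: dissipation, monotonicity, Hoelder continuity\<close>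

lemma nl_zero [simp]: "nl m 0 = 0"
  by (simp add: nl_def)

lemma norm_nl: "cmod (nl m z) = cmod z powr m"
  by (cases "z = 0") (auto simp: nl_def norm_mult powr_mult_base mult.commute)

text \<open>Because this product is real, \<open>a * nl m z\<close> has a dissipation proportional
  to \<open>Im a\<close>, whatever \<open>Re a\<close> is.\<close>

lemma nl_mult_cnj: "nl m z * cnj z = of_real (cmod z powr (m + 1))"
proof (cases "z = 0")
  case False
  have "nl m z * cnj z = of_real (cmod z powr (m - 1)) * (z * cnj z)"
    using False by (simp add: nl_def)
  also have "\<dots> = of_real (cmod z powr (m - 1) * cmod z * cmod z)"
    by (simp add: complex_norm_square power2_eq_square flip: complex_norm_square)
  also have "cmod z powr (m - 1) * cmod z * cmod z = cmod z powr (m + 1)"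
    using False by (simp add: powr_mult_base mult.commute add.commute)
  finally show ?thesis .
qed (simp add: nl_def)

lemma nl_one: "nl 1 z = z"
  by (simp add: nl_def)

lemma borel_measurable_nl [measurable]: "nl m \<in> borel_measurable borel"
  unfolding nl_def by measurable

text \<open>This is the Liskevich--Perelmuter inequality; it is where the relation between
  \<open>Re a\<close>, \<open>Im a\<close> and \<open>m\<close> enters.\<close>
lemma nl_monotone:
  assumes m: "0 < m" "m \<le> 1" and a: "0 \<le> Im a" "(1 - m) * \<bar>Re a\<bar> \<le> 2 * sqrt m * Im a"
  shows "0 \<le> Im (a * ((nl m z - nl m w) * cnj (z - w)))"
proof (cases "z = 0 \<or> w = 0")
  \<comment> \<open>If one argument vanishes, the difference is up to sign the nonlinearity of a
    single number, and the product is real.\<close>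
  case True
  then have "(nl m z - nl m w) * cnj (z - w) = of_real (cmod (z - w) powr (m + 1))"
  proof
    assume "z = 0"
    then show ?thesis using nl_mult_cnj[of m w] by simp
  next
    assume "w = 0"
    then show ?thesis using nl_mult_cnj[of m z] by simp
  qed
  then show ?thesis using a by simp
next
  case False
  define r s where "r = cmod z" and "s = cmod w"
  define \<alpha> \<beta> where "\<alpha> = r powr (m - 1)" and "\<beta> = s powr (m - 1)"
  define q where "q = z * cnj w"
  define X where "X = (nl m z - nl m w) * cnj (z - w)"
  have rs: "0 < r" "0 < s" using False by (auto simp: r_def s_def)
  have ab: "0 < \<alpha>" "0 < \<beta>" using rs by (auto simp: \<alpha>_def \<beta>_def)
  have "X = of_real \<alpha> * (z * cnj z) + of_real \<beta> * (w * cnj w) - of_real \<alpha> * q - of_real \<beta> * cnj q"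
    using False by (simp add: X_def nl_def \<alpha>_def \<beta>_def r_def s_def q_def algebra_simps)
  then have X: "X = of_real (\<alpha> * r\<^sup>2 + \<beta> * s\<^sup>2) - of_real \<alpha> * q - of_real \<beta> * cnj q"
    by (simp add: r_def s_def flip: complex_norm_square)
  have ReX: "Re X = \<alpha> * r\<^sup>2 + \<beta> * s\<^sup>2 - (\<alpha> + \<beta>) * Re q" by (simp add: X algebra_simps)
  have ImX: "Im X = - (\<alpha> - \<beta>) * Im q" by (simp add: X algebra_simps)
  have q: "(Re q)\<^sup>2 + (Im q)\<^sup>2 = (r * s)\<^sup>2"
    unfolding cmod_power2[symmetric] by (simp add: q_def r_def s_def norm_mult)
  \<comment> \<open>In these terms the hypothesis reads
    \<open>k * \<bar>Re a\<bar> \<le> Im a\<close>, so it suffices that \<open>X\<close> lies in the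
    sector \<open>\<bar>Im X\<bar> \<le> k * Re X\<close>.\<close>
  define k where "k = (1 - m) / (2 * sqrt m)"
  have k: "0 \<le> k" using m by (simp add: k_def)
  have k2: "4 * m * k\<^sup>2 = (1 - m)\<^sup>2" using m by (simp add: k_def power_divide power_mult_distrib)
  have ak: "k * \<bar>Re a\<bar> \<le> Im a" using a(2) m by (simp add: k_def field_simps)
  have "4 * m * ((\<alpha> - \<beta>)\<^sup>2 * (r * s)\<^sup>2) \<le> 4 * m * (k\<^sup>2 * ((r\<^sup>2 - s\<^sup>2) * ((\<alpha> * r)\<^sup>2 - (\<beta> * s)\<^sup>2)))"
    using powr_quadratic_inequality[OF m rs] k2 unfolding \<alpha>_def \<beta>_def by (simp add: mult.assoc[symmetric])
  then have main: "(\<alpha> - \<beta>)\<^sup>2 * (r * s)\<^sup>2 \<le> k\<^sup>2 * ((r\<^sup>2 - s\<^sup>2) * ((\<alpha> * r)\<^sup>2 - (\<beta> * s)\<^sup>2))"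
    using m by simp
  \<comment> \<open>Cauchy-Schwarz in the plane, arranged so that one of the vectors is
    \<open>q\<close>, of length \<open>r * s\<close>. After inserting \<open>main\<close> the
    right-hand side becomes an exact square.\<close>
  have "(\<bar>\<alpha> - \<beta>\<bar> * \<bar>Im q\<bar> + k * (\<alpha> + \<beta>) * Re q)\<^sup>2
      \<le> ((\<alpha> - \<beta>)\<^sup>2 + (k * (\<alpha> + \<beta>))\<^sup>2) * ((Re q)\<^sup>2 + (Im q)\<^sup>2)"
  proof -
    have "(A * x + B * y)\<^sup>2 \<le> (A\<^sup>2 + B\<^sup>2) * (y\<^sup>2 + x\<^sup>2)" for A B x y :: real
    proof -
      have "0 \<le> (A * y - B * x)\<^sup>2" by simp
      then show ?thesis by (simp add: power2_sum power2_diff power_mult_distrib algebra_simps)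
    qed
    from this[of "\<bar>\<alpha> - \<beta>\<bar>" "\<bar>Im q\<bar>" "k * (\<alpha> + \<beta>)" "Re q"] show ?thesis by simp
  qed
  also have "\<dots> = (\<alpha> - \<beta>)\<^sup>2 * (r * s)\<^sup>2 + k\<^sup>2 * ((\<alpha> + \<beta>)\<^sup>2 * (r * s)\<^sup>2)"
    unfolding q by (simp only: power_mult_distrib[of k] distrib_right mult.assoc)
  also have "\<dots> \<le> k\<^sup>2 * ((r\<^sup>2 - s\<^sup>2) * ((\<alpha> * r)\<^sup>2 - (\<beta> * s)\<^sup>2)) + k\<^sup>2 * ((\<alpha> + \<beta>)\<^sup>2 * (r * s)\<^sup>2)"
    using main by simp
  also have "\<dots> = (k * (\<alpha> * r\<^sup>2 + \<beta> * s\<^sup>2))\<^sup>2" by (simp add: power2_eq_square algebra_simps)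
  finally have "\<bar>\<alpha> - \<beta>\<bar> * \<bar>Im q\<bar> + k * (\<alpha> + \<beta>) * Re q \<le> k * (\<alpha> * r\<^sup>2 + \<beta> * s\<^sup>2)"
    by (rule power2_le_imp_le) (use k ab in auto)
  then have kX: "\<bar>Im X\<bar> \<le> k * Re X" 
    unfolding ReX by (simp only: ImX abs_mult abs_minus_cancel) (simp add: algebra_simps)
  \<comment> \<open>For \<open>m = 1\<close> the constant \<open>k\<close> is 0 and the sector bound
    says nothing about the sign of \<open>Re X\<close>. The sign is therefore derived separately,
    from monotonicity of \<open>\<lambda>r. r powr m\<close>.\<close>
  have ReX0: "0 \<le> Re X"
  proof -
    have "\<bar>Re q\<bar> \<le> r * s" using abs_Re_le_cmod[of q] by (simp add: q_def r_def s_def norm_mult)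
    then have "(\<alpha> + \<beta>) * Re q \<le> (\<alpha> + \<beta>) * (r * s)" using ab by (intro mult_left_mono) auto
    moreover have "\<alpha> * r\<^sup>2 + \<beta> * s\<^sup>2 - (\<alpha> + \<beta>) * (r * s) = (\<alpha> * r - \<beta> * s) * (r - s)"
      by (simp add: power2_eq_square algebra_simps)
    moreover have "0 \<le> (\<alpha> * r - \<beta> * s) * (r - s)"
    proof -
      have e: "\<alpha> * r = r powr m" "\<beta> * s = s powr m"
        using rs by (auto simp: \<alpha>_def \<beta>_def powr_mult_base mult.commute)
      show ?thesis
      proof (cases "s \<le> r")
        case True
        then have "s powr m \<le> r powr m" using rs m by (intro powr_mono2) auto
        then show ?thesis using True by (simp add: e)
      next
        case False
        then have "r powr m \<le> s powr m" using rs m by (intro powr_mono2) auto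
        then show ?thesis using False by (simp add: e mult_nonpos_nonpos)
      qed
    qed
    ultimately show ?thesis unfolding ReX by linarith
  qed
  have "\<bar>Re a * Im X\<bar> \<le> \<bar>Re a\<bar> * (k * Re X)" using kX by (simp add: abs_mult mult_left_mono)
  also have "\<dots> = (k * \<bar>Re a\<bar>) * Re X" by simp
  also have "\<dots> \<le> Im a * Re X" using ak ReX0 by (rule mult_right_mono)
  finally have "0 \<le> Re a * Im X + Im a * Re X" by linarith
  then have "0 \<le> Im (a * X)" by simp
  then show ?thesis unfolding X_def .
qed

text \<open>If the shorter vector is no longer than \<open>z - w\<close>, both terms are bounded
  separately, which gives the constant \<open>2 + 1 = 3\<close>. Otherwise the difference is split
  into a change of the vector and a change of the radial factor, and each part is at most
  \<open>cmod (z - w) powr m\<close>.\<close>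

lemma nl_Holder:
  assumes m: "0 < m" "m \<le> 1"
  shows "cmod (nl m z - nl m w) \<le> 3 * cmod (z - w) powr m"
proof -
  have *: "cmod (nl m z - nl m w) \<le> 3 * cmod (z - w) powr m" if le: "cmod w \<le> cmod z" for z w
  proof (cases "cmod w \<le> cmod (z - w)")
    case True
    have "cmod z \<le> 2 * cmod (z - w)" using norm_triangle_sub[of z w] True by simp
    then have "cmod z powr m \<le> (2 * cmod (z - w)) powr m" using m by (intro powr_mono2) auto
    also have "\<dots> = 2 powr m * cmod (z - w) powr m" by (simp add: powr_mult)
    also have "\<dots> \<le> 2 * cmod (z - w) powr m" using m powr_mono[of m 1 2] by (intro mult_right_mono) auto
    finally have "cmod z powr m \<le> 2 * cmod (z - w) powr m" .
    moreover have "cmod w powr m \<le> cmod (z - w) powr m" using True m by (intro powr_mono2) auto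
    moreover have "cmod (nl m z - nl m w) \<le> cmod (nl m z) + cmod (nl m w)" by (rule norm_triangle_ineq4)
    ultimately show ?thesis by (simp add: norm_nl)
  next
    case False
    define r s d where "r = cmod z" and "s = cmod w" and "d = cmod (z - w)"
    have ds: "d < s" and sr: "s \<le> r" and d0: "0 \<le> d" using False le by (auto simp: r_def s_def d_def)
    have rd: "r - s \<le> d" unfolding r_def s_def d_def by (rule norm_triangle_ineq2)
    have z0: "z \<noteq> 0" "w \<noteq> 0" using ds d0 sr by (auto simp: r_def s_def)
    have b: "r powr (m - 1) * d \<le> d powr m"
    proof (cases "d = 0")
      case False
      then have "r powr (m - 1) \<le> d powr (m - 1)" using d0 ds sr m by (intro powr_mono2') auto
      then have "r powr (m - 1) * d \<le> d powr (m - 1) * d" using d0 by (rule mult_right_mono)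
      also have "\<dots> = d powr m" using d0 False by (simp add: powr_mult_base mult.commute)
      finally show ?thesis .
    qed simp
    have sp: "0 < s" "0 < r" using ds d0 sr by auto
    have "nl m z - nl m w = of_real (r powr (m - 1)) * (z - w) + of_real (r powr (m - 1) - s powr (m - 1)) * w"
      using z0 by (simp add: nl_def r_def s_def algebra_simps)
    then have "cmod (nl m z - nl m w) \<le> cmod (of_real (r powr (m - 1)) * (z - w)) + cmod (of_real (r powr (m - 1) - s powr (m - 1)) * w)"
      by (simp only: norm_triangle_ineq)
    also have "\<dots> = r powr (m - 1) * d + \<bar>r powr (m - 1) - s powr (m - 1)\<bar> * s"
      by (simp add: norm_mult d_def s_def flip: of_real_diff)
    also have "\<bar>r powr (m - 1) - s powr (m - 1)\<bar> = s powr (m - 1) - r powr (m - 1)"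
      using powr_mono2'[of "m - 1" s r] sp sr m by simp
    also have "(s powr (m - 1) - r powr (m - 1)) * s = s powr m - r powr (m - 1) * s"
      using sp powr_mult_base[of s "m - 1"] by (simp add: algebra_simps)
    also have "s powr m - r powr (m - 1) * s \<le> r powr m - r powr (m - 1) * s"
      using powr_mono2[of m s r] sp sr m by simp
    also have "r powr m - r powr (m - 1) * s = r powr (m - 1) * (r - s)"
      using sp powr_mult_base[of r "m - 1"] by (simp add: algebra_simps)
    also have "r powr (m - 1) * (r - s) \<le> r powr (m - 1) * d" using rd by (intro mult_left_mono) auto
    finally have "cmod (nl m z - nl m w) \<le> 2 * (r powr (m - 1) * d)" by (simp add: mult.commute)
    also have "\<dots> \<le> 3 * d powr m" using b powr_ge_zero[of d m] by linarith
    finally show ?thesis by (simp add: d_def)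
  qed
  show ?thesis
    using *[of z w] *[of w z] by (cases "cmod w \<le> cmod z") (auto simp: norm_minus_commute)
qed

text \<open>Below the threshold \<open>b\<close> with \<open>b powr p = \<eta>\<close> the constant
  suffices; above it the exponent may be raised at the cost of \<open>b powr (p - q)\<close>. On a
  set of finite measure this exchanges one power for another up to a small error, in place of
  Hoelder's inequality.\<close>

lemma powr_le_add_powr:
  fixes p q \<eta> :: real assumes "0 < p" "p \<le> q" "0 < \<eta>"
  obtains C where "0 \<le> C" "\<And>x. 0 \<le> x \<Longrightarrow> x powr p \<le> \<eta> + C * x powr q"
proof
  define b where "b = \<eta> powr (1 / p)"
  have b: "0 < b" "b powr p = \<eta>" using assms by (auto simp: b_def powr_powr)
  show "0 \<le> b powr (p - q)" by simp
  fix x :: real assume x: "0 \<le> x"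
  show "x powr p \<le> \<eta> + b powr (p - q) * x powr q"
  proof (cases "x \<le> b")
    case True
    then have "x powr p \<le> \<eta>" using powr_mono2[of p x b] x b assms by simp
    then show ?thesis by (simp add: add_increasing2)
  next
    case False
    then have "x powr (p - q) \<le> b powr (p - q)" using b assms by (intro powr_mono2') auto
    then have "x powr (p - q) * x powr q \<le> b powr (p - q) * x powr q" by (intro mult_right_mono) auto
    moreover have "x powr (p - q) * x powr q = x powr p" using False b by (simp flip: powr_add)
    ultimately show ?thesis using assms by simp
  qed
qed

section \<open>Smooth cut-off functions\<close>

text \<open>For \<open>k = 0\<close> the classical smooth function \<open>exp (- 1 / x)\<close>,
  extended by 0. Differentiation produces powers of \<open>inverse x\<close>, and including them
  makes the linear span of the family closed under it.\<close>

definition flat :: "nat \<Rightarrow> real \<Rightarrow> real" where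
  "flat k x = (if 0 < x then inverse x ^ k * exp (- inverse x) else 0)"

lemma flat_tendsto_0: "(flat k \<longlongrightarrow> 0) (at_right 0)"
proof -
  have "((\<lambda>x::real. inverse x ^ k / exp (inverse x)) \<longlongrightarrow> 0) (at_right 0)"
    by (rule filterlim_compose[OF tendsto_power_div_exp_0 filterlim_inverse_at_top_right])
  moreover have "eventually (\<lambda>x. inverse x ^ k / exp (inverse x) = flat k x) (at_right 0)"
    unfolding eventually_at_right_field
    by (intro exI[of _ 1]) (auto simp: flat_def exp_minus divide_inverse)
  ultimately show ?thesis by (rule Lim_transform_eventually)
qed

lemma DERIV_flat: "(flat k has_real_derivative (flat (k + 2) x - real k * flat (k + 1) x)) (at x)"
proof -
  consider "x < 0" | "x = 0" | "0 < x" by linarith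
  then show ?thesis
  proof cases
    case 1
    have "((\<lambda>x. 0) has_real_derivative 0) (at x)" by simp
    then have "(flat k has_real_derivative 0) (at x)"
      by (rule has_field_derivative_transform_within_open[where S="{..<0}"]) (use 1 in \<open>auto simp: flat_def\<close>)
    then show ?thesis using 1 by (simp add: flat_def)
  next
    case 2
    \<comment> \<open>To the right of 0 the difference quotient of \<open>flat k\<close> is
      \<open>flat (Suc k)\<close>, which tends to 0; to the left it is 0.\<close>
    have "((\<lambda>h. flat k h / h) \<longlongrightarrow> 0) (at 0)"
    proof (rule filterlim_split_at_real)
      have "eventually (\<lambda>h. 0 = flat k h / h) (at_left 0)"
        unfolding eventually_at_left_field by (intro exI[of _ "-1"]) (auto simp: flat_def)
      then show "((\<lambda>h. flat k h / h) \<longlongrightarrow> 0) (at_left 0)"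
        by (rule Lim_transform_eventually[rotated]) simp
      have "eventually (\<lambda>h. flat (Suc k) h = flat k h / h) (at_right 0)"
        unfolding eventually_at_right_field by (intro exI[of _ 1]) (auto simp: flat_def divide_inverse)
      then show "((\<lambda>h. flat k h / h) \<longlongrightarrow> 0) (at_right 0)"
        by (rule Lim_transform_eventually[rotated]) (rule flat_tendsto_0)
    qed
    then show ?thesis using 2 by (simp add: DERIV_def flat_def)
  next
    case 3
    have "((\<lambda>x. inverse x ^ k) has_real_derivative (- real k * inverse x ^ (k + 1))) (at x)"
      by (rule DERIV_cong[OF DERIV_power[OF DERIV_inverse[OF less_imp_neq[OF 3, symmetric]]]])
         (cases k; simp add: algebra_simps)
    moreover have "((\<lambda>x. exp (- inverse x)) has_real_derivative (exp (- inverse x) * inverse x ^ 2)) (at x)"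
    proof (rule DERIV_cong[OF DERIV_chain'[OF DERIV_minus[OF DERIV_inverse[OF less_imp_neq[OF 3, symmetric]]] DERIV_exp]])
    qed (simp add: numeral_2_eq_2 mult.commute)
    ultimately have "((\<lambda>x. inverse x ^ k * exp (- inverse x)) has_real_derivative
       (- real k * inverse x ^ (k + 1) * exp (- inverse x) + exp (- inverse x) * inverse x ^ 2 * inverse x ^ k)) (at x)"
      by (rule DERIV_mult)
    also have "- real k * inverse x ^ (k + 1) * exp (- inverse x) + exp (- inverse x) * inverse x ^ 2 * inverse x ^ k
      = flat (k + 2) x - real k * flat (k + 1) x"
      using 3 by (simp add: flat_def power2_eq_square)
    finally show ?thesis
      by (rule has_field_derivative_transform_within_open[where S="{0<..}"]) (use 3 in \<open>auto simp: flat_def\<close>)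
  qed
qed

text \<open>Linear combinations of products supported in the unit interval. Smoothness of the basic
  bump follows from closure of this set under differentiation, without a formula for the
  derivatives.\<close>

inductive_set bumps :: "(real \<Rightarrow> real) set" where
  base: "(\<lambda>t. flat k t * flat l (1 - t)) \<in> bumps"
| add: "f \<in> bumps \<Longrightarrow> g \<in> bumps \<Longrightarrow> (\<lambda>t. f t + g t) \<in> bumps"
| scale: "f \<in> bumps \<Longrightarrow> (\<lambda>t. c * f t) \<in> bumps"

lemma bumps_deriv:
  assumes "f \<in> bumps"
  shows "\<exists>g\<in>bumps. \<forall>t. (f has_real_derivative g t) (at t)"
  using assms
proof induction
  case (base k l)
  let ?g = "\<lambda>t. (flat (k + 2) t * flat l (1 - t) + (- real k) * (flat (k + 1) t * flat l (1 - t)))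
     + ((-1) * (flat k t * flat (l + 2) (1 - t)) + real l * (flat k t * flat (l + 1) (1 - t)))"
  have "?g \<in> bumps" by (intro bumps.intros)
  moreover have "((\<lambda>t. flat k t * flat l (1 - t)) has_real_derivative ?g t) (at t)" for t
  proof -
    have "((\<lambda>t. flat l (1 - t)) has_real_derivative
        (flat (l + 2) (1 - t) - real l * flat (l + 1) (1 - t)) * (- 1)) (at t)"
      by (rule DERIV_chain'[OF _ DERIV_flat]) (auto intro!: derivative_eq_intros)
    from DERIV_mult[OF DERIV_flat this, of k]
    show ?thesis by (rule DERIV_cong) (simp add: algebra_simps)
  qed
  ultimately show ?case by (intro bexI[where x="?g"]) auto
next
  case (add f g)
  then obtain f' g' where *: "f' \<in> bumps" "g' \<in> bumps"
    "\<And>t. (f has_real_derivative f' t) (at t)" "\<And>t. (g has_real_derivative g' t) (at t)" by blast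
  then show ?case by (intro bexI[of _ "\<lambda>t. f' t + g' t"]) (auto intro: bumps.add DERIV_add)
next
  case (scale f c)
  then obtain f' where *: "f' \<in> bumps" "\<And>t. (f has_real_derivative f' t) (at t)" by blast
  then show ?case by (intro bexI[of _ "\<lambda>t. c * f' t"]) (auto intro: bumps.scale DERIV_cmult)
qed

lemma bumps_eq_0: "f \<in> bumps \<Longrightarrow> t \<notin> {0<..<1} \<Longrightarrow> f t = 0"
  by (induction rule: bumps.induct) (auto simp: flat_def)

text \<open>The normalised primitive of a bump. Smoothness is expressed by supplying all derivatives
  as a sequence \<open>P\<close>, the format in which the time factors of test functions are used
  later.\<close>

lemma smooth_step:
  obtains P :: "nat \<Rightarrow> real \<Rightarrow> real" where
    "\<And>k t. (P k has_real_derivative P (Suc k) t) (at t)"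
    "\<And>t. t \<le> 0 \<Longrightarrow> P 0 t = 0" "\<And>t. 1 \<le> t \<Longrightarrow> P 0 t = 1"
    "\<And>t. P 0 t \<in> {0..1}" "\<And>t. 0 \<le> P 1 t" "\<And>t. t \<notin> {0<..<1} \<Longrightarrow> P 1 t = 0"
proof -
  obtain D where D: "\<And>f. f \<in> bumps \<Longrightarrow> D f \<in> bumps"
    "\<And>f t. f \<in> bumps \<Longrightarrow> (f has_real_derivative D f t) (at t)"
    using bumps_deriv by metis
  define b where "b t = flat 0 t * flat 0 (1 - t)" for t :: real
  have b: "b \<in> bumps" using bumps.base[of 0 0] by (simp add: b_def[abs_def])
  have b0: "0 \<le> b t" for t by (simp add: b_def flat_def)
  have Dk: "(D ^^ k) b \<in> bumps" for k by (induction k) (auto simp: b D(1))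
  have cb: "continuous_on S b" for S
    by (intro continuous_at_imp_continuous_on ballI DERIV_isCont[OF D(2)[OF b]])
  \<comment> \<open>The lower limit lies to the left of the support, so that 0 is an interior point
    and the fundamental theorem of calculus gives a two-sided derivative there.\<close>
  define Q where "Q t = integral {-1..t} b" for t
  have Q0: "Q t = 0" if "t \<le> 0" for t
  proof -
    have "integral {-1..t} b = integral {-1..t} (\<lambda>_. 0)"
      using that by (intro integral_cong bumps_eq_0[OF b]) auto
    then show ?thesis by (simp add: Q_def)
  qed
  have DQ: "(Q has_real_derivative b t) (at t)" for t
  proof (cases "t < 0")
    case True
    have "((\<lambda>t. 0) has_real_derivative 0) (at t)" by simp
    then have "(Q has_real_derivative 0) (at t)"
      by (rule has_field_derivative_transform_within_open[where S="{..<0}"]) (use True Q0 in auto)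
    then show ?thesis using True bumps_eq_0[OF b, of t] by simp
  next
    case False
    have "(Q has_real_derivative b t) (at t within {-1..t + 1})"
      unfolding Q_def by (rule integral_has_real_derivative[OF cb]) (use False in auto)
    then show ?thesis using False by (subst (asm) at_within_interior) auto
  qed
  have mono: "Q s \<le> Q t" if "s \<le> t" for s t
    by (rule DERIV_nonneg_imp_nondecreasing[OF that]) (use DQ b0 in blast)
  have Q1: "Q t = Q 1" if "1 \<le> t" for t
  proof -
    have "Q t \<le> Q 1"
      by (rule DERIV_nonpos_imp_nonincreasing[OF that]) (use DQ bumps_eq_0[OF b] in force)
    then show ?thesis using mono[OF that] by simp
  qed
  have "Q 0 < Q 1"
  proof -
    have "\<exists>y. (Q has_real_derivative y) (at x) \<and> 0 < y" if "0 < x" "x < 1" for x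
    proof -
      have "0 < b x" using that by (simp add: b_def flat_def)
      then show ?thesis using DQ by blast
    qed
    moreover have "continuous_on {0..1} Q"
      by (intro continuous_at_imp_continuous_on ballI DERIV_isCont[OF DQ])
    ultimately show ?thesis by (intro DERIV_pos_imp_increasing_open[of 0 1 Q]) auto
  qed
  then have pos: "0 < Q 1" using Q0[of 0] by simp
  define P where "P k = (case k of 0 \<Rightarrow> (\<lambda>t. Q t / Q 1) | Suc j \<Rightarrow> (\<lambda>t. (D ^^ j) b t / Q 1))" for k
  show ?thesis
  proof (rule that[of P])
    fix k t
    show "(P k has_real_derivative P (Suc k) t) (at t)"
    proof (cases k)
      case 0
      show ?thesis using DERIV_cdivide[OF DQ[of t], of "Q 1"] by (simp add: P_def 0)
    next
      case (Suc j)
      show ?thesis using DERIV_cdivide[OF D(2)[OF Dk[of j], of t], of "Q 1"] by (simp add: P_def Suc)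
    qed
  next
    fix t :: real assume "t \<le> 0" then show "P 0 t = 0" by (simp add: P_def Q0)
  next
    fix t :: real assume "1 \<le> t" then have "Q t = Q 1" by (rule Q1)
    then show "P 0 t = 1" using pos by (simp add: P_def)
  next
    fix t :: real
    have "0 \<le> Q t" using Q0[of t] mono[of 0 t] Q0[of 0] by (cases "t \<le> 0") auto
    moreover have "Q t \<le> Q 1" using Q1[of t] mono[of t 1] by (cases "1 \<le> t") auto
    ultimately show "P 0 t \<in> {0..1}" using pos by (simp add: P_def)
  next
    fix t :: real show "0 \<le> P 1 t" using b0 pos by (simp add: P_def)
  next
    fix t :: real assume "t \<notin> {0<..<1}"
    then show "P 1 t = 0" using bumps_eq_0[OF b] by (simp add: P_def)
  qed
qed

section \<open>Directional derivatives and tensor products of test functions\<close>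

lemma smooth_fun_has_vector_derivative:
  assumes "smooth_fun f"
  shows "((\<lambda>s. diter vs f (x + s *\<^sub>R v)) has_vector_derivative diter (v # vs) f (x + s *\<^sub>R v)) (at s)"
proof -
  \<comment> \<open>\<open>smooth_fun\<close> only provides derivatives at parameter 0; a derivative
    at \<open>s\<close> is one at 0 for the base point moved by
    \<open>s *\<^sub>R v\<close>.\<close>
  let ?y = "x + s *\<^sub>R v"
  have "(\<lambda>s::real. diter vs f (?y + s *\<^sub>R v)) differentiable (at 0)"
    using assms by (simp add: smooth_fun_def)
  then have "((\<lambda>s. diter vs f (?y + s *\<^sub>R v)) has_vector_derivative diter (v # vs) f ?y) (at 0)"
    by (simp add: vector_derivative_works dderiv_def)
  then have *: "((\<lambda>s. diter vs f (?y + s *\<^sub>R v)) has_vector_derivative diter (v # vs) f ?y) (at (s - s))"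
    by simp
  have "((\<lambda>t. t - s) has_vector_derivative 1) (at s)"
    by (auto intro!: derivative_eq_intros)
  from vector_diff_chain_at[OF this *]
  have "((\<lambda>t. diter vs f (?y + (t - s) *\<^sub>R v)) has_vector_derivative diter (v # vs) f ?y) (at s)"
    by (simp add: o_def)
  then show ?thesis by (simp add: algebra_simps)
qed

lemma smooth_fun_continuous: "smooth_fun f \<Longrightarrow> continuous_on UNIV (diter vs f)"
  by (simp add: smooth_fun_def)

text \<open>As for \<open>bumps\<close>: a space of continuous functions that contains the product
  of \<open>d 0\<close> and \<open>\<phi>\<close> and is closed under directional derivatives in
  space-time. This yields \<open>smooth_fun\<close> for the product without computing mixed
  derivatives.\<close>

inductive_set tensors :: "(nat \<Rightarrow> real \<Rightarrow> real) \<Rightarrow> ('a::real_normed_vector \<Rightarrow> complex) \<Rightarrow> (real \<times> 'a \<Rightarrow> complex) set"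
  for d \<phi> where
  base: "(\<lambda>z. of_real (d k (fst z)) * diter ws \<phi> (snd z)) \<in> tensors d \<phi>"
| add: "f \<in> tensors d \<phi> \<Longrightarrow> g \<in> tensors d \<phi> \<Longrightarrow> (\<lambda>z. f z + g z) \<in> tensors d \<phi>"
| scale: "f \<in> tensors d \<phi> \<Longrightarrow> (\<lambda>z. c * f z) \<in> tensors d \<phi>"

context
  fixes d :: "nat \<Rightarrow> real \<Rightarrow> real" and \<phi> :: "'a::real_normed_vector \<Rightarrow> complex"
  assumes d: "\<And>k t. (d k has_real_derivative d (Suc k) t) (at t)" and \<phi>: "smooth_fun \<phi>"
begin

lemma tensor_has_vector_derivative:
  "((\<lambda>s. of_real (d k (fst (z + s *\<^sub>R v))) * diter ws \<phi> (snd (z + s *\<^sub>R v))) has_vector_derivative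
     (of_real (fst v * d (Suc k) (fst z)) * diter ws \<phi> (snd z) + of_real (d k (fst z)) * diter (snd v # ws) \<phi> (snd z))) (at 0)"
proof -
  have "((\<lambda>s. fst z + s * fst v) has_real_derivative fst v) (at 0)"
    by (auto intro!: derivative_eq_intros)
  from DERIV_chain'[OF this d, of k]
  have "((\<lambda>s. d k (fst z + s * fst v)) has_real_derivative fst v * d (Suc k) (fst z)) (at 0)"
    by (simp add: mult.commute)
  from has_vector_derivative_of_real[OF this]
  have 1: "((\<lambda>s. complex_of_real (d k (fst z + s * fst v))) has_vector_derivative of_real (fst v * d (Suc k) (fst z))) (at 0)" .
  have 2: "((\<lambda>s. diter ws \<phi> (snd z + s *\<^sub>R snd v)) has_vector_derivative diter (snd v # ws) \<phi> (snd z)) (at 0)"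
    using smooth_fun_has_vector_derivative[OF \<phi>, of ws "snd z" "snd v" 0] by simp
  show ?thesis
    using has_vector_derivative_mult[OF 1 2] by (simp add: add.commute)
qed

lemma tensors_deriv:
  assumes "F \<in> tensors d \<phi>"
  shows "\<exists>F'\<in>tensors d \<phi>. \<forall>z. ((\<lambda>s. F (z + s *\<^sub>R v)) has_vector_derivative F' z) (at 0)"
  using assms
proof induction
  case (base k ws)
  let ?F = "\<lambda>z. of_real (fst v) * (of_real (d (Suc k) (fst z)) * diter ws \<phi> (snd z))
    + of_real (d k (fst z)) * diter (snd v # ws) \<phi> (snd z)"
  have "?F \<in> tensors d \<phi>" by (intro tensors.intros)
  then show ?case
    
    by (rule bexI[rotated], intro allI) (use tensor_has_vector_derivative[of k _ v ws] in \<open>simp only: of_real_mult mult.assoc\<close>)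
next
  case (add f g)
  then obtain f' g' where *: "f' \<in> tensors d \<phi>" "g' \<in> tensors d \<phi>"
    "\<And>z. ((\<lambda>s. f (z + s *\<^sub>R v)) has_vector_derivative f' z) (at 0)"
    "\<And>z. ((\<lambda>s. g (z + s *\<^sub>R v)) has_vector_derivative g' z) (at 0)" by blast
  then show ?case
    by (intro bexI[of _ "\<lambda>t. f' t + g' t"]) (auto intro: tensors.add has_vector_derivative_add)
next
  case (scale f c)
  then obtain f' where *: "f' \<in> tensors d \<phi>" "\<And>z. ((\<lambda>s. f (z + s *\<^sub>R v)) has_vector_derivative f' z) (at 0)" by blast
  then show ?case
    by (intro bexI[of _ "\<lambda>t. c * f' t"]) (auto intro: tensors.scale has_vector_derivative_mult_right)
qed

lemma tensors_dderiv: "F \<in> tensors d \<phi> \<Longrightarrow> dderiv v F \<in> tensors d \<phi>"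
proof -
  assume "F \<in> tensors d \<phi>"
  from tensors_deriv[OF this, of v] obtain F' where F': "F' \<in> tensors d \<phi>"
    "\<And>z. ((\<lambda>s. F (z + s *\<^sub>R v)) has_vector_derivative F' z) (at 0)" by blast
  have "dderiv v F = F'" unfolding dderiv_def using vector_derivative_at[OF F'(2)] by auto
  then show ?thesis using F'(1) by simp
qed

lemma tensors_continuous: "F \<in> tensors d \<phi> \<Longrightarrow> continuous_on UNIV F"
proof (induction rule: tensors.induct)
  case (base k ws)
  have "continuous_on UNIV (d k)" by (intro continuous_at_imp_continuous_on ballI DERIV_isCont[OF d])
  then have "continuous_on UNIV (\<lambda>z::real \<times> 'a. d k (fst z))"
    by (rule continuous_on_compose2) (auto intro!: continuous_intros)
  moreover have "continuous_on UNIV (\<lambda>z::real \<times> 'a. diter ws \<phi> (snd z))"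
    by (rule continuous_on_compose2[OF smooth_fun_continuous[OF \<phi>]]) (auto intro!: continuous_intros)
  ultimately show ?case by (intro continuous_intros)
qed (auto intro!: continuous_intros)

lemma smooth_fun_tensor: "smooth_fun (\<lambda>z. of_real (d 0 (fst z)) * \<phi> (snd z))"
proof -
  let ?F = "\<lambda>z. of_real (d 0 (fst z)) * \<phi> (snd z)"
  have F: "diter vs ?F \<in> tensors d \<phi>" for vs
    by (induction vs) (use tensors.base[of d 0 "[]" \<phi>] in \<open>auto simp: tensors_dderiv\<close>)
  have "(\<lambda>s::real. diter vs ?F (x + s *\<^sub>R v)) differentiable (at 0)" for vs v x
    using tensors_deriv[OF F, where v=v] by (meson differentiableI_vector)
  then show ?thesis unfolding smooth_fun_def using F tensors_continuous by blast
qed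

lemma dderiv_tensor:
  "dderiv v (\<lambda>z. of_real (d k (fst z)) * diter ws \<phi> (snd z)) z
     = of_real (fst v * d (Suc k) (fst z)) * diter ws \<phi> (snd z) + of_real (d k (fst z)) * diter (snd v # ws) \<phi> (snd z)"
  unfolding dderiv_def by (rule vector_derivative_at[OF tensor_has_vector_derivative])

end

lemma dt_tensor:
  assumes "\<And>k t. (d k has_real_derivative d (Suc k) t) (at t)" "smooth_fun \<phi>"
  shows "dt (\<lambda>z. of_real (d 0 (fst z)) * \<phi> (snd z)) z = of_real (d 1 (fst z)) * \<phi> (snd z)"
proof -
  \<comment> \<open>The direction \<open>(1, 0)\<close> also differentiates the space factor, in
    direction 0.\<close>
  have "dderiv 0 \<phi> x = 0" for x by (simp add: dderiv_def)
  then show ?thesis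
    using dderiv_tensor[where d=d and \<phi>=\<phi>, OF assms, of "(1, 0)" 0 "[]" z] by (simp add: dt_def)
qed

lemma lapx_tensor:
  assumes "\<And>k t. (d k has_real_derivative d (Suc k) t) (at t)" "smooth_fun \<phi>"
  shows "lapx (\<lambda>z. of_real (d 0 (fst z)) * \<phi> (snd z)) z = of_real (d 0 (fst z)) * lap \<phi> (snd z)"
proof -
  have 1: "dderiv (0, i) (\<lambda>z. of_real (d 0 (fst z)) * \<phi> (snd z))
      = (\<lambda>z. of_real (d 0 (fst z)) * diter [i] \<phi> (snd z))" for i
    using dderiv_tensor[where d=d and \<phi>=\<phi>, OF assms, of "(0, i)" 0 "[]"] by auto
  have 2: "dderiv (0, i) (\<lambda>z. of_real (d 0 (fst z)) * diter [i] \<phi> (snd z)) z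
      = of_real (d 0 (fst z)) * dderiv i (dderiv i \<phi>) (snd z)" for i
    using dderiv_tensor[where d=d and \<phi>=\<phi>, OF assms, of "(0, i)" 0 "[i]" z] by simp
  show ?thesis
    unfolding lapx_def lap_def 1 2 by (rule sum_distrib_left[symmetric])
qed

lemma test_fun_tensor:
  assumes d: "\<And>k t. (d k has_real_derivative d (Suc k) t) (at t)" and \<phi>: "test_fun \<Omega> \<phi>"
    and supp: "\<And>t. t \<notin> {\<alpha>..\<beta>} \<Longrightarrow> d 0 t = 0" and \<alpha>: "0 < \<alpha>"
  shows "test_fun ({0<..} \<times> \<Omega>) (\<lambda>z. of_real (d 0 (fst z)) * \<phi> (snd z))"
proof -
  let ?F = "\<lambda>z. complex_of_real (d 0 (fst z)) * \<phi> (snd z)"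
  \<comment> \<open>The support lies over a closed time interval that starts at
    \<open>\<alpha>\<close>, hence stays away from the initial time.\<close>
  let ?K = "{\<alpha>..\<beta>} \<times> closure {x. \<phi> x \<noteq> 0}"
  have K: "compact ?K" using \<phi> by (auto simp: test_fun_def intro!: compact_Times)
  have "z \<in> ?K" if "?F z \<noteq> 0" for z
    using that supp[of "fst z"] closure_subset[of "{x. \<phi> x \<noteq> 0}"] by (cases z) auto
  then have "{z. ?F z \<noteq> 0} \<subseteq> ?K" by blast
  then have cl: "closure {z. ?F z \<noteq> 0} \<subseteq> ?K"
    using K by (intro closure_minimal compact_imp_closed)
  have "compact (?K \<inter> closure {z. ?F z \<noteq> 0})" by (rule compact_Int_closed[OF K closed_closure])
  moreover have "?K \<inter> closure {z. ?F z \<noteq> 0} = closure {z. ?F z \<noteq> 0}" using cl by auto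
  ultimately have c: "compact (closure {z. ?F z \<noteq> 0})" by simp
  have "?K \<subseteq> {0<..} \<times> \<Omega>" using \<phi> \<alpha> by (auto simp: test_fun_def)
  with cl have "closure {z. ?F z \<noteq> 0} \<subseteq> {0<..} \<times> \<Omega>" by (rule order_trans)
  moreover have "smooth_fun \<phi>" using \<phi> by (simp add: test_fun_def)
  ultimately show ?thesis
    using smooth_fun_tensor[where d=d and \<phi>=\<phi>, OF d] c unfolding test_fun_def by blast
qed

text \<open>The rescaled \<open>P 1\<close> is an approximate identity of total mass
  \<open>P 0 1 - P 0 0 = 1\<close>, supported to the right of \<open>a\<close>. One-sidedness
  matters because \<open>V\<close> is controlled on \<open>{a..a + 1}\<close> only. The substitution
  \<open>t = a + s / Suc n\<close> makes the weight independent of \<open>n\<close>, and dominated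
  convergence applies.\<close>

lemma smooth_step_approximates_point_value:
  fixes V :: "real \<Rightarrow> complex" and P :: "nat \<Rightarrow> real \<Rightarrow> real"
  assumes P: "\<And>k t. (P k has_real_derivative P (Suc k) t) (at t)"
    "P 0 0 = 0" "P 0 1 = 1" "\<And>t. 0 \<le> P 1 t" "\<And>t. t \<notin> {0<..<1} \<Longrightarrow> P 1 t = 0"
    and V: "continuous_on {a..a + 1} V"
  shows "(\<lambda>n. LINT t|lborel. of_real (real (Suc n) * P 1 (real (Suc n) * (t - a))) * V t) \<longlonglongrightarrow> V a"
proof -
  have cP: "isCont (P 1) t" for t using P(1)[of 1] by (rule DERIV_isCont)
  obtain B where B: "\<And>t. t \<in> {a..a + 1} \<Longrightarrow> cmod (V t) \<le> B"
    using compact_imp_bounded[OF compact_continuous_image[OF V compact_Icc]]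
    unfolding bounded_iff by blast
  define g where "g n s = complex_of_real (P 1 s) * V (a + s / real (Suc n))" for n s
  have g0: "g n s = indicator {0..1} s *\<^sub>R g n s" for n s
    by (cases "s \<in> {0<..<1}") (auto simp: g_def P(5) simp del: One_nat_def)
  have sub: "(LINT t|lborel. of_real (real (Suc n) * P 1 (real (Suc n) * (t - a))) * V t) = (LINT s|lborel. g n s)" for n
  proof -
    have "(LINT t|lborel. of_real (real (Suc n) * P 1 (real (Suc n) * (t - a))) * V t)
      = \<bar>1 / real (Suc n)\<bar> *\<^sub>R (LINT s|lborel. of_real (real (Suc n) * P 1 (real (Suc n) * (a + 1 / real (Suc n) * s - a))) * V (a + 1 / real (Suc n) * s))"
      by (rule lborel_integral_real_affine) simp
    also have "\<dots> = (LINT s|lborel. (1 / real (Suc n)) *\<^sub>R (of_real (real (Suc n) * P 1 (real (Suc n) * (a + 1 / real (Suc n) * s - a))) * V (a + 1 / real (Suc n) * s)))"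
      by simp
    also have "\<dots> = (LINT s|lborel. g n s)"
      by (intro Bochner_Integration.integral_cong) (auto simp: g_def scaleR_conv_of_real simp del: of_nat_Suc)
    finally show ?thesis .
  qed
  have meas: "g n \<in> borel_measurable lborel" for n
  proof -
    have "continuous_on {0..1} (\<lambda>s. V (a + s / real (Suc n)))"
      by (rule continuous_on_compose2[OF V]) (auto intro!: continuous_intros simp: field_simps)
    moreover have "continuous_on {0..1} (\<lambda>s. complex_of_real (P 1 s))"
      by (intro continuous_on_of_real continuous_at_imp_continuous_on ballI cP)
    ultimately have "continuous_on {0..1} (g n)"
      unfolding g_def by (intro continuous_on_mult)
    then have "(\<lambda>s. indicator {0..1} s *\<^sub>R g n s) \<in> borel_measurable borel"
      by (intro borel_measurable_continuous_on_indicator) auto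
    then show ?thesis using g0 by simp
  qed
  have "(\<lambda>n. LINT s|lborel. g n s) \<longlonglongrightarrow> (LINT s|lborel. of_real (P 1 s) * V a)"
  proof (rule integral_dominated_convergence[where w="\<lambda>s. indicator {0..1} s *\<^sub>R (P 1 s * B)"])
    have "P 1 \<in> borel_measurable borel"
      using cP by (intro borel_measurable_continuous_onI continuous_at_imp_continuous_on) auto
    then show "(\<lambda>s. complex_of_real (P 1 s) * V a) \<in> borel_measurable lborel" by measurable
    show "integrable lborel (\<lambda>s. indicator {0..1} s *\<^sub>R (P 1 s * B))"
      using cP by (intro borel_integrable_compact continuous_intros continuous_at_imp_continuous_on) auto
    show "AE s in lborel. (\<lambda>n. g n s) \<longlonglongrightarrow> of_real (P 1 s) * V a"
    proof (rule AE_I2)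
      fix s :: real
      show "(\<lambda>n. g n s) \<longlonglongrightarrow> of_real (P 1 s) * V a"
      proof (cases "s \<in> {0<..<1}")
        case True
        have "(\<lambda>n. s / real (Suc n)) \<longlonglongrightarrow> 0"
          by (rule LIMSEQ_Suc[OF lim_const_over_n])
        from tendsto_add[OF tendsto_const this, of a]
        have "(\<lambda>n. a + s / real (Suc n)) \<longlonglongrightarrow> a" by simp
        then have "(\<lambda>n. V (a + s / real (Suc n))) \<longlonglongrightarrow> V a"
          by (rule continuous_on_tendsto_compose[OF V]) (use True in \<open>auto simp: field_simps\<close>)
        then show ?thesis unfolding g_def by (intro tendsto_intros)
      qed (simp add: g_def P(5) del: One_nat_def)
    qed
    fix n
    show "AE s in lborel. norm (g n s) \<le> indicator {0..1} s *\<^sub>R (P 1 s * B)"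
    proof (rule AE_I2)
      fix s :: real
      show "norm (g n s) \<le> indicator {0..1} s *\<^sub>R (P 1 s * B)"
      proof (cases "s \<in> {0<..<1}")
        case True
        then have "cmod (V (a + s / real (Suc n))) \<le> B" by (intro B) (auto simp: field_simps)
        then show ?thesis using True P(4)[of s] by (auto simp: g_def norm_mult intro: mult_left_mono)
      qed (simp add: g_def P(5) del: One_nat_def)
    qed
  qed (rule meas)
  also have "(LINT s|lborel. of_real (P 1 s) * V a) = of_real (LINT s|lborel. P 1 s) * V a"
    by (simp add: integral_complex_of_real)
  also have "(LINT s|lborel. P 1 s) = (LINT s|lborel. P 1 s * indicator {0..1} s)"
  proof (intro Bochner_Integration.integral_cong refl)
    fix s :: real
    show "P 1 s = P 1 s * indicator {0..1} s"
      by (cases "s \<in> {0<..<1}") (auto simp: P(5) simp del: One_nat_def)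
  qed
  also have "\<dots> = P 0 1 - P 0 0"
    by (rule integral_FTC_Icc_real) (use P(1)[of 0] cP in \<open>auto intro: has_field_derivative_at_within\<close>)
  finally show ?thesis unfolding sub by (simp add: P)
qed

text \<open>Du Bois-Reymond: \<open>d\<close> ranges over the test functions together with all their derivatives.\<close>
lemma weak_derivative_imp_difference:
  fixes V W :: "real \<Rightarrow> complex"
  assumes t: "t1 \<le> t2" and V: "continuous_on {t1..t2 + 1} V"
    and W: "set_integrable lborel {t1..t2 + 1} W"
    and weak: "\<And>d. (\<And>k t. (d k has_real_derivative d (Suc k) t) (at t)) \<Longrightarrow>
      (\<And>t. t \<notin> {t1..t2 + 1} \<Longrightarrow> d (0::nat) t = 0) \<Longrightarrow>
      (LINT t|lborel. of_real (d 1 t) * V t) = (LINT t|lborel. of_real (d 0 t) * W t)"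
  shows "V t1 - V t2 = (LINT t:{t1..t2}|lborel. W t)"
proof -
  obtain P :: "nat \<Rightarrow> real \<Rightarrow> real" where P:
    "\<And>k t. (P k has_real_derivative P (Suc k) t) (at t)"
    "\<And>t. t \<le> 0 \<Longrightarrow> P 0 t = 0" "\<And>t. 1 \<le> t \<Longrightarrow> P 0 t = 1"
    "\<And>t. P 0 t \<in> {0..1}" "\<And>t. 0 \<le> P 1 t" "\<And>t. t \<notin> {0<..<1} \<Longrightarrow> P 1 t = 0"
    using smooth_step by metis
  have cP: "isCont (P k) t" for k t using P(1)[of k] by (rule DERIV_isCont)
  have mP: "P k \<in> borel_measurable borel" for k
    using cP by (intro borel_measurable_continuous_onI continuous_at_imp_continuous_on) auto
  \<comment> \<open>A plateau: one step rises just after \<open>t1\<close>, and one that rises just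
    after \<open>t2\<close> is subtracted. As \<open>n\<close> grows, \<open>d n 0\<close> tends to
    the indicator of the interval between them and \<open>d n 1\<close> to the difference of two
    point evaluations. The second step is complete by \<open>t2 + 1\<close>, hence the enlarged
    interval; the power of \<open>Suc n\<close> comes from the chain rule.\<close>
  define d where "d n k t = real (Suc n) ^ k * (P k (real (Suc n) * (t - t1)) - P k (real (Suc n) * (t - t2)))" for n k t
  have md [measurable]: "d n k \<in> borel_measurable borel" for n k
    unfolding d_def using mP[of k] by measurable
  have dd: "(d n k has_real_derivative d n (Suc k) t) (at t)" for n k t
  proof -
    have "((\<lambda>t. P k (real (Suc n) * (t - a))) has_real_derivative P (Suc k) (real (Suc n) * (t - a)) * real (Suc n)) (at t)" for a
      by (rule DERIV_chain'[OF _ P(1)]) (auto intro!: derivative_eq_intros)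
    from DERIV_cmult[OF DERIV_diff[OF this[of t1] this[of t2]], of "real (Suc n) ^ k"]
    show ?thesis unfolding d_def by (rule DERIV_cong) (simp add: algebra_simps)
  qed
  have d0: "d n 0 t = 0" if "t \<notin> {t1..t2 + 1}" for n t
  proof (cases "t < t1")
    case True
    then have "real (Suc n) * (t - t1) \<le> 0" "real (Suc n) * (t - t2) \<le> 0"
      using t by (auto intro!: mult_nonneg_nonpos)
    then show ?thesis by (simp add: d_def P(2))
  next
    case False
    then have "1 \<le> t - t1" "1 \<le> t - t2" using that t by auto
    then have "1 \<le> real (Suc n) * (t - t1)" "1 \<le> real (Suc n) * (t - t2)"
      using mult_mono[of 1 "real (Suc n)" 1 "t - t1"] mult_mono[of 1 "real (Suc n)" 1 "t - t2"] by auto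
    then show ?thesis by (simp add: d_def P(3))
  qed
  have eq: "(LINT t|lborel. of_real (d n 1 t) * V t) = (LINT t|lborel. of_real (d n 0 t) * W t)" for n
    by (rule weak[OF dd d0])
  have "(\<lambda>n. LINT t|lborel. of_real (d n 1 t) * V t) \<longlonglongrightarrow> V t1 - V t2"
  proof -
    let ?I = "\<lambda>n a. LINT t|lborel. of_real (real (Suc n) * P 1 (real (Suc n) * (t - a))) * V t"
    have split: "(LINT t|lborel. of_real (d n 1 t) * V t) = ?I n t1 - ?I n t2" for n
    proof -
      have int: "integrable lborel (\<lambda>t. of_real (real (Suc n) * P 1 (real (Suc n) * (t - a))) * V t)" if "a \<in> {t1, t2}" for a
      proof -
        have "continuous_on {t1..t2 + 1} (\<lambda>t. of_real (real (Suc n) * P 1 (real (Suc n) * (t - a))) * V t)"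
          by (intro continuous_on_mult continuous_on_of_real continuous_on_const V
              continuous_at_imp_continuous_on ballI isCont_o2[OF _ cP] continuous_intros)
        then have "integrable lborel (\<lambda>t. indicator {t1..t2 + 1} t *\<^sub>R (of_real (real (Suc n) * P 1 (real (Suc n) * (t - a))) * V t))"
          by (rule borel_integrable_compact[OF compact_Icc])
        moreover have "indicator {t1..t2 + 1} s *\<^sub>R (of_real (real (Suc n) * P 1 (real (Suc n) * (s - a))) * V s)
          = of_real (real (Suc n) * P 1 (real (Suc n) * (s - a))) * V s" for s
        proof (cases "s \<in> {t1..t2 + 1}")
          case False
          have "P 1 (real (Suc n) * (s - a)) = 0"
          proof (cases "s < t1")
            case True
            then have "real (Suc n) * (s - a) \<le> 0"
              using that t by (auto intro!: mult_nonneg_nonpos)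
            then show ?thesis by (intro P(6)) auto
          next
            case False': False
            then have "1 \<le> s - a" using False that t by auto
            then have "1 \<le> real (Suc n) * (s - a)" using mult_mono[of 1 "real (Suc n)" 1 "s - a"] by auto
            then show ?thesis by (intro P(6)) auto
          qed
          then show ?thesis by simp
        qed simp
        ultimately show ?thesis by simp
      qed
      have "(LINT t|lborel. of_real (d n 1 t) * V t) = (LINT t|lborel.
          of_real (real (Suc n) * P 1 (real (Suc n) * (t - t1))) * V t - of_real (real (Suc n) * P 1 (real (Suc n) * (t - t2))) * V t)"
        by (intro Bochner_Integration.integral_cong refl) (simp add: d_def algebra_simps)
      also have "\<dots> = ?I n t1 - ?I n t2"
        by (rule Bochner_Integration.integral_diff[OF int int]) auto
      finally show ?thesis .
    qed
    have "(\<lambda>n. ?I n t1) \<longlonglongrightarrow> V t1"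
      by (rule smooth_step_approximates_point_value[OF P(1) _ _ P(5) P(6)])
         (use P t in \<open>auto intro!: continuous_on_subset[OF V]\<close>)
    moreover have "(\<lambda>n. ?I n t2) \<longlonglongrightarrow> V t2"
      by (rule smooth_step_approximates_point_value[OF P(1) _ _ P(5) P(6)])
         (use P t in \<open>auto intro!: continuous_on_subset[OF V]\<close>)
    ultimately show ?thesis unfolding split by (rule tendsto_diff)
  qed
  moreover have "(\<lambda>n. LINT t|lborel. of_real (d n 0 t) * W t) \<longlonglongrightarrow> (LINT t|lborel. indicator {t1<..t2} t *\<^sub>R W t)"
  proof -
    have dW: "of_real (d n 0 t) * W t = of_real (d n 0 t) * (indicator {t1..t2 + 1} t *\<^sub>R W t)" for n t
      using d0[of t n] by (cases "t \<in> {t1..t2 + 1}") auto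
    have iW: "indicator {t1<..t2} t *\<^sub>R W t = indicator {t1<..t2} t *\<^sub>R (indicator {t1..t2 + 1} t *\<^sub>R W t)" for t
      by (simp add: indicator_def)
    have mW [measurable]: "(\<lambda>t. indicator {t1..t2 + 1} t *\<^sub>R W t) \<in> borel_measurable lborel"
      using W unfolding set_integrable_def by (rule borel_measurable_integrable)
    show ?thesis unfolding dW iW
    proof (rule integral_dominated_convergence[where w="\<lambda>t. norm (indicator {t1..t2 + 1} t *\<^sub>R W t)"])
      show "(\<lambda>t. indicator {t1<..t2} t *\<^sub>R (indicator {t1..t2 + 1} t *\<^sub>R W t)) \<in> borel_measurable lborel"
        by measurable
      show "(\<lambda>t. complex_of_real (d n 0 t) * (indicator {t1..t2 + 1} t *\<^sub>R W t)) \<in> borel_measurable lborel" for n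
        by measurable
      show "integrable lborel (\<lambda>t. norm (indicator {t1..t2 + 1} t *\<^sub>R W t))"
        using W unfolding set_integrable_def by (rule integrable_norm)
      have "\<bar>d n 0 t\<bar> \<le> 1" for n t
        using P(4)[of "real (Suc n) * (t - t1)"] P(4)[of "real (Suc n) * (t - t2)"] by (auto simp: d_def)
      then show "AE t in lborel. norm (complex_of_real (d n 0 t) * (indicator {t1..t2 + 1} t *\<^sub>R W t)) \<le> norm (indicator {t1..t2 + 1} t *\<^sub>R W t)" for n
        by (intro AE_I2) (simp only: norm_mult norm_of_real mult_left_le_one_le[OF norm_ge_zero abs_ge_zero])
      have "(\<lambda>n. d n 0 t) \<longlonglongrightarrow> indicator {t1<..t2} t" for t
      proof -
        have step: "(\<lambda>n. P 0 (real (Suc n) * (t - a))) \<longlonglongrightarrow> indicator {a<..} t" for a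
        proof (cases "a < t")
          case True
          have "eventually (\<lambda>n. 1 / (t - a) < real (Suc n)) sequentially"
            using filterlim_compose[OF filterlim_real_sequentially filterlim_Suc]
            unfolding filterlim_at_top_dense by blast
          then have "eventually (\<lambda>n. 1 = P 0 (real (Suc n) * (t - a))) sequentially"
            by eventually_elim (use True P(3) in \<open>auto simp: field_simps\<close>)
          then show ?thesis using True
            by (intro Lim_transform_eventually[OF tendsto_const]) (auto simp: indicator_def)
        next
          case False
          then have "P 0 (real (Suc n) * (t - a)) = 0" for n by (intro P(2) mult_nonneg_nonpos) auto
          then show ?thesis using False by simp
        qed
        have "(\<lambda>n. d n 0 t) \<longlonglongrightarrow> indicator {t1<..} t - indicator {t2<..} t"
          unfolding d_def using tendsto_diff[OF step[of t1] step[of t2]] by simp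
        moreover have "indicator {t1<..} t - indicator {t2<..} t = (indicator {t1<..t2} t :: real)"
          using t by (auto simp: indicator_def)
        ultimately show ?thesis by simp
      qed
      then show "AE t in lborel. (\<lambda>n. complex_of_real (d n 0 t) * (indicator {t1..t2 + 1} t *\<^sub>R W t))
          \<longlonglongrightarrow> indicator {t1<..t2} t *\<^sub>R (indicator {t1..t2 + 1} t *\<^sub>R W t)"
        unfolding scaleR_conv_of_real[of "indicator {t1<..t2} _"]
        by (intro AE_I2 tendsto_mult tendsto_of_real tendsto_const)
    qed
  qed
  ultimately have "V t1 - V t2 = (LINT t|lborel. indicator {t1<..t2} t *\<^sub>R W t)"
    using LIMSEQ_unique unfolding eq by blast
  \<comment> \<open>The limit of the plateaus is half-open; the missing left endpoint is a null
    set.\<close>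
  also have "\<dots> = (LINT t|lborel. indicator {t1..t2} t *\<^sub>R W t)"
  proof (rule integral_cong_AE)
    have "set_integrable lborel {t1..t2} W" "set_integrable lborel {t1<..t2} W"
      by (rule set_integrable_subset[OF W]; auto)+
    then show "(\<lambda>t. indicator {t1..t2} t *\<^sub>R W t) \<in> borel_measurable lborel"
      "(\<lambda>t. indicator {t1<..t2} t *\<^sub>R W t) \<in> borel_measurable lborel"
      unfolding set_integrable_def by (auto intro: borel_measurable_integrable)
    show "AE t in lborel. indicator {t1<..t2} t *\<^sub>R W t = indicator {t1..t2} t *\<^sub>R W t"
      using AE_lborel_singleton[of t1] by eventually_elim (auto simp: indicator_def)
  qed
  finally show ?thesis by (simp add: set_lebesgue_integral_def)
qed

text \<open>Truncating \<open>v\<close> to \<open>A\<close> makes the hypotheses hold at almost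
  every time, so that the facts about product measures apply.\<close>

lemma l2_Bochner_set:
  fixes v :: "real \<Rightarrow> 'a::euclidean_space \<Rightarrow> complex"
  assumes v: "(\<lambda>z. v (fst z) (snd z)) \<in> borel_measurable borel" and A: "A \<in> sets borel"
    and sq: "AE s in lborel. s \<in> A \<longrightarrow> sq_integrable lborel (v s)"
    and int: "set_integrable lborel A (\<lambda>s. l2norm lborel (v s))"
  shows "AE x in lborel. set_integrable lborel A (\<lambda>s. v s x)"
    and "sq_integrable lborel (\<lambda>x. LINT s:A|lborel. v s x)"
    and "l2norm lborel (\<lambda>x. LINT s:A|lborel. v s x) \<le> (LINT s:A|lborel. l2norm lborel (v s))"
    and "sq_integrable lborel g \<Longrightarrow> set_integrable lborel A (\<lambda>s. l2inner lborel (v s) g)"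
    and "sq_integrable lborel g \<Longrightarrow>
      l2inner lborel (\<lambda>x. LINT s:A|lborel. v s x) g = (LINT s:A|lborel. l2inner lborel (v s) g)"
proof -
  define w where "w s x = indicator A s *\<^sub>R v s x" for s x
  have [measurable]: "A \<in> sets borel" by fact
  have "(\<lambda>z. w (fst z) (snd z)) \<in> borel_measurable borel"
    unfolding w_def
  proof (rule borel_measurable_scaleR[OF _ v])
    have "fst \<in> borel_measurable (borel :: (real \<times> 'a) measure)"
      by (intro borel_measurable_continuous_onI continuous_intros)
    then show "(\<lambda>z::real \<times> 'a. indicat_real A (fst z)) \<in> borel_measurable borel"
      by measurable
  qed
  then have w: "(\<lambda>(s, x). w s x) \<in> borel_measurable (lborel \<Otimes>\<^sub>M lborel)"
    by (simp add: lborel_prod split_beta')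
  have ws: "w s = (\<lambda>x. of_real (indicator A s) * v s x)" for s by (simp add: w_def scaleR_conv_of_real fun_eq_iff)
  have nw: "l2norm lborel (w s) = indicator A s *\<^sub>R l2norm lborel (v s)" for s
    unfolding ws l2norm_scale by simp
  have iw: "l2inner lborel (w s) g = indicator A s *\<^sub>R l2inner lborel (v s) g" for s g
    unfolding ws l2inner_scale_left by (simp add: scaleR_conv_of_real)
  have sqw: "AE s in lborel. sq_integrable lborel (w s)"
    using sq by eventually_elim (auto simp: ws indicator_def)
  have intw: "integrable lborel (\<lambda>s. l2norm lborel (w s))"
    using int by (simp add: nw set_integrable_def)
  have W: "(\<lambda>x. LINT s:A|lborel. v s x) = (\<lambda>x. LINT s|lborel. w s x)"
    by (simp add: set_lebesgue_integral_def w_def)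
  show "AE x in lborel. set_integrable lborel A (\<lambda>s. v s x)"
    using lborel_pair.l2_Bochner_AE_integrable[OF w sqw intw] by (simp add: set_integrable_def w_def)
  show "sq_integrable lborel (\<lambda>x. LINT s:A|lborel. v s x)"
    unfolding W by (rule lborel_pair.l2_Bochner_sq_integrable[OF w sqw intw])
  show "l2norm lborel (\<lambda>x. LINT s:A|lborel. v s x) \<le> (LINT s:A|lborel. l2norm lborel (v s))"
    using lborel_pair.l2_Bochner_norm_le[OF w sqw intw] unfolding W by (simp add: nw set_lebesgue_integral_def)
  show "set_integrable lborel A (\<lambda>s. l2inner lborel (v s) g)" if "sq_integrable lborel g"
    using lborel_pair.l2_Bochner_inner_integrable[OF w sqw intw that] by (simp add: iw set_integrable_def)
  show "l2inner lborel (\<lambda>x. LINT s:A|lborel. v s x) g = (LINT s:A|lborel. l2inner lborel (v s) g)"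
    if "sq_integrable lborel g"
    using lborel_pair.l2_Bochner_inner[OF w sqw intw that] unfolding W by (simp add: iw set_lebesgue_integral_def)
qed

section \<open>Translations and integrals along segments\<close>

lemma measurable_shift:
  fixes f :: "'a::euclidean_space \<Rightarrow> 'b::topological_space"
  assumes "f \<in> borel_measurable borel" shows "(\<lambda>x. f (x + e)) \<in> borel_measurable borel"
  using measurable_compose[OF _ assms, of "\<lambda>x. x + e" borel] by simp

lemma nn_integral_lborel_shift:
  fixes f :: "'a::euclidean_space \<Rightarrow> ennreal"
  assumes "f \<in> borel_measurable borel"
  shows "(\<integral>\<^sup>+x. f (x + e) \<partial>lborel) = (\<integral>\<^sup>+x. f x \<partial>lborel)"
proof -
  have "(\<integral>\<^sup>+x. f x \<partial>lborel) = (\<integral>\<^sup>+x. f x \<partial>distr lborel borel ((+) e))"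
    by (simp add: lborel_distr_plus)
  also have "\<dots> = (\<integral>\<^sup>+x. f (e + x) \<partial>lborel)"
    using assms by (intro nn_integral_distr) auto
  finally show ?thesis by (simp add: add.commute)
qed

lemma integral_lborel_shift:
  fixes f :: "'a::euclidean_space \<Rightarrow> 'b::{banach, second_countable_topology}"
  assumes "f \<in> borel_measurable borel"
  shows "(LINT x|lborel. f (x + e)) = (LINT x|lborel. f x)"
proof -
  have "(LINT x|lborel. f x) = (LINT x|distr lborel borel ((+) e). f x)"
    by (simp add: lborel_distr_plus)
  also have "\<dots> = (LINT x|lborel. f (e + x))"
    using assms by (intro integral_distr) auto
  finally show ?thesis by (simp add: add.commute)
qed

lemma sq_integrable_shift:
  assumes "sq_integrable lborel (f :: 'a::euclidean_space \<Rightarrow> complex)"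
  shows "sq_integrable lborel (\<lambda>x. f (x + e))"
proof (rule sq_integrableI)
  have f: "f \<in> borel_measurable borel" using assms by (simp add: sq_integrable_def)
  show "(\<lambda>x. f (x + e)) \<in> borel_measurable lborel" using measurable_shift[OF f] by simp
  have "(\<lambda>x. ennreal ((cmod (f x))\<^sup>2)) \<in> borel_measurable borel" using f by measurable
  from nn_integral_lborel_shift[OF this, of e] sq_integrable_nn[OF assms]
  show "(\<integral>\<^sup>+x. ennreal ((cmod (f (x + e)))\<^sup>2) \<partial>lborel) < \<infinity>" by simp
qed

lemma l2norm_shift:
  assumes f: "f \<in> borel_measurable borel"
  shows "l2norm lborel (\<lambda>x. f (x + e :: 'a::euclidean_space)) = l2norm lborel f"
proof -
  have "(\<lambda>x. (cmod (f x))\<^sup>2) \<in> borel_measurable borel" using f by measurable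
  from integral_lborel_shift[OF this, of e] show ?thesis by (simp add: l2norm_def)
qed

lemma l2inner_shift:
  assumes f: "f \<in> borel_measurable borel" and g: "g \<in> borel_measurable borel"
  shows "l2inner lborel (\<lambda>x. f (x + e :: 'a::euclidean_space)) g = l2inner lborel f (\<lambda>x. g (x - e))"
proof -
  have "(\<lambda>x. f x * cnj (g (x - e))) \<in> borel_measurable borel"
    using f measurable_shift[OF g, of "-e"] by simp
  from integral_lborel_shift[OF this, of e] show ?thesis by (simp add: l2inner_def)
qed

text \<open>If \<open>f\<close> is the derivative of a smooth function in direction
  \<open>e\<close>, this is the increment of that function along \<open>\<rho> *\<^sub>R e\<close>.
  As an operator on \<open>L^2\<close> it has norm at most \<open>\<rho>\<close> for nonnegative
  \<open>\<rho>\<close>, and reversing \<open>e\<close> gives its adjoint.\<close>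

definition segment_integral :: "real \<Rightarrow> 'a::euclidean_space \<Rightarrow> ('a \<Rightarrow> complex) \<Rightarrow> 'a \<Rightarrow> complex" where
  "segment_integral \<rho> e f x = (LINT s:{0..\<rho>}|lborel. f (x + s *\<^sub>R e))"

lemma set_integrable_const_Icc: "set_integrable lborel {a..b::real} (\<lambda>s. c :: 'b::{banach, second_countable_topology})"
  unfolding set_integrable_def by (rule borel_integrable_compact) auto

context
  fixes f :: "'a::euclidean_space \<Rightarrow> complex" and e :: 'a and \<rho> :: real
  assumes f: "sq_integrable lborel f"
begin

private lemma fm: "f \<in> borel_measurable borel"
  using f by (simp add: sq_integrable_def)

private lemma joint_shift: "(\<lambda>z::real \<times> 'a. f (snd z + fst z *\<^sub>R e)) \<in> borel_measurable borel"
proof -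
  have "(\<lambda>z::real \<times> 'a. snd z + fst z *\<^sub>R e) \<in> borel_measurable borel"
    by (intro borel_measurable_continuous_onI continuous_intros)
  from measurable_compose[OF this fm] show ?thesis .
qed

private lemma hyps:
  "AE s in lborel. s \<in> {0..\<rho>} \<longrightarrow> sq_integrable lborel (\<lambda>x. f (x + s *\<^sub>R e))"
  "set_integrable lborel {0..\<rho>} (\<lambda>s. l2norm lborel (\<lambda>x. f (x + s *\<^sub>R e)))"
  by (simp_all add: sq_integrable_shift[OF f] l2norm_shift[OF fm] set_integrable_const_Icc)

lemma sq_integrable_segment_integral: "sq_integrable lborel (segment_integral \<rho> e f)"
  unfolding segment_integral_def[abs_def]
  by (rule l2_Bochner_set(2)[where v="\<lambda>s x. f (x + s *\<^sub>R e)", OF joint_shift _ hyps]) simp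

lemma l2norm_segment_integral:
  assumes "0 \<le> \<rho>" shows "l2norm lborel (segment_integral \<rho> e f) \<le> \<rho> * l2norm lborel f"
proof -
  have "l2norm lborel (segment_integral \<rho> e f) \<le> (LINT s:{0..\<rho>}|lborel. l2norm lborel (\<lambda>x. f (x + s *\<^sub>R e)))"
    unfolding segment_integral_def[abs_def]
    by (rule l2_Bochner_set(3)[where v="\<lambda>s x. f (x + s *\<^sub>R e)", OF joint_shift _ hyps]) simp
  then show ?thesis using assms by (simp add: l2norm_shift[OF fm] set_lebesgue_integral_def)
qed

lemma l2inner_segment_integral:
  assumes "sq_integrable lborel g"
  shows "l2inner lborel (segment_integral \<rho> e f) g
    = (LINT s:{0..\<rho>}|lborel. l2inner lborel (\<lambda>x. f (x + s *\<^sub>R e)) g)"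
  unfolding segment_integral_def[abs_def]
  by (rule l2_Bochner_set(5)[where v="\<lambda>s x. f (x + s *\<^sub>R e)", OF joint_shift _ hyps assms]) simp

end

text \<open>The adjoint of a translation is the opposite translation; this is integrated along the
  segment.\<close>

lemma segment_integral_adjoint:
  assumes f: "sq_integrable lborel f" and g: "sq_integrable lborel g"
  shows "l2inner lborel (segment_integral \<rho> e f) g = l2inner lborel f (segment_integral \<rho> (- e) g)"
proof -
  have m: "f \<in> borel_measurable borel" "g \<in> borel_measurable borel"
    using f g by (auto simp: sq_integrable_def)
  have "l2inner lborel f (segment_integral \<rho> (- e) g) = cnj (l2inner lborel (segment_integral \<rho> (- e) g) f)"
    by (rule l2inner_commute)
  also have "\<dots> = (LINT s:{0..\<rho>}|lborel. cnj (l2inner lborel (\<lambda>x. g (x + s *\<^sub>R (- e))) f))"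
    unfolding l2inner_segment_integral[OF g f]
    by (simp add: set_lebesgue_integral_def flip: Bochner_Integration.integral_cnj)
  also have "\<dots> = (LINT s:{0..\<rho>}|lborel. l2inner lborel (\<lambda>x. f (x + s *\<^sub>R e)) g)"
    by (simp add: l2inner_shift[OF m] flip: l2inner_commute)
  finally show ?thesis by (simp add: l2inner_segment_integral[OF f g])
qed

section \<open>Test functions\<close>

text \<open>Derivatives are local. This passes compact support from a test function to all its
  iterated derivatives.\<close>

lemma diter_eq_0:
  assumes "open U" "\<And>x. x \<in> U \<Longrightarrow> f x = 0" "x \<in> U"
  shows "diter vs f x = 0"
  using assms(3)
proof (induction vs arbitrary: x)
  case Nil then show ?case using assms by simp
next
  case (Cons v vs)
  have "eventually (\<lambda>s::real. x + s *\<^sub>R v \<in> U) (nhds 0)"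
  proof -
    have "open ((\<lambda>s::real. x + s *\<^sub>R v) -` U)"
      by (intro open_vimage assms continuous_intros)
    then show ?thesis using eventually_nhds_in_open[of _ "0::real"] Cons.prems by force
  qed
  then have ev: "eventually (\<lambda>s::real. diter vs f (x + s *\<^sub>R v) = 0) (nhds 0)"
    by eventually_elim (rule Cons.IH)
  then have at0: "diter vs f (x + (0::real) *\<^sub>R v) = 0" by (rule eventually_nhds_x_imp_x)
  have "((\<lambda>s::real. diter vs f (x + s *\<^sub>R v)) has_vector_derivative 0) (at 0)
      = ((\<lambda>s::real. 0::complex) has_vector_derivative 0) (at 0)"
    by (rule has_vector_derivative_cong_ev) (use ev at0 in auto)
  then have "((\<lambda>s::real. diter vs f (x + s *\<^sub>R v)) has_vector_derivative 0) (at 0)" by simp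
  then show ?case by (simp add: dderiv_def vector_derivative_at)
qed

lemma test_fun_diter_eq_0:
  assumes "x \<notin> closure {x. \<phi> x \<noteq> 0}" shows "diter vs \<phi> x = 0"
proof (rule diter_eq_0[of "- closure {x. \<phi> x \<noteq> 0}"])
  show "\<phi> x = 0" if "x \<in> - closure {x. \<phi> x \<noteq> 0}" for x
    using that closure_subset[of "{x. \<phi> x \<noteq> 0}"] by auto
qed (use assms in auto)

lemma test_fun_diter_continuous: "test_fun U \<phi> \<Longrightarrow> continuous_on UNIV (diter vs \<phi>)"
  by (simp add: test_fun_def smooth_fun_def)

lemma test_fun_diter_measurable: "test_fun U \<phi> \<Longrightarrow> diter vs \<phi> \<in> borel_measurable borel"
  by (rule borel_measurable_continuous_onI[OF test_fun_diter_continuous])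

lemma test_fun_diter_vanishes_outside:
  assumes "test_fun U \<phi>" "x \<notin> U" shows "diter vs \<phi> x = 0"
  using assms by (intro test_fun_diter_eq_0) (auto simp: test_fun_def)

lemma integrable_continuous_compact_support:
  fixes f :: "'a::euclidean_space \<Rightarrow> 'b::{banach, second_countable_topology}"
  assumes "continuous_on UNIV f" "compact K" "\<And>x. x \<notin> K \<Longrightarrow> f x = 0"
  shows "integrable lborel f"
proof -
  have "integrable lborel (\<lambda>x. indicator K x *\<^sub>R f x)"
    by (rule borel_integrable_compact[OF assms(2) continuous_on_subset[OF assms(1)]]) auto
  moreover have "(\<lambda>x. indicator K x *\<^sub>R f x) = f" using assms(3) by (auto simp: indicator_def)
  ultimately show ?thesis by simp
qed

lemma sq_integrable_continuous_compact_support: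
  fixes f :: "'a::euclidean_space \<Rightarrow> complex"
  assumes "continuous_on UNIV f" "compact K" "\<And>x. x \<notin> K \<Longrightarrow> f x = 0"
  shows "sq_integrable lborel f"
  unfolding sq_integrable_def
proof
  show "f \<in> borel_measurable lborel" using borel_measurable_continuous_onI[OF assms(1)] by simp
  show "integrable lborel (\<lambda>x. (cmod (f x))\<^sup>2)"
    by (rule integrable_continuous_compact_support[OF _ assms(2)]) (use assms in \<open>auto intro!: continuous_intros\<close>)
qed

lemma test_fun_diter_sq_integrable:
  assumes "test_fun U (\<phi> :: 'a::euclidean_space \<Rightarrow> complex)" shows "sq_integrable lborel (diter vs \<phi>)"
  by (rule sq_integrable_continuous_compact_support[OF test_fun_diter_continuous[OF assms]
        _ test_fun_diter_eq_0]) (use assms in \<open>auto simp: test_fun_def\<close>)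

lemma test_fun_sq_integrable: "test_fun U (\<phi> :: 'a::euclidean_space \<Rightarrow> complex) \<Longrightarrow> sq_integrable lborel \<phi>"
  using test_fun_diter_sq_integrable[of U \<phi> "[]"] by simp

lemma test_fun_dderiv_sq_integrable:
  "test_fun U (\<phi> :: 'a::euclidean_space \<Rightarrow> complex) \<Longrightarrow> sq_integrable lborel (dderiv v \<phi>)"
  using test_fun_diter_sq_integrable[of U \<phi> "[v]"] by simp

lemma test_fun_lap_sq_integrable:
  "test_fun U (\<phi> :: 'a::euclidean_space \<Rightarrow> complex) \<Longrightarrow> sq_integrable lborel (lap \<phi>)"
  using test_fun_diter_sq_integrable[of U \<phi> "[_, _]"]
  unfolding lap_def[abs_def] by (intro sq_integrable_sum) simp

lemma test_fun_has_vector_derivative: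
  "test_fun U \<phi> \<Longrightarrow> ((\<lambda>s. diter vs \<phi> (x + s *\<^sub>R v)) has_vector_derivative diter (v # vs) \<phi> (x + s *\<^sub>R v)) (at s)"
  by (rule smooth_fun_has_vector_derivative) (simp add: test_fun_def)

lemma smooth_fun_diter_cnj:
  assumes "smooth_fun f" shows "diter vs (\<lambda>x. cnj (f x)) = (\<lambda>x. cnj (diter vs f x))"
proof (induction vs)
  case (Cons v vs)
  have "((\<lambda>s. cnj (diter vs f (x + s *\<^sub>R v))) has_vector_derivative cnj (diter (v # vs) f x)) (at 0)" for x
    using bounded_linear.has_vector_derivative[OF bounded_linear_cnj smooth_fun_has_vector_derivative[OF assms, of vs x v 0]]
    by simp
  then show ?case by (auto simp: Cons dderiv_def vector_derivative_at)
qed simp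

lemma smooth_fun_cnj: "smooth_fun f \<Longrightarrow> smooth_fun (\<lambda>x. cnj (f x))"
  unfolding smooth_fun_def[of "\<lambda>x. cnj (f x)"] smooth_fun_diter_cnj
proof (intro conjI allI)
  assume f: "smooth_fun f"
  fix vs show "continuous_on UNIV (\<lambda>x. cnj (diter vs f x))"
    using smooth_fun_continuous[OF f] by (intro continuous_intros)
  fix v x show "(\<lambda>s::real. cnj (diter vs f (x + s *\<^sub>R v))) differentiable at 0"
    using bounded_linear.has_vector_derivative[OF bounded_linear_cnj smooth_fun_has_vector_derivative[OF f, of vs x v 0]]
    by (rule differentiableI_vector)
qed

lemma test_fun_cnj: "test_fun U \<phi> \<Longrightarrow> test_fun U (\<lambda>x. cnj (\<phi> x))"
  by (simp add: test_fun_def smooth_fun_cnj)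

lemma smooth_fun_diter_diff:
  assumes "smooth_fun f" "smooth_fun g"
  shows "diter vs (\<lambda>x. f x - g x) = (\<lambda>x. diter vs f x - diter vs g x)"
proof (induction vs)
  case (Cons v vs)
  have "((\<lambda>s. diter vs f (x + s *\<^sub>R v) - diter vs g (x + s *\<^sub>R v)) has_vector_derivative
      diter (v # vs) f x - diter (v # vs) g x) (at 0)" for x
    using has_vector_derivative_diff[OF smooth_fun_has_vector_derivative[OF assms(1), of vs x v 0]
        smooth_fun_has_vector_derivative[OF assms(2), of vs x v 0]] by simp
  then show ?case by (auto simp: Cons dderiv_def vector_derivative_at)
qed simp

lemma test_fun_diff:
  assumes "test_fun U f" "test_fun U g" shows "test_fun U (\<lambda>x. f x - g x)"
proof -
  have fg: "smooth_fun f" "smooth_fun g" using assms by (auto simp: test_fun_def)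
  let ?K = "closure {x. f x \<noteq> 0} \<union> closure {x. g x \<noteq> 0}"
  have sm: "smooth_fun (\<lambda>x. f x - g x)"
    unfolding smooth_fun_def[of "\<lambda>x. f x - g x"] smooth_fun_diter_diff[OF fg]
  proof (intro conjI allI)
    fix vs show "continuous_on UNIV (\<lambda>x. diter vs f x - diter vs g x)"
      using smooth_fun_continuous[OF fg(1)] smooth_fun_continuous[OF fg(2)] by (intro continuous_intros)
    fix v x show "(\<lambda>s::real. diter vs f (x + s *\<^sub>R v) - diter vs g (x + s *\<^sub>R v)) differentiable at 0"
      using has_vector_derivative_diff[OF smooth_fun_has_vector_derivative[OF fg(1), of vs x v 0]
        smooth_fun_has_vector_derivative[OF fg(2), of vs x v 0]]
      by (rule differentiableI_vector)
  qed
  have K: "compact ?K" "?K \<subseteq> U" using assms by (auto simp: test_fun_def)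
  have "{x. f x - g x \<noteq> 0} \<subseteq> {x. f x \<noteq> 0} \<union> {x. g x \<noteq> 0}" by auto
  then have cl: "closure {x. f x - g x \<noteq> 0} \<subseteq> ?K" by (metis closure_Un closure_mono)
  have "compact (?K \<inter> closure {x. f x - g x \<noteq> 0})" by (rule compact_Int_closed[OF K(1) closed_closure])
  moreover have "?K \<inter> closure {x. f x - g x \<noteq> 0} = closure {x. f x - g x \<noteq> 0}" using cl by auto
  ultimately show ?thesis using sm cl K(2) unfolding test_fun_def by auto
qed

text \<open>By translation invariance, averaging \<open>f'\<close> over the segments from
  \<open>x\<close> to \<open>x + v\<close> does not change its integral. By the fundamental theorem
  of calculus the averaged integrand is \<open>f (x + v) - f x\<close>, whose integral vanishes by
  translation invariance again. No coordinate is singled out, so every direction is covered at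
  once.\<close>

lemma integral_directional_derivative_eq_0:
  fixes f f' :: "'a::euclidean_space \<Rightarrow> complex"
  assumes f: "integrable lborel f" and f': "continuous_on UNIV f'" "integrable lborel f'"
    and deriv: "\<And>x s. ((\<lambda>s. f (x + s *\<^sub>R v)) has_vector_derivative f' (x + s *\<^sub>R v)) (at s)"
  shows "(LINT x|lborel. f' x) = 0"
proof -
  have mf: "f \<in> borel_measurable borel" "f' \<in> borel_measurable borel"
    using f f'(2)[THEN borel_measurable_integrable] borel_measurable_integrable[OF f] by simp_all
  have ftc: "(LINT s|lborel. indicator {0..1} s *\<^sub>R f' (x + s *\<^sub>R v)) = f (x + v) - f x" for x
  proof -
    have "continuous_on {0..1} (\<lambda>s. f' (x + s *\<^sub>R v))"
      by (rule continuous_on_compose2[OF f'(1)]) (auto intro!: continuous_intros)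
    with integral_FTC_Icc[of 0 1 "\<lambda>s. f (x + s *\<^sub>R v)" "\<lambda>s. f' (x + s *\<^sub>R v)",
        OF _ has_vector_derivative_at_within[OF deriv]]
    show ?thesis by simp
  qed
  have jm: "(\<lambda>(s, x). indicat_real {0..1} s *\<^sub>R f' (x + s *\<^sub>R v)) \<in> borel_measurable (lborel \<Otimes>\<^sub>M lborel)"
  proof -
    have "(\<lambda>z::real \<times> 'a. snd z + fst z *\<^sub>R v) \<in> borel_measurable borel" "fst \<in> borel_measurable (borel :: (real \<times> 'a) measure)"
      by (intro borel_measurable_continuous_onI continuous_intros)+
    note [measurable] = this(2) measurable_compose[OF this(1) mf(2)]
    have "(\<lambda>z::real \<times> 'a. indicat_real {0..1} (fst z) *\<^sub>R f' (snd z + fst z *\<^sub>R v)) \<in> borel_measurable borel"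
      by measurable
    then show ?thesis by (simp add: lborel_prod split_beta')
  qed
  have int: "integrable (lborel \<Otimes>\<^sub>M lborel) (\<lambda>(s, x). indicat_real {0..1} s *\<^sub>R f' (x + s *\<^sub>R v))"
  proof (rule integrableI_bounded[OF jm])
    have mm: "(\<lambda>z. ennreal (norm (case z of (s, x) \<Rightarrow> indicat_real {0..1} s *\<^sub>R f' (x + s *\<^sub>R v)))) \<in> borel_measurable (lborel \<Otimes>\<^sub>M lborel)"
      using jm by measurable
    have "(\<integral>\<^sup>+z. ennreal (norm (case z of (s, x) \<Rightarrow> indicat_real {0..1} s *\<^sub>R f' (x + s *\<^sub>R v))) \<partial>(lborel \<Otimes>\<^sub>M lborel))
      = (\<integral>\<^sup>+s. (\<integral>\<^sup>+x. ennreal (norm (indicat_real {0..1} s *\<^sub>R f' (x + s *\<^sub>R v))) \<partial>lborel) \<partial>lborel)"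
      using lborel.nn_integral_fst[OF mm] by simp
    also have "\<dots> = (\<integral>\<^sup>+s. indicator {0..1::real} s * (\<integral>\<^sup>+x. ennreal (norm (f' x)) \<partial>lborel) \<partial>lborel)"
    proof (rule nn_integral_cong)
      fix s :: real
      have m: "(\<lambda>x. ennreal (norm (f' x))) \<in> borel_measurable borel" using mf(2) by measurable
      show "(\<integral>\<^sup>+x. ennreal (norm (indicat_real {0..1} s *\<^sub>R f' (x + s *\<^sub>R v))) \<partial>lborel)
        = indicator {0..1} s * (\<integral>\<^sup>+x. ennreal (norm (f' x)) \<partial>lborel)"
        using nn_integral_lborel_shift[OF m, of "s *\<^sub>R v"] by (simp add: indicator_def)
    qed
    also have "\<dots> = (\<integral>\<^sup>+x. ennreal (norm (f' x)) \<partial>lborel)"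
      by (simp add: nn_integral_multc)
    also have "\<dots> < \<infinity>" using f'(2) by (simp add: integrable_iff_bounded)
    finally show "(\<integral>\<^sup>+z. ennreal (norm (case z of (s, x) \<Rightarrow> indicat_real {0..1} s *\<^sub>R f' (x + s *\<^sub>R v))) \<partial>(lborel \<Otimes>\<^sub>M lborel)) < \<infinity>" .
  qed
  have "(LINT x|lborel. f' x) = (LINT s|lborel. indicat_real {0..1::real} s *\<^sub>R (LINT x|lborel. f' x))"
    by simp
  also have "\<dots> = (LINT s|lborel. (LINT x|lborel. indicat_real {0..1} s *\<^sub>R f' (x + s *\<^sub>R v)))"
    by (simp add: integral_lborel_shift[OF mf(2)])
  also have "\<dots> = (LINT x|lborel. (LINT s|lborel. indicat_real {0..1} s *\<^sub>R f' (x + s *\<^sub>R v)))"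
    by (rule lborel_pair.Fubini_integral[OF int, symmetric])
  also have "\<dots> = (LINT x|lborel. f (x + v) - f x)" by (simp add: ftc)
  also have "\<dots> = 0"
  proof -
    have "integrable lborel (\<lambda>x. f (x + v))"
    proof (rule integrableI_bounded)
      have m: "(\<lambda>x. ennreal (norm (f x))) \<in> borel_measurable borel" using mf(1) by measurable
      show "(\<integral>\<^sup>+x. ennreal (norm (f (x + v))) \<partial>lborel) < \<infinity>"
        using nn_integral_lborel_shift[OF m, of v] f by (simp add: integrable_iff_bounded)
    qed (use measurable_shift[OF mf(1)] in simp)
    then show ?thesis using f integral_lborel_shift[OF mf(1), of v] by simp
  qed
  finally show ?thesis .
qed

text \<open>Compact support of \<open>f\<close> makes the product and its derivative integrable,
  whatever smooth \<open>g\<close> is; the integral of the derivative is then 0.\<close>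

lemma test_fun_integral_by_parts:
  fixes f g :: "'a::euclidean_space \<Rightarrow> complex"
  assumes f: "test_fun U f" and g: "smooth_fun g"
  shows "(LINT x|lborel. f x * dderiv v (diter vs g) x) = - (LINT x|lborel. dderiv v f x * diter vs g x)"
proof -
  let ?K = "closure {x. f x \<noteq> 0}"
  have K: "compact ?K" using f by (simp add: test_fun_def)
  have sf: "smooth_fun f" using f by (simp add: test_fun_def)
  have f0: "f x = 0" "dderiv v f x = 0" if "x \<notin> ?K" for x
    using test_fun_diter_eq_0[OF that, of "[]"] test_fun_diter_eq_0[OF that, of "[v]"] by auto
  have c: "continuous_on UNIV f" "continuous_on UNIV (dderiv v f)" "continuous_on UNIV (diter vs g)"
      "continuous_on UNIV (dderiv v (diter vs g))"
    using smooth_fun_continuous[OF sf, of "[]"] smooth_fun_continuous[OF sf, of "[v]"]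
      smooth_fun_continuous[OF g, of vs] smooth_fun_continuous[OF g, of "v # vs"]
    by (simp_all only: diter.simps)
  have i1: "integrable lborel (\<lambda>x. f x * dderiv v (diter vs g) x)"
    by (rule integrable_continuous_compact_support[OF continuous_on_mult[OF c(1,4)] K]) (drule f0, simp)
  have i2: "integrable lborel (\<lambda>x. dderiv v f x * diter vs g x)"
    by (rule integrable_continuous_compact_support[OF continuous_on_mult[OF c(2,3)] K]) (drule f0(2), simp)
  have "(LINT x|lborel. f x * dderiv v (diter vs g) x + dderiv v f x * diter vs g x) = 0"
  proof (rule integral_directional_derivative_eq_0)
    show "integrable lborel (\<lambda>x. f x * diter vs g x)"
      by (rule integrable_continuous_compact_support[OF continuous_on_mult[OF c(1,3)] K]) (drule f0, simp)
    show "continuous_on UNIV (\<lambda>x. f x * dderiv v (diter vs g) x + dderiv v f x * diter vs g x)"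
      using c by (intro continuous_intros)
    show "integrable lborel (\<lambda>x. f x * dderiv v (diter vs g) x + dderiv v f x * diter vs g x)"
      using i1 i2 by simp
    show "((\<lambda>s. f (x + s *\<^sub>R v) * diter vs g (x + s *\<^sub>R v)) has_vector_derivative
        f (x + s *\<^sub>R v) * dderiv v (diter vs g) (x + s *\<^sub>R v) + dderiv v f (x + s *\<^sub>R v) * diter vs g (x + s *\<^sub>R v)) (at s)" for x s
      using has_vector_derivative_mult[OF smooth_fun_has_vector_derivative[OF sf, of "[]" x v s]
          smooth_fun_has_vector_derivative[OF g, of vs x v s]] by simp
  qed
  then show ?thesis using i1 i2 by (simp add: eq_neg_iff_add_eq_0)
qed

section \<open>Weak gradients\<close>

text \<open>The notion of \<open>H10\<close> transferred to the whole space: Borel representatives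
  and real-valued norms. One sequence of test functions has to approximate \<open>w\<close> and
  \<open>D\<close> together, which is what encodes both the weak gradient and the zero boundary
  values.\<close>

definition H10_grad :: "'a::euclidean_space set \<Rightarrow> ('a \<Rightarrow> complex) \<Rightarrow> ('a \<Rightarrow> 'a \<Rightarrow> complex) \<Rightarrow> bool" where
  "H10_grad \<Omega> w D \<longleftrightarrow> sq_integrable lborel w \<and> (\<forall>i\<in>Basis. sq_integrable lborel (\<lambda>x. D x i)) \<and>
     (\<exists>\<phi>. (\<forall>k. test_fun \<Omega> (\<phi> k)) \<and>
          (\<lambda>k. l2norm lborel (\<lambda>x. \<phi> k x - w x)) \<longlonglongrightarrow> 0 \<and>
          (\<forall>i\<in>Basis. (\<lambda>k. l2norm lborel (\<lambda>x. dderiv i (\<phi> k) x - D x i)) \<longlonglongrightarrow> 0))"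

lemma l2norm_diff_tendsto_0:
  assumes "\<And>k. sq_integrable M (f k)" "sq_integrable M f'" "\<And>k. sq_integrable M (g k)" "sq_integrable M g'"
    "(\<lambda>k. l2norm M (\<lambda>x. f k x - f' x)) \<longlonglongrightarrow> 0" "(\<lambda>k. l2norm M (\<lambda>x. g k x - g' x)) \<longlonglongrightarrow> 0"
  shows "(\<lambda>k. l2norm M (\<lambda>x. (f k x - g k x) - (f' x - g' x))) \<longlonglongrightarrow> 0"
proof (rule Lim_null_comparison)
  show "(\<lambda>k. l2norm M (\<lambda>x. f k x - f' x) + l2norm M (\<lambda>x. g k x - g' x)) \<longlonglongrightarrow> 0"
    using tendsto_add[OF assms(5,6)] by simp
  show "\<forall>\<^sub>F k in sequentially. norm (l2norm M (\<lambda>x. (f k x - g k x) - (f' x - g' x)))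
      \<le> l2norm M (\<lambda>x. f k x - f' x) + l2norm M (\<lambda>x. g k x - g' x)"
  proof (rule always_eventually, rule allI)
    fix k
    have "(\<lambda>x. (f k x - g k x) - (f' x - g' x)) = (\<lambda>x. (f k x - f' x) - (g k x - g' x))"
      by (simp add: fun_eq_iff)
    then show "norm (l2norm M (\<lambda>x. (f k x - g k x) - (f' x - g' x)))
      \<le> l2norm M (\<lambda>x. f k x - f' x) + l2norm M (\<lambda>x. g k x - g' x)"
      using l2norm_triangle_diff[OF sq_integrable_diff[OF assms(1,2)] sq_integrable_diff[OF assms(3,4)], of k k]
      by simp
  qed
qed

lemma H10_grad_diff:
  assumes "H10_grad \<Omega> w D" "H10_grad \<Omega> w' D'"
  shows "H10_grad \<Omega> (\<lambda>x. w x - w' x) (\<lambda>x i. D x i - D' x i)"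
proof -
  from assms(1) obtain \<phi> where w: "sq_integrable lborel w" "\<And>i. i \<in> Basis \<Longrightarrow> sq_integrable lborel (\<lambda>x. D x i)"
    and \<phi>: "\<And>k. test_fun \<Omega> (\<phi> k)" "(\<lambda>k. l2norm lborel (\<lambda>x. \<phi> k x - w x)) \<longlonglongrightarrow> 0"
      "\<And>i. i \<in> Basis \<Longrightarrow> (\<lambda>k. l2norm lborel (\<lambda>x. dderiv i (\<phi> k) x - D x i)) \<longlonglongrightarrow> 0"
    unfolding H10_grad_def by blast
  from assms(2) obtain \<psi> where w': "sq_integrable lborel w'" "\<And>i. i \<in> Basis \<Longrightarrow> sq_integrable lborel (\<lambda>x. D' x i)"
    and \<psi>: "\<And>k. test_fun \<Omega> (\<psi> k)" "(\<lambda>k. l2norm lborel (\<lambda>x. \<psi> k x - w' x)) \<longlonglongrightarrow> 0"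
      "\<And>i. i \<in> Basis \<Longrightarrow> (\<lambda>k. l2norm lborel (\<lambda>x. dderiv i (\<psi> k) x - D' x i)) \<longlonglongrightarrow> 0"
    unfolding H10_grad_def by blast
  have dd: "dderiv i (\<lambda>x. \<phi> k x - \<psi> k x) x = dderiv i (\<phi> k) x - dderiv i (\<psi> k) x" for i k x
  proof -
    have "smooth_fun (\<phi> k)" "smooth_fun (\<psi> k)" using \<phi>(1) \<psi>(1) by (auto simp: test_fun_def)
    from smooth_fun_diter_diff[OF this, of "[i]"] show ?thesis by (simp only: diter.simps fun_eq_iff)
  qed
  show ?thesis unfolding H10_grad_def
  proof (intro conjI ballI exI[of _ "\<lambda>k x. \<phi> k x - \<psi> k x"] allI)
    show "test_fun \<Omega> (\<lambda>x. \<phi> k x - \<psi> k x)" for k by (rule test_fun_diff[OF \<phi>(1) \<psi>(1)])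
    show "(\<lambda>k. l2norm lborel (\<lambda>x. \<phi> k x - \<psi> k x - (w x - w' x))) \<longlonglongrightarrow> 0"
      by (rule l2norm_diff_tendsto_0[OF test_fun_sq_integrable[OF \<phi>(1)] w(1) test_fun_sq_integrable[OF \<psi>(1)] w'(1) \<phi>(2) \<psi>(2)])
    fix i :: 'a assume i: "i \<in> Basis"
    show "(\<lambda>k. l2norm lborel (\<lambda>x. dderiv i (\<lambda>x. \<phi> k x - \<psi> k x) x - (D x i - D' x i))) \<longlonglongrightarrow> 0"
      unfolding dd
      by (rule l2norm_diff_tendsto_0[OF test_fun_dderiv_sq_integrable[OF \<phi>(1)] w(2)[OF i] test_fun_dderiv_sq_integrable[OF \<psi>(1)] w'(2)[OF i] \<phi>(3)[OF i] \<psi>(3)[OF i]])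
    show "sq_integrable lborel (\<lambda>x. D x i - D' x i)" by (rule sq_integrable_diff[OF w(2)[OF i] w'(2)[OF i]])
  qed (rule sq_integrable_diff[OF w(1) w'(1)])
qed

lemma integral_mult_eq_l2inner: "(LINT x|lborel. f x * g x) = l2inner lborel f (\<lambda>x. cnj (g x))"
  by (simp add: l2inner_def)

text \<open>Integration by parts holds for the approximating test functions, and both sides are
  continuous in the norms in which these converge.\<close>

lemma H10_grad_integral_lap:
  assumes w: "H10_grad \<Omega> w D" and \<psi>: "test_fun \<Omega> \<psi>"
  shows "(LINT x|lborel. w x * lap \<psi> x) = - (\<Sum>i\<in>Basis. LINT x|lborel. D x i * dderiv i \<psi> x)"
proof -
  from w obtain \<phi> where wi: "sq_integrable lborel w" "\<And>i. i \<in> Basis \<Longrightarrow> sq_integrable lborel (\<lambda>x. D x i)"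
    and \<phi>: "\<And>k. test_fun \<Omega> (\<phi> k)" "(\<lambda>k. l2norm lborel (\<lambda>x. \<phi> k x - w x)) \<longlonglongrightarrow> 0"
      "\<And>i. i \<in> Basis \<Longrightarrow> (\<lambda>k. l2norm lborel (\<lambda>x. dderiv i (\<phi> k) x - D x i)) \<longlonglongrightarrow> 0"
    unfolding H10_grad_def by blast
  have s\<psi>: "smooth_fun \<psi>" using \<psi> by (simp add: test_fun_def)
  note sl = sq_integrable_cnj[OF test_fun_lap_sq_integrable[OF \<psi>]]
  note sd = sq_integrable_cnj[OF test_fun_dderiv_sq_integrable[OF \<psi>]]
  have sdd: "sq_integrable lborel (dderiv i (dderiv i \<psi>))" for i
    using test_fun_diter_sq_integrable[OF \<psi>, of "[i, i]"] by simp
  have L: "(\<lambda>k. LINT x|lborel. \<phi> k x * lap \<psi> x) \<longlonglongrightarrow> (LINT x|lborel. w x * lap \<psi> x)"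
    unfolding integral_mult_eq_l2inner
    by (rule l2inner_tendsto_left[OF test_fun_sq_integrable[OF \<phi>(1)] wi(1) sl \<phi>(2)])
  have eq: "(LINT x|lborel. \<phi> k x * lap \<psi> x) = - (\<Sum>i\<in>Basis. LINT x|lborel. dderiv i (\<phi> k) x * dderiv i \<psi> x)" for k
  proof -
    have "(LINT x|lborel. \<phi> k x * lap \<psi> x) = (LINT x|lborel. (\<Sum>i\<in>Basis. \<phi> k x * dderiv i (dderiv i \<psi>) x))"
      by (simp add: lap_def sum_distrib_left)
    also have "\<dots> = (\<Sum>i\<in>Basis. LINT x|lborel. \<phi> k x * dderiv i (dderiv i \<psi>) x)"
      by (rule Bochner_Integration.integral_sum) (rule sq_integrable_mult[OF test_fun_sq_integrable[OF \<phi>(1)] sdd])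
    also have "\<dots> = (\<Sum>i\<in>Basis. - (LINT x|lborel. dderiv i (\<phi> k) x * dderiv i \<psi> x))"
      using test_fun_integral_by_parts[OF \<phi>(1)[of k] s\<psi>, of _ "[_]"] by simp
    finally show ?thesis by (simp add: sum_negf)
  qed
  have "(\<lambda>k. - (\<Sum>i\<in>Basis. LINT x|lborel. dderiv i (\<phi> k) x * dderiv i \<psi> x))
      \<longlonglongrightarrow> - (\<Sum>i\<in>Basis. LINT x|lborel. D x i * dderiv i \<psi> x)"
    unfolding integral_mult_eq_l2inner
    by (intro tendsto_minus tendsto_sum l2inner_tendsto_left test_fun_dderiv_sq_integrable[OF \<phi>(1)] wi(2) sd \<phi>(3))
  with L[unfolded eq] show ?thesis by (rule LIMSEQ_unique)
qed

lemma test_fun_dderiv_cnj: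
  assumes "test_fun U \<psi>"
  shows "dderiv i (\<lambda>x. cnj (\<psi> x)) = (\<lambda>x. cnj (dderiv i \<psi> x))"
    and "lap (\<lambda>x. cnj (\<psi> x)) = (\<lambda>x. cnj (lap \<psi> x))"
proof -
  have *: "smooth_fun \<psi>" using assms by (simp add: test_fun_def)
  show "dderiv i (\<lambda>x. cnj (\<psi> x)) = (\<lambda>x. cnj (dderiv i \<psi> x))"
    using smooth_fun_diter_cnj[OF *, of "[i]"] by simp
  have "dderiv i (dderiv i (\<lambda>x. cnj (\<psi> x))) = (\<lambda>x. cnj (dderiv i (dderiv i \<psi>) x))" for i
    using smooth_fun_diter_cnj[OF *, of "[i, i]"] by simp
  then show "lap (\<lambda>x. cnj (\<psi> x)) = (\<lambda>x. cnj (lap \<psi> x))" by (simp add: lap_def fun_eq_iff)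
qed

lemma H10_grad_l2inner_lap:
  assumes "H10_grad \<Omega> w D" "test_fun \<Omega> \<psi>"
  shows "l2inner lborel w (lap \<psi>) = - (\<Sum>i\<in>Basis. l2inner lborel (\<lambda>x. D x i) (dderiv i \<psi>))"
  using H10_grad_integral_lap[OF assms(1) test_fun_cnj[OF assms(2)]]
  by (simp add: l2inner_def test_fun_dderiv_cnj[OF assms(2)])

text \<open>Density extends a weak identity from test functions to all functions with zero boundary
  values. Later this lets the equation for an average be paired with the individual values that are
  averaged.\<close>

lemma H10_grad_pairing:
  assumes w: "H10_grad \<Omega> w G" and D: "\<And>i. i \<in> Basis \<Longrightarrow> sq_integrable lborel (\<lambda>x. D x i)"
    and l: "sq_integrable lborel l"
    and weak: "\<And>\<psi>. test_fun \<Omega> \<psi> \<Longrightarrow> (\<Sum>i\<in>Basis. l2inner lborel (\<lambda>x. D x i) (dderiv i \<psi>)) = l2inner lborel l \<psi>"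
  shows "(\<Sum>i\<in>Basis. l2inner lborel (\<lambda>x. D x i) (\<lambda>x. G x i)) = l2inner lborel l w"
proof -
  from w obtain \<phi> where wi: "sq_integrable lborel w" "\<And>i. i \<in> Basis \<Longrightarrow> sq_integrable lborel (\<lambda>x. G x i)"
    and \<phi>: "\<And>k. test_fun \<Omega> (\<phi> k)" "(\<lambda>k. l2norm lborel (\<lambda>x. \<phi> k x - w x)) \<longlonglongrightarrow> 0"
      "\<And>i. i \<in> Basis \<Longrightarrow> (\<lambda>k. l2norm lborel (\<lambda>x. dderiv i (\<phi> k) x - G x i)) \<longlonglongrightarrow> 0"
    unfolding H10_grad_def by blast
  have eq: "(\<Sum>i\<in>Basis. l2inner lborel (\<lambda>x. D x i) (dderiv i (\<phi> k))) = l2inner lborel l (\<phi> k)" for k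
    by (rule weak[OF \<phi>(1)])
  have "(\<lambda>k. \<Sum>i\<in>Basis. l2inner lborel (\<lambda>x. D x i) (dderiv i (\<phi> k)))
      \<longlonglongrightarrow> (\<Sum>i\<in>Basis. l2inner lborel (\<lambda>x. D x i) (\<lambda>x. G x i))"
    by (intro tendsto_sum l2inner_tendsto_right test_fun_dderiv_sq_integrable[OF \<phi>(1)] wi(2) D \<phi>(3))
  moreover have "(\<lambda>k. l2inner lborel l (\<phi> k)) \<longlonglongrightarrow> l2inner lborel l w"
    by (rule l2inner_tendsto_right[OF test_fun_sq_integrable[OF \<phi>(1)] wi(1) l \<phi>(2)])
  ultimately show ?thesis unfolding eq by (rule LIMSEQ_unique)
qed

text \<open>A weak form of \<open>z (x + \<rho> e) - z x = \<integral>\<^sub>0\<^sup>\<rho> d (x + s e) ds\<close> that is stable under \<open>L\<^sup>2\<close> limits and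
  under averaging over a parameter.\<close>
definition has_weak_increments :: "'a::euclidean_space \<Rightarrow> ('a \<Rightarrow> complex) \<Rightarrow> ('a \<Rightarrow> complex) \<Rightarrow> bool" where
  "has_weak_increments e d z \<longleftrightarrow> (\<forall>\<rho>\<ge>0. \<forall>F. sq_integrable lborel F \<longrightarrow>
     l2inner lborel z (\<lambda>x. F (x - \<rho> *\<^sub>R e) - F x) = l2inner lborel d (segment_integral \<rho> (- e) F))"

text \<open>For smooth functions the segment integral of the derivative is the increment; taking
  adjoints moves translation and segment integral to \<open>F\<close>.\<close>

lemma test_fun_has_weak_increments:
  fixes \<phi> :: "'a::euclidean_space \<Rightarrow> complex"
  assumes \<phi>: "test_fun U \<phi>"
  shows "has_weak_increments e (dderiv e \<phi>) \<phi>"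
  unfolding has_weak_increments_def
proof (intro allI impI)
  fix \<rho> :: real and F :: "'a \<Rightarrow> complex" assume \<rho>: "0 \<le> \<rho>" and F: "sq_integrable lborel F"
  note s = test_fun_sq_integrable[OF \<phi>]
  have m: "\<phi> \<in> borel_measurable borel" "F \<in> borel_measurable borel" using s F by (auto simp: sq_integrable_def)
  have seg: "segment_integral \<rho> e (dderiv e \<phi>) x = \<phi> (x + \<rho> *\<^sub>R e) - \<phi> x" for x
  proof -
    have "continuous_on {0..\<rho>} (\<lambda>s. dderiv e \<phi> (x + s *\<^sub>R e))"
      by (rule continuous_on_compose2[of UNIV "dderiv e \<phi>"])
         (use test_fun_diter_continuous[OF \<phi>, of "[e]"] in \<open>auto intro!: continuous_intros\<close>)
    moreover have "((\<lambda>s. \<phi> (x + s *\<^sub>R e)) has_vector_derivative dderiv e \<phi> (x + s *\<^sub>R e)) (at s within {0..\<rho>})" for s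
      using test_fun_has_vector_derivative[OF \<phi>, of "[]" x e s] by (simp add: has_vector_derivative_at_within)
    ultimately have "(LINT s|lborel. indicator {0..\<rho>} s *\<^sub>R dderiv e \<phi> (x + s *\<^sub>R e)) = \<phi> (x + \<rho> *\<^sub>R e) - \<phi> (x + 0 *\<^sub>R e)"
      using \<rho> by (intro integral_FTC_Icc)
    then show ?thesis by (simp add: segment_integral_def set_lebesgue_integral_def)
  qed
  then have seg': "segment_integral \<rho> e (dderiv e \<phi>) = (\<lambda>x. \<phi> (x + \<rho> *\<^sub>R e) - \<phi> x)" by (rule ext)
  have "l2inner lborel (dderiv e \<phi>) (segment_integral \<rho> (- e) F) = l2inner lborel (\<lambda>x. \<phi> (x + \<rho> *\<^sub>R e) - \<phi> x) F"
    using segment_integral_adjoint[OF test_fun_dderiv_sq_integrable[OF \<phi>, of e] F, of \<rho> e] seg' by simp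
  also have "\<dots> = l2inner lborel \<phi> (\<lambda>x. F (x - \<rho> *\<^sub>R e)) - l2inner lborel \<phi> F"
    by (simp add: l2inner_diff_left sq_integrable_shift s F l2inner_shift[OF m])
  also have "\<dots> = l2inner lborel \<phi> (\<lambda>x. F (x - \<rho> *\<^sub>R e) - F x)"
    using sq_integrable_shift[OF F, of "- (\<rho> *\<^sub>R e)"] by (simp add: l2inner_diff_right s F)
  finally show "l2inner lborel \<phi> (\<lambda>x. F (x - \<rho> *\<^sub>R e) - F x) = l2inner lborel (dderiv e \<phi>) (segment_integral \<rho> (- e) F)" ..
qed

lemma H10_grad_has_weak_increments:
  fixes w :: "'a::euclidean_space \<Rightarrow> complex"
  assumes w: "H10_grad \<Omega> w D" and i: "i \<in> Basis"
  shows "has_weak_increments i (\<lambda>x. D x i) w"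
  unfolding has_weak_increments_def
proof (intro allI impI)
  fix \<rho> :: real and F :: "'a \<Rightarrow> complex" assume \<rho>: "0 \<le> \<rho>" and F: "sq_integrable lborel F"
  from w obtain \<phi> where wi: "sq_integrable lborel w" "\<And>i. i \<in> Basis \<Longrightarrow> sq_integrable lborel (\<lambda>x. D x i)"
    and \<phi>: "\<And>k. test_fun \<Omega> (\<phi> k)" "(\<lambda>k. l2norm lborel (\<lambda>x. \<phi> k x - w x)) \<longlonglongrightarrow> 0"
      "\<And>i. i \<in> Basis \<Longrightarrow> (\<lambda>k. l2norm lborel (\<lambda>x. dderiv i (\<phi> k) x - D x i)) \<longlonglongrightarrow> 0"
    unfolding H10_grad_def by blast
  have "sq_integrable lborel (\<lambda>x. F (x - \<rho> *\<^sub>R i) - F x)"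
    using sq_integrable_diff[OF sq_integrable_shift[OF F, of "- (\<rho> *\<^sub>R i)"] F] by simp
  then have L: "(\<lambda>k. l2inner lborel (\<phi> k) (\<lambda>x. F (x - \<rho> *\<^sub>R i) - F x)) \<longlonglongrightarrow> l2inner lborel w (\<lambda>x. F (x - \<rho> *\<^sub>R i) - F x)"
    by (rule l2inner_tendsto_left[OF test_fun_sq_integrable[OF \<phi>(1)] wi(1) _ \<phi>(2)])
  have R: "(\<lambda>k. l2inner lborel (dderiv i (\<phi> k)) (segment_integral \<rho> (- i) F)) \<longlonglongrightarrow> l2inner lborel (\<lambda>x. D x i) (segment_integral \<rho> (- i) F)"
    by (rule l2inner_tendsto_left[OF test_fun_dderiv_sq_integrable[OF \<phi>(1)] wi(2)[OF i] sq_integrable_segment_integral[OF F] \<phi>(3)[OF i]])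
  have eq: "l2inner lborel (\<phi> k) (\<lambda>x. F (x - \<rho> *\<^sub>R i) - F x) = l2inner lborel (dderiv i (\<phi> k)) (segment_integral \<rho> (- i) F)" for k
    using test_fun_has_weak_increments[OF \<phi>(1)] \<rho> F by (simp add: has_weak_increments_def)
  show "l2inner lborel w (\<lambda>x. F (x - \<rho> *\<^sub>R i) - F x) = l2inner lborel (\<lambda>x. D x i) (segment_integral \<rho> (- i) F)"
    by (rule LIMSEQ_unique[OF L[unfolded eq] R])
qed

text \<open>Taking for \<open>F\<close> the increment itself turns the left side of the definition
  into its squared norm, while the segment integral costs a factor \<open>\<rho>\<close>; one norm
  of \<open>F\<close> cancels.\<close>

lemma weak_increments_l2norm_le:
  fixes z :: "'a::euclidean_space \<Rightarrow> complex"
  assumes "has_weak_increments e d z" and z: "sq_integrable lborel z" and d: "sq_integrable lborel d" and \<rho>: "0 \<le> \<rho>"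
  shows "l2norm lborel (\<lambda>x. z (x + \<rho> *\<^sub>R e) - z x) \<le> \<rho> * l2norm lborel d"
proof -
  define F where "F x = z (x + \<rho> *\<^sub>R e) - z x" for x
  have F: "sq_integrable lborel F"
    unfolding F_def by (rule sq_integrable_diff[OF sq_integrable_shift[OF z] z])
  have m: "z \<in> borel_measurable borel" "F \<in> borel_measurable borel" using z F by (auto simp: sq_integrable_def)
  have F': "sq_integrable lborel (\<lambda>x. F (x - \<rho> *\<^sub>R e))"
    using sq_integrable_shift[OF F, of "- (\<rho> *\<^sub>R e)"] by simp
  have "of_real ((l2norm lborel F)\<^sup>2) = l2inner lborel F F" by (simp add: l2inner_self)
  also have "\<dots> = l2inner lborel (\<lambda>x. z (x + \<rho> *\<^sub>R e)) F - l2inner lborel z F"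
    using l2inner_diff_left[OF sq_integrable_shift[OF z] z F, of "\<rho> *\<^sub>R e"] by (simp add: F_def[abs_def])
  also have "\<dots> = l2inner lborel z (\<lambda>x. F (x - \<rho> *\<^sub>R e) - F x)"
    by (simp add: l2inner_shift[OF m] l2inner_diff_right[OF z F' F])
  also have "\<dots> = l2inner lborel d (segment_integral \<rho> (- e) F)"
    using assms(1) \<rho> F by (simp add: has_weak_increments_def)
  finally have "(l2norm lborel F)\<^sup>2 = cmod (l2inner lborel d (segment_integral \<rho> (- e) F))"
    by (metis norm_of_real abs_of_nonneg zero_le_power2)
  also have "\<dots> \<le> l2norm lborel d * l2norm lborel (segment_integral \<rho> (- e) F)"
    by (rule l2_Cauchy_Schwarz[OF d sq_integrable_segment_integral[OF F]])
  also have "\<dots> \<le> l2norm lborel d * (\<rho> * l2norm lborel F)"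
    by (intro mult_left_mono l2norm_segment_integral F \<rho>) simp
  finally have *: "l2norm lborel F * l2norm lborel F \<le> (\<rho> * l2norm lborel d) * l2norm lborel F"
    by (simp add: power2_eq_square algebra_simps)
  have "l2norm lborel F \<le> \<rho> * l2norm lborel d"
  proof (cases "l2norm lborel F = 0")
    case False
    then have "0 < l2norm lborel F" using l2norm_nonneg[of lborel F] by linarith
    then show ?thesis using * by (simp only: mult_le_cancel_right_pos)
  qed (use \<rho> in simp)
  then show ?thesis by (simp add: F_def[abs_def])
qed

text \<open>The translation is carried out one summand at a time. Each further increment is taken at
  a translated point, which does not change its norm.\<close>

lemma l2norm_shift_sum_le:
  fixes z :: "'a::euclidean_space \<Rightarrow> complex"
  assumes z: "sq_integrable lborel z" and A: "finite A"
    and le: "\<And>i. i \<in> A \<Longrightarrow> l2norm lborel (\<lambda>x. z (x + c i *\<^sub>R i) - z x) \<le> B i"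
  shows "l2norm lborel (\<lambda>x. z (x + (\<Sum>i\<in>A. c i *\<^sub>R i)) - z x) \<le> (\<Sum>i\<in>A. B i)"
  using A le
proof (induction A rule: finite_induct)
  case (insert j A)
  define e where "e = (\<Sum>i\<in>A. c i *\<^sub>R i)"
  have m: "z \<in> borel_measurable borel" using z by (simp add: sq_integrable_def)
  have eq: "(\<lambda>x. z (x + (\<Sum>i\<in>insert j A. c i *\<^sub>R i)) - z x)
      = (\<lambda>x. (z ((x + e) + c j *\<^sub>R j) - z (x + e)) + (z (x + e) - z x))"
    using insert.hyps by (simp add: e_def algebra_simps)
  have "l2norm lborel (\<lambda>x. (z ((x + e) + c j *\<^sub>R j) - z (x + e)) + (z (x + e) - z x))
      \<le> l2norm lborel (\<lambda>x. z ((x + e) + c j *\<^sub>R j) - z (x + e)) + l2norm lborel (\<lambda>x. z (x + e) - z x)"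
    by (rule l2norm_triangle[OF sq_integrable_shift[OF sq_integrable_diff[OF sq_integrable_shift[OF z] z]]
          sq_integrable_diff[OF sq_integrable_shift[OF z] z]])
  also have "l2norm lborel (\<lambda>x. z ((x + e) + c j *\<^sub>R j) - z (x + e)) = l2norm lborel (\<lambda>x. z (x + c j *\<^sub>R j) - z x)"
    by (rule l2norm_shift[where f="\<lambda>x. z (x + c j *\<^sub>R j) - z x"])
       (intro borel_measurable_diff measurable_shift m)
  also have "l2norm lborel (\<lambda>x. z (x + c j *\<^sub>R j) - z x) \<le> B j" by (rule insert.prems) simp
  also have "l2norm lborel (\<lambda>x. z (x + e) - z x) \<le> (\<Sum>i\<in>A. B i)"
    unfolding e_def by (rule insert.IH) (use insert.prems in simp)
  finally show ?case unfolding eq using insert.hyps by simp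
qed simp

text \<open>A Nash-type inequality, because on average over \<open>e\<close> in a cube of side \<open>r\<close>, the inner product of \<open>z\<close> with its
  translate by \<open>e\<close> is at most \<open>r\<close> to the power minus dimension times the square of the \<open>L\<^sup>1\<close> norm.\<close>
lemma l2norm_le_shift_plus_L1:
  fixes z :: "'a::euclidean_space \<Rightarrow> complex"
  assumes z: "sq_integrable lborel z" and r: "0 < r"
    and shift: "\<And>e. e \<in> cbox 0 (r *\<^sub>R One) \<Longrightarrow> l2norm lborel (\<lambda>x. z (x + e) - z x) \<le> B"
    and L1: "(\<integral>\<^sup>+x. ennreal (cmod (z x)) \<partial>lborel) \<le> ennreal I" and I: "0 \<le> I"
  shows "(l2norm lborel z)\<^sup>2 \<le> B\<^sup>2 / 2 + I\<^sup>2 / r ^ DIM('a)"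
proof -
  have m [measurable]: "z \<in> borel_measurable borel" using z by (simp add: sq_integrable_def)
  let ?Q = "cbox 0 (r *\<^sub>R One) :: 'a set"
  have B: "0 \<le> B" using order_trans[OF l2norm_nonneg shift[of 0]] r by (auto simp: mem_box)
  have Q: "emeasure lborel ?Q = ennreal (r ^ DIM('a))"
    using r by (simp add: emeasure_lborel_cbox_eq inner_Basis)
  \<comment> \<open>The translate has the same norm as \<open>z\<close>, so expanding the square of
    the increment expresses the norm of \<open>z\<close> by the increment and the inner product with
    the translate.\<close>
  have e: "ennreal ((l2norm lborel z)\<^sup>2)
     \<le> ennreal (B\<^sup>2 / 2) + (\<integral>\<^sup>+x. ennreal (cmod (z (x + e))) * ennreal (cmod (z x)) \<partial>lborel)" if "e \<in> ?Q" for e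
  proof -
    note ze = sq_integrable_shift[OF z, of e]
    have "(l2norm lborel (\<lambda>x. z (x + e) - z x))\<^sup>2 = 2 * (l2norm lborel z)\<^sup>2 - 2 * Re (l2inner lborel (\<lambda>x. z (x + e)) z)"
      using l2norm_diff_power2[OF ze z] l2norm_shift[OF m, of e] by simp
    moreover have "(l2norm lborel (\<lambda>x. z (x + e) - z x))\<^sup>2 \<le> B\<^sup>2"
      by (intro power_mono shift that) simp
    moreover have "Re (l2inner lborel (\<lambda>x. z (x + e)) z) \<le> (LINT x|lborel. cmod (z (x + e)) * cmod (z x))"
    proof -
      have "Re (l2inner lborel (\<lambda>x. z (x + e)) z) \<le> cmod (l2inner lborel (\<lambda>x. z (x + e)) z)" by (rule complex_Re_le_cmod)
      also have "\<dots> \<le> (LINT x|lborel. cmod (z (x + e) * cnj (z x)))"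
        unfolding l2inner_def by (rule integral_norm_bound)
      finally show ?thesis by (simp add: norm_mult)
    qed
    ultimately have "(l2norm lborel z)\<^sup>2 \<le> B\<^sup>2 / 2 + (LINT x|lborel. cmod (z (x + e)) * cmod (z x))" by simp
    then have "ennreal ((l2norm lborel z)\<^sup>2) \<le> ennreal (B\<^sup>2 / 2 + (LINT x|lborel. cmod (z (x + e)) * cmod (z x)))"
      by (rule ennreal_leI)
    also have "\<dots> = ennreal (B\<^sup>2 / 2) + ennreal (LINT x|lborel. cmod (z (x + e)) * cmod (z x))"
      by (intro ennreal_plus integral_nonneg_AE) auto
    also have "ennreal (LINT x|lborel. cmod (z (x + e)) * cmod (z x)) = (\<integral>\<^sup>+x. ennreal (cmod (z (x + e)) * cmod (z x)) \<partial>lborel)"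
      by (rule nn_integral_eq_integral[OF sq_integrable_norm_mult[OF ze z], symmetric]) simp
    finally show ?thesis by (simp add: ennreal_mult)
  qed
  have jm [measurable]: "(\<lambda>(e, x). z (x + e)) \<in> borel_measurable (lborel \<Otimes>\<^sub>M lborel)"
  proof -
    have "(\<lambda>p::'a \<times> 'a. snd p + fst p) \<in> borel_measurable borel"
      by (intro borel_measurable_continuous_onI continuous_intros)
    from measurable_compose[OF this m] show ?thesis by (simp add: lborel_prod split_beta')
  qed
  \<comment> \<open>Integration over the cube multiplies by its volume. The inner-product term is
    enlarged from the cube to all translations, where Tonelli factors it into the square of the
    \<open>L^1\<close> norm.\<close>
  have "ennreal ((l2norm lborel z)\<^sup>2) * ennreal (r ^ DIM('a)) = (\<integral>\<^sup>+e. ennreal ((l2norm lborel z)\<^sup>2) * indicator ?Q e \<partial>lborel)"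
    by (simp add: nn_integral_cmult_indicator Q)
  also have "\<dots> \<le> (\<integral>\<^sup>+e. ennreal (B\<^sup>2 / 2) * indicator ?Q e + (\<integral>\<^sup>+x. ennreal (cmod (z (x + e))) * ennreal (cmod (z x)) \<partial>lborel) \<partial>lborel)"
    by (intro nn_integral_mono) (use e in \<open>auto simp: indicator_def\<close>)
  also have "\<dots> = (\<integral>\<^sup>+e. ennreal (B\<^sup>2 / 2) * indicator ?Q e \<partial>lborel) +
      (\<integral>\<^sup>+e. (\<integral>\<^sup>+x. ennreal (cmod (z (x + e))) * ennreal (cmod (z x)) \<partial>lborel) \<partial>lborel)"
    by (rule nn_integral_add) measurable
  also have "(\<integral>\<^sup>+e. ennreal (B\<^sup>2 / 2) * indicator ?Q e \<partial>lborel) = ennreal (B\<^sup>2 / 2) * ennreal (r ^ DIM('a))"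
    by (simp add: nn_integral_cmult_indicator Q)
  also have "(\<integral>\<^sup>+e. (\<integral>\<^sup>+x. ennreal (cmod (z (x + e))) * ennreal (cmod (z x)) \<partial>lborel) \<partial>lborel)
      = (\<integral>\<^sup>+x. (\<integral>\<^sup>+e. ennreal (cmod (z (x + e))) * ennreal (cmod (z x)) \<partial>lborel) \<partial>lborel)"
    by (rule lborel_pair.Fubini'[symmetric]) measurable
  also have "\<dots> = (\<integral>\<^sup>+x. (\<integral>\<^sup>+e. ennreal (cmod (z e)) \<partial>lborel) * ennreal (cmod (z x)) \<partial>lborel)"
  proof (rule nn_integral_cong)
    fix x
    have "(\<integral>\<^sup>+e. ennreal (cmod (z (x + e))) * ennreal (cmod (z x)) \<partial>lborel)
       = (\<integral>\<^sup>+e. ennreal (cmod (z (e + x))) \<partial>lborel) * ennreal (cmod (z x))"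
      using measurable_shift[OF m, of x] by (subst nn_integral_multc[symmetric]) (auto simp: add.commute)
    also have "(\<integral>\<^sup>+e. ennreal (cmod (z (e + x))) \<partial>lborel) = (\<integral>\<^sup>+e. ennreal (cmod (z e)) \<partial>lborel)"
      by (rule nn_integral_lborel_shift) measurable
    finally show "(\<integral>\<^sup>+e. ennreal (cmod (z (x + e))) * ennreal (cmod (z x)) \<partial>lborel)
       = (\<integral>\<^sup>+e. ennreal (cmod (z e)) \<partial>lborel) * ennreal (cmod (z x))" .
  qed
  also have "\<dots> = (\<integral>\<^sup>+e. ennreal (cmod (z e)) \<partial>lborel) * (\<integral>\<^sup>+x. ennreal (cmod (z x)) \<partial>lborel)"
    by (rule nn_integral_cmult) measurable
  also have "\<dots> \<le> ennreal I * ennreal I" by (intro mult_mono L1) auto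
  finally have "ennreal ((l2norm lborel z)\<^sup>2 * r ^ DIM('a)) \<le> ennreal (B\<^sup>2 / 2 * r ^ DIM('a) + I * I)"
    using r I B by (simp add: ennreal_mult add_left_mono del: times_divide_eq_left)
  then have "(l2norm lborel z)\<^sup>2 * r ^ DIM('a) \<le> B\<^sup>2 / 2 * r ^ DIM('a) + I * I"
    using r I by (subst (asm) ennreal_le_iff) auto
  then have "(l2norm lborel z)\<^sup>2 \<le> (B\<^sup>2 / 2 * r ^ DIM('a) + I * I) / r ^ DIM('a)"
    using r by (simp add: pos_le_divide_eq)
  then show ?thesis using r by (simp add: add_divide_distrib power2_eq_square)
qed

section \<open>Sliding windows in time\<close>

lemma set_integral_combine_Icc:
  fixes f :: "real \<Rightarrow> 'b::euclidean_space"
  assumes f: "set_integrable lborel {a..c} f" and "a \<le> b" "b \<le> c"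
  shows "(LINT s:{a..b}|lborel. f s) + (LINT s:{b..c}|lborel. f s) = (LINT s:{a..c}|lborel. f s)"
proof -
  have "set_integrable lborel {a..b} f" "set_integrable lborel {b..c} f"
    by (rule set_integrable_subset[OF f]; use assms in auto)+
  then show ?thesis
    using assms set_borel_integral_eq_integral[OF f]
    by (simp add: set_borel_integral_eq_integral Henstock_Kurzweil_Integration.integral_combine)
qed

lemma set_integral_shift_Icc:
  fixes f :: "real \<Rightarrow> 'b::euclidean_space"
  assumes f: "set_integrable lborel {a + h..b + h} f"
  shows "set_integrable lborel {a..b} (\<lambda>s. f (s + h))"
    and "(LINT s:{a..b}|lborel. f (s + h)) = (LINT s:{a + h..b + h}|lborel. f s)"
proof -
  let ?g = "\<lambda>s. indicator {a + h..b + h} s *\<^sub>R f s"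
  have g: "integrable lborel ?g" using f by (simp add: set_integrable_def)
  have m: "?g \<in> borel_measurable borel" using borel_measurable_integrable[OF g] by simp
  have eq: "(\<lambda>s. indicator {a..b} s *\<^sub>R f (s + h)) = (\<lambda>s. ?g (s + h))"
    by (auto simp: indicator_def fun_eq_iff)
  show "(LINT s:{a..b}|lborel. f (s + h)) = (LINT s:{a + h..b + h}|lborel. f s)"
    unfolding set_lebesgue_integral_def eq by (rule integral_lborel_shift[OF m])
  show "set_integrable lborel {a..b} (\<lambda>s. f (s + h))"
    unfolding set_integrable_def eq
  proof (rule integrableI_bounded)
    show "(\<lambda>s. ?g (s + h)) \<in> borel_measurable lborel" using measurable_shift[OF m] by simp
    have m': "(\<lambda>s. ennreal (norm (?g s))) \<in> borel_measurable borel" using m by measurable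
    show "(\<integral>\<^sup>+s. ennreal (norm (?g (s + h))) \<partial>lborel) < \<infinity>"
      using nn_integral_lborel_shift[OF m', of h] g by (simp add: integrable_iff_bounded)
  qed
qed

text \<open>The integral over \<open>{a..b + h}\<close> can be cut at \<open>b\<close> or at
  \<open>a + h\<close>; comparing the two cuts gives the identity. It is the integrated form of
  differentiating a moving window.\<close>

lemma set_integral_shift_difference:
  fixes f :: "real \<Rightarrow> 'b::euclidean_space"
  assumes f: "set_integrable lborel {a..b + h} f" and ab: "a \<le> b" and h: "0 \<le> h"
  shows "(LINT s:{b..b + h}|lborel. f s) - (LINT s:{a..a + h}|lborel. f s) = (LINT s:{a..b}|lborel. f (s + h) - f s)"
proof -
  have i1: "set_integrable lborel {a + h..b + h} f"
    by (rule set_integrable_subset[OF f]) (use ab h in auto)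
  have i2: "set_integrable lborel {a..b} f"
    by (rule set_integrable_subset[OF f]) (use ab h in auto)
  have "(LINT s:{a..b}|lborel. f (s + h) - f s) = (LINT s:{a..b}|lborel. f (s + h)) - (LINT s:{a..b}|lborel. f s)"
    by (rule set_integral_diff(2)[OF set_integral_shift_Icc(1)[OF i1] i2])
  also have "(LINT s:{a..b}|lborel. f (s + h)) = (LINT s:{a + h..b + h}|lborel. f s)"
    by (rule set_integral_shift_Icc(2)[OF i1])
  finally have D: "(LINT s:{a..b}|lborel. f (s + h) - f s) = (LINT s:{a + h..b + h}|lborel. f s) - (LINT s:{a..b}|lborel. f s)" .
  have P: "(LINT s:{a..b}|lborel. f s) + (LINT s:{b..b + h}|lborel. f s) = (LINT s:{a..b + h}|lborel. f s)"
    by (rule set_integral_combine_Icc[OF f]) (use ab h in auto)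
  have Q: "(LINT s:{a..a + h}|lborel. f s) + (LINT s:{a + h..b + h}|lborel. f s) = (LINT s:{a..b + h}|lborel. f s)"
    by (rule set_integral_combine_Icc[OF f]) (use ab h in auto)
  have alg: "Q - P = B - A" if "A + Q = S" "P + B = S" for A B P Q S :: 'b
  proof -
    have "Q - P = (A + Q) - A - P" by simp
    also have "A + Q = P + B" using that by simp
    also have "P + B - A - P = B - A" by simp
    finally show ?thesis .
  qed
  show ?thesis unfolding D by (rule alg[OF P Q])
qed

section \<open>Functions of time with values in \<open>L\<^sup>2\<close>\<close>

text \<open>Continuity into \<open>L^2\<close>, phrased by norms of differences because the values
  are representatives and not classes.\<close>

definition l2_continuous_on :: "real set \<Rightarrow> (real \<Rightarrow> 'a::euclidean_space \<Rightarrow> complex) \<Rightarrow> bool" where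
  "l2_continuous_on S w \<longleftrightarrow> (\<forall>t\<in>S. sq_integrable lborel (w t)) \<and>
     (\<forall>t\<in>S. ((\<lambda>s. l2norm lborel (\<lambda>x. w s x - w t x)) \<longlongrightarrow> 0) (at t within S))"

lemma l2_continuous_on_sq: "l2_continuous_on S w \<Longrightarrow> t \<in> S \<Longrightarrow> sq_integrable lborel (w t)"
  by (simp add: l2_continuous_on_def)

lemma l2_continuous_on_tendsto:
  "l2_continuous_on S w \<Longrightarrow> t \<in> S \<Longrightarrow> ((\<lambda>s. l2norm lborel (\<lambda>x. w s x - w t x)) \<longlongrightarrow> 0) (at t within S)"
  by (simp add: l2_continuous_on_def)

lemma l2_continuous_on_subset:
  assumes w: "l2_continuous_on S w" and T: "T \<subseteq> S" shows "l2_continuous_on T w"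
  unfolding l2_continuous_on_def
proof (intro conjI ballI)
  fix t assume "t \<in> T"
  then have t: "t \<in> S" using T by blast
  show "sq_integrable lborel (w t)" by (rule l2_continuous_on_sq[OF w t])
  show "((\<lambda>s. l2norm lborel (\<lambda>x. w s x - w t x)) \<longlongrightarrow> 0) (at t within T)"
    by (rule tendsto_within_subset[OF l2_continuous_on_tendsto[OF w t] T])
qed

lemma l2_continuous_on_bound:
  assumes u: "l2_continuous_on S u" and w: "\<And>t. t \<in> S \<Longrightarrow> sq_integrable lborel (w t)"
    and le: "\<And>s t. s \<in> S \<Longrightarrow> t \<in> S \<Longrightarrow>
      l2norm lborel (\<lambda>x. w s x - w t x) \<le> c * l2norm lborel (\<lambda>x. u s x - u t x)"
  shows "l2_continuous_on S w"
  unfolding l2_continuous_on_def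
proof (intro conjI ballI)
  fix t assume t: "t \<in> S"
  show "((\<lambda>s. l2norm lborel (\<lambda>x. w s x - w t x)) \<longlongrightarrow> 0) (at t within S)"
  proof (rule Lim_null_comparison)
    show "((\<lambda>s. c * l2norm lborel (\<lambda>x. u s x - u t x)) \<longlongrightarrow> 0) (at t within S)"
      using tendsto_mult_right_zero[OF l2_continuous_on_tendsto[OF u t]] .
    show "\<forall>\<^sub>F s in at t within S. norm (l2norm lborel (\<lambda>x. w s x - w t x)) \<le> c * l2norm lborel (\<lambda>x. u s x - u t x)"
      unfolding eventually_at_filter by (rule always_eventually) (use le t in auto)
  qed
qed (rule w)

lemma l2_continuous_on_diff:
  assumes u: "l2_continuous_on S u" and w: "l2_continuous_on S w"
  shows "l2_continuous_on S (\<lambda>t x. u t x - w t x)"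
  unfolding l2_continuous_on_def
proof (intro conjI ballI)
  fix t assume t: "t \<in> S"
  show "sq_integrable lborel (\<lambda>x. u t x - w t x)"
    by (intro sq_integrable_diff l2_continuous_on_sq[OF u t] l2_continuous_on_sq[OF w t])
  show "((\<lambda>s. l2norm lborel (\<lambda>x. (u s x - w s x) - (u t x - w t x))) \<longlongrightarrow> 0) (at t within S)"
  proof (rule Lim_null_comparison)
    show "((\<lambda>s. l2norm lborel (\<lambda>x. u s x - u t x) + l2norm lborel (\<lambda>x. w s x - w t x)) \<longlongrightarrow> 0) (at t within S)"
      using tendsto_add[OF l2_continuous_on_tendsto[OF u t] l2_continuous_on_tendsto[OF w t]] by simp
    have "l2norm lborel (\<lambda>x. (u s x - w s x) - (u t x - w t x))
        \<le> l2norm lborel (\<lambda>x. u s x - u t x) + l2norm lborel (\<lambda>x. w s x - w t x)" if s: "s \<in> S" for s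
    proof -
      have "(\<lambda>x. (u s x - w s x) - (u t x - w t x)) = (\<lambda>x. (u s x - u t x) - (w s x - w t x))"
        by (simp add: fun_eq_iff)
      then show ?thesis
        using l2norm_triangle_diff[OF sq_integrable_diff[OF l2_continuous_on_sq[OF u s] l2_continuous_on_sq[OF u t]]
          sq_integrable_diff[OF l2_continuous_on_sq[OF w s] l2_continuous_on_sq[OF w t]]] by simp
    qed
    then show "\<forall>\<^sub>F s in at t within S. norm (l2norm lborel (\<lambda>x. (u s x - w s x) - (u t x - w t x)))
        \<le> l2norm lborel (\<lambda>x. u s x - u t x) + l2norm lborel (\<lambda>x. w s x - w t x)"
      unfolding eventually_at_filter by (intro always_eventually allI impI) simp
  qed
qed

lemma l2_continuous_on_scale:
  assumes u: "l2_continuous_on S u" shows "l2_continuous_on S (\<lambda>t x. c * u t x)"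
proof (rule l2_continuous_on_bound[OF u, where c="cmod c"])
  show "l2norm lborel (\<lambda>x. c * u s x - c * u t x) \<le> cmod c * l2norm lborel (\<lambda>x. u s x - u t x)" for s t
    using l2norm_scale[of lborel c "\<lambda>x. u s x - u t x"] by (simp add: right_diff_distrib)
qed (intro sq_integrable_scale l2_continuous_on_sq[OF u])

lemma l2_continuous_on_shift:
  assumes u: "l2_continuous_on {0<..} u" and h: "0 \<le> h"
  shows "l2_continuous_on {0<..} (\<lambda>t. u (t + h))"
  unfolding l2_continuous_on_def
proof (intro conjI ballI)
  fix t :: real assume t: "t \<in> {0<..}"
  then have th: "t + h \<in> {0<..}" using h by auto
  show "sq_integrable lborel (u (t + h))" by (rule l2_continuous_on_sq[OF u th])
  have "((\<lambda>s. l2norm lborel (\<lambda>x. u s x - u (t + h) x)) \<longlongrightarrow> 0) (at (t + h))"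
    using l2_continuous_on_tendsto[OF u th] th by (simp add: at_within_open[OF th])
  then have "((\<lambda>s. l2norm lborel (\<lambda>x. u (s + h) x - u (t + h) x)) \<longlongrightarrow> 0) (at t)"
    using LIM_offset[of "\<lambda>s. l2norm lborel (\<lambda>x. u s x - u (t + h) x)" 0 "t + h" h] by simp
  then show "((\<lambda>s. l2norm lborel (\<lambda>x. u (s + h) x - u (t + h) x)) \<longlongrightarrow> 0) (at t within {0<..})"
    by (rule tendsto_within_subset) simp
qed

lemma l2_continuous_on_continuous_norm_diff:
  assumes w: "l2_continuous_on S w" and c: "sq_integrable lborel c"
  shows "continuous_on S (\<lambda>s. l2norm lborel (\<lambda>x. w s x - c x))"
  unfolding continuous_on_def
proof (intro ballI)
  fix t assume t: "t \<in> S"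
  show "((\<lambda>s. l2norm lborel (\<lambda>x. w s x - c x)) \<longlongrightarrow> l2norm lborel (\<lambda>x. w t x - c x)) (at t within S)"
  proof (rule LIM_zero_cancel, rule Lim_null_comparison[OF _ l2_continuous_on_tendsto[OF w t]])
    have "\<bar>l2norm lborel (\<lambda>x. w s x - c x) - l2norm lborel (\<lambda>x. w t x - c x)\<bar> \<le> l2norm lborel (\<lambda>x. w s x - w t x)"
      if s: "s \<in> S" for s
      using l2norm_abs_diff_le[OF sq_integrable_diff[OF l2_continuous_on_sq[OF w s] c]
        sq_integrable_diff[OF l2_continuous_on_sq[OF w t] c]] by simp
    then show "\<forall>\<^sub>F s in at t within S. norm (l2norm lborel (\<lambda>x. w s x - c x) - l2norm lborel (\<lambda>x. w t x - c x))
        \<le> l2norm lborel (\<lambda>x. w s x - w t x)"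
      unfolding eventually_at_filter by (intro always_eventually allI impI) simp
  qed
qed

lemma l2_continuous_on_continuous_norm:
  "l2_continuous_on S w \<Longrightarrow> continuous_on S (\<lambda>s. l2norm lborel (w s))"
  using l2_continuous_on_continuous_norm_diff[of S w "\<lambda>_. 0"] by simp

lemma l2inner_diff_bound:
  assumes "sq_integrable M f" "sq_integrable M g" "sq_integrable M f'" "sq_integrable M g'"
  shows "cmod (l2inner M f g - l2inner M f' g')
    \<le> l2norm M (\<lambda>x. f x - f' x) * l2norm M g + l2norm M f' * l2norm M (\<lambda>x. g x - g' x)"
proof -
  have "l2inner M f g - l2inner M f' g' = l2inner M (\<lambda>x. f x - f' x) g + l2inner M f' (\<lambda>x. g x - g' x)"
    using assms by (simp add: l2inner_diff_left l2inner_diff_right)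
  then have "cmod (l2inner M f g - l2inner M f' g')
      \<le> cmod (l2inner M (\<lambda>x. f x - f' x) g) + cmod (l2inner M f' (\<lambda>x. g x - g' x))"
    by (simp add: norm_triangle_ineq)
  also have "\<dots> \<le> l2norm M (\<lambda>x. f x - f' x) * l2norm M g + l2norm M f' * l2norm M (\<lambda>x. g x - g' x)"
    by (intro add_mono l2_Cauchy_Schwarz sq_integrable_diff assms)
  finally show ?thesis .
qed

lemma l2_continuous_on_continuous_inner:
  assumes w: "l2_continuous_on S w" and u: "l2_continuous_on S u"
  shows "continuous_on S (\<lambda>s. l2inner lborel (w s) (u s))"
  unfolding continuous_on_def
proof (intro ballI)
  fix t assume t: "t \<in> S"
  have n: "((\<lambda>s. l2norm lborel (u s)) \<longlongrightarrow> l2norm lborel (u t)) (at t within S)"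
    using l2_continuous_on_continuous_norm[OF u] t by (simp add: continuous_on_def)
  show "((\<lambda>s. l2inner lborel (w s) (u s)) \<longlongrightarrow> l2inner lborel (w t) (u t)) (at t within S)"
  proof (rule LIM_zero_cancel, rule Lim_null_comparison)
    show "((\<lambda>s. l2norm lborel (\<lambda>x. w s x - w t x) * l2norm lborel (u s)
        + l2norm lborel (w t) * l2norm lborel (\<lambda>x. u s x - u t x)) \<longlongrightarrow> 0) (at t within S)"
      using tendsto_add[OF tendsto_mult[OF l2_continuous_on_tendsto[OF w t] n]
        tendsto_mult_right_zero[OF l2_continuous_on_tendsto[OF u t], of "l2norm lborel (w t)"]] by simp
    show "\<forall>\<^sub>F s in at t within S. norm (l2inner lborel (w s) (u s) - l2inner lborel (w t) (u t))
      \<le> l2norm lborel (\<lambda>x. w s x - w t x) * l2norm lborel (u s) + l2norm lborel (w t) * l2norm lborel (\<lambda>x. u s x - u t x)"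
      unfolding eventually_at_filter
      by (intro always_eventually allI impI l2inner_diff_bound l2_continuous_on_sq[OF w] l2_continuous_on_sq[OF u] t)
  qed
qed

text \<open>The values of \<open>w\<close> are representatives and not points of a metric space, so
  the Heine-Cantor theorem is applied to the real function of two times given by the norm of the
  difference. It vanishes on the diagonal, and \<open>(s, t)\<close> is compared with
  \<open>(t, t)\<close>.\<close>

lemma l2_uniformly_continuous:
  assumes w: "l2_continuous_on S w" and S: "compact S" and \<epsilon>: "0 < \<epsilon>"
  obtains \<delta> where "0 < \<delta>" "\<And>s t. s \<in> S \<Longrightarrow> t \<in> S \<Longrightarrow> \<bar>s - t\<bar> < \<delta> \<Longrightarrow> l2norm lborel (\<lambda>x. w s x - w t x) < \<epsilon>"
proof -
  let ?f = "\<lambda>p. l2norm lborel (\<lambda>x. w (fst p) x - w (snd p) x)"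
  have "continuous_on (S \<times> S) ?f"
    unfolding continuous_on_def
  proof (intro ballI)
    fix p assume p: "p \<in> S \<times> S"
    let ?n = "\<lambda>t s. l2norm lborel (\<lambda>x. w s x - w t x)"
    have c: "continuous_on S (?n t)" if "t \<in> S" for t
      by (rule l2_continuous_on_continuous_norm_diff[OF w l2_continuous_on_sq[OF w that]])
    have "continuous_on (S \<times> S) (\<lambda>q. ?n (fst p) (fst q))"
      by (rule continuous_on_compose2[OF c]) (use p in \<open>auto intro!: continuous_intros\<close>)
    then have 1: "((\<lambda>q. ?n (fst p) (fst q)) \<longlongrightarrow> 0) (at p within S \<times> S)"
      using p by (force simp: continuous_on_def)
    have "continuous_on (S \<times> S) (\<lambda>q. ?n (snd p) (snd q))"
      by (rule continuous_on_compose2[OF c]) (use p in \<open>auto intro!: continuous_intros\<close>)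
    then have 2: "((\<lambda>q. ?n (snd p) (snd q)) \<longlongrightarrow> 0) (at p within S \<times> S)"
      using p by (force simp: continuous_on_def)
    show "(?f \<longlongrightarrow> ?f p) (at p within S \<times> S)"
    proof (rule LIM_zero_cancel, rule Lim_null_comparison)
      show "((\<lambda>q. ?n (fst p) (fst q) + ?n (snd p) (snd q)) \<longlongrightarrow> 0) (at p within S \<times> S)"
        using tendsto_add[OF 1 2] by simp
      have "\<bar>?f q - ?f p\<bar> \<le> ?n (fst p) (fst q) + ?n (snd p) (snd q)" if q: "q \<in> S \<times> S" for q
      proof -
        have s: "sq_integrable lborel (w (fst p))" "sq_integrable lborel (w (snd p))"
          "sq_integrable lborel (w (fst q))" "sq_integrable lborel (w (snd q))"
          using p q l2_continuous_on_sq[OF w] by auto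
        have "(\<lambda>x. (w (fst q) x - w (snd q) x) - (w (fst p) x - w (snd p) x))
          = (\<lambda>x. (w (fst q) x - w (fst p) x) - (w (snd q) x - w (snd p) x))" by (simp add: fun_eq_iff)
        then show ?thesis
          using l2norm_abs_diff_le[OF sq_integrable_diff[OF s(3,4)] sq_integrable_diff[OF s(1,2)]]
            l2norm_triangle_diff[OF sq_integrable_diff[OF s(3,1)] sq_integrable_diff[OF s(4,2)]] by simp
      qed
      then show "\<forall>\<^sub>F q in at p within S \<times> S. norm (?f q - ?f p) \<le> ?n (fst p) (fst q) + ?n (snd p) (snd q)"
        unfolding eventually_at_filter by (intro always_eventually allI impI) simp
    qed
  qed
  then have "uniformly_continuous_on (S \<times> S) ?f"
    by (rule compact_uniformly_continuous[OF _ compact_Times[OF S S]])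
  then have "\<exists>\<delta>>0. \<forall>p\<in>S \<times> S. \<forall>q\<in>S \<times> S. dist q p < \<delta> \<longrightarrow> dist (?f q) (?f p) < \<epsilon>"
    using \<epsilon> unfolding uniformly_continuous_on_def by (elim allE[of _ \<epsilon>] impE)
  then obtain \<delta> where \<delta>: "0 < \<delta>"
    "\<And>p q. p \<in> S \<times> S \<Longrightarrow> q \<in> S \<times> S \<Longrightarrow> dist q p < \<delta> \<Longrightarrow> dist (?f q) (?f p) < \<epsilon>"
    by blast
  show thesis
  proof (rule that[OF \<delta>(1)])
    fix s t assume "s \<in> S" "t \<in> S" "\<bar>s - t\<bar> < \<delta>"
    then show "l2norm lborel (\<lambda>x. w s x - w t x) < \<epsilon>"
      using \<delta>(2)[of "(t, t)" "(s, t)"] by (simp add: dist_Pair_Pair dist_real_def)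
  qed
qed

lemma l2_continuous_on_integrable_norm:
  assumes "l2_continuous_on S w" "{a..b} \<subseteq> S"
  shows "set_integrable lborel {a..b} (\<lambda>s. l2norm lborel (w s))"
  unfolding set_integrable_def
  by (rule borel_integrable_compact[OF compact_Icc
      continuous_on_subset[OF l2_continuous_on_continuous_norm[OF assms(1)] assms(2)]])

lemma norm_set_integral_le:
  fixes f :: "real \<Rightarrow> complex"
  assumes f: "set_integrable lborel A f" and g: "set_integrable lborel A g"
    and le: "AE s in lborel. s \<in> A \<longrightarrow> norm (f s) \<le> g s"
  shows "norm (LINT s:A|lborel. f s) \<le> (LINT s:A|lborel. g s)"
proof -
  have "norm (LINT s:A|lborel. f s) \<le> (LINT s|lborel. norm (indicator A s *\<^sub>R f s))"
    unfolding set_lebesgue_integral_def by (rule integral_norm_bound)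
  also have "\<dots> \<le> (LINT s|lborel. indicator A s *\<^sub>R g s)"
  proof (rule integral_mono_AE)
    show "integrable lborel (\<lambda>s. norm (indicator A s *\<^sub>R f s))" using f unfolding set_integrable_def by (rule integrable_norm)
    show "integrable lborel (\<lambda>s. indicator A s *\<^sub>R g s)" using g unfolding set_integrable_def .
    show "AE s in lborel. norm (indicator A s *\<^sub>R f s) \<le> indicator A s *\<^sub>R g s"
      using le by eventually_elim (auto simp: indicator_def)
  qed
  finally show ?thesis by (simp add: set_lebesgue_integral_def)
qed

lemma set_integral_const_Icc:
  "a \<le> b \<Longrightarrow> (LINT s:{a..b::real}|lborel. c :: 'b::{banach, second_countable_topology}) = (b - a) *\<^sub>R c"
  by (simp add: set_lebesgue_integral_def)

lemma set_integral_cnj: "(LINT s:A|M. cnj (f s)) = cnj (LINT s:A|M. f s)"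
  using Bochner_Integration.integral_cnj[of M "\<lambda>s. indicator A s *\<^sub>R f s"]
  by (simp add: set_lebesgue_integral_def)

lemma set_integrable_cnj: "set_integrable M A f \<Longrightarrow> set_integrable M A (\<lambda>s. cnj (f s))"
  using integrable_cnj[of M "\<lambda>s. indicator A s *\<^sub>R f s"] by (simp add: set_integrable_def)

text \<open>Meant for an error term \<open>d\<close>: bounding its pairing with itself involves only
  scalar integrals, since averages can be taken out of an inner product.\<close>

lemma l2norm_le_by_duality:
  assumes d: "sq_integrable M d" and K: "0 \<le> K" and le: "cmod (l2inner M d d) \<le> K * l2norm M d"
  shows "l2norm M d \<le> K"
proof (cases "l2norm M d = 0")
  case False
  then have p: "0 < l2norm M d" using l2norm_nonneg[of M d] by linarith
  have "cmod (l2inner M d d) = l2norm M d * l2norm M d"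
    unfolding l2inner_self norm_of_real by (simp add: power2_eq_square)
  then show ?thesis using le p by simp
qed (use K in simp)

section \<open>Averages over a time window\<close>

definition l2_integrable_on :: "real set \<Rightarrow> (real \<Rightarrow> 'a::euclidean_space \<Rightarrow> complex) \<Rightarrow> bool" where
  "l2_integrable_on A f \<longleftrightarrow> jmeas f \<and> (AE s in lborel. s \<in> A \<longrightarrow> sq_integrable lborel (f s)) \<and>
     set_integrable lborel A (\<lambda>s. l2norm lborel (f s))"

lemma l2_integrable_onI_continuous:
  assumes "l2_continuous_on S w" "jmeas w" "{a..b} \<subseteq> S"
  shows "l2_integrable_on {a..b} w"
  unfolding l2_integrable_on_def
proof (intro conjI)
  show "AE s in lborel. s \<in> {a..b} \<longrightarrow> sq_integrable lborel (w s)"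
    by (rule AE_I2) (use l2_continuous_on_sq[OF assms(1)] assms(3) in blast)
qed (rule assms(2) l2_continuous_on_integrable_norm[OF assms(1,3)])+

text \<open>The Steklov average. The window extends forward, so that averages at positive times only
  see positive times.\<close>

definition time_avg :: "real \<Rightarrow> (real \<Rightarrow> 'a \<Rightarrow> complex) \<Rightarrow> real \<Rightarrow> 'a \<Rightarrow> complex" where
  "time_avg h f t x = of_real (1 / h) * (LINT s:{t..t + h}|lborel. f s x)"

context
  fixes f :: "real \<Rightarrow> 'a::euclidean_space \<Rightarrow> complex" and t h :: real
  assumes f: "l2_integrable_on {t..t + h} f"
begin

private lemma joint: "(\<lambda>z. f (fst z) (snd z)) \<in> borel_measurable borel"
  and sq: "AE s in lborel. s \<in> {t..t + h} \<longrightarrow> sq_integrable lborel (f s)"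
  and int: "set_integrable lborel {t..t + h} (\<lambda>s. l2norm lborel (f s))"
  using f by (auto simp: l2_integrable_on_def jmeas_def)

private lemma Icc: "{t..t + h} \<in> sets borel" by simp

lemma sq_integrable_time_avg: "sq_integrable lborel (time_avg h f t)"
  unfolding time_avg_def[abs_def] by (intro sq_integrable_scale l2_Bochner_set(2)[OF joint Icc sq int])

lemma l2norm_time_avg:
  assumes "0 < h"
  shows "l2norm lborel (time_avg h f t) \<le> (1 / h) * (LINT s:{t..t + h}|lborel. l2norm lborel (f s))"
proof -
  have "l2norm lborel (time_avg h f t) = (1 / h) * l2norm lborel (\<lambda>x. LINT s:{t..t + h}|lborel. f s x)"
    unfolding time_avg_def[abs_def] l2norm_scale using assms by (simp add: norm_divide)
  also have "\<dots> \<le> (1 / h) * (LINT s:{t..t + h}|lborel. l2norm lborel (f s))"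
    using assms by (intro mult_left_mono l2_Bochner_set(3)[OF joint Icc sq int]) auto
  finally show ?thesis .
qed

lemma time_avg_inner_integrable:
  "sq_integrable lborel g \<Longrightarrow> set_integrable lborel {t..t + h} (\<lambda>s. l2inner lborel (f s) g)"
  by (rule l2_Bochner_set(4)[OF joint Icc sq int])

lemma l2inner_time_avg_left:
  "sq_integrable lborel g \<Longrightarrow> l2inner lborel (time_avg h f t) g
    = of_real (1 / h) * (LINT s:{t..t + h}|lborel. l2inner lborel (f s) g)"
  unfolding time_avg_def[abs_def] l2inner_scale_left
  by (subst l2_Bochner_set(5)[OF joint Icc sq int]) simp_all

lemma time_avg_inner_integrable_right:
  assumes "sq_integrable lborel g"
  shows "set_integrable lborel {t..t + h} (\<lambda>s. l2inner lborel g (f s))"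
  using set_integrable_cnj[OF time_avg_inner_integrable[OF assms]] by (simp flip: l2inner_commute)

lemma l2inner_time_avg_right:
  assumes "sq_integrable lborel g"
  shows "l2inner lborel g (time_avg h f t) = of_real (1 / h) * (LINT s:{t..t + h}|lborel. l2inner lborel g (f s))"
proof -
  have "l2inner lborel g (time_avg h f t) = cnj (l2inner lborel (time_avg h f t) g)" by (rule l2inner_commute)
  also have "\<dots> = of_real (1 / h) * (LINT s:{t..t + h}|lborel. cnj (l2inner lborel (f s) g))"
    unfolding l2inner_time_avg_left[OF assms] set_integral_cnj by simp
  finally show ?thesis by (simp flip: l2inner_commute)
qed

text \<open>The error is tested with itself, so that the vector-valued average becomes a scalar one.
  With \<open>c = 0\<close> this also bounds the norm of an average.\<close>

lemma l2norm_time_avg_diff: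
  assumes h: "0 < h" and c: "sq_integrable lborel c" and \<epsilon>: "0 \<le> \<epsilon>"
    and le: "\<And>s. s \<in> {t..t + h} \<Longrightarrow> sq_integrable lborel (f s) \<Longrightarrow> l2norm lborel (\<lambda>x. f s x - c x) \<le> \<epsilon>"
  shows "l2norm lborel (\<lambda>x. time_avg h f t x - c x) \<le> \<epsilon>"
proof -
  define d where "d x = time_avg h f t x - c x" for x
  have d: "sq_integrable lborel d" unfolding d_def by (intro sq_integrable_diff sq_integrable_time_avg c)
  note i1 = time_avg_inner_integrable[OF d]
  have i2: "set_integrable lborel {t..t + h} (\<lambda>s. l2inner lborel c d)" by (rule set_integrable_const_Icc)
  have "l2inner lborel d d = l2inner lborel (time_avg h f t) d - l2inner lborel c d"
    unfolding d_def[abs_def] using d unfolding d_def[abs_def]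
    by (intro l2inner_diff_left sq_integrable_time_avg c)
  also have "\<dots> = of_real (1 / h) * (LINT s:{t..t + h}|lborel. l2inner lborel (f s) d - l2inner lborel c d)"
    unfolding l2inner_time_avg_left[OF d] set_integral_diff(2)[OF i1 i2]
    using h by (simp add: set_integral_const_Icc scaleR_conv_of_real right_diff_distrib)
  finally have 1: "cmod (l2inner lborel d d) = (1 / h) * cmod (LINT s:{t..t + h}|lborel. l2inner lborel (f s) d - l2inner lborel c d)"
    using h by (simp add: norm_mult norm_divide)
  have 2: "cmod (LINT s:{t..t + h}|lborel. l2inner lborel (f s) d - l2inner lborel c d)
      \<le> (LINT s:{t..t + h}|lborel. \<epsilon> * l2norm lborel d)"
  proof (rule norm_set_integral_le[OF set_integral_diff(1)[OF i1 i2] set_integrable_const_Icc])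
    show "AE s in lborel. s \<in> {t..t + h} \<longrightarrow> cmod (l2inner lborel (f s) d - l2inner lborel c d) \<le> \<epsilon> * l2norm lborel d"
      using sq
    proof eventually_elim
      case (elim s)
      show ?case
      proof
        assume s: "s \<in> {t..t + h}"
        then have fs: "sq_integrable lborel (f s)" using elim by blast
        have "cmod (l2inner lborel (f s) d - l2inner lborel c d) = cmod (l2inner lborel (\<lambda>x. f s x - c x) d)"
          by (simp add: l2inner_diff_left[OF fs c d])
        also have "\<dots> \<le> l2norm lborel (\<lambda>x. f s x - c x) * l2norm lborel d"
          by (intro l2_Cauchy_Schwarz sq_integrable_diff fs c d)
        also have "\<dots> \<le> \<epsilon> * l2norm lborel d" by (rule mult_right_mono[OF le[OF s fs]]) simp
        finally show "cmod (l2inner lborel (f s) d - l2inner lborel c d) \<le> \<epsilon> * l2norm lborel d" .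
      qed
    qed
  qed
  have 3: "(1 / h) * (LINT s:{t..t + h}|lborel. \<epsilon> * l2norm lborel d) = \<epsilon> * l2norm lborel d"
    using h by (simp add: set_integral_const_Icc)
  have "cmod (l2inner lborel d d) \<le> \<epsilon> * l2norm lborel d"
    using mult_left_mono[OF 2, of "1 / h"] h unfolding 1 3 by simp
  then have "l2norm lborel d \<le> \<epsilon>" by (rule l2norm_le_by_duality[OF d \<epsilon>])
  then show ?thesis by (simp add: d_def[abs_def])
qed

end

text \<open>A mean value inequality. The difference quotient of \<open>v\<close> over
  \<open>h\<close> is the derivative of the average; \<open>c\<close> stands for its value at one
  time and \<open>\<eta>\<close> for its oscillation over \<open>{a..b}\<close>. Continuity of
  \<open>v\<close> suffices, which is the gain from averaging.\<close>

lemma time_avg_increment: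
  fixes v :: "real \<Rightarrow> 'a::euclidean_space \<Rightarrow> complex"
  assumes v: "l2_continuous_on {0<..} v" "jmeas v" and a: "0 < a" and ab: "a \<le> b" and h: "0 < h"
    and c: "sq_integrable lborel c" and \<eta>: "0 \<le> \<eta>"
    and le: "\<And>s. s \<in> {a..b} \<Longrightarrow> l2norm lborel (\<lambda>x. of_real (1 / h) * (v (s + h) x - v s x) - c x) \<le> \<eta>"
  shows "l2norm lborel (\<lambda>x. time_avg h v b x - time_avg h v a x - of_real (b - a) * c x) \<le> (b - a) * \<eta>"
proof -
  define d where "d x = time_avg h v b x - time_avg h v a x - of_real (b - a) * c x" for x
  have ia: "l2_integrable_on {a..a + h} v" and ib: "l2_integrable_on {b..b + h} v" and iab: "l2_integrable_on {a..a + (b + h - a)} v"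
    by (rule l2_integrable_onI_continuous[OF v]; use a ab h in auto)+
  note sa = sq_integrable_time_avg[OF ia] and sb = sq_integrable_time_avg[OF ib]
  note sc = sq_integrable_scale[OF c, of "of_real (b - a)"]
  have d: "sq_integrable lborel d" unfolding d_def by (intro sq_integrable_diff sa sb sc)
  have vs: "sq_integrable lborel (v s)" if "0 < s" for s using l2_continuous_on_sq[OF v(1)] that by simp
  have i: "set_integrable lborel {a..b + h} (\<lambda>s. l2inner lborel (v s) d)"
    using time_avg_inner_integrable[OF iab d] by simp
  have i0: "set_integrable lborel {a..b} (\<lambda>s. l2inner lborel (v s) d)"
    and i1': "set_integrable lborel {a + h..b + h} (\<lambda>s. l2inner lborel (v s) d)"
    by (rule set_integrable_subset[OF i]; use ab h in auto)+
  note i1 = set_integral_shift_Icc(1)[OF i1']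
  have ic: "set_integrable lborel {a..b} (\<lambda>s. l2inner lborel c d)" by (rule set_integrable_const_Icc)
  have im: "set_integrable lborel {a..b} (\<lambda>s. of_real (1 / h) * (l2inner lborel (v (s + h)) d - l2inner lborel (v s) d))"
    by (intro set_integrable_mult_right set_integral_diff(1) i0 i1)
  define k where "k s = of_real (1 / h) * (l2inner lborel (v (s + h)) d - l2inner lborel (v s) d) - l2inner lborel c d" for s
  have ik: "set_integrable lborel {a..b} k" unfolding k_def
    by (intro set_integral_diff(1) im ic)
  have "l2inner lborel d d = l2inner lborel (time_avg h v b) d - l2inner lborel (time_avg h v a) d - of_real (b - a) * l2inner lborel c d"
  proof -
    have "l2inner lborel d d = l2inner lborel (\<lambda>x. time_avg h v b x - time_avg h v a x - of_real (b - a) * c x) d"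
      by (simp add: d_def[abs_def])
    then show ?thesis
      by (simp only: l2inner_diff_left[OF sq_integrable_diff[OF sb sa] sc d] l2inner_diff_left[OF sb sa d] l2inner_scale_left)
  qed
  also have "\<dots> = of_real (1 / h) * ((LINT s:{b..b + h}|lborel. l2inner lborel (v s) d) - (LINT s:{a..a + h}|lborel. l2inner lborel (v s) d))
      - of_real (b - a) * l2inner lborel c d"
    by (simp only: l2inner_time_avg_left[OF ia d] l2inner_time_avg_left[OF ib d] right_diff_distrib)
  also have "\<dots> = (LINT s:{a..b}|lborel. k s)"
    unfolding set_integral_shift_difference[OF i ab less_imp_le[OF h]] k_def
    using set_integral_diff(2)[OF im ic]
    by (simp add: set_integral_const_Icc[OF ab] scaleR_conv_of_real)
  finally have eq: "l2inner lborel d d = (LINT s:{a..b}|lborel. k s)" .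
  have "cmod (l2inner lborel d d) \<le> (LINT s:{a..b}|lborel. \<eta> * l2norm lborel d)"
    unfolding eq
  proof (rule norm_set_integral_le[OF ik set_integrable_const_Icc], rule AE_I2, rule impI)
    fix s assume s: "s \<in> {a..b}"
    then have p: "0 < s" "0 < s + h" using a h by auto
    have ks: "k s = l2inner lborel (\<lambda>x. of_real (1 / h) * (v (s + h) x - v s x) - c x) d"
      unfolding k_def
      by (simp only: l2inner_diff_left[OF sq_integrable_scale[OF sq_integrable_diff[OF vs[OF p(2)] vs[OF p(1)]]] c d]
          l2inner_scale_left l2inner_diff_left[OF vs[OF p(2)] vs[OF p(1)] d])
    have "cmod (k s) \<le> l2norm lborel (\<lambda>x. of_real (1 / h) * (v (s + h) x - v s x) - c x) * l2norm lborel d"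
      unfolding ks
      by (rule l2_Cauchy_Schwarz[OF sq_integrable_diff[OF sq_integrable_scale[OF sq_integrable_diff[OF vs[OF p(2)] vs[OF p(1)]]] c] d])
    also have "\<dots> \<le> \<eta> * l2norm lborel d" by (rule mult_right_mono[OF le[OF s]]) simp
    finally show "cmod (k s) \<le> \<eta> * l2norm lborel d" .
  qed
  then have "cmod (l2inner lborel d d) \<le> ((b - a) * \<eta>) * l2norm lborel d"
    by (simp add: set_integral_const_Icc[OF ab] ac_simps)
  then have "l2norm lborel d \<le> (b - a) * \<eta>"
    using ab \<eta> by (intro l2norm_le_by_duality[OF d]) auto
  then show ?thesis by (simp add: d_def[abs_def])
qed

text \<open>The average is differentiable in \<open>L^2\<close> although \<open>v\<close> is merely
  continuous; the derivative of the squared norm is read off from a first-order expansion of the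
  average with remainder \<open>R\<close>.\<close>

lemma time_avg_norm_deriv:
  fixes v :: "real \<Rightarrow> 'a::euclidean_space \<Rightarrow> complex"
  assumes v: "l2_continuous_on {0<..} v" "jmeas v" and t: "0 < t" and h: "0 < h"
  shows "((\<lambda>\<tau>. (l2norm lborel (time_avg h v \<tau>))\<^sup>2) has_real_derivative
    2 * Re (l2inner lborel (\<lambda>x. of_real (1 / h) * (v (t + h) x - v t x)) (time_avg h v t))) (at t)"
proof -
  define c where "c \<tau> x = of_real (1 / h) * (v (\<tau> + h) x - v \<tau> x)" for \<tau> x
  have cc: "l2_continuous_on {0<..} c"
    unfolding c_def by (rule l2_continuous_on_scale[OF l2_continuous_on_diff[OF l2_continuous_on_shift[OF v(1) less_imp_le[OF h]] v(1)]])
  have ct: "sq_integrable lborel (c t)" using l2_continuous_on_sq[OF cc] t by simp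
  have z: "sq_integrable lborel (time_avg h v \<tau>)" if "0 < \<tau>" for \<tau>
    by (rule sq_integrable_time_avg[OF l2_integrable_onI_continuous[OF v]]) (use that in auto)
  let ?z = "time_avg h v" and ?D = "2 * Re (l2inner lborel (c t) (time_avg h v t))"
  let ?y = "\<lambda>\<tau>. (l2norm lborel (?z \<tau>))\<^sup>2"
  let ?A = "2 * l2norm lborel (?z t)" and ?B = "(l2norm lborel (c t) + 1)\<^sup>2"
  have quot: "\<bar>(?y \<tau> - ?y t) / (\<tau> - t) - ?D\<bar> \<le> ?A * \<eta> + \<bar>\<tau> - t\<bar> * ?B"
    if \<eta>: "0 < \<eta>" "\<eta> \<le> 1" and \<delta>: "\<And>s. \<bar>s - t\<bar> \<le> \<bar>\<tau> - t\<bar> \<Longrightarrow> 0 < s \<and> l2norm lborel (\<lambda>x. c s x - c t x) \<le> \<eta>" and ne: "\<tau> \<noteq> t"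
    for \<eta> \<tau>
  proof -
    have \<tau>: "0 < \<tau>" using \<delta>[of \<tau>] by simp
    \<comment> \<open>\<open>w\<close> is the increment of the average and \<open>R\<close> what
      remains after subtracting its linear part; by the mean value inequality \<open>R\<close> has
      norm at most \<open>\<bar>\<tau> - t\<bar> * \<eta>\<close>.\<close>
    define w where "w x = ?z \<tau> x - ?z t x" for x
    define R where "R x = w x - of_real (\<tau> - t) * c t x" for x
    have w: "sq_integrable lborel w" unfolding w_def by (intro sq_integrable_diff z \<tau> t)
    have sR: "sq_integrable lborel R" unfolding R_def by (intro sq_integrable_diff w sq_integrable_scale ct)
    have R: "l2norm lborel R \<le> \<bar>\<tau> - t\<bar> * \<eta>"
    proof (cases "t \<le> \<tau>")
      case True
      have "l2norm lborel (\<lambda>x. ?z \<tau> x - ?z t x - of_real (\<tau> - t) * c t x) \<le> (\<tau> - t) * \<eta>"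
        by (rule time_avg_increment[OF v t True h ct]) (use \<eta> \<delta> in \<open>auto simp: c_def[abs_def]\<close>)
      then show ?thesis using True by (simp add: R_def[abs_def] w_def)
    next
      \<comment> \<open>For \<open>\<tau> < t\<close> the endpoints exchange their roles; the
        remainder only changes sign.\<close>
      case False
      then have le: "\<tau> \<le> t" by simp
      have "l2norm lborel (\<lambda>x. ?z t x - ?z \<tau> x - of_real (t - \<tau>) * c t x) \<le> (t - \<tau>) * \<eta>"
        by (rule time_avg_increment[OF v \<tau> le h ct]) (use \<eta> \<delta> in \<open>auto simp: c_def[abs_def]\<close>)
      moreover have "(\<lambda>x. ?z t x - ?z \<tau> x - of_real (t - \<tau>) * c t x) = (\<lambda>x. - R x)"
        by (auto simp: R_def w_def algebra_simps)
      ultimately show ?thesis using False by simp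
    qed
    have y: "?y \<tau> - ?y t = 2 * Re (l2inner lborel w (?z t)) + (l2norm lborel w)\<^sup>2"
    proof -
      have zw: "?z \<tau> = (\<lambda>x. ?z t x + w x)" by (simp add: w_def)
      have "?y \<tau> = ?y t + 2 * Re (l2inner lborel (?z t) w) + (l2norm lborel w)\<^sup>2"
        by (subst zw) (rule l2norm_add_power2[OF z[OF t] w])
      moreover have "Re (l2inner lborel (?z t) w) = Re (l2inner lborel w (?z t))" by (subst l2inner_commute) simp
      ultimately show ?thesis by simp
    qed
    have wR: "l2inner lborel w (?z t) = of_real (\<tau> - t) * l2inner lborel (c t) (?z t) + l2inner lborel R (?z t)"
    proof -
      have "l2inner lborel R (?z t) = l2inner lborel w (?z t) - of_real (\<tau> - t) * l2inner lborel (c t) (?z t)"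
        unfolding R_def[abs_def] l2inner_scale_left[symmetric] by (intro l2inner_diff_left w sq_integrable_scale ct z t)
      then show ?thesis by simp
    qed
    have "?y \<tau> - ?y t - (\<tau> - t) * ?D = 2 * Re (l2inner lborel R (?z t)) + (l2norm lborel w)\<^sup>2"
      unfolding y wR by (simp add: algebra_simps)
    moreover have "\<bar>Re (l2inner lborel R (?z t))\<bar> \<le> \<bar>\<tau> - t\<bar> * \<eta> * l2norm lborel (?z t)"
    proof -
      have "\<bar>Re (l2inner lborel R (?z t))\<bar> \<le> cmod (l2inner lborel R (?z t))" by (rule abs_Re_le_cmod)
      also have "\<dots> \<le> l2norm lborel R * l2norm lborel (?z t)" by (rule l2_Cauchy_Schwarz[OF sR z[OF t]])
      also have "\<dots> \<le> \<bar>\<tau> - t\<bar> * \<eta> * l2norm lborel (?z t)" by (rule mult_right_mono[OF R]) simp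
      finally show ?thesis .
    qed
    moreover have "(l2norm lborel w)\<^sup>2 \<le> \<bar>\<tau> - t\<bar> * (\<bar>\<tau> - t\<bar> * ?B)"
    proof -
      have wc: "w = (\<lambda>x. of_real (\<tau> - t) * c t x + R x)" by (simp add: R_def)
      have "l2norm lborel w \<le> l2norm lborel (\<lambda>x. of_real (\<tau> - t) * c t x) + l2norm lborel R"
        by (subst wc) (rule l2norm_triangle[OF sq_integrable_scale[OF ct] sR])
      also have "l2norm lborel (\<lambda>x. of_real (\<tau> - t) * c t x) = \<bar>\<tau> - t\<bar> * l2norm lborel (c t)"
        unfolding l2norm_scale norm_of_real ..
      also have "\<bar>\<tau> - t\<bar> * l2norm lborel (c t) + l2norm lborel R \<le> \<bar>\<tau> - t\<bar> * l2norm lborel (c t) + \<bar>\<tau> - t\<bar> * 1"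
        using R mult_left_mono[OF \<eta>(2), of "\<bar>\<tau> - t\<bar>"] by simp
      finally have "(l2norm lborel w)\<^sup>2 \<le> (\<bar>\<tau> - t\<bar> * (l2norm lborel (c t) + 1))\<^sup>2"
        by (intro power_mono) (simp_all add: distrib_left)
      then show ?thesis unfolding power_mult_distrib by (simp add: power2_eq_square mult.assoc)
    qed
    ultimately have "\<bar>?y \<tau> - ?y t - (\<tau> - t) * ?D\<bar> \<le> 2 * (\<bar>\<tau> - t\<bar> * \<eta> * l2norm lborel (?z t)) + \<bar>\<tau> - t\<bar> * (\<bar>\<tau> - t\<bar> * ?B)"
      using zero_le_power2[of "l2norm lborel w"] by linarith
    also have "\<dots> = \<bar>\<tau> - t\<bar> * (?A * \<eta> + \<bar>\<tau> - t\<bar> * ?B)" by (simp add: algebra_simps)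
    finally have "\<bar>?y \<tau> - ?y t - (\<tau> - t) * ?D\<bar> \<le> \<bar>\<tau> - t\<bar> * (?A * \<eta> + \<bar>\<tau> - t\<bar> * ?B)" .
    moreover have "(?y \<tau> - ?y t) / (\<tau> - t) - ?D = (?y \<tau> - ?y t - (\<tau> - t) * ?D) / (\<tau> - t)"
      using ne by (simp add: diff_divide_distrib)
    ultimately show ?thesis using ne by (simp only: abs_divide) (simp add: pos_divide_le_eq mult.commute)
  qed
  have "((\<lambda>\<tau>. (?y \<tau> - ?y t) / (\<tau> - t)) \<longlongrightarrow> ?D) (at t)"
  proof (rule LIM_I)
    fix e :: real assume e: "0 < e"
    \<comment> \<open>Half of \<open>e\<close> is reserved for each of the two error terms in
      \<open>quot\<close>; the summand 1 keeps the denominators positive.\<close>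
    define \<eta> where "\<eta> = min 1 (e / (2 * (?A + 1)))"
    have A0: "0 \<le> ?A" by simp
    have \<eta>: "0 < \<eta>" "\<eta> \<le> 1" using e A0 by (auto simp: \<eta>_def intro!: divide_pos_pos add_nonneg_pos)
    have A\<eta>: "?A * \<eta> < e / 2"
    proof -
      have "?A * \<eta> \<le> ?A * (e / (2 * (?A + 1)))" by (intro mult_left_mono) (auto simp: \<eta>_def)
      also have "\<dots> = (e / 2) * (?A / (?A + 1))"
      proof -
        have "A * (e / (2 * (A + 1))) = (e / 2) * (A / (A + 1))" for A :: real by simp
        then show ?thesis .
      qed
      also have "\<dots> < (e / 2) * 1"
      proof (rule mult_strict_left_mono)
        have "A / (A + 1) < 1" if "0 \<le> A" for A :: real using that by simp
        then show "?A / (?A + 1) < 1" using A0 .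
      qed (use e in simp)
      finally show ?thesis by simp
    qed
    have "((\<lambda>s. l2norm lborel (\<lambda>x. c s x - c t x)) \<longlongrightarrow> 0) (at t)"
      using l2_continuous_on_tendsto[OF cc, of t] t by (simp add: at_within_open[of t "{0<..}"])
    from LIM_D[OF this \<eta>(1)] obtain \<delta> where \<delta>: "0 < \<delta>"
      "\<And>s. s \<noteq> t \<Longrightarrow> \<bar>s - t\<bar> < \<delta> \<Longrightarrow> l2norm lborel (\<lambda>x. c s x - c t x) < \<eta>"
      by auto
    \<comment> \<open>The bound by \<open>t\<close> keeps all times at distance at most
      \<open>\<bar>\<tau> - t\<bar>\<close> from \<open>t\<close> positive.\<close>
    define \<rho> where "\<rho> = min (min \<delta> t) (e / (2 * (?B + 1)))"
    have \<rho>: "0 < \<rho>" using \<delta>(1) t e by (auto simp: \<rho>_def intro!: divide_pos_pos add_nonneg_pos)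
    show "\<exists>r>0. \<forall>\<tau>. \<tau> \<noteq> t \<and> norm (\<tau> - t) < r \<longrightarrow> norm ((?y \<tau> - ?y t) / (\<tau> - t) - ?D) < e"
    proof (intro exI conjI allI impI)
      fix \<tau> assume \<tau>: "\<tau> \<noteq> t \<and> norm (\<tau> - t) < \<rho>"
      then have \<tau>1: "\<bar>\<tau> - t\<bar> < \<delta>" "\<bar>\<tau> - t\<bar> < t" "\<bar>\<tau> - t\<bar> < e / (2 * (?B + 1))" by (auto simp: \<rho>_def)
      have "\<bar>(?y \<tau> - ?y t) / (\<tau> - t) - ?D\<bar> \<le> ?A * \<eta> + \<bar>\<tau> - t\<bar> * ?B"
      proof (rule quot[OF \<eta>])
        fix s assume "\<bar>s - t\<bar> \<le> \<bar>\<tau> - t\<bar>"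
        then show "0 < s \<and> l2norm lborel (\<lambda>x. c s x - c t x) \<le> \<eta>"
          using \<tau>1 \<delta>(2)[of s] \<eta>(1) by (cases "s = t") auto
      qed (use \<tau> in simp)
      also have "\<bar>\<tau> - t\<bar> * ?B \<le> e / (2 * (?B + 1)) * ?B" by (intro mult_right_mono less_imp_le[OF \<tau>1(3)]) simp
      also have "e / (2 * (?B + 1)) * ?B \<le> e / 2"
      proof -
        have "e / (2 * (B + 1)) * B \<le> e / 2" if "0 \<le> B" for B :: real
          using that e by (simp add: divide_le_eq)
        then show ?thesis using zero_le_power2 by blast
      qed
      finally show "norm ((?y \<tau> - ?y t) / (\<tau> - t) - ?D) < e" using A\<eta> by simp
    qed (rule \<rho>)
  qed
  then show ?thesis by (simp add: has_field_derivative_iff c_def[abs_def])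
qed

section \<open>Almost-everywhere facts, shifts and differences in time\<close>

lemma set_integral_cong_AE_integrable:
  fixes f g :: "real \<Rightarrow> 'b::{banach, second_countable_topology}"
  assumes "set_integrable lborel A f" "set_integrable lborel A g" "AE s in lborel. s \<in> A \<longrightarrow> f s = g s"
  shows "(LINT s:A|lborel. f s) = (LINT s:A|lborel. g s)"
  unfolding set_lebesgue_integral_def
proof (rule integral_cong_AE)
  show "(\<lambda>s. indicator A s *\<^sub>R f s) \<in> borel_measurable lborel" "(\<lambda>s. indicator A s *\<^sub>R g s) \<in> borel_measurable lborel"
    using assms(1,2) unfolding set_integrable_def by (simp_all only: borel_measurable_integrable)
  show "AE s in lborel. indicator A s *\<^sub>R f s = indicator A s *\<^sub>R g s"
    using assms(3) by eventually_elim (auto simp: indicator_def)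
qed

lemma set_integral_sum_integrable:
  fixes f :: "'i \<Rightarrow> 'c \<Rightarrow> 'b::{banach, second_countable_topology}"
  assumes "\<And>i. i \<in> I \<Longrightarrow> set_integrable M A (f i)"
  shows "set_integrable M A (\<lambda>s. \<Sum>i\<in>I. f i s)"
    and "(LINT s:A|M. \<Sum>i\<in>I. f i s) = (\<Sum>i\<in>I. LINT s:A|M. f i s)"
  using assms unfolding set_integrable_def set_lebesgue_integral_def scaleR_sum_right
  by (simp_all add: Bochner_Integration.integrable_sum Bochner_Integration.integral_sum)

lemma AE_lborel_shift:
  fixes h :: real
  assumes "AE s in lborel. P s" shows "AE s in lborel. P (s + h)"
proof -
  from AE_E[OF assms] obtain N where N: "{s. \<not> P s} \<subseteq> N" "N \<in> sets borel" "emeasure lborel N = 0" by auto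
  have "emeasure lborel ((\<lambda>s. s + h) -` N) = (\<integral>\<^sup>+s. indicator ((\<lambda>s. s + h) -` N) s \<partial>lborel)"
    using measurable_sets[OF _ N(2), of "\<lambda>s. s + h" borel] by simp
  also have "\<dots> = (\<integral>\<^sup>+s. indicator N (s + h) \<partial>lborel)"
    by (rule nn_integral_cong) (simp add: indicator_def)
  also have "\<dots> = (\<integral>\<^sup>+s. indicator N s \<partial>lborel)" by (rule nn_integral_lborel_shift) (use N(2) in measurable)
  also have "\<dots> = 0" using N by simp
  finally have "emeasure lborel ((\<lambda>s. s + h) -` N) = 0" .
  moreover have "(\<lambda>s. s + h) -` N \<in> sets lborel"
    using measurable_sets[OF _ N(2), of "\<lambda>s. s + h" borel] by simp
  ultimately show ?thesis by (intro AE_I[of _ _ "(\<lambda>s. s + h) -` N"]) (use N(1) in auto)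
qed

lemma jmeas_shift:
  assumes "jmeas f" shows "jmeas (\<lambda>t. f (t + h))"
proof -
  have "(\<lambda>z::real \<times> 'a. (fst z + h, snd z)) \<in> borel_measurable borel"
    by (intro borel_measurable_continuous_onI continuous_intros)
  from measurable_compose[OF this assms[unfolded jmeas_def]] show ?thesis by (simp add: jmeas_def)
qed

lemma jmeas_diff: "jmeas f \<Longrightarrow> jmeas g \<Longrightarrow> jmeas (\<lambda>t x. f t x - g t x)"
  unfolding jmeas_def by (rule borel_measurable_diff)

lemma jmeas_l2norm:
  assumes "jmeas f" shows "(\<lambda>s. l2norm lborel (f s)) \<in> borel_measurable borel"
proof -
  have "(\<lambda>z. f (fst z) (snd z)) \<in> borel_measurable (lborel \<Otimes>\<^sub>M lborel)"
    using assms by (simp add: jmeas_def lborel_prod)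
  then have "(\<lambda>(s, x). (cmod (f s x))\<^sup>2) \<in> borel_measurable (lborel \<Otimes>\<^sub>M lborel)"
    unfolding split_beta' by measurable
  from lborel.borel_measurable_lebesgue_integral[OF this]
  have "(\<lambda>s. LINT x|lborel. (cmod (f s x))\<^sup>2) \<in> borel_measurable lborel" by simp
  then show ?thesis unfolding l2norm_def by measurable
qed

lemma l2_integrable_on_shift:
  assumes "l2_integrable_on {a + h..b + h} f" shows "l2_integrable_on {a..b} (\<lambda>t. f (t + h))"
  unfolding l2_integrable_on_def
proof (intro conjI)
  show "jmeas (\<lambda>t. f (t + h))" using assms by (intro jmeas_shift) (simp add: l2_integrable_on_def)
  have "AE s in lborel. s \<in> {a + h..b + h} \<longrightarrow> sq_integrable lborel (f s)"
    using assms by (simp add: l2_integrable_on_def)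
  from AE_lborel_shift[OF this, of h]
  show "AE s in lborel. s \<in> {a..b} \<longrightarrow> sq_integrable lborel (f (s + h))" by eventually_elim auto
  show "set_integrable lborel {a..b} (\<lambda>s. l2norm lborel (f (s + h)))"
    using assms by (intro set_integral_shift_Icc(1)) (simp add: l2_integrable_on_def)
qed

lemma l2_integrable_on_diff:
  assumes f: "l2_integrable_on A f" and g: "l2_integrable_on A g" and A: "A \<in> sets borel"
  shows "l2_integrable_on A (\<lambda>t x. f t x - g t x)"
  unfolding l2_integrable_on_def
proof (intro conjI)
  have j: "jmeas f" "jmeas g" and sf: "AE s in lborel. s \<in> A \<longrightarrow> sq_integrable lborel (f s)"
    and sg: "AE s in lborel. s \<in> A \<longrightarrow> sq_integrable lborel (g s)"
    using f g by (auto simp: l2_integrable_on_def)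
  show jd: "jmeas (\<lambda>t x. f t x - g t x)" by (rule jmeas_diff[OF j])
  show "AE s in lborel. s \<in> A \<longrightarrow> sq_integrable lborel (\<lambda>x. f s x - g s x)"
    using sf sg by eventually_elim (auto intro: sq_integrable_diff)
  have i: "set_integrable lborel A (\<lambda>s. l2norm lborel (f s) + l2norm lborel (g s))"
    using f g by (intro set_integral_add(1)) (auto simp: l2_integrable_on_def)
  show "set_integrable lborel A (\<lambda>s. l2norm lborel (\<lambda>x. f s x - g s x))"
    unfolding set_integrable_def
  proof (rule Bochner_Integration.integrable_bound[OF i[unfolded set_integrable_def]])
    have [measurable]: "A \<in> sets borel" by fact
    note [measurable] = jmeas_l2norm[OF jd]
    show "(\<lambda>s. indicat_real A s *\<^sub>R l2norm lborel (\<lambda>x. f s x - g s x)) \<in> borel_measurable lborel" by measurable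
    show "AE s in lborel. norm (indicat_real A s *\<^sub>R l2norm lborel (\<lambda>x. f s x - g s x))
        \<le> norm (indicat_real A s *\<^sub>R (l2norm lborel (f s) + l2norm lborel (g s)))"
      using sf sg
    proof eventually_elim
      case (elim s)
      show ?case
      proof (cases "s \<in> A")
        case True
        then show ?thesis using l2norm_triangle_diff[of lborel "f s" "g s"] elim by simp
      qed simp
    qed
  qed
qed

lemma l2_integrable_on_inner:
  assumes f: "l2_integrable_on {a..b} f" and g: "sq_integrable lborel g"
  shows "set_integrable lborel {a..b} (\<lambda>s. l2inner lborel (f s) g)"
  using time_avg_inner_integrable[of a "b - a" f, OF _ g] f by simp

section \<open>Linear equation and energy estimates\<close>

text \<open>The equation \<open>i v_t + Delta v + F = 0\<close>, integrated over a time interval and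
  tested with a fixed \<open>\<phi>\<close>, so that no time derivative occurs. Nonlinearity and
  forcing are hidden in \<open>F\<close>; the class is thus linear, and differences and time shifts
  of solutions remain in it.\<close>

definition linear_solution :: "'a::euclidean_space set \<Rightarrow> (real \<Rightarrow> 'a \<Rightarrow> complex) \<Rightarrow>
    (real \<Rightarrow> 'a \<Rightarrow> 'a \<Rightarrow> complex) \<Rightarrow> (real \<Rightarrow> 'a \<Rightarrow> complex) \<Rightarrow> bool" where
  "linear_solution \<Omega> v G F \<longleftrightarrow> jmeas v \<and> l2_continuous_on {0<..} v \<and>
     (\<forall>i\<in>Basis. \<forall>a>0. \<forall>b. l2_integrable_on {a..b} (\<lambda>t x. G t x i)) \<and>
     (\<forall>a>0. \<forall>b. l2_integrable_on {a..b} F) \<and>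
     (AE t in lborel. 0 < t \<longrightarrow> H10_grad \<Omega> (v t) (G t)) \<and>
     (\<forall>\<phi> s t. test_fun \<Omega> \<phi> \<longrightarrow> 0 < s \<longrightarrow> s \<le> t \<longrightarrow>
        \<i> * l2inner lborel (\<lambda>x. v t x - v s x) \<phi>
        + (LINT \<tau>:{s..t}|lborel. l2inner lborel (v \<tau>) (lap \<phi>) + l2inner lborel (F \<tau>) \<phi>) = 0)"

lemma linear_solutionD:
  assumes "linear_solution \<Omega> v G F"
  shows "jmeas v" "l2_continuous_on {0<..} v"
    and "\<And>i a b. i \<in> Basis \<Longrightarrow> 0 < a \<Longrightarrow> l2_integrable_on {a..b} (\<lambda>t x. G t x i)"
    and "\<And>a b. 0 < a \<Longrightarrow> l2_integrable_on {a..b} F"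
    and "AE t in lborel. 0 < t \<longrightarrow> H10_grad \<Omega> (v t) (G t)"
    and "\<And>\<phi> s t. test_fun \<Omega> \<phi> \<Longrightarrow> 0 < s \<Longrightarrow> s \<le> t \<Longrightarrow>
        \<i> * l2inner lborel (\<lambda>x. v t x - v s x) \<phi>
        + (LINT \<tau>:{s..t}|lborel. l2inner lborel (v \<tau>) (lap \<phi>) + l2inner lborel (F \<tau>) \<phi>) = 0"
    and "\<And>t. 0 < t \<Longrightarrow> sq_integrable lborel (v t)"
    and "\<And>a b. 0 < a \<Longrightarrow> l2_integrable_on {a..b} v"
proof -
  show v: "jmeas v" "l2_continuous_on {0<..} v" using assms unfolding linear_solution_def by blast+
  show "sq_integrable lborel (v t)" if "0 < t" for t using l2_continuous_on_sq[OF v(2)] that by simp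
  show "l2_integrable_on {a..b} v" if "0 < a" for a b
    by (rule l2_integrable_onI_continuous[OF v(2,1)]) (use that in auto)
qed (use assms in \<open>unfold linear_solution_def, blast+\<close>)

lemma linear_solution_diff:
  assumes 1: "linear_solution \<Omega> v G F" and 2: "linear_solution \<Omega> v' G' F'"
  shows "linear_solution \<Omega> (\<lambda>t x. v t x - v' t x) (\<lambda>t x i. G t x i - G' t x i) (\<lambda>t x. F t x - F' t x)"
  unfolding linear_solution_def
proof (intro conjI ballI allI impI)
  show "jmeas (\<lambda>t x. v t x - v' t x)" by (intro jmeas_diff linear_solutionD(1)[OF 1] linear_solutionD(1)[OF 2])
  show "l2_continuous_on {0<..} (\<lambda>t x. v t x - v' t x)"
    by (intro l2_continuous_on_diff linear_solutionD(2)[OF 1] linear_solutionD(2)[OF 2])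
  show "l2_integrable_on {a..b} (\<lambda>t x. G t x i - G' t x i)" if "i \<in> Basis" "0 < a" for i a b
    by (rule l2_integrable_on_diff[OF linear_solutionD(3)[OF 1 that] linear_solutionD(3)[OF 2 that]]) simp
  show "l2_integrable_on {a..b} (\<lambda>t x. F t x - F' t x)" if "0 < a" for a b
    by (rule l2_integrable_on_diff[OF linear_solutionD(4)[OF 1 that] linear_solutionD(4)[OF 2 that]]) simp
  show "AE t in lborel. 0 < t \<longrightarrow> H10_grad \<Omega> (\<lambda>x. v t x - v' t x) (\<lambda>x i. G t x i - G' t x i)"
    using linear_solutionD(5)[OF 1] linear_solutionD(5)[OF 2] by eventually_elim (blast intro: H10_grad_diff)
  fix \<phi> and s t :: real assume \<phi>: "test_fun \<Omega> \<phi>" and s: "0 < s" and st: "s \<le> t"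
  have t: "0 < t" using s st by simp
  note v = linear_solutionD(7)[OF 1] and v' = linear_solutionD(7)[OF 2]
  note p = test_fun_sq_integrable[OF \<phi>] and l = test_fun_lap_sq_integrable[OF \<phi>]
  have i: "set_integrable lborel {s..t} (\<lambda>\<tau>. l2inner lborel (v \<tau>) (lap \<phi>) + l2inner lborel (F \<tau>) \<phi>)"
    by (intro set_integral_add(1) l2_integrable_on_inner linear_solutionD(8)[OF 1 s] linear_solutionD(4)[OF 1 s] p l)
  have i': "set_integrable lborel {s..t} (\<lambda>\<tau>. l2inner lborel (v' \<tau>) (lap \<phi>) + l2inner lborel (F' \<tau>) \<phi>)"
    by (intro set_integral_add(1) l2_integrable_on_inner linear_solutionD(8)[OF 2 s] linear_solutionD(4)[OF 2 s] p l)
  have "(LINT \<tau>:{s..t}|lborel. l2inner lborel (\<lambda>x. v \<tau> x - v' \<tau> x) (lap \<phi>) + l2inner lborel (\<lambda>x. F \<tau> x - F' \<tau> x) \<phi>)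
    = (LINT \<tau>:{s..t}|lborel. (l2inner lborel (v \<tau>) (lap \<phi>) + l2inner lborel (F \<tau>) \<phi>)
        - (l2inner lborel (v' \<tau>) (lap \<phi>) + l2inner lborel (F' \<tau>) \<phi>))"
  proof (rule set_integral_cong_AE_integrable)
    show "set_integrable lborel {s..t} (\<lambda>\<tau>. l2inner lborel (\<lambda>x. v \<tau> x - v' \<tau> x) (lap \<phi>) + l2inner lborel (\<lambda>x. F \<tau> x - F' \<tau> x) \<phi>)"
      by (intro set_integral_add(1) l2_integrable_on_inner l2_integrable_on_diff p l
          linear_solutionD(8)[OF 1 s] linear_solutionD(4)[OF 1 s] linear_solutionD(8)[OF 2 s] linear_solutionD(4)[OF 2 s]) auto
    show "set_integrable lborel {s..t} (\<lambda>\<tau>. (l2inner lborel (v \<tau>) (lap \<phi>) + l2inner lborel (F \<tau>) \<phi>)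
        - (l2inner lborel (v' \<tau>) (lap \<phi>) + l2inner lborel (F' \<tau>) \<phi>))"
      by (rule set_integral_diff(1)[OF i i'])
    have "AE \<tau> in lborel. \<tau> \<in> {s..t} \<longrightarrow> sq_integrable lborel (F \<tau>)" "AE \<tau> in lborel. \<tau> \<in> {s..t} \<longrightarrow> sq_integrable lborel (F' \<tau>)"
      using linear_solutionD(4)[OF 1 s] linear_solutionD(4)[OF 2 s] by (auto simp: l2_integrable_on_def)
    then show "AE \<tau> in lborel. \<tau> \<in> {s..t} \<longrightarrow> l2inner lborel (\<lambda>x. v \<tau> x - v' \<tau> x) (lap \<phi>) + l2inner lborel (\<lambda>x. F \<tau> x - F' \<tau> x) \<phi>
       = (l2inner lborel (v \<tau>) (lap \<phi>) + l2inner lborel (F \<tau>) \<phi>) - (l2inner lborel (v' \<tau>) (lap \<phi>) + l2inner lborel (F' \<tau>) \<phi>)"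
    proof eventually_elim
      case (elim \<tau>)
      show ?case
      proof
        assume "\<tau> \<in> {s..t}"
        then have "sq_integrable lborel (v \<tau>)" "sq_integrable lborel (v' \<tau>)" "sq_integrable lborel (F \<tau>)" "sq_integrable lborel (F' \<tau>)"
          using elim v v' s by auto
        then show "l2inner lborel (\<lambda>x. v \<tau> x - v' \<tau> x) (lap \<phi>) + l2inner lborel (\<lambda>x. F \<tau> x - F' \<tau> x) \<phi>
           = (l2inner lborel (v \<tau>) (lap \<phi>) + l2inner lborel (F \<tau>) \<phi>) - (l2inner lborel (v' \<tau>) (lap \<phi>) + l2inner lborel (F' \<tau>) \<phi>)"
          by (simp add: l2inner_diff_left p l)
      qed
    qed
  qed
  also have "\<dots> = (LINT \<tau>:{s..t}|lborel. l2inner lborel (v \<tau>) (lap \<phi>) + l2inner lborel (F \<tau>) \<phi>)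
      - (LINT \<tau>:{s..t}|lborel. l2inner lborel (v' \<tau>) (lap \<phi>) + l2inner lborel (F' \<tau>) \<phi>)"
    by (rule set_integral_diff(2)[OF i i'])
  finally have I: "(LINT \<tau>:{s..t}|lborel. l2inner lborel (\<lambda>x. v \<tau> x - v' \<tau> x) (lap \<phi>) + l2inner lborel (\<lambda>x. F \<tau> x - F' \<tau> x) \<phi>) = \<dots>" .
  have J: "l2inner lborel (\<lambda>x. (v t x - v' t x) - (v s x - v' s x)) \<phi>
      = l2inner lborel (\<lambda>x. v t x - v s x) \<phi> - l2inner lborel (\<lambda>x. v' t x - v' s x) \<phi>"
  proof -
    have "(\<lambda>x. (v t x - v' t x) - (v s x - v' s x)) = (\<lambda>x. (v t x - v s x) - (v' t x - v' s x))"
      by (simp add: fun_eq_iff)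
    then show ?thesis
      using l2inner_diff_left[OF sq_integrable_diff[OF v[OF t] v[OF s]] sq_integrable_diff[OF v'[OF t] v'[OF s]] p] by simp
  qed
  have alg: "\<i> * (A - B) + (C - E) = 0" if "\<i> * A + C = 0" "\<i> * B + E = 0" for A B C E :: complex
  proof -
    have "\<i> * (A - B) + (C - E) = (\<i> * A + C) - (\<i> * B + E)" by (simp add: algebra_simps)
    then show ?thesis using that by simp
  qed
  show "\<i> * l2inner lborel (\<lambda>x. (v t x - v' t x) - (v s x - v' s x)) \<phi>
      + (LINT \<tau>:{s..t}|lborel. l2inner lborel (\<lambda>x. v \<tau> x - v' \<tau> x) (lap \<phi>) + l2inner lborel (\<lambda>x. F \<tau> x - F' \<tau> x) \<phi>) = 0"
    unfolding I J by (rule alg[OF linear_solutionD(6)[OF 1 \<phi> s st] linear_solutionD(6)[OF 2 \<phi> s st]])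
qed

lemma linear_solution_shift:
  assumes 1: "linear_solution \<Omega> v G F" and h: "0 \<le> h"
  shows "linear_solution \<Omega> (\<lambda>t. v (t + h)) (\<lambda>t. G (t + h)) (\<lambda>t. F (t + h))"
  unfolding linear_solution_def
proof (intro conjI ballI allI impI)
  show "jmeas (\<lambda>t. v (t + h))" by (rule jmeas_shift[OF linear_solutionD(1)[OF 1]])
  show "l2_continuous_on {0<..} (\<lambda>t. v (t + h))" by (rule l2_continuous_on_shift[OF linear_solutionD(2)[OF 1] h])
  show "l2_integrable_on {a..b} (\<lambda>t x. G (t + h) x i)" if "i \<in> Basis" "0 < a" for i a b
    by (rule l2_integrable_on_shift[where f="\<lambda>t x. G t x i"]) (use linear_solutionD(3)[OF 1] that h in auto)
  show "l2_integrable_on {a..b} (\<lambda>t. F (t + h))" if "0 < a" for a b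
    by (rule l2_integrable_on_shift) (use linear_solutionD(4)[OF 1] that h in auto)
  show "AE t in lborel. 0 < t \<longrightarrow> H10_grad \<Omega> (v (t + h)) (G (t + h))"
    using AE_lborel_shift[OF linear_solutionD(5)[OF 1], of h] by eventually_elim (use h in auto)
  fix \<phi> and s t :: real assume \<phi>: "test_fun \<Omega> \<phi>" and s: "0 < s" and st: "s \<le> t"
  have sh: "0 < s + h" "s + h \<le> t + h" using s st h by auto
  have "set_integrable lborel {s + h..t + h} (\<lambda>\<tau>. l2inner lborel (v \<tau>) (lap \<phi>) + l2inner lborel (F \<tau>) \<phi>)"
    by (intro set_integral_add(1) l2_integrable_on_inner linear_solutionD(8)[OF 1 sh(1)] linear_solutionD(4)[OF 1 sh(1)]
        test_fun_sq_integrable[OF \<phi>] test_fun_lap_sq_integrable[OF \<phi>])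
  from set_integral_shift_Icc(2)[OF this] linear_solutionD(6)[OF 1 \<phi> sh]
  show "\<i> * l2inner lborel (\<lambda>x. v (t + h) x - v (s + h) x) \<phi>
      + (LINT \<tau>:{s..t}|lborel. l2inner lborel (v (\<tau> + h)) (lap \<phi>) + l2inner lborel (F (\<tau> + h)) \<phi>) = 0"
    by simp
qed

text \<open>Averaging the equation gives \<open>- Delta z = l\<close> with \<open>l\<close> in
  \<open>L^2\<close>, because the time derivative becomes a difference quotient. To pair this with
  \<open>z\<close>, the weak identity is extended to each \<open>v s\<close> by density and then
  averaged over \<open>s\<close>, in place of an approximation of \<open>z\<close> by test
  functions. The resulting Green identity is used twice: through its imaginary part for the energy,
  and through its real part for the gradient.\<close>

lemma linear_solution_avg:
  fixes v :: "real \<Rightarrow> 'a::euclidean_space \<Rightarrow> complex"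
  assumes lin: "linear_solution \<Omega> v G F" and t: "0 < t" and h: "0 < h"
  defines "z \<equiv> time_avg h v t" and "D \<equiv> \<lambda>i. time_avg h (\<lambda>s x. G s x i) t"
    and "l \<equiv> \<lambda>x. \<i> * (of_real (1 / h) * (v (t + h) x - v t x)) + time_avg h F t x"
  shows "(\<Sum>i\<in>Basis. of_real ((l2norm lborel (D i))\<^sup>2)) = l2inner lborel l z"
    and "\<And>i. i \<in> Basis \<Longrightarrow> has_weak_increments i (D i) z"
    and "sq_integrable lborel z" "\<And>i. i \<in> Basis \<Longrightarrow> sq_integrable lborel (D i)" "sq_integrable lborel l"
proof -
  note iv = linear_solutionD(8)[OF lin t, of "t + h"]
  note iG = linear_solutionD(3)[OF lin _ t, of _ "t + h"]
  note iF = linear_solutionD(4)[OF lin t, of "t + h"]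
  have th: "0 < t + h" using t h by simp
  note vt = linear_solutionD(7)[OF lin t] and vth = linear_solutionD(7)[OF lin th]
  show z: "sq_integrable lborel z" unfolding z_def by (rule sq_integrable_time_avg[OF iv])
  show D: "sq_integrable lborel (D i)" if "i \<in> Basis" for i unfolding D_def by (rule sq_integrable_time_avg[OF iG[OF that]])
  note sF = sq_integrable_time_avg[OF iF]
  show l: "sq_integrable lborel l" unfolding l_def by (intro sq_integrable_add sq_integrable_scale sq_integrable_diff vt vth sF)
  have AE: "AE s in lborel. s \<in> {t..t + h} \<longrightarrow> H10_grad \<Omega> (v s) (G s)"
    using linear_solutionD(5)[OF lin] by eventually_elim (use t in auto)
  have weak: "(\<Sum>i\<in>Basis. l2inner lborel (D i) (dderiv i \<psi>)) = l2inner lborel l \<psi>" if \<psi>: "test_fun \<Omega> \<psi>" for \<psi>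
  proof -
    note p = test_fun_sq_integrable[OF \<psi>] and lp = test_fun_lap_sq_integrable[OF \<psi>] and dp = test_fun_dderiv_sq_integrable[OF \<psi>]
    note i1 = l2_integrable_on_inner[OF iv lp] and i2 = l2_integrable_on_inner[OF iF p]
    have i3: "set_integrable lborel {t..t + h} (\<lambda>s. \<Sum>i\<in>Basis. l2inner lborel (\<lambda>x. G s x i) (dderiv i \<psi>))"
      by (rule set_integral_sum_integrable(1), rule l2_integrable_on_inner[OF iG dp])
    have "l2inner lborel l \<psi> = \<i> * of_real (1 / h) * l2inner lborel (\<lambda>x. v (t + h) x - v t x) \<psi>
        + of_real (1 / h) * (LINT s:{t..t + h}|lborel. l2inner lborel (F s) \<psi>)"
      unfolding l_def
      by (subst l2inner_add_left[OF sq_integrable_scale[OF sq_integrable_scale[OF sq_integrable_diff[OF vth vt]]] sF p])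
         (simp only: l2inner_scale_left l2inner_time_avg_left[OF iF p] mult.assoc)
    also have "\<dots> = of_real (1 / h) * (\<i> * l2inner lborel (\<lambda>x. v (t + h) x - v t x) \<psi>
        + (LINT s:{t..t + h}|lborel. l2inner lborel (F s) \<psi>))"
      by (simp add: algebra_simps)
    also have "\<i> * l2inner lborel (\<lambda>x. v (t + h) x - v t x) \<psi> + (LINT s:{t..t + h}|lborel. l2inner lborel (F s) \<psi>)
        = - (LINT s:{t..t + h}|lborel. l2inner lborel (v s) (lap \<psi>))"
      using linear_solutionD(6)[OF lin \<psi> t, of "t + h"] h unfolding set_integral_add(2)[OF i1 i2]
      by (simp add: eq_neg_iff_add_eq_0 ac_simps)
    also have "(LINT s:{t..t + h}|lborel. l2inner lborel (v s) (lap \<psi>))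
        = (LINT s:{t..t + h}|lborel. - (\<Sum>i\<in>Basis. l2inner lborel (\<lambda>x. G s x i) (dderiv i \<psi>)))"
    proof (rule set_integral_cong_AE_integrable[OF i1])
      show "set_integrable lborel {t..t + h} (\<lambda>s. - (\<Sum>i\<in>Basis. l2inner lborel (\<lambda>x. G s x i) (dderiv i \<psi>)))"
        using set_integrable_mult_right[of "-1" lborel "{t..t + h}" "\<lambda>s. \<Sum>i\<in>Basis. l2inner lborel (\<lambda>x. G s x i) (dderiv i \<psi>)"] i3 by simp
      show "AE s in lborel. s \<in> {t..t + h} \<longrightarrow> l2inner lborel (v s) (lap \<psi>) = - (\<Sum>i\<in>Basis. l2inner lborel (\<lambda>x. G s x i) (dderiv i \<psi>))"
        using AE by eventually_elim (use H10_grad_l2inner_lap[OF _ \<psi>] in blast)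
    qed
    also have "\<dots> = - (LINT s:{t..t + h}|lborel. (\<Sum>i\<in>Basis. l2inner lborel (\<lambda>x. G s x i) (dderiv i \<psi>)))"
      by (simp add: set_lebesgue_integral_def)
    also have "(LINT s:{t..t + h}|lborel. (\<Sum>i\<in>Basis. l2inner lborel (\<lambda>x. G s x i) (dderiv i \<psi>)))
        = (\<Sum>i\<in>Basis. (LINT s:{t..t + h}|lborel. l2inner lborel (\<lambda>x. G s x i) (dderiv i \<psi>)))"
      by (rule set_integral_sum_integrable(2), rule l2_integrable_on_inner[OF iG dp])
    finally have "l2inner lborel l \<psi> = of_real (1 / h) * (\<Sum>i\<in>Basis. (LINT s:{t..t + h}|lborel. l2inner lborel (\<lambda>x. G s x i) (dderiv i \<psi>)))"
      by simp
    also have "\<dots> = (\<Sum>i\<in>Basis. l2inner lborel (D i) (dderiv i \<psi>))"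
      unfolding D_def sum_distrib_left by (intro sum.cong refl l2inner_time_avg_left[symmetric] iG dp)
    finally show ?thesis ..
  qed
  \<comment> \<open>The test function is replaced by \<open>v s\<close>, which has zero boundary
    values for almost every \<open>s\<close> in the window.\<close>
  have pair: "AE s in lborel. s \<in> {t..t + h} \<longrightarrow> (\<Sum>i\<in>Basis. l2inner lborel (D i) (\<lambda>x. G s x i)) = l2inner lborel l (v s)"
    using AE by eventually_elim (use H10_grad_pairing[of \<Omega> _ _ "\<lambda>x i. D i x", OF _ D l weak] in blast)
  have i4: "set_integrable lborel {t..t + h} (\<lambda>s. \<Sum>i\<in>Basis. l2inner lborel (D i) (\<lambda>x. G s x i))"
    by (rule set_integral_sum_integrable(1), rule time_avg_inner_integrable_right[OF iG D])
  have "l2inner lborel l z = of_real (1 / h) * (LINT s:{t..t + h}|lborel. l2inner lborel l (v s))"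
    unfolding z_def by (rule l2inner_time_avg_right[OF iv l])
  also have "(LINT s:{t..t + h}|lborel. l2inner lborel l (v s)) = (LINT s:{t..t + h}|lborel. \<Sum>i\<in>Basis. l2inner lborel (D i) (\<lambda>x. G s x i))"
    by (rule set_integral_cong_AE_integrable[OF time_avg_inner_integrable_right[OF iv l] i4])
       (use pair in \<open>eventually_elim, simp\<close>)
  also have "\<dots> = (\<Sum>i\<in>Basis. (LINT s:{t..t + h}|lborel. l2inner lborel (D i) (\<lambda>x. G s x i)))"
    by (rule set_integral_sum_integrable(2), rule time_avg_inner_integrable_right[OF iG D])
  also have "of_real (1 / h) * \<dots> = (\<Sum>i\<in>Basis. l2inner lborel (D i) (D i))"
    unfolding sum_distrib_left
  proof (intro sum.cong refl)
    fix i :: 'a assume i: "i \<in> Basis"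
    show "of_real (1 / h) * (LINT s:{t..t + h}|lborel. l2inner lborel (D i) (\<lambda>x. G s x i)) = l2inner lborel (D i) (D i)"
      using l2inner_time_avg_right[OF iG[OF i] D[OF i]] by (simp add: D_def)
  qed
  finally show "(\<Sum>i\<in>Basis. of_real ((l2norm lborel (D i))\<^sup>2)) = l2inner lborel l z"
    by (simp add: l2inner_self)
  fix i :: 'a assume i: "i \<in> Basis"
  \<comment> \<open>The increment identity is linear in the pair of function and derivative, hence
    survives averaging.\<close>
  show "has_weak_increments i (D i) z"
    unfolding has_weak_increments_def
  proof (intro allI impI)
    fix \<rho> :: real and Q :: "'a \<Rightarrow> complex" assume \<rho>: "0 \<le> \<rho>" and Q: "sq_integrable lborel Q"
    have Q': "sq_integrable lborel (\<lambda>x. Q (x - \<rho> *\<^sub>R i) - Q x)"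
      using sq_integrable_diff[OF sq_integrable_shift[OF Q, of "- (\<rho> *\<^sub>R i)"] Q] by simp
    note sS = sq_integrable_segment_integral[OF Q, of \<rho> "- i"]
    have "(LINT s:{t..t + h}|lborel. l2inner lborel (v s) (\<lambda>x. Q (x - \<rho> *\<^sub>R i) - Q x))
      = (LINT s:{t..t + h}|lborel. l2inner lborel (\<lambda>x. G s x i) (segment_integral \<rho> (- i) Q))"
    proof (rule set_integral_cong_AE_integrable[OF l2_integrable_on_inner[OF iv Q'] l2_integrable_on_inner[OF iG[OF i] sS]])
      show "AE s in lborel. s \<in> {t..t + h} \<longrightarrow> l2inner lborel (v s) (\<lambda>x. Q (x - \<rho> *\<^sub>R i) - Q x)
        = l2inner lborel (\<lambda>x. G s x i) (segment_integral \<rho> (- i) Q)"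
        using AE
      proof eventually_elim
        case (elim s)
        show ?case
        proof
          assume "s \<in> {t..t + h}"
          then have "H10_grad \<Omega> (v s) (G s)" using elim by blast
          from H10_grad_has_weak_increments[OF this i] \<rho> Q
          show "l2inner lborel (v s) (\<lambda>x. Q (x - \<rho> *\<^sub>R i) - Q x) = l2inner lborel (\<lambda>x. G s x i) (segment_integral \<rho> (- i) Q)"
            unfolding has_weak_increments_def by blast
        qed
      qed
    qed
    then show "l2inner lborel z (\<lambda>x. Q (x - \<rho> *\<^sub>R i) - Q x) = l2inner lborel (D i) (segment_integral \<rho> (- i) Q)"
      unfolding z_def D_def l2inner_time_avg_left[OF iv Q'] l2inner_time_avg_left[OF iG[OF i] sS] by simp
  qed
qed

section \<open>Energy inequality and norm bounds\<close>

lemma le_of_le_add_small_mult: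
  fixes X Y C :: real
  assumes "\<And>\<epsilon>. 0 < \<epsilon> \<Longrightarrow> \<epsilon> \<le> 1 \<Longrightarrow> X \<le> Y + \<epsilon> * C"
  shows "X \<le> Y"
proof (rule field_le_epsilon)
  fix e :: real assume e: "0 < e"
  define \<epsilon> where "\<epsilon> = min 1 (e / (\<bar>C\<bar> + 1))"
  have \<epsilon>: "0 < \<epsilon>" "\<epsilon> \<le> 1" "\<epsilon> \<le> e / (\<bar>C\<bar> + 1)" using e by (auto simp: \<epsilon>_def intro!: divide_pos_pos)
  have "\<epsilon> * C \<le> \<epsilon> * (\<bar>C\<bar> + 1)" using \<epsilon>(1) by (intro mult_left_mono) auto
  also have "\<dots> \<le> e / (\<bar>C\<bar> + 1) * (\<bar>C\<bar> + 1)" using \<epsilon>(3) by (intro mult_right_mono) auto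
  also have "\<dots> = e" by (simp add: add_nonneg_eq_0_iff)
  finally show "X \<le> Y + e" using assms[OF \<epsilon>(1,2)] by linarith
qed

lemma set_integral_nonneg_Icc:
  fixes f :: "real \<Rightarrow> real"
  assumes "\<And>s. 0 \<le> f s" shows "0 \<le> (LINT s:A|lborel. f s)"
  unfolding set_lebesgue_integral_def by (rule integral_nonneg_AE, rule AE_I2) (simp add: assms)

text \<open>The squared norm of the average is differentiable, and its derivative is computed from
  the averaged equation, whose Laplacian contributes nothing to the imaginary part. The forcing is
  only integrable in time, so its averages cannot be compared with \<open>g\<close> at individual
  times: they are kept as increments of the primitive \<open>\<Gamma>\<close> until everything is
  integrated over \<open>{s..t}\<close>. Windows that start in \<open>{s..t}\<close> reach beyond
  \<open>t\<close>, hence the upper limit \<open>t + \<delta>\<close>.\<close>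

lemma energy_inequality:
  fixes v :: "real \<Rightarrow> 'a::euclidean_space \<Rightarrow> complex"
  assumes lin: "linear_solution \<Omega> v G (\<lambda>t x. N t x - g t x)"
    and N: "l2_continuous_on {0<..} N"
    and g: "\<And>a b. 0 < a \<Longrightarrow> l2_integrable_on {a..b} g"
    and s: "0 < s" and st: "s \<le> t" and \<delta>: "0 < \<delta>"
    and M: "\<And>\<tau>. \<tau> \<in> {s..t} \<Longrightarrow> l2norm lborel (v \<tau>) \<le> M"
  shows "(l2norm lborel (v t))\<^sup>2 + 2 * (LINT \<tau>:{s..t}|lborel. Im (l2inner lborel (N \<tau>) (v \<tau>)))
    \<le> (l2norm lborel (v s))\<^sup>2 + 2 * M * (LINT \<tau>:{s..t + \<delta>}|lborel. l2norm lborel (g \<tau>))"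
proof -
  note v = linear_solutionD(2)[OF lin] and jv = linear_solutionD(1)[OF lin]
  have vs: "sq_integrable lborel (v \<tau>)" if "0 < \<tau>" for \<tau> using linear_solutionD(7)[OF lin that] .
  have Ns: "sq_integrable lborel (N \<tau>)" if "0 < \<tau>" for \<tau> using l2_continuous_on_sq[OF N] that by simp
  have M0: "0 \<le> M" using order_trans[OF l2norm_nonneg M[of s]] st by simp
  define \<gamma> where "\<gamma> \<tau> = l2norm lborel (g \<tau>)" for \<tau>
  have \<gamma>0: "0 \<le> \<gamma> \<tau>" for \<tau> by (simp add: \<gamma>_def)
  have i\<gamma>: "set_integrable lborel {a..b} \<gamma>" if "0 < a" for a b
    using g[OF that, of b] by (simp add: l2_integrable_on_def \<gamma>_def[abs_def])
  define \<Gamma> where "\<Gamma> \<tau> = (LINT \<sigma>:{s..\<tau>}|lborel. \<gamma> \<sigma>)" for \<tau>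
  have \<Gamma>_diff: "(LINT \<sigma>:{a..b}|lborel. \<gamma> \<sigma>) = \<Gamma> b - \<Gamma> a" if "s \<le> a" "a \<le> b" for a b
    using set_integral_combine_Icc[OF i\<gamma>[OF s] that] by (simp add: \<Gamma>_def)
  have \<Gamma>0: "0 \<le> \<Gamma> a" for a unfolding \<Gamma>_def by (rule set_integral_nonneg_Icc[OF \<gamma>0])
  have \<Gamma>mono: "\<Gamma> a \<le> \<Gamma> b" if "s \<le> a" "a \<le> b" for a b
    using \<Gamma>_diff[OF that] set_integral_nonneg_Icc[of \<gamma> "{a..b}", OF \<gamma>0] by simp
  have \<Gamma>cont: "continuous_on {s..b} \<Gamma>" for b
  proof -
    have "continuous_on {s..b} (\<lambda>x. integral {s..x} \<gamma>)"
      by (rule indefinite_integral_continuous_1) (rule set_borel_integral_eq_integral(1)[OF i\<gamma>[OF s]])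
    then show ?thesis unfolding \<Gamma>_def using set_borel_integral_eq_integral(2)[OF i\<gamma>[OF s]] by simp
  qed
  have i\<Gamma>: "set_integrable lborel {s..b} \<Gamma>" for b
    unfolding set_integrable_def by (rule borel_integrable_compact[OF compact_Icc \<Gamma>cont])
  define d where "d \<tau> = Im (l2inner lborel (N \<tau>) (v \<tau>))" for \<tau>
  have dcont: "continuous_on {s..t} d"
    unfolding d_def using s
    by (intro continuous_on_Im continuous_on_subset[OF l2_continuous_on_continuous_inner[OF N v]]) auto
  have id: "set_integrable lborel {s..t} d"
    unfolding set_integrable_def by (rule borel_integrable_compact[OF compact_Icc dcont])
  have "continuous_on {s..t} (\<lambda>\<tau>. l2norm lborel (N \<tau>))"
    by (rule continuous_on_subset[OF l2_continuous_on_continuous_norm[OF N]]) (use s in auto)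
  then have "bounded ((\<lambda>\<tau>. l2norm lborel (N \<tau>)) ` {s..t})"
    by (intro compact_imp_bounded compact_continuous_image compact_Icc)
  then obtain K where K: "\<And>\<tau>. \<tau> \<in> {s..t} \<Longrightarrow> l2norm lborel (N \<tau>) \<le> K"
    unfolding bounded_iff by fastforce
  have K0: "0 \<le> K" using order_trans[OF l2norm_nonneg K[of s]] st by simp
  have sub: "{s..t + \<delta>} \<subseteq> {0<..}" using s by auto
  \<comment> \<open>Collects the factors of \<open>\<epsilon>\<close> from all errors below. It
    involves neither \<open>\<epsilon>\<close> nor the window length, so these errors disappear in
    the limit.\<close>
  define C where "C = 4 * M + 4 + 2 * (M + 1 + K) * (t - s) + 2 * \<Gamma> (t + \<delta>)"
  have "(l2norm lborel (v t))\<^sup>2 + 2 * (LINT \<tau>:{s..t}|lborel. d \<tau>)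
      \<le> ((l2norm lborel (v s))\<^sup>2 + 2 * M * \<Gamma> (t + \<delta>)) + \<epsilon> * C" if \<epsilon>: "0 < \<epsilon>" "\<epsilon> \<le> 1" for \<epsilon>
  proof -
    obtain \<delta>1 where \<delta>1: "0 < \<delta>1" "\<And>a b. a \<in> {s..t + \<delta>} \<Longrightarrow> b \<in> {s..t + \<delta>} \<Longrightarrow> \<bar>a - b\<bar> < \<delta>1 \<Longrightarrow> l2norm lborel (\<lambda>x. v a x - v b x) < \<epsilon>"
      by (rule l2_uniformly_continuous[OF l2_continuous_on_subset[OF v sub] compact_Icc \<epsilon>(1)]) (rule that)
    obtain \<delta>2 where \<delta>2: "0 < \<delta>2" "\<And>a b. a \<in> {s..t + \<delta>} \<Longrightarrow> b \<in> {s..t + \<delta>} \<Longrightarrow> \<bar>a - b\<bar> < \<delta>2 \<Longrightarrow> l2norm lborel (\<lambda>x. N a x - N b x) < \<epsilon>"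
      by (rule l2_uniformly_continuous[OF l2_continuous_on_subset[OF N sub] compact_Icc \<epsilon>(1)]) (rule that)
    \<comment> \<open>Within a window of this length \<open>v\<close> and \<open>N\<close> change by
      less than \<open>\<epsilon>\<close>, and the window stays inside the interval on which this
      was established.\<close>
    define h where "h = min \<delta> (min \<delta>1 \<delta>2) / 2"
    have h: "0 < h" "h \<le> \<delta>" "h < \<delta>1" "h < \<delta>2" using \<delta> \<delta>1(1) \<delta>2(1) by (auto simp: h_def)
    have near: "l2norm lborel (\<lambda>x. v \<sigma> x - v \<tau> x) \<le> \<epsilon>" "l2norm lborel (\<lambda>x. N \<sigma> x - N \<tau> x) \<le> \<epsilon>"
      if "\<tau> \<in> {s..t}" "\<sigma> \<in> {\<tau>..\<tau> + h}" for \<sigma> \<tau>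
      using \<delta>1(2)[of \<sigma> \<tau>] \<delta>2(2)[of \<sigma> \<tau>] that h by auto
    define z where "z = time_avg h v"
    have iv: "l2_integrable_on {\<tau>..b} v" if "0 < \<tau>" for \<tau> b using linear_solutionD(8)[OF lin that] .
    have zs: "sq_integrable lborel (z \<tau>)" if "0 < \<tau>" for \<tau> unfolding z_def by (rule sq_integrable_time_avg[OF iv[OF that]])
    have zv: "l2norm lborel (\<lambda>x. z \<tau> x - v \<tau> x) \<le> \<epsilon>" if \<tau>: "\<tau> \<in> {s..t}" for \<tau>
    proof -
      have p: "0 < \<tau>" using \<tau> s by auto
      show ?thesis unfolding z_def
        by (rule l2norm_time_avg_diff[OF iv[OF p] h(1) vs[OF p] less_imp_le[OF \<epsilon>(1)] near(1)[OF \<tau>]])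
    qed
    have zM: "l2norm lborel (z \<tau>) \<le> M + \<epsilon>" if \<tau>: "\<tau> \<in> {s..t}" for \<tau>
    proof -
      have p: "0 < \<tau>" using \<tau> s by auto
      show ?thesis using l2norm_le_add_diff[OF zs[OF p] vs[OF p]] zv[OF \<tau>] M[OF \<tau>] by linarith
    qed
    define y where "y \<tau> = (l2norm lborel (z \<tau>))\<^sup>2" for \<tau>
    define y' where "y' \<tau> = 2 * Re (l2inner lborel (\<lambda>x. of_real (1 / h) * (v (\<tau> + h) x - v \<tau> x)) (z \<tau>))" for \<tau>
    have dy: "(y has_real_derivative y' \<tau>) (at \<tau>)" if "0 < \<tau>" for \<tau>
      unfolding y_def y'_def z_def by (rule time_avg_norm_deriv[OF v jv that h(1)])
    \<comment> \<open>The first part is the expected derivative with its error. The second is the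
      average of the norm of \<open>g\<close> over the window, weighted with the bound on
      \<open>z\<close>.\<close>
    define B where "B \<tau> = (- 2 * d \<tau> + 2 * \<epsilon> * (M + 1 + K)) + (2 * (M + \<epsilon>) / h) * (\<Gamma> (\<tau> + h) - \<Gamma> \<tau>)" for \<tau>
    have bound: "y' \<tau> \<le> B \<tau>" if \<tau>: "\<tau> \<in> {s..t}" for \<tau>
    proof -
      have p: "0 < \<tau>" using \<tau> s by auto
      have ph: "0 < \<tau> + h" using p h by simp
      define c where "c x = of_real (1 / h) * (v (\<tau> + h) x - v \<tau> x)" for x
      have c: "sq_integrable lborel c" unfolding c_def by (intro sq_integrable_scale sq_integrable_diff vs p ph)
      define F where "F = (\<lambda>t x. N t x - g t x)"
      have iF: "l2_integrable_on {\<tau>..\<tau> + h} F" unfolding F_def by (rule linear_solutionD(4)[OF lin p])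
      define Fh where "Fh = time_avg h F \<tau>"
      have Fh: "sq_integrable lborel Fh" unfolding Fh_def by (rule sq_integrable_time_avg[OF iF])
      note avg = linear_solution_avg(1)[OF lin p h(1), folded F_def c_def Fh_def z_def]
      have "l2inner lborel (\<lambda>x. \<i> * c x + Fh x) (z \<tau>) = \<i> * l2inner lborel c (z \<tau>) + l2inner lborel Fh (z \<tau>)"
        by (simp only: l2inner_add_left[OF sq_integrable_scale[OF c] Fh zs[OF p]] l2inner_scale_left)
      then have "\<i> * l2inner lborel c (z \<tau>) + l2inner lborel Fh (z \<tau>)
          = (\<Sum>i\<in>Basis. of_real ((l2norm lborel (time_avg h (\<lambda>s x. G s x i) \<tau>))\<^sup>2))"
        using avg by simp
      \<comment> \<open>A sum of squared norms is real; this is the point where the Laplacian drops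
        out.\<close>
      then have "Im (\<i> * l2inner lborel c (z \<tau>) + l2inner lborel Fh (z \<tau>)) = 0"
        by (simp only: of_real_sum[symmetric] Im_complex_of_real)
      then have y'eq: "y' \<tau> = - 2 * Im (l2inner lborel Fh (z \<tau>))"
        unfolding y'_def c_def[abs_def, symmetric] by simp
      \<comment> \<open>The pairing at the left end of the window. Replacing
        \<open>N \<sigma>\<close> by \<open>N \<tau>\<close> and \<open>z \<tau>\<close> by
        \<open>v \<tau>\<close> costs the error term with \<open>\<epsilon>\<close>.\<close>
      define I where "I = l2inner lborel (N \<tau>) (v \<tau>)"
      note iFz = time_avg_inner_integrable[OF iF zs[OF p]]
      have iI: "set_integrable lborel {\<tau>..\<tau> + h} (\<lambda>\<sigma>. I)" by (rule set_integrable_const_Icc)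
      have "l2inner lborel Fh (z \<tau>) - I = of_real (1 / h) * (LINT \<sigma>:{\<tau>..\<tau> + h}|lborel. l2inner lborel (F \<sigma>) (z \<tau>) - I)"
        unfolding Fh_def l2inner_time_avg_left[OF iF zs[OF p]] set_integral_diff(2)[OF iFz iI]
        using h by (simp add: set_integral_const_Icc scaleR_conv_of_real right_diff_distrib)
      then have 1: "cmod (l2inner lborel Fh (z \<tau>) - I) = (1 / h) * cmod (LINT \<sigma>:{\<tau>..\<tau> + h}|lborel. l2inner lborel (F \<sigma>) (z \<tau>) - I)"
        using h by (simp add: norm_mult norm_divide)
      have ir: "set_integrable lborel {\<tau>..\<tau> + h} (\<lambda>\<sigma>. (M + \<epsilon>) * \<gamma> \<sigma>)"
        by (intro set_integrable_mult_right i\<gamma> p)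
      have ik: "set_integrable lborel {\<tau>..\<tau> + h} (\<lambda>\<sigma>. \<epsilon> * (M + 1 + K))" by (rule set_integrable_const_Icc)
      have 2: "cmod (LINT \<sigma>:{\<tau>..\<tau> + h}|lborel. l2inner lborel (F \<sigma>) (z \<tau>) - I)
          \<le> (LINT \<sigma>:{\<tau>..\<tau> + h}|lborel. \<epsilon> * (M + 1 + K) + (M + \<epsilon>) * \<gamma> \<sigma>)"
      proof (rule norm_set_integral_le[OF set_integral_diff(1)[OF iFz iI] set_integral_add(1)[OF ik ir]])
        have "AE \<sigma> in lborel. \<sigma> \<in> {\<tau>..\<tau> + h} \<longrightarrow> sq_integrable lborel (g \<sigma>)"
          using g[OF p] by (simp add: l2_integrable_on_def)
        then show "AE \<sigma> in lborel. \<sigma> \<in> {\<tau>..\<tau> + h} \<longrightarrow> cmod (l2inner lborel (F \<sigma>) (z \<tau>) - I) \<le> \<epsilon> * (M + 1 + K) + (M + \<epsilon>) * \<gamma> \<sigma>"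
        proof eventually_elim
          case (elim \<sigma>)
          show ?case
          proof
            assume \<sigma>: "\<sigma> \<in> {\<tau>..\<tau> + h}"
            then have gs: "sq_integrable lborel (g \<sigma>)" and \<sigma>0: "0 < \<sigma>" using elim p by auto
            note NS = Ns[OF \<sigma>0] and NT = Ns[OF p] and Z = zs[OF p] and VT = vs[OF p]
            have "l2inner lborel (F \<sigma>) (z \<tau>) - I = (l2inner lborel (N \<sigma>) (z \<tau>) - I) - l2inner lborel (g \<sigma>) (z \<tau>)"
              unfolding F_def using l2inner_diff_left[OF NS gs Z] by simp
            then have "cmod (l2inner lborel (F \<sigma>) (z \<tau>) - I) \<le> cmod (l2inner lborel (N \<sigma>) (z \<tau>) - I) + cmod (l2inner lborel (g \<sigma>) (z \<tau>))"
              by (simp only: norm_triangle_ineq4)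
            also have "cmod (l2inner lborel (N \<sigma>) (z \<tau>) - I)
                \<le> l2norm lborel (\<lambda>x. N \<sigma> x - N \<tau> x) * l2norm lborel (z \<tau>) + l2norm lborel (N \<tau>) * l2norm lborel (\<lambda>x. z \<tau> x - v \<tau> x)"
              unfolding I_def by (rule l2inner_diff_bound[OF NS Z NT VT])
            also have "l2norm lborel (\<lambda>x. N \<sigma> x - N \<tau> x) * l2norm lborel (z \<tau>) \<le> \<epsilon> * (M + 1)"
              by (rule mult_mono[OF near(2)[OF \<tau> \<sigma>]]) (use zM[OF \<tau>] \<epsilon> in auto)
            also have "l2norm lborel (N \<tau>) * l2norm lborel (\<lambda>x. z \<tau> x - v \<tau> x) \<le> K * \<epsilon>"
              by (rule mult_mono[OF K[OF \<tau>] zv[OF \<tau>] K0]) simp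
            also have "cmod (l2inner lborel (g \<sigma>) (z \<tau>)) \<le> \<gamma> \<sigma> * l2norm lborel (z \<tau>)"
              unfolding \<gamma>_def by (rule l2_Cauchy_Schwarz[OF gs Z])
            also have "\<gamma> \<sigma> * l2norm lborel (z \<tau>) \<le> \<gamma> \<sigma> * (M + \<epsilon>)"
              by (rule mult_left_mono[OF zM[OF \<tau>] \<gamma>0])
            finally show "cmod (l2inner lborel (F \<sigma>) (z \<tau>) - I) \<le> \<epsilon> * (M + 1 + K) + (M + \<epsilon>) * \<gamma> \<sigma>"
              by (simp add: algebra_simps)
          qed
        qed
      qed
      have 3: "(LINT \<sigma>:{\<tau>..\<tau> + h}|lborel. \<epsilon> * (M + 1 + K) + (M + \<epsilon>) * \<gamma> \<sigma>)
          = h * (\<epsilon> * (M + 1 + K)) + (M + \<epsilon>) * (\<Gamma> (\<tau> + h) - \<Gamma> \<tau>)"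
        unfolding set_integral_add(2)[OF ik ir] set_integral_mult_right
        using \<Gamma>_diff[of \<tau> "\<tau> + h"] \<tau> h by (simp add: set_integral_const_Icc)
      have "cmod (l2inner lborel Fh (z \<tau>) - I) \<le> (1 / h) * (h * (\<epsilon> * (M + 1 + K)) + (M + \<epsilon>) * (\<Gamma> (\<tau> + h) - \<Gamma> \<tau>))"
        unfolding 1 using mult_left_mono[OF 2[unfolded 3], of "1 / h"] h by simp
      also have "\<dots> = \<epsilon> * (M + 1 + K) + ((M + \<epsilon>) / h) * (\<Gamma> (\<tau> + h) - \<Gamma> \<tau>)"
        using h by (simp add: distrib_left)
      finally have "\<bar>Im (l2inner lborel Fh (z \<tau>) - I)\<bar> \<le> \<epsilon> * (M + 1 + K) + ((M + \<epsilon>) / h) * (\<Gamma> (\<tau> + h) - \<Gamma> \<tau>)"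
        using abs_Im_le_cmod order_trans by blast
      then have le: "- 2 * Im (l2inner lborel Fh (z \<tau>)) \<le> - 2 * Im I + 2 * (\<epsilon> * (M + 1 + K) + ((M + \<epsilon>) / h) * (\<Gamma> (\<tau> + h) - \<Gamma> \<tau>))"
        by simp
      have "2 * (\<epsilon> * q + (P / h) * X) = 2 * \<epsilon> * q + (2 * P / h) * X" for q P X :: real
        by (simp add: distrib_left)
      from le[unfolded this]
      show ?thesis unfolding y'eq B_def d_def I_def by (simp only: add.assoc)
    qed
    have iD: "set_integrable lborel {s..t} (\<lambda>\<tau>. \<Gamma> (\<tau> + h) - \<Gamma> \<tau>)"
      by (rule set_integral_diff(1)[OF set_integral_shift_Icc(1) i\<Gamma>]) (rule set_integrable_subset[OF i\<Gamma>[of "t + h"]], use h in auto)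
    have i1: "set_integrable lborel {s..t} (\<lambda>\<tau>. - 2 * d \<tau> + 2 * \<epsilon> * (M + 1 + K))"
      by (intro set_integral_add(1) set_integrable_mult_right id set_integrable_const_Icc)
    have i2: "set_integrable lborel {s..t} (\<lambda>\<tau>. (2 * (M + \<epsilon>) / h) * (\<Gamma> (\<tau> + h) - \<Gamma> \<tau>))"
      by (intro set_integrable_mult_right iD)
    have iB: "set_integrable lborel {s..t} B" unfolding B_def by (rule set_integral_add(1)[OF i1 i2])
    have "(y' has_integral (y t - y s)) {s..t}"
    proof (rule fundamental_theorem_of_calculus[OF st])
      fix x assume "x \<in> {s..t}"
      then have "0 < x" using s by auto
      from dy[OF this] show "(y has_vector_derivative y' x) (at x within {s..t})"
        unfolding has_real_derivative_iff_has_vector_derivative by (rule has_vector_derivative_at_within)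
    qed
    then have "y t - y s \<le> integral {s..t} B"
      by (rule has_integral_le[OF _ integrable_integral[OF set_borel_integral_eq_integral(1)[OF iB]] bound])
    also have "\<dots> = (LINT \<tau>:{s..t}|lborel. B \<tau>)" by (rule set_borel_integral_eq_integral(2)[OF iB, symmetric])
    also have "\<dots> = - 2 * (LINT \<tau>:{s..t}|lborel. d \<tau>) + (t - s) * (2 * \<epsilon> * (M + 1 + K))
        + (2 * (M + \<epsilon>) / h) * (LINT \<tau>:{s..t}|lborel. \<Gamma> (\<tau> + h) - \<Gamma> \<tau>)"
    proof -
      have a: "(LINT \<tau>:{s..t}|lborel. - 2 * d \<tau> + 2 * \<epsilon> * (M + 1 + K)) = (LINT \<tau>:{s..t}|lborel. - 2 * d \<tau>) + (LINT \<tau>:{s..t}|lborel. 2 * \<epsilon> * (M + 1 + K))"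
        by (intro set_integral_add(2) set_integrable_mult_right id set_integrable_const_Icc)
      show ?thesis unfolding B_def set_integral_add(2)[OF i1 i2] a set_integral_mult_right set_integral_const_Icc[OF st] by simp
    qed
    \<comment> \<open>At individual times the increment of \<open>\<Gamma>\<close> has no rate in
      \<open>h\<close>, but its integral is a difference of two windows of length \<open>h\<close>,
      which compensates the division by \<open>h\<close>.\<close>
    also have "(LINT \<tau>:{s..t}|lborel. \<Gamma> (\<tau> + h) - \<Gamma> \<tau>) \<le> h * \<Gamma> (t + \<delta>)"
    proof -
      have "(LINT \<tau>:{s..t}|lborel. \<Gamma> (\<tau> + h) - \<Gamma> \<tau>) = (LINT \<tau>:{t..t + h}|lborel. \<Gamma> \<tau>) - (LINT \<tau>:{s..s + h}|lborel. \<Gamma> \<tau>)"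
        by (rule set_integral_shift_difference[OF i\<Gamma> st less_imp_le[OF h(1)], symmetric])
      also have "\<dots> \<le> (LINT \<tau>:{t..t + h}|lborel. \<Gamma> \<tau>)" using set_integral_nonneg_Icc[of \<Gamma> "{s..s + h}", OF \<Gamma>0] by simp
      also have "\<dots> \<le> (LINT \<tau>:{t..t + h}|lborel. \<Gamma> (t + \<delta>))"
      proof (rule set_integral_mono)
        show "set_integrable lborel {t..t + h} \<Gamma>" by (rule set_integrable_subset[OF i\<Gamma>[of "t + h"]]) (use st in auto)
        show "\<Gamma> \<tau> \<le> \<Gamma> (t + \<delta>)" if "\<tau> \<in> {t..t + h}" for \<tau> using that st h by (intro \<Gamma>mono) auto
      qed (rule set_integrable_const_Icc)
      also have "\<dots> = h * \<Gamma> (t + \<delta>)" using h by (simp add: set_integral_const_Icc)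
      finally show ?thesis .
    qed
    then have "(2 * (M + \<epsilon>) / h) * (LINT \<tau>:{s..t}|lborel. \<Gamma> (\<tau> + h) - \<Gamma> \<tau>) \<le> (2 * (M + \<epsilon>) / h) * (h * \<Gamma> (t + \<delta>))"
      by (rule mult_left_mono) (use M0 \<epsilon> h in auto)
    also have "(2 * (M + \<epsilon>) / h) * (h * \<Gamma> (t + \<delta>)) = 2 * (M + \<epsilon>) * \<Gamma> (t + \<delta>)" using h by simp
    finally have Y: "y t - y s \<le> - 2 * (LINT \<tau>:{s..t}|lborel. d \<tau>) + (t - s) * (2 * \<epsilon> * (M + 1 + K)) + 2 * (M + \<epsilon>) * \<Gamma> (t + \<delta>)"
      by simp
    have ts: "s \<in> {s..t}" "t \<in> {s..t}" "0 < t" using s st by auto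
    have \<epsilon>2: "\<epsilon>\<^sup>2 \<le> \<epsilon>" using \<epsilon> by (simp add: power2_eq_square mult_left_le_one_le)
    \<comment> \<open>Back from the average to \<open>v\<close> at both endpoints, at a cost of
      order \<open>\<epsilon>\<close>.\<close>
    have "(l2norm lborel (v t))\<^sup>2 \<le> (l2norm lborel (z t) + \<epsilon>)\<^sup>2"
      using l2norm_le_add_diff[OF vs[OF ts(3)] zs[OF ts(3)]] zv[OF ts(2)]
      by (intro power_mono) (simp_all add: l2norm_minus_commute[of lborel "v t"])
    also have "\<dots> = y t + 2 * \<epsilon> * l2norm lborel (z t) + \<epsilon>\<^sup>2" by (simp add: y_def power2_sum)
    also have "\<dots> \<le> y t + 2 * \<epsilon> * (M + 1) + \<epsilon>"
      using mult_left_mono[of "l2norm lborel (z t)" "M + 1" "2 * \<epsilon>"] zM[OF ts(2)] \<epsilon> \<epsilon>2 by linarith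
    finally have vt: "(l2norm lborel (v t))\<^sup>2 \<le> y t + 2 * \<epsilon> * (M + 1) + \<epsilon>" .
    have "y s \<le> (l2norm lborel (v s) + \<epsilon>)\<^sup>2"
      unfolding y_def using l2norm_le_add_diff[OF zs[OF s] vs[OF s]] zv[OF ts(1)]
      by (intro power_mono) simp_all
    also have "\<dots> = (l2norm lborel (v s))\<^sup>2 + 2 * \<epsilon> * l2norm lborel (v s) + \<epsilon>\<^sup>2" by (simp add: power2_sum)
    also have "\<dots> \<le> (l2norm lborel (v s))\<^sup>2 + 2 * \<epsilon> * M + \<epsilon>"
      using mult_left_mono[of "l2norm lborel (v s)" M "2 * \<epsilon>"] M[OF ts(1)] \<epsilon> \<epsilon>2 by linarith
    finally have ys: "y s \<le> (l2norm lborel (v s))\<^sup>2 + 2 * \<epsilon> * M + \<epsilon>" .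
    have "\<epsilon> * C = 2 * \<epsilon> * (M + 1) + \<epsilon> + 2 * \<epsilon> * M + \<epsilon> + (t - s) * (2 * \<epsilon> * (M + 1 + K)) + 2 * \<epsilon> * \<Gamma> (t + \<delta>)"
      by (simp add: C_def algebra_simps)
    moreover have "2 * (M + \<epsilon>) * \<Gamma> (t + \<delta>) = 2 * M * \<Gamma> (t + \<delta>) + 2 * \<epsilon> * \<Gamma> (t + \<delta>)" by (simp add: algebra_simps)
    ultimately show ?thesis using vt ys Y by linarith
  qed
  then have "(l2norm lborel (v t))\<^sup>2 + 2 * (LINT \<tau>:{s..t}|lborel. d \<tau>) \<le> (l2norm lborel (v s))\<^sup>2 + 2 * M * \<Gamma> (t + \<delta>)"
    by (rule le_of_le_add_small_mult)
  then show ?thesis by (simp add: d_def \<Gamma>_def \<gamma>_def)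
qed

text \<open>The energy inequality is applied up to the time where the norm is maximal on
  \<open>{s..t}\<close>. The maximum \<open>M\<close> then satisfies
  \<open>M * M \<le> M * l2norm lborel (v s) + 2 * M * I'\<close>, and dividing by \<open>M\<close>
  gives a linear bound. This takes the place of differentiating the norm, which may vanish.\<close>

lemma l2norm_le_of_dissipative:
  fixes v :: "real \<Rightarrow> 'a::euclidean_space \<Rightarrow> complex"
  assumes lin: "linear_solution \<Omega> v G (\<lambda>t x. N t x - g t x)"
    and N: "l2_continuous_on {0<..} N"
    and g: "\<And>a b. 0 < a \<Longrightarrow> l2_integrable_on {a..b} g"
    and s: "0 < s" and st: "s \<le> t" and \<delta>: "0 < \<delta>"
    and diss: "\<And>\<tau>. 0 < \<tau> \<Longrightarrow> 0 \<le> Im (l2inner lborel (N \<tau>) (v \<tau>))"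
  shows "l2norm lborel (v t) \<le> l2norm lborel (v s) + 2 * (LINT \<tau>:{s..t + \<delta>}|lborel. l2norm lborel (g \<tau>))"
proof -
  have "continuous_on {s..t} (\<lambda>\<tau>. l2norm lborel (v \<tau>))"
    by (rule continuous_on_subset[OF l2_continuous_on_continuous_norm[OF linear_solutionD(2)[OF lin]]]) (use s in auto)
  from continuous_attains_sup[OF compact_Icc _ this] st
  obtain \<tau> where \<tau>: "\<tau> \<in> {s..t}" and max: "\<And>r. r \<in> {s..t} \<Longrightarrow> l2norm lborel (v r) \<le> l2norm lborel (v \<tau>)" by auto
  define M where "M = l2norm lborel (v \<tau>)"
  define I where "I = (LINT \<tau>:{s..t + \<delta>}|lborel. l2norm lborel (g \<tau>))"
  define I' where "I' = (LINT r:{s..\<tau> + \<delta>}|lborel. l2norm lborel (g r))"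
  have ig: "set_integrable lborel {s..b} (\<lambda>r. l2norm lborel (g r))" for b
    using g[OF s] by (simp add: l2_integrable_on_def)
  have "(LINT r:{s..\<tau> + \<delta>}|lborel. l2norm lborel (g r)) + (LINT r:{\<tau> + \<delta>..t + \<delta>}|lborel. l2norm lborel (g r)) = I"
    unfolding I_def by (rule set_integral_combine_Icc[OF ig]) (use \<tau> \<delta> in auto)
  then have I': "I' \<le> I"
    using set_integral_nonneg_Icc[of "\<lambda>r. l2norm lborel (g r)" "{\<tau> + \<delta>..t + \<delta>}"] by (simp add: I'_def)
  have I0: "0 \<le> I'" unfolding I'_def by (rule set_integral_nonneg_Icc) simp
  have "M\<^sup>2 + 2 * (LINT r:{s..\<tau>}|lborel. Im (l2inner lborel (N r) (v r))) \<le> (l2norm lborel (v s))\<^sup>2 + 2 * M * I'"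
    unfolding M_def I'_def by (rule energy_inequality[OF lin N g s _ \<delta>]) (use \<tau> max in auto)
  moreover have "0 \<le> (LINT r:{s..\<tau>}|lborel. Im (l2inner lborel (N r) (v r)))"
    unfolding set_lebesgue_integral_def
    by (rule integral_nonneg_AE, rule AE_I2) (use diss s in \<open>simp add: indicator_def\<close>)
  ultimately have E: "M * M \<le> l2norm lborel (v s) * l2norm lborel (v s) + 2 * M * I'" by (simp add: power2_eq_square)
  have "M \<le> l2norm lborel (v s) + 2 * I'"
  proof (rule ccontr)
    assume "\<not> ?thesis"
    then have lt: "l2norm lborel (v s) + 2 * I' < M" by simp
    have sM: "l2norm lborel (v s) \<le> M" unfolding M_def by (rule max) (use st in simp)
    have M0: "0 < M" using lt I0 l2norm_nonneg[of lborel "v s"] by linarith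
    have "l2norm lborel (v s) * l2norm lborel (v s) \<le> M * l2norm lborel (v s)"
      by (rule mult_right_mono[OF sM]) simp
    moreover have "M * (l2norm lborel (v s) + 2 * I') < M * M" by (rule mult_strict_left_mono[OF lt M0])
    ultimately show False using E by (simp add: algebra_simps)
  qed
  moreover have "l2norm lborel (v t) \<le> M" unfolding M_def by (rule max) (use st in simp)
  ultimately show ?thesis using I' by (simp add: I_def)
qed

section \<open>From the PDE to the linear equation\<close>

text \<open>Extension by zero moves the problem to the whole space, where translations act.\<close>

definition zext :: "'a set \<Rightarrow> ('a \<Rightarrow> complex) \<Rightarrow> 'a \<Rightarrow> complex" where
  "zext \<Omega> w x = indicator \<Omega> x *\<^sub>R w x"

lemma zext_outside: "x \<notin> \<Omega> \<Longrightarrow> zext \<Omega> w x = 0"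
  by (simp add: zext_def)

lemma zext_diff: "zext \<Omega> (\<lambda>x. f x - g x) = (\<lambda>x. zext \<Omega> f x - zext \<Omega> g x)"
  by (simp add: zext_def fun_eq_iff scaleR_diff_right)

text \<open>The problem is posed with the completed measure, while the Fubini arguments use the
  Borel measure; on Borel representatives the two agree. Limits such as \<open>u t\<close> are only
  known to be Lebesgue measurable and stay on the \<open>lebesgue\<close> side.\<close>

lemma l2norm_lebesgue_eq:
  assumes "f \<in> borel_measurable borel"
  shows "l2norm lebesgue f = l2norm lborel f"
  unfolding l2norm_def using assms by (subst integral_completion) auto

lemma sq_integrable_lebesgue_iff:
  assumes "f \<in> borel_measurable borel"
  shows "sq_integrable lebesgue f \<longleftrightarrow> sq_integrable lborel f"
proof -
  have m: "(\<lambda>x. (cmod (f x))\<^sup>2) \<in> borel_measurable lborel" using assms by measurable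
  have "f \<in> borel_measurable lebesgue" using assms by (intro measurable_completion) simp
  then show ?thesis unfolding sq_integrable_def using assms integrable_completion[OF m] by simp
qed

lemma Lpow_2_eq: "Lpow \<Omega> 2 w = (\<integral>\<^sup>+x. ennreal ((cmod (zext \<Omega> w x))\<^sup>2) \<partial>lebesgue)"
  unfolding Lpow_def by (intro nn_integral_cong) (auto simp: zext_def indicator_def)

lemma Lnorm_2_eq:
  assumes "sq_integrable lebesgue (zext \<Omega> w)"
  shows "Lnorm \<Omega> 2 w = ennreal (l2norm lebesgue (zext \<Omega> w))"
proof -
  have "Lpow \<Omega> 2 w = ennreal ((l2norm lebesgue (zext \<Omega> w))\<^sup>2)"
    unfolding Lpow_2_eq by (rule sq_integrable_nn[OF assms])
  then show ?thesis by (simp add: Lnorm_def epow_def powr_half_sqrt)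
qed

lemma Lnorm_finite_iff: "Lnorm \<Omega> p w < \<infinity> \<longleftrightarrow> Lpow \<Omega> p w < \<infinity>"
  by (auto simp: Lnorm_def epow_def less_top)

lemma sq_integrable_zextI:
  assumes "zext \<Omega> w \<in> borel_measurable lebesgue" "Lnorm \<Omega> 2 w < \<infinity>"
  shows "sq_integrable lebesgue (zext \<Omega> w)"
  using assms unfolding Lnorm_finite_iff Lpow_2_eq by (intro sq_integrableI) auto

lemma zext_borel:
  assumes "open \<Omega>" "w \<in> borel_measurable borel" shows "zext \<Omega> w \<in> borel_measurable borel"
proof -
  have [measurable]: "\<Omega> \<in> sets borel" "w \<in> borel_measurable borel" using assms by simp_all
  show ?thesis unfolding zext_def by measurable
qed

lemma zext_lebesgue:
  assumes "open \<Omega>" "w \<in> borel_measurable lebesgue" shows "zext \<Omega> w \<in> borel_measurable lebesgue"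
proof -
  have [measurable]: "\<Omega> \<in> sets lebesgue" "w \<in> borel_measurable lebesgue"
    using assms by (auto simp: borel_open)
  show ?thesis unfolding zext_def by measurable
qed

lemma Lnorm_2_borel:
  assumes "open \<Omega>" "w \<in> borel_measurable borel" "Lnorm \<Omega> 2 w < \<infinity>"
  shows "sq_integrable lborel (zext \<Omega> w)" "Lnorm \<Omega> 2 w = ennreal (l2norm lborel (zext \<Omega> w))"
proof -
  note b = zext_borel[OF assms(1,2)]
  have s: "sq_integrable lebesgue (zext \<Omega> w)"
    using b assms by (intro sq_integrable_zextI measurable_completion) auto
  then show "sq_integrable lborel (zext \<Omega> w)" using sq_integrable_lebesgue_iff[OF b] by simp
  show "Lnorm \<Omega> 2 w = ennreal (l2norm lborel (zext \<Omega> w))"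
    using Lnorm_2_eq[OF s] l2norm_lebesgue_eq[OF b] by simp
qed

lemma Lnorm_2_borel':
  assumes "open \<Omega>" "w \<in> borel_measurable borel" "sq_integrable lborel (zext \<Omega> w)"
  shows "Lnorm \<Omega> 2 w = ennreal (l2norm lborel (zext \<Omega> w))"
  using Lnorm_2_eq[of \<Omega> w] sq_integrable_lebesgue_iff[OF zext_borel[OF assms(1,2)]]
    l2norm_lebesgue_eq[OF zext_borel[OF assms(1,2)]] assms(3) by simp

lemma jmeas_section:
  assumes "jmeas v" shows "v t \<in> borel_measurable borel"
proof -
  have "(\<lambda>x. (t, x)) \<in> borel_measurable borel" by (intro borel_measurable_continuous_onI continuous_intros)
  from measurable_compose[OF this assms[unfolded jmeas_def]] show ?thesis by simp
qed

lemma jmeas_zext: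
  assumes "open \<Omega>" "jmeas v" shows "jmeas (\<lambda>t. zext \<Omega> (v t))"
proof -
  have "snd \<in> borel_measurable (borel :: (real \<times> 'a) measure)"
    by (intro borel_measurable_continuous_onI continuous_intros)
  moreover have "\<Omega> \<in> sets borel" using assms(1) by simp
  ultimately have "(\<lambda>z::real \<times> 'a. indicat_real \<Omega> (snd z)) \<in> borel_measurable borel" by measurable
  then show ?thesis using assms(2) unfolding jmeas_def zext_def by (rule borel_measurable_scaleR)
qed

lemma borel_measurable_epow: "(\<lambda>x. epow x r) \<in> borel_measurable borel"
  unfolding epow_def by measurable

lemma epow_mono: "0 \<le> r \<Longrightarrow> x \<le> y \<Longrightarrow> epow x r \<le> epow y r"
  unfolding epow_def by (auto simp: top_unique enn2real_mono less_top intro!: ennreal_leI powr_mono2)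

lemma jmeas_Lnorm_measurable:
  assumes "open \<Omega>" "jmeas f" shows "(\<lambda>t. Lnorm \<Omega> 2 (f t)) \<in> borel_measurable borel"
proof -
  have j: "(\<lambda>(t, x). zext \<Omega> (f t) x) \<in> borel_measurable (lborel \<Otimes>\<^sub>M lborel)"
    using jmeas_zext[OF assms] by (simp add: jmeas_def lborel_prod split_beta')
  have "(\<lambda>(t, x). ennreal ((cmod (zext \<Omega> (f t) x))\<^sup>2)) \<in> borel_measurable (lborel \<Otimes>\<^sub>M lborel)"
    using j unfolding split_beta' by measurable
  from lborel.borel_measurable_nn_integral_fst[OF this]
  have "(\<lambda>t. Lpow \<Omega> 2 (f t)) \<in> borel_measurable borel"
    unfolding Lpow_2_eq nn_integral_completion by simp
  from measurable_compose[OF this borel_measurable_epow] show ?thesis unfolding Lnorm_def .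
qed

lemma l2_integrable_on_zext:
  fixes f :: "real \<Rightarrow> 'a::euclidean_space \<Rightarrow> complex"
  assumes \<Omega>: "open \<Omega>" and f: "jmeas f" and A: "A \<in> sets borel"
    and fin: "(\<integral>\<^sup>+t\<in>A. Lnorm \<Omega> 2 (f t) \<partial>lborel) < \<infinity>"
  shows "l2_integrable_on A (\<lambda>t. zext \<Omega> (f t))"
    and "ennreal (LINT t:A|lborel. l2norm lborel (zext \<Omega> (f t))) = (\<integral>\<^sup>+t\<in>A. Lnorm \<Omega> 2 (f t) \<partial>lborel)"
proof -
  note [measurable] = jmeas_Lnorm_measurable[OF \<Omega> f] A
  have "AE t in lborel. Lnorm \<Omega> 2 (f t) * indicator A t \<noteq> \<infinity>"
    by (rule nn_integral_PInf_AE) (use fin in auto)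
  then have AE: "AE t in lborel. t \<in> A \<longrightarrow> Lnorm \<Omega> 2 (f t) < \<infinity>"
    by eventually_elim (auto simp: less_top)
  then have sq: "AE t in lborel. t \<in> A \<longrightarrow> sq_integrable lborel (zext \<Omega> (f t))
      \<and> Lnorm \<Omega> 2 (f t) = ennreal (l2norm lborel (zext \<Omega> (f t)))"
    by eventually_elim (use Lnorm_2_borel[OF \<Omega> jmeas_section[OF f]] in blast)
  have m: "(\<lambda>t. indicat_real A t *\<^sub>R l2norm lborel (zext \<Omega> (f t))) \<in> borel_measurable lborel"
    using jmeas_l2norm[OF jmeas_zext[OF \<Omega> f]] by measurable
  have nn: "(\<integral>\<^sup>+t. ennreal (indicat_real A t *\<^sub>R l2norm lborel (zext \<Omega> (f t))) \<partial>lborel) = (\<integral>\<^sup>+t\<in>A. Lnorm \<Omega> 2 (f t) \<partial>lborel)"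
    by (rule nn_integral_cong_AE, use sq in eventually_elim) (auto simp: indicator_def)
  have i: "integrable lborel (\<lambda>t. indicat_real A t *\<^sub>R l2norm lborel (zext \<Omega> (f t)))"
    by (rule integrableI_nonneg[OF m]) (use nn fin in auto)
  show "l2_integrable_on A (\<lambda>t. zext \<Omega> (f t))"
    unfolding l2_integrable_on_def
  proof (intro conjI jmeas_zext[OF \<Omega> f])
    show "AE s in lborel. s \<in> A \<longrightarrow> sq_integrable lborel (zext \<Omega> (f s))" using sq by eventually_elim blast
    show "set_integrable lborel A (\<lambda>s. l2norm lborel (zext \<Omega> (f s)))" using i by (simp add: set_integrable_def)
  qed
  show "ennreal (LINT t:A|lborel. l2norm lborel (zext \<Omega> (f t))) = (\<integral>\<^sup>+t\<in>A. Lnorm \<Omega> 2 (f t) \<partial>lborel)"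
    using nn_integral_eq_integral[OF i] nn by (simp add: set_lebesgue_integral_def)
qed

lemma l2_integrable_on_subset:
  assumes "l2_integrable_on B f" "A \<subseteq> B" "A \<in> sets borel" shows "l2_integrable_on A f"
  unfolding l2_integrable_on_def
proof (intro conjI)
  show "jmeas f" using assms(1) by (simp add: l2_integrable_on_def)
  show "AE s in lborel. s \<in> A \<longrightarrow> sq_integrable lborel (f s)"
    using assms(1)[unfolded l2_integrable_on_def, THEN conjunct2, THEN conjunct1] by eventually_elim (use assms(2) in blast)
  show "set_integrable lborel A (\<lambda>s. l2norm lborel (f s))"
    by (rule set_integrable_subset[where A=B]) (use assms in \<open>auto simp: l2_integrable_on_def\<close>)
qed

lemma L1loc_L2_integrable:
  assumes \<Omega>: "open \<Omega>" and g: "L1loc_L2 \<Omega> g" and a: "0 < a"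
  shows "l2_integrable_on {a..b} (\<lambda>t. zext \<Omega> (g t))"
proof (rule l2_integrable_on_subset)
  have "0 < \<bar>b\<bar> + 1" by simp
  then show "l2_integrable_on {0<..<\<bar>b\<bar> + 1} (\<lambda>t. zext \<Omega> (g t))"
    using g unfolding L1loc_L2_def by (intro l2_integrable_on_zext(1)[OF \<Omega>]) auto
qed (use a in auto)

lemma C_L2_l2_continuous:
  assumes \<Omega>: "open \<Omega>" and j: "jmeas v" and C: "C_L2 \<Omega> v"
  shows "l2_continuous_on {0..} (\<lambda>t. zext \<Omega> (v t))"
  unfolding l2_continuous_on_def
proof (intro conjI ballI)
  have sq: "sq_integrable lborel (zext \<Omega> (v t))" if "0 \<le> t" for t
    using C that unfolding C_L2_def memL_def Lnorm_finite_iff[symmetric]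
    by (intro Lnorm_2_borel(1)[OF \<Omega> jmeas_section[OF j]]) blast
  then show "sq_integrable lborel (zext \<Omega> (v t))" if "t \<in> {0..}" for t using that by simp
  fix t :: real assume t: "t \<in> {0..}"
  have eq: "Lnorm \<Omega> 2 (\<lambda>x. v s x - v t x) = ennreal (l2norm lborel (\<lambda>x. zext \<Omega> (v s) x - zext \<Omega> (v t) x))" if "0 \<le> s" for s
  proof -
    have b: "(\<lambda>x. v s x - v t x) \<in> borel_measurable borel"
      by (intro borel_measurable_diff jmeas_section[OF j])
    have "sq_integrable lborel (zext \<Omega> (\<lambda>x. v s x - v t x))"
      unfolding zext_diff using t that by (intro sq_integrable_diff sq) auto
    from Lnorm_2_borel'[OF \<Omega> b this] show ?thesis by (simp add: zext_diff)
  qed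
  have "((\<lambda>s. Lnorm \<Omega> 2 (\<lambda>x. v s x - v t x)) \<longlongrightarrow> 0) (at t within {0..})"
    using C t by (simp add: C_L2_def)
  moreover have "\<forall>\<^sub>F s in at t within {0..}. Lnorm \<Omega> 2 (\<lambda>x. v s x - v t x) = ennreal (l2norm lborel (\<lambda>x. zext \<Omega> (v s) x - zext \<Omega> (v t) x))"
    unfolding eventually_at_filter by (intro always_eventually allI impI eq) simp
  ultimately have "((\<lambda>s. ennreal (l2norm lborel (\<lambda>x. zext \<Omega> (v s) x - zext \<Omega> (v t) x))) \<longlongrightarrow> ennreal 0) (at t within {0..})"
    by (simp add: Lim_transform_eventually)
  then show "((\<lambda>s. l2norm lborel (\<lambda>x. zext \<Omega> (v s) x - zext \<Omega> (v t) x)) \<longlongrightarrow> 0) (at t within {0..})"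
    by (rule tendsto_ennrealD) auto
qed

text \<open>For \<open>m < 1\<close> the nonlinearity is only Hoelder continuous, so an error
  \<open>\<eta>\<close> is allowed. It stems from an additive constant integrated over
  \<open>\<Omega>\<close>, which is where finite measure enters; for \<open>m = 1\<close> the map is
  the identity. Taking \<open>h = 0\<close> gives the growth bound for the nonlinearity along
  bounded solutions.\<close>

lemma nl_l2_modulus:
  fixes \<Omega> :: "'a::euclidean_space set"
  assumes m: "0 < m" "m \<le> 1" and fin: "m < 1 \<Longrightarrow> emeasure lborel \<Omega> < \<infinity>" and \<Omega>: "open \<Omega>" and \<eta>: "0 < \<eta>"
  obtains C where "0 \<le> C" "\<And>f h. sq_integrable lborel f \<Longrightarrow> sq_integrable lborel h \<Longrightarrow>
     (\<And>x. x \<notin> \<Omega> \<Longrightarrow> f x = 0) \<Longrightarrow> (\<And>x. x \<notin> \<Omega> \<Longrightarrow> h x = 0) \<Longrightarrow>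
     sq_integrable lborel (\<lambda>x. nl m (f x)) \<and>
     (l2norm lborel (\<lambda>x. nl m (f x) - nl m (h x)))\<^sup>2 \<le> \<eta> + C * (l2norm lborel (\<lambda>x. f x - h x))\<^sup>2"
proof (cases "m < 1")
  case False
  then have "m = 1" using m by simp
  show thesis
    by (rule that[of 1]) (use \<eta> \<open>m = 1\<close> in \<open>auto simp: nl_one\<close>)
next
  case True
  define \<mu> where "\<mu> = measure lborel \<Omega>"
  \<comment> \<open>The 9 is the square of the Hoelder constant 3; \<open>\<mu> + 1\<close> makes
    the constant integrate to at most \<open>\<eta>\<close> over \<open>\<Omega>\<close>.\<close>
  define \<eta>' where "\<eta>' = \<eta> / (\<mu> + 1) / 9"
  have \<mu>: "0 \<le> \<mu>" by (simp add: \<mu>_def)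
  have \<eta>': "0 < \<eta>'" using \<eta> \<mu> by (simp add: \<eta>'_def)
  obtain C where C: "0 \<le> C" "\<And>x. 0 \<le> x \<Longrightarrow> x powr (2 * m) \<le> \<eta>' + C * x powr 2"
    using powr_le_add_powr[of "2 * m" 2 \<eta>'] m \<eta>' by auto
  have iO: "integrable lborel (indicat_real \<Omega>)" using fin[OF True] \<Omega> by (simp add: integrable_indicator_iff)
  have pw: "(cmod (nl m z - nl m w))\<^sup>2 \<le> 9 * \<eta>' * indicat_real \<Omega> x + 9 * C * (cmod (z - w))\<^sup>2"
    if "x \<notin> \<Omega> \<Longrightarrow> z = 0" "x \<notin> \<Omega> \<Longrightarrow> w = 0" for x z w
  proof (cases "x \<in> \<Omega>")
    case True
    have "(cmod (nl m z - nl m w))\<^sup>2 \<le> (3 * cmod (z - w) powr m)\<^sup>2"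
      by (intro power_mono nl_Holder m) simp
    also have "\<dots> = 9 * cmod (z - w) powr (2 * m)"
      by (simp add: power_mult_distrib power2_eq_square flip: powr_add)
    also have "\<dots> \<le> 9 * (\<eta>' + C * cmod (z - w) powr 2)" using C(2)[of "cmod (z - w)"] by simp
    finally show ?thesis using True by (simp add: algebra_simps)
  next
    case False then show ?thesis using that by simp
  qed
  have key: "sq_integrable lborel (\<lambda>x. nl m (f x) - nl m (h x)) \<and>
     (l2norm lborel (\<lambda>x. nl m (f x) - nl m (h x)))\<^sup>2 \<le> \<eta> + 9 * C * (l2norm lborel (\<lambda>x. f x - h x))\<^sup>2"
    if f: "sq_integrable lborel f" and h: "sq_integrable lborel h" and "\<And>x. x \<notin> \<Omega> \<Longrightarrow> f x = 0" "\<And>x. x \<notin> \<Omega> \<Longrightarrow> h x = 0" for f h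
  proof -
    have mf: "f \<in> borel_measurable borel" "h \<in> borel_measurable borel" using f h by (auto simp: sq_integrable_def)
    have md: "(\<lambda>x. nl m (f x) - nl m (h x)) \<in> borel_measurable lborel"
      using measurable_compose[OF mf(1) borel_measurable_nl] measurable_compose[OF mf(2) borel_measurable_nl] by measurable
    have ib: "integrable lborel (\<lambda>x. 9 * \<eta>' * indicat_real \<Omega> x + 9 * C * (cmod (f x - h x))\<^sup>2)"
      using iO sq_integrable_diff[OF f h] unfolding sq_integrable_def
      by (intro Bochner_Integration.integrable_add integrable_mult_right) auto
    have le: "(cmod (nl m (f x) - nl m (h x)))\<^sup>2 \<le> 9 * \<eta>' * indicat_real \<Omega> x + 9 * C * (cmod (f x - h x))\<^sup>2" for x
      by (rule pw) (use that in auto)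
    have i: "integrable lborel (\<lambda>x. (cmod (nl m (f x) - nl m (h x)))\<^sup>2)"
    proof (rule Bochner_Integration.integrable_bound[OF ib])
      show "(\<lambda>x. (cmod (nl m (f x) - nl m (h x)))\<^sup>2) \<in> borel_measurable lborel" using md by measurable
      show "AE x in lborel. norm ((cmod (nl m (f x) - nl m (h x)))\<^sup>2) \<le> norm (9 * \<eta>' * indicat_real \<Omega> x + 9 * C * (cmod (f x - h x))\<^sup>2)"
      proof (rule AE_I2)
        fix x show "norm ((cmod (nl m (f x) - nl m (h x)))\<^sup>2) \<le> norm (9 * \<eta>' * indicat_real \<Omega> x + 9 * C * (cmod (f x - h x))\<^sup>2)"
          using le[of x] by simp
      qed
    qed
    have "(l2norm lborel (\<lambda>x. nl m (f x) - nl m (h x)))\<^sup>2 \<le> (LINT x|lborel. 9 * \<eta>' * indicat_real \<Omega> x + 9 * C * (cmod (f x - h x))\<^sup>2)"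
      unfolding l2norm_power2 by (rule integral_mono[OF i ib le])
    also have "\<dots> = 9 * \<eta>' * \<mu> + 9 * C * (l2norm lborel (\<lambda>x. f x - h x))\<^sup>2"
      using iO sq_integrable_diff[OF f h] \<Omega> unfolding sq_integrable_def l2norm_power2 \<mu>_def by simp
    also have "9 * \<eta>' * \<mu> \<le> \<eta>"
    proof -
      have "9 * (A / 9) * \<mu> = A * \<mu>" for A by simp
      from this[of "\<eta> / (\<mu> + 1)"] have "9 * \<eta>' * \<mu> = \<eta> * (\<mu> / (\<mu> + 1))" by (simp only: \<eta>'_def) simp
      also have "\<dots> \<le> \<eta> * 1" using \<eta> \<mu> by (intro mult_left_mono) auto
      finally show ?thesis by simp
    qed
    finally show ?thesis using i md by (simp add: sq_integrable_def)
  qed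
  show thesis
  proof (rule that[of "9 * C"])
    fix f h :: "'a \<Rightarrow> complex"
    assume "sq_integrable lborel f" "sq_integrable lborel h" "\<And>x. x \<notin> \<Omega> \<Longrightarrow> f x = 0" "\<And>x. x \<notin> \<Omega> \<Longrightarrow> h x = 0"
    then show "sq_integrable lborel (\<lambda>x. nl m (f x)) \<and>
     (l2norm lborel (\<lambda>x. nl m (f x) - nl m (h x)))\<^sup>2 \<le> \<eta> + 9 * C * (l2norm lborel (\<lambda>x. f x - h x))\<^sup>2"
      \<comment> \<open>Comparison with 0 yields square integrability of the nonlinearity
        itself.\<close>
      using key[of f h] key[of f "\<lambda>_. 0"] by simp
  qed (use C in simp)
qed

text \<open>Two choices in sequence: first \<open>\<eta>\<close> as half of the permitted squared
  error, then closeness of the arguments in terms of the constant \<open>C\<close> that belongs to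
  this \<open>\<eta>\<close>.\<close>

lemma l2_continuous_on_nl:
  assumes m: "0 < m" "m \<le> 1" and fin: "m < 1 \<Longrightarrow> emeasure lborel \<Omega> < \<infinity>" and \<Omega>: "open \<Omega>"
    and w: "l2_continuous_on S w" and out: "\<And>t x. x \<notin> \<Omega> \<Longrightarrow> w t x = 0"
  shows "l2_continuous_on S (\<lambda>t x. nl m (w t x))"
  unfolding l2_continuous_on_def
proof (intro conjI ballI)
  fix t assume t: "t \<in> S"
  obtain C1 where C1: "0 \<le> C1" "\<And>f h. sq_integrable lborel f \<Longrightarrow> sq_integrable lborel h \<Longrightarrow>
     (\<And>x. x \<notin> \<Omega> \<Longrightarrow> f x = 0) \<Longrightarrow> (\<And>x. x \<notin> \<Omega> \<Longrightarrow> h x = 0) \<Longrightarrow>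
     sq_integrable lborel (\<lambda>x. nl m (f x)) \<and>
     (l2norm lborel (\<lambda>x. nl m (f x) - nl m (h x)))\<^sup>2 \<le> 1 + C1 * (l2norm lborel (\<lambda>x. f x - h x))\<^sup>2"
    by (rule nl_l2_modulus[OF m fin \<Omega>, of 1]) auto
  show "sq_integrable lborel (\<lambda>x. nl m (w t x))"
    using C1(2)[of "w t" "w t"] l2_continuous_on_sq[OF w t] out by simp
  show "((\<lambda>s. l2norm lborel (\<lambda>x. nl m (w s x) - nl m (w t x))) \<longlongrightarrow> 0) (at t within S)"
  proof (rule tendstoI)
    fix e :: real assume e: "0 < e"
    then have e2: "0 < e\<^sup>2 / 2" by simp
    obtain C where C: "0 \<le> C" "\<And>f h. sq_integrable lborel f \<Longrightarrow> sq_integrable lborel h \<Longrightarrow>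
     (\<And>x. x \<notin> \<Omega> \<Longrightarrow> f x = 0) \<Longrightarrow> (\<And>x. x \<notin> \<Omega> \<Longrightarrow> h x = 0) \<Longrightarrow>
     sq_integrable lborel (\<lambda>x. nl m (f x)) \<and>
     (l2norm lborel (\<lambda>x. nl m (f x) - nl m (h x)))\<^sup>2 \<le> e\<^sup>2 / 2 + C * (l2norm lborel (\<lambda>x. f x - h x))\<^sup>2"
      by (rule nl_l2_modulus[OF m fin \<Omega> e2]) auto
    have "((\<lambda>s. C * (l2norm lborel (\<lambda>x. w s x - w t x))\<^sup>2) \<longlongrightarrow> C * 0\<^sup>2) (at t within S)"
      by (intro tendsto_intros l2_continuous_on_tendsto[OF w t])
    then have "\<forall>\<^sub>F s in at t within S. C * (l2norm lborel (\<lambda>x. w s x - w t x))\<^sup>2 < e\<^sup>2 / 2"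
      using e2 by (intro order_tendstoD) auto
    moreover have "\<forall>\<^sub>F s in at t within S. s \<in> S"
      unfolding eventually_at_filter by (rule always_eventually) simp
    ultimately show "\<forall>\<^sub>F s in at t within S. dist (l2norm lborel (\<lambda>x. nl m (w s x) - nl m (w t x))) 0 < e"
    proof eventually_elim
      case (elim s)
      have "(l2norm lborel (\<lambda>x. nl m (w s x) - nl m (w t x)))\<^sup>2 < e\<^sup>2"
        using C(2)[of "w s" "w t"] l2_continuous_on_sq[OF w] elim t out by fastforce
      then have "l2norm lborel (\<lambda>x. nl m (w s x) - nl m (w t x)) < e"
        using e by (intro power_less_imp_less_base[of _ 2 e]) auto
      then show ?case by simp
    qed
  qed
qed

text \<open>On bounded time intervals this turns the \<open>L^(m+1)\<close> bound in time for the
  gradient into the \<open>L^1\<close> bound that \<open>l2_integrable_on\<close> asks for.\<close>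

lemma le_one_plus_epow: "1 \<le> r \<Longrightarrow> y \<le> 1 + epow y r"
proof (cases y)
  case (real x)
  assume r: "1 \<le> r"
  have "x \<le> 1 + x powr r"
  proof (cases "x \<le> 1")
    case False
    then have "x powr 1 \<le> x powr r" using r by (intro powr_mono) auto
    then show ?thesis using False by simp
  qed (simp add: add_increasing2)
  then have "ennreal x \<le> ennreal (1 + x powr r)" by (rule ennreal_leI)
  then show ?thesis using real by (simp add: epow_def ennreal_plus)
qed (simp add: epow_def)

lemma zext_test_fun:
  assumes "test_fun \<Omega> \<phi>" shows "zext \<Omega> \<phi> = \<phi>" "zext \<Omega> (dderiv i \<phi>) = dderiv i \<phi>"
proof -
  have "zext \<Omega> (diter vs \<phi>) = diter vs \<phi>" for vs
    using test_fun_diter_vanishes_outside[OF assms, of _ vs] by (auto simp: zext_def indicator_def fun_eq_iff)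
  from this[of "[]"] this[of "[i]"] show "zext \<Omega> \<phi> = \<phi>" "zext \<Omega> (dderiv i \<phi>) = dderiv i \<phi>" by simp_all
qed

lemma Lnorm_diff_tendsto_imp_l2norm:
  fixes \<Omega> :: "'a::euclidean_space set"
  assumes \<Omega>: "open \<Omega>" and f: "\<And>k. f k \<in> borel_measurable borel" "\<And>k. sq_integrable lborel (zext \<Omega> (f k))"
    and w: "w \<in> borel_measurable borel" "sq_integrable lborel (zext \<Omega> w)"
    and lim: "(\<lambda>k. Lnorm \<Omega> 2 (\<lambda>x. f k x - w x)) \<longlonglongrightarrow> 0"
  shows "(\<lambda>k. l2norm lborel (\<lambda>x. zext \<Omega> (f k) x - zext \<Omega> w x)) \<longlonglongrightarrow> 0"
proof -
  have "Lnorm \<Omega> 2 (\<lambda>x. f k x - w x) = ennreal (l2norm lborel (\<lambda>x. zext \<Omega> (f k) x - zext \<Omega> w x))" for k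
  proof -
    have "(\<lambda>x. f k x - w x) \<in> borel_measurable borel" using f(1) w(1) by (rule borel_measurable_diff)
    moreover have "sq_integrable lborel (zext \<Omega> (\<lambda>x. f k x - w x))"
      unfolding zext_diff by (rule sq_integrable_diff[OF f(2) w(2)])
    ultimately show ?thesis using Lnorm_2_borel'[OF \<Omega>, of "\<lambda>x. f k x - w x"] by (simp add: zext_diff)
  qed
  then have "(\<lambda>k. ennreal (l2norm lborel (\<lambda>x. zext \<Omega> (f k) x - zext \<Omega> w x))) \<longlonglongrightarrow> ennreal 0"
    using lim by simp
  then show ?thesis by (rule tendsto_ennrealD) auto
qed

lemma H10_imp_H10_grad:
  fixes \<Omega> :: "'a::euclidean_space set"
  assumes \<Omega>: "open \<Omega>" and H: "H10 \<Omega> w G" and w: "w \<in> borel_measurable borel"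
    and G: "\<And>i. i \<in> Basis \<Longrightarrow> (\<lambda>x. G x i) \<in> borel_measurable borel"
  shows "H10_grad \<Omega> (zext \<Omega> w) (\<lambda>x i. zext \<Omega> (\<lambda>x. G x i) x)"
proof -
  from H obtain \<phi> where \<phi>: "\<And>k. test_fun \<Omega> (\<phi> k)" "(\<lambda>k. Lnorm \<Omega> 2 (\<lambda>x. \<phi> k x - w x)) \<longlonglongrightarrow> 0"
    "\<And>i. i \<in> Basis \<Longrightarrow> (\<lambda>k. Lnorm \<Omega> 2 (\<lambda>x. dderiv i (\<phi> k) x - G x i)) \<longlonglongrightarrow> 0"
    and mem: "memL \<Omega> 2 w" "\<And>i. i \<in> Basis \<Longrightarrow> memL \<Omega> 2 (\<lambda>x. G x i)"
    unfolding H10_def by blast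
  have sw: "sq_integrable lborel (zext \<Omega> w)"
    using mem(1) by (intro Lnorm_2_borel(1)[OF \<Omega> w]) (simp only: memL_def Lnorm_finite_iff)
  have sG: "sq_integrable lborel (zext \<Omega> (\<lambda>x. G x i))" if "i \<in> Basis" for i
    using mem(2)[OF that] by (intro Lnorm_2_borel(1)[OF \<Omega> G[OF that]]) (simp only: memL_def Lnorm_finite_iff)
  have m\<phi>: "\<phi> k \<in> borel_measurable borel" "dderiv i (\<phi> k) \<in> borel_measurable borel" for k i
    using test_fun_diter_measurable[OF \<phi>(1), of "[]"] test_fun_diter_measurable[OF \<phi>(1), of "[i]"] by simp_all
  show ?thesis
    unfolding H10_grad_def
  proof (intro conjI ballI exI[of _ \<phi>] allI \<phi>(1) sw sG)
    show "(\<lambda>k. l2norm lborel (\<lambda>x. \<phi> k x - zext \<Omega> w x)) \<longlonglongrightarrow> 0"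
      using Lnorm_diff_tendsto_imp_l2norm[of \<Omega> \<phi> w, OF \<Omega> m\<phi>(1) _ w sw \<phi>(2)] test_fun_sq_integrable[OF \<phi>(1)]
      by (simp add: zext_test_fun(1)[OF \<phi>(1)])
    fix i :: 'a assume i: "i \<in> Basis"
    show "(\<lambda>k. l2norm lborel (\<lambda>x. dderiv i (\<phi> k) x - zext \<Omega> (\<lambda>x. G x i) x)) \<longlonglongrightarrow> 0"
      using Lnorm_diff_tendsto_imp_l2norm[of \<Omega> "\<lambda>k. dderiv i (\<phi> k)" "\<lambda>x. G x i", OF \<Omega> m\<phi>(2) _ G[OF i] sG[OF i] \<phi>(3)[OF i]]
        test_fun_dderiv_sq_integrable[OF \<phi>(1)]
      by (simp add: zext_test_fun(2)[OF \<phi>(1)])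
  qed
qed

text \<open>Passes from the space-time integrals of the distributional formulation to time integrals
  of inner products. The weight \<open>c\<close> is bounded and vanishes outside
  \<open>{a..b}\<close>, so integrability of \<open>f\<close> on that interval is enough for
  Fubini.\<close>

lemma weighted_joint_integral:
  fixes f :: "real \<Rightarrow> 'a::euclidean_space \<Rightarrow> complex" and c :: "real \<Rightarrow> complex"
  assumes f: "l2_integrable_on {a..b} f" and c: "continuous_on UNIV c" "\<And>s. s \<notin> {a..b} \<Longrightarrow> c s = 0"
    and \<psi>: "sq_integrable lborel \<psi>"
  shows "integrable (lborel \<Otimes>\<^sub>M lborel) (\<lambda>(s, x). c s * f s x * cnj (\<psi> x))"
    and "(LINT z|(lborel \<Otimes>\<^sub>M lborel). (case z of (s, x) \<Rightarrow> c s * f s x * cnj (\<psi> x))) = (LINT s|lborel. c s * l2inner lborel (f s) \<psi>)"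
proof -
  define v where "v s x = c s * f s x" for s x
  have jf: "(\<lambda>z. f (fst z) (snd z)) \<in> borel_measurable borel"
    and sq: "AE s in lborel. s \<in> {a..b} \<longrightarrow> sq_integrable lborel (f s)"
    and int: "set_integrable lborel {a..b} (\<lambda>s. l2norm lborel (f s))"
    using f by (auto simp: l2_integrable_on_def jmeas_def)
  have mc: "c \<in> borel_measurable borel" by (rule borel_measurable_continuous_onI[OF c(1)])
  have "(\<lambda>z::real \<times> 'a. c (fst z)) \<in> borel_measurable borel"
    by (intro borel_measurable_continuous_onI continuous_on_compose2[OF c(1)] continuous_intros) auto
  then have "(\<lambda>z. v (fst z) (snd z)) \<in> borel_measurable borel"
    unfolding v_def using jf by (rule borel_measurable_times)
  then have jv: "(\<lambda>(s, x). v s x) \<in> borel_measurable (lborel \<Otimes>\<^sub>M lborel)" by (simp add: lborel_prod split_beta')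
  have sqv: "AE s in lborel. sq_integrable lborel (v s)"
    using sq
  proof eventually_elim
    case (elim s)
    show ?case
    proof (cases "s \<in> {a..b}")
      case True then show ?thesis unfolding v_def using elim by (intro sq_integrable_scale) blast
    next
      case False then show ?thesis using c(2) by (simp add: v_def[abs_def])
    qed
  qed
  have nv: "l2norm lborel (v s) = cmod (c s) * (indicat_real {a..b} s *\<^sub>R l2norm lborel (f s))" for s
    unfolding v_def l2norm_scale using c(2)[of s] by (cases "s \<in> {a..b}") auto
  obtain B where B: "\<And>s. s \<in> {a..b} \<Longrightarrow> cmod (c s) \<le> B"
    using compact_imp_bounded[OF compact_continuous_image[OF continuous_on_subset[OF c(1)] compact_Icc]]
    unfolding bounded_iff by blast
  have intv: "integrable lborel (\<lambda>s. l2norm lborel (v s))"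
  proof (rule Bochner_Integration.integrable_bound)
    show "integrable lborel (\<lambda>s. B * (indicat_real {a..b} s *\<^sub>R l2norm lborel (f s)))"
      using int unfolding set_integrable_def by (rule integrable_mult_right)
    show "(\<lambda>s. l2norm lborel (v s)) \<in> borel_measurable lborel"
      unfolding nv using mc int[unfolded set_integrable_def, THEN borel_measurable_integrable] by measurable
    show "AE s in lborel. norm (l2norm lborel (v s)) \<le> norm (B * (indicat_real {a..b} s *\<^sub>R l2norm lborel (f s)))"
    proof (rule AE_I2)
      fix s
      show "norm (l2norm lborel (v s)) \<le> norm (B * (indicat_real {a..b} s *\<^sub>R l2norm lborel (f s)))"
      proof (cases "s \<in> {a..b}")
        case True
        then have "cmod (c s) * l2norm lborel (f s) \<le> B * l2norm lborel (f s)" by (intro mult_right_mono B) auto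
        moreover have "0 \<le> B" using order_trans[OF norm_ge_zero B[OF True]] .
        ultimately show ?thesis using True by (simp add: nv abs_mult)
      qed (simp add: nv)
    qed
  qed
  note i = lborel_pair.l2_Bochner_joint_integrable[OF jv sqv intv \<psi>]
  then show "integrable (lborel \<Otimes>\<^sub>M lborel) (\<lambda>(s, x). c s * f s x * cnj (\<psi> x))" by (simp add: v_def)
  have "(LINT z|(lborel \<Otimes>\<^sub>M lborel). (case z of (s, x) \<Rightarrow> v s x * cnj (\<psi> x))) = (LINT s|lborel. (LINT x|lborel. v s x * cnj (\<psi> x)))"
    using lborel_pair.integral_fst'[OF i] by simp
  also have "\<dots> = (LINT s|lborel. l2inner lborel (v s) \<psi>)" by (simp add: l2inner_def)
  finally show "(LINT z|(lborel \<Otimes>\<^sub>M lborel). (case z of (s, x) \<Rightarrow> c s * f s x * cnj (\<psi> x))) = (LINT s|lborel. c s * l2inner lborel (f s) \<psi>)"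
    by (simp add: v_def[abs_def] l2inner_scale_left)
qed

text \<open>Testing with products of a function of time and a fixed function of space turns the
  distributional equation into a weak ordinary differential equation for the inner product with
  \<open>\<phi>\<close>. Since \<open>v\<close> is continuous into \<open>L^2\<close>, the du
  Bois-Reymond argument then gives the integrated equation between any two positive times.\<close>

lemma H2_solution_imp_linear_solution:
  fixes \<Omega> :: "'a::euclidean_space set"
  assumes \<Omega>: "open \<Omega>" and m: "0 < m" "m \<le> 1" and fin: "m < 1 \<Longrightarrow> emeasure lborel \<Omega> < \<infinity>"
    and H2: "H2_solution m a \<Omega> g v" and C: "C_L2 \<Omega> v" and g: "L1loc_L2 \<Omega> g"
  shows "\<exists>G. linear_solution \<Omega> (\<lambda>t. zext \<Omega> (v t)) G (\<lambda>t x. a * nl m (zext \<Omega> (v t) x) - zext \<Omega> (g t) x)"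
proof -
  define w where "w t = zext \<Omega> (v t)" for t
  define N where "N t x = a * nl m (w t x)" for t x
  define F where "F t x = N t x - zext \<Omega> (g t) x" for t x
  have jv: "jmeas v" using H2 by (simp add: H2_solution_def)
  have jg: "jmeas g" using g by (simp add: L1loc_L2_def)
  have jw: "jmeas w" unfolding w_def by (rule jmeas_zext[OF \<Omega> jv])
  have cw: "l2_continuous_on {0<..} w"
    unfolding w_def by (rule l2_continuous_on_subset[OF C_L2_l2_continuous[OF \<Omega> jv C]]) auto
  have cN: "l2_continuous_on {0<..} N"
    unfolding N_def by (rule l2_continuous_on_scale[OF l2_continuous_on_nl[OF m fin \<Omega> cw]]) (auto simp: w_def zext_outside)
  have jN: "jmeas N"
    unfolding N_def jmeas_def
    using measurable_compose[OF jw[unfolded jmeas_def] borel_measurable_nl] by (intro borel_measurable_times) auto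
  have iF: "l2_integrable_on {\<alpha>..\<beta>} F" if "0 < \<alpha>" for \<alpha> \<beta>
    unfolding F_def
    by (rule l2_integrable_on_diff[OF l2_integrable_onI_continuous[OF cN jN] L1loc_L2_integrable[OF \<Omega> g that]]) (use that in auto)
  have iw: "l2_integrable_on {\<alpha>..\<beta>} w" if "0 < \<alpha>" for \<alpha> \<beta>
    by (rule l2_integrable_onI_continuous[OF cw jw]) (use that in auto)
  from H2 obtain G where jG: "\<And>i. i \<in> Basis \<Longrightarrow> jmeas (\<lambda>t x. G t x i)"
    and HG: "AE t in lborel. t > 0 \<longrightarrow> H10 \<Omega> (v t) (G t) \<and> memL \<Omega> (m + 1) (v t)"
    and NG: "\<And>T. T > 0 \<Longrightarrow> (\<integral>\<^sup>+ t\<in>{0<..<T}. epow (H1norm \<Omega> (v t) (G t) + Lnorm \<Omega> (m + 1) (v t)) (m + 1) \<partial>lborel) < \<infinity>"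
    unfolding H2_solution_def by blast
  define D where "D t x i = zext \<Omega> (\<lambda>x. G t x i) x" for t x i
  have HD: "AE t in lborel. 0 < t \<longrightarrow> H10_grad \<Omega> (w t) (D t)"
    using HG
  proof eventually_elim
    case (elim t)
    show ?case
    proof
      assume "0 < t"
      then have "H10 \<Omega> (v t) (G t)" using elim by blast
      from H10_imp_H10_grad[OF \<Omega> this jmeas_section[OF jv] jmeas_section[OF jG]]
      show "H10_grad \<Omega> (w t) (D t)" by (simp add: w_def D_def[abs_def])
    qed
  qed
  have iD: "l2_integrable_on {\<alpha>..\<beta>} (\<lambda>t x. D t x i)" if i: "i \<in> Basis" and \<alpha>: "0 < \<alpha>" for i \<alpha> \<beta>
  proof -
    define T where "T = \<bar>\<beta>\<bar> + 1"
    have T: "0 < T" by (simp add: T_def)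
    note [measurable] = jmeas_Lnorm_measurable[OF \<Omega> jG[OF i]] borel_measurable_epow
    let ?y = "\<lambda>t. Lnorm \<Omega> 2 (\<lambda>x. G t x i)"
    \<comment> \<open>One component of the gradient is dominated by the full norm whose integral
      \<open>H2_solution\<close> bounds.\<close>
    have pw: "epow (?y t) (m + 1) \<le> epow (H1norm \<Omega> (v t) (G t) + Lnorm \<Omega> (m + 1) (v t)) (m + 1)" for t
    proof -
      have "Lpow \<Omega> 2 (\<lambda>x. G t x i) \<le> (\<Sum>i\<in>Basis. Lpow \<Omega> 2 (\<lambda>x. G t x i))"
        by (rule member_le_sum[OF i]) auto
      also have "\<dots> \<le> Lpow \<Omega> 2 (v t) + (\<Sum>i\<in>Basis. Lpow \<Omega> 2 (\<lambda>x. G t x i))" by simp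
      finally have "?y t \<le> H1norm \<Omega> (v t) (G t)"
        unfolding Lnorm_def H1norm_def by (intro epow_mono) auto
      also have "\<dots> \<le> H1norm \<Omega> (v t) (G t) + Lnorm \<Omega> (m + 1) (v t)" by simp
      finally show ?thesis using m by (intro epow_mono) auto
    qed
    have "(\<integral>\<^sup>+t\<in>{0<..<T}. ?y t \<partial>lborel) \<le> (\<integral>\<^sup>+t. indicator {0<..<T} t + epow (?y t) (m + 1) * indicator {0<..<T} t \<partial>lborel)"
      by (intro nn_integral_mono) (use le_one_plus_epow[of "m + 1"] m in \<open>auto simp: indicator_def\<close>)
    also have "\<dots> = (\<integral>\<^sup>+t. indicator {0<..<T} t \<partial>lborel) + (\<integral>\<^sup>+t\<in>{0<..<T}. epow (?y t) (m + 1) \<partial>lborel)"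
      by (rule nn_integral_add) measurable
    also have "\<dots> \<le> (\<integral>\<^sup>+t. indicator {0<..<T} t \<partial>lborel)
        + (\<integral>\<^sup>+t\<in>{0<..<T}. epow (H1norm \<Omega> (v t) (G t) + Lnorm \<Omega> (m + 1) (v t)) (m + 1) \<partial>lborel)"
      by (intro add_left_mono nn_integral_mono mult_right_mono pw) auto
    also have "\<dots> < \<infinity>" using NG[OF T] T by simp
    finally have "l2_integrable_on {0<..<T} (\<lambda>t. zext \<Omega> (\<lambda>x. G t x i))"
      by (intro l2_integrable_on_zext(1)[OF \<Omega> jG[OF i]]) auto
    then show ?thesis unfolding D_def
      by (rule l2_integrable_on_subset) (use \<alpha> in \<open>auto simp: T_def\<close>)
  qed
  have "linear_solution \<Omega> w D F"
    unfolding linear_solution_def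
  proof (intro conjI jw cw ballI allI impI iD iF HD)
    fix \<phi> and s t :: real assume \<phi>: "test_fun \<Omega> \<phi>" and s: "0 < s" and st: "s \<le> t"
    note p = test_fun_sq_integrable[OF \<phi>] and lp = test_fun_lap_sq_integrable[OF \<phi>]
    define V where "V \<tau> = l2inner lborel (w \<tau>) \<phi>" for \<tau>
    define W where "W \<tau> = l2inner lborel (w \<tau>) (lap \<phi>) + l2inner lborel (F \<tau>) \<phi>" for \<tau>
    have iW: "set_integrable lborel {s..t + 1} W"
      unfolding W_def by (rule set_integral_add(1)[OF l2_integrable_on_inner[OF iw[OF s] lp] l2_integrable_on_inner[OF iF[OF s] p]])
    have "l2_continuous_on {0<..} (\<lambda>_. \<phi>)" by (simp add: l2_continuous_on_def p)
    from l2_continuous_on_continuous_inner[OF cw this]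
    have cV: "continuous_on {s..t + 1} V" unfolding V_def by (rule continuous_on_subset) (use s in auto)
    \<comment> \<open>The equation says that \<open>V\<close> has weak derivative
      \<open>\<i> * W\<close>; the derivative is moved to \<open>d\<close>, hence the opposite sign
      on both sides.\<close>
    have "V s - V t = (LINT \<tau>:{s..t}|lborel. - \<i> * W \<tau>)"
    proof (rule weak_derivative_imp_difference[OF st cV])
      show "set_integrable lborel {s..t + 1} (\<lambda>\<tau>. - \<i> * W \<tau>)" by (rule set_integrable_mult_right) (rule iW)
      fix d :: "nat \<Rightarrow> real \<Rightarrow> real"
      assume d: "\<And>k t. (d k has_real_derivative d (Suc k) t) (at t)" and d0: "\<And>\<tau>. \<tau> \<notin> {s..t + 1} \<Longrightarrow> d 0 \<tau> = 0"
      have d1: "d 1 \<tau> = 0" if "\<tau> \<notin> {s..t + 1}" for \<tau>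
      proof -
        have "((\<lambda>_. 0) has_real_derivative 0) (at \<tau>)" by simp
        then have "(d 0 has_real_derivative 0) (at \<tau>)"
          by (rule has_field_derivative_transform_within_open[where S="- {s..t + 1}"]) (use that d0 in auto)
        then show ?thesis using DERIV_unique[OF d[of 0 \<tau>]] by simp
      qed
      have cd: "continuous_on UNIV (d k)" for k by (intro continuous_at_imp_continuous_on ballI DERIV_isCont[OF d])
      \<comment> \<open>The space factor is conjugated because \<open>l2inner\<close> conjugates its
        second argument.\<close>
      define \<Phi> where "\<Phi> z = complex_of_real (d 0 (fst z)) * cnj (\<phi> (snd z))" for z :: "real \<times> 'a"
      have c\<phi>: "test_fun \<Omega> (\<lambda>x. cnj (\<phi> x))" by (rule test_fun_cnj[OF \<phi>])
      have sm: "smooth_fun (\<lambda>x. cnj (\<phi> x))" using c\<phi> by (simp add: test_fun_def)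
      have t\<Phi>: "test_fun ({0<..} \<times> \<Omega>) \<Phi>"
        unfolding \<Phi>_def[abs_def] by (rule test_fun_tensor[where d=d, OF d c\<phi> d0 s])
      have dt: "dt \<Phi> z = of_real (d 1 (fst z)) * cnj (\<phi> (snd z))" for z
        unfolding \<Phi>_def[abs_def] by (rule dt_tensor[where d=d, OF d sm])
      have lx: "lapx \<Phi> z = of_real (d 0 (fst z)) * cnj (lap \<phi> (snd z))" for z
        unfolding \<Phi>_def[abs_def] using lapx_tensor[where d=d, OF d sm, of z] by (simp add: test_fun_dderiv_cnj(2)[OF \<phi>])
      define q where "q z = - \<i> * v (fst z) (snd z) * dt \<Phi> z + v (fst z) (snd z) * lapx \<Phi> z
            + a * nl m (v (fst z) (snd z)) * \<Phi> z - g (fst z) (snd z) * \<Phi> z" for z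
      have eq0: "(LINT z:{0<..} \<times> \<Omega>|lebesgue. q z) = 0"
        using H2 t\<Phi> unfolding H2_solution_def q_def by blast
      \<comment> \<open>The three tensor parts: time derivative, Laplacian, and nonlinearity with
        forcing. Written with the zero extensions they live on all of space-time, which
        \<open>qq\<close> justifies pointwise.\<close>
      define q1 where "q1 z = (case z of (\<tau>, x) \<Rightarrow> (- \<i> * of_real (d 1 \<tau>)) * w \<tau> x * cnj (\<phi> x))" for z
      define q2 where "q2 z = (case z of (\<tau>, x) \<Rightarrow> of_real (d 0 \<tau>) * w \<tau> x * cnj (lap \<phi> x))" for z
      define q3 where "q3 z = (case z of (\<tau>, x) \<Rightarrow> of_real (d 0 \<tau>) * F \<tau> x * cnj (\<phi> x))" for z
      have qq: "indicator ({0<..} \<times> \<Omega>) z *\<^sub>R q z = q1 z + q2 z + q3 z" for z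
      proof (cases z)
        case (Pair \<tau> x)
        show ?thesis
        proof (cases "x \<in> \<Omega> \<and> \<tau> \<in> {s..t + 1}")
          case True
          then have e: "w \<tau> x = v \<tau> x" "F \<tau> x = a * nl m (v \<tau> x) - g \<tau> x" "0 < \<tau>"
            using s by (auto simp: w_def F_def N_def zext_def)
          show ?thesis using True e(3)
            by (simp add: Pair q_def q1_def q2_def q3_def dt lx \<Phi>_def e(1,2)) (simp add: algebra_simps)
        next
          case False
          then consider "x \<notin> \<Omega>" | "\<tau> \<notin> {s..t + 1}" by blast
          then show ?thesis
          proof cases
            case 1
            then have "w \<tau> x = 0" "F \<tau> x = 0" by (auto simp: w_def F_def N_def zext_def)
            then show ?thesis using 1 by (simp add: Pair q1_def q2_def q3_def)
          next
            case 2
            then show ?thesis using d0[OF 2] d1[OF 2]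
              by (simp add: Pair q_def q1_def q2_def q3_def dt lx \<Phi>_def del: One_nat_def)
          qed
        qed
      qed
      have c1: "continuous_on UNIV (\<lambda>\<tau>. - \<i> * complex_of_real (d 1 \<tau>))"
        by (intro continuous_on_mult continuous_on_const continuous_on_of_real cd)
      have c0: "continuous_on UNIV (\<lambda>\<tau>. complex_of_real (d 0 \<tau>))" by (intro continuous_on_of_real cd)
      have z1: "\<tau> \<notin> {s..t + 1} \<Longrightarrow> - \<i> * complex_of_real (d 1 \<tau>) = 0" for \<tau> by (drule d1) (simp del: One_nat_def)
      have z0: "\<tau> \<notin> {s..t + 1} \<Longrightarrow> complex_of_real (d 0 \<tau>) = 0" for \<tau> by (drule d0) simp
      note j1 = weighted_joint_integral[OF iw[OF s] c1 z1 p, folded q1_def]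
      note j2 = weighted_joint_integral[OF iw[OF s] c0 z0 lp, folded q2_def]
      note j3 = weighted_joint_integral[OF iF[OF s] c0 z0 p, folded q3_def]
      have i1: "integrable (lborel \<Otimes>\<^sub>M lborel) q1" and i2: "integrable (lborel \<Otimes>\<^sub>M lborel) q2" and i3: "integrable (lborel \<Otimes>\<^sub>M lborel) q3"
        using j1(1) j2(1) j3(1) unfolding q1_def[abs_def] q2_def[abs_def] q3_def[abs_def] by simp_all
      have i12: "integrable (lborel \<Otimes>\<^sub>M lborel) (\<lambda>z. q1 z + q2 z)" using i1 i2 by (rule Bochner_Integration.integrable_add)
      have mq: "(\<lambda>z. q1 z + q2 z + q3 z) \<in> borel_measurable lborel"
        using borel_measurable_integrable[OF Bochner_Integration.integrable_add[OF i12 i3]] by (simp add: lborel_prod)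
      have "0 = (LINT z|lebesgue. q1 z + q2 z + q3 z)"
        using eq0 unfolding set_lebesgue_integral_def qq by simp
      also have "\<dots> = (LINT z|(lborel \<Otimes>\<^sub>M lborel). q1 z + q2 z + q3 z)"
        using integral_completion[OF mq] by (simp add: lborel_prod)
      also have "\<dots> = (LINT z|(lborel \<Otimes>\<^sub>M lborel). q1 z) + (LINT z|(lborel \<Otimes>\<^sub>M lborel). q2 z) + (LINT z|(lborel \<Otimes>\<^sub>M lborel). q3 z)"
        by (simp only: Bochner_Integration.integral_add[OF i12 i3] Bochner_Integration.integral_add[OF i1 i2])
      also have "(LINT z|(lborel \<Otimes>\<^sub>M lborel). q1 z) = (LINT \<tau>|lborel. - \<i> * of_real (d 1 \<tau>) * V \<tau>)"
        using j1(2) by (simp add: q1_def V_def)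
      also have "\<dots> = - \<i> * (LINT \<tau>|lborel. of_real (d 1 \<tau>) * V \<tau>)"
        unfolding mult.assoc by (rule integral_mult_right_zero)
      also have "(LINT z|(lborel \<Otimes>\<^sub>M lborel). q2 z) = (LINT \<tau>|lborel. of_real (d 0 \<tau>) * l2inner lborel (w \<tau>) (lap \<phi>))"
        using j2(2) by (simp add: q2_def)
      also have "(LINT z|(lborel \<Otimes>\<^sub>M lborel). q3 z) = (LINT \<tau>|lborel. of_real (d 0 \<tau>) * l2inner lborel (F \<tau>) \<phi>)"
        using j3(2) by (simp add: q3_def)
      finally have "\<i> * (LINT \<tau>|lborel. of_real (d 1 \<tau>) * V \<tau>)
        = (LINT \<tau>|lborel. of_real (d 0 \<tau>) * l2inner lborel (w \<tau>) (lap \<phi>)) + (LINT \<tau>|lborel. of_real (d 0 \<tau>) * l2inner lborel (F \<tau>) \<phi>)"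
        by (simp add: algebra_simps eq_neg_iff_add_eq_0)
      also have "\<dots> = (LINT \<tau>|lborel. of_real (d 0 \<tau>) * W \<tau>)"
      proof -
        have k: "integrable lborel (\<lambda>\<tau>. of_real (d 0 \<tau>) * u \<tau>)" if u: "set_integrable lborel {s..t + 1} u" for u :: "real \<Rightarrow> complex"
        proof -
          obtain B where B: "\<And>\<tau>. \<tau> \<in> {s..t + 1} \<Longrightarrow> norm (d 0 \<tau>) \<le> B"
            using compact_imp_bounded[OF compact_continuous_image[OF continuous_on_subset[OF cd] compact_Icc]]
            unfolding bounded_iff by blast
          have mu: "(\<lambda>\<tau>. indicator {s..t + 1} \<tau> *\<^sub>R u \<tau>) \<in> borel_measurable lborel"
            using u unfolding set_integrable_def by (rule borel_measurable_integrable)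
          have md: "d 0 \<in> borel_measurable lborel" using borel_measurable_continuous_onI[OF cd[of 0]] by simp
          have e: "of_real (d 0 \<tau>) * u \<tau> = of_real (d 0 \<tau>) * (indicator {s..t + 1} \<tau> *\<^sub>R u \<tau>)" for \<tau>
            using z0[of \<tau>] by (cases "\<tau> \<in> {s..t + 1}") auto
          have n: "norm (of_real (d 0 \<tau>) * u \<tau>) \<le> norm (B *\<^sub>R (indicator {s..t + 1} \<tau> *\<^sub>R u \<tau>))" for \<tau>
          proof (cases "\<tau> \<in> {s..t + 1}")
            case True
            have "norm (d 0 \<tau>) * norm (u \<tau>) \<le> B * norm (u \<tau>)" by (rule mult_right_mono[OF B[OF True]]) simp
            moreover have "0 \<le> B" using order_trans[OF norm_ge_zero B[OF True]] .
            ultimately show ?thesis using True by (simp add: norm_mult)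
          next
            case False then show ?thesis using z0[OF False] by simp
          qed
          show ?thesis
          proof (rule Bochner_Integration.integrable_bound)
            show "integrable lborel (\<lambda>\<tau>. B *\<^sub>R (indicator {s..t + 1} \<tau> *\<^sub>R u \<tau>))"
              using u unfolding set_integrable_def by (rule integrable_scaleR_right)
            show "(\<lambda>\<tau>. of_real (d 0 \<tau>) * u \<tau>) \<in> borel_measurable lborel" unfolding e using md mu by measurable
          qed (rule AE_I2, rule n)
        qed
        show ?thesis
          using Bochner_Integration.integral_add[OF k[OF l2_integrable_on_inner[OF iw[OF s] lp]] k[OF l2_integrable_on_inner[OF iF[OF s] p]]]
          by (simp add: W_def distrib_left)
      qed
      finally have I: "\<i> * (LINT \<tau>|lborel. of_real (d 1 \<tau>) * V \<tau>) = (LINT \<tau>|lborel. of_real (d 0 \<tau>) * W \<tau>)" .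
      have alg: "X = - \<i> * (\<i> * X)" for X :: complex by (simp add: mult.assoc[symmetric])
      have "(LINT \<tau>|lborel. of_real (d 1 \<tau>) * V \<tau>) = - \<i> * (LINT \<tau>|lborel. of_real (d 0 \<tau>) * W \<tau>)"
        unfolding I[symmetric] by (rule alg)
      also have "\<dots> = (LINT \<tau>|lborel. - \<i> * (of_real (d 0 \<tau>) * W \<tau>))" by (rule integral_mult_right_zero[symmetric])
      also have "\<dots> = (LINT \<tau>|lborel. of_real (d 0 \<tau>) * (- \<i> * W \<tau>))" by (simp add: mult.left_commute)
      finally show "(LINT \<tau>|lborel. of_real (d 1 \<tau>) * V \<tau>) = (LINT \<tau>|lborel. of_real (d 0 \<tau>) * (- \<i> * W \<tau>))" .
    qed
    then have V: "V t - V s = \<i> * (LINT \<tau>:{s..t}|lborel. W \<tau>)"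
      unfolding set_integral_mult_right by (simp add: algebra_simps)
    have tp: "0 < t" using s st by simp
    have "l2inner lborel (\<lambda>x. w t x - w s x) \<phi> = V t - V s"
      unfolding V_def by (rule l2inner_diff_left[OF l2_continuous_on_sq[OF cw] l2_continuous_on_sq[OF cw] p]) (use s tp in auto)
    then show "\<i> * l2inner lborel (\<lambda>x. w t x - w s x) \<phi>
        + (LINT \<tau>:{s..t}|lborel. l2inner lborel (w \<tau>) (lap \<phi>) + l2inner lborel (F \<tau>) \<phi>) = 0"
      unfolding V W_def[symmetric] by (simp add: mult.assoc[symmetric])
  qed
  then show ?thesis unfolding w_def F_def N_def by blast
qed

section \<open>Decay\<close>

text \<open>What the decay argument takes from an approximating solution after extension by zero.
  The constants below are chosen before \<open>w\<close> and \<open>g\<close>, so they serve all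
  approximations at once.\<close>

definition damped_solution :: "real \<Rightarrow> complex \<Rightarrow> 'a::euclidean_space set \<Rightarrow>
    (real \<Rightarrow> 'a \<Rightarrow> complex) \<Rightarrow> (real \<Rightarrow> 'a \<Rightarrow> complex) \<Rightarrow> bool" where
  "damped_solution m a \<Omega> w g \<longleftrightarrow>
     (\<exists>G. linear_solution \<Omega> w G (\<lambda>t x. a * nl m (w t x) - g t x)) \<and>
     (\<forall>t x. x \<notin> \<Omega> \<longrightarrow> w t x = 0) \<and> (\<forall>\<alpha>>0. \<forall>\<beta>. l2_integrable_on {\<alpha>..\<beta>} g)"

lemma set_integral_mono_subset:
  fixes f :: "real \<Rightarrow> real"
  assumes "set_integrable lborel B f" "\<And>s. 0 \<le> f s" "A \<subseteq> B" "A \<in> sets borel"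
  shows "(LINT s:A|lborel. f s) \<le> (LINT s:B|lborel. f s)"
  unfolding set_lebesgue_integral_def
proof (rule integral_mono)
  show "integrable lborel (\<lambda>s. indicat_real A s *\<^sub>R f s)"
    using set_integrable_subset[OF assms(1) _ assms(3)] assms(4) by (simp add: set_integrable_def)
  show "integrable lborel (\<lambda>s. indicat_real B s *\<^sub>R f s)" using assms(1) by (simp add: set_integrable_def)
  show "indicat_real A s *\<^sub>R f s \<le> indicat_real B s *\<^sub>R f s" for s
    using assms(2)[of s] assms(3) by (auto simp: indicator_def)
qed

lemma Im_l2inner_nonneg:
  assumes "sq_integrable M f" "sq_integrable M g" "\<And>x. 0 \<le> Im (f x * cnj (g x))"
  shows "0 \<le> Im (l2inner M f g)"
proof -
  have "Im (l2inner M f g) = (LINT x|M. Im (f x * cnj (g x)))"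
    unfolding l2inner_def by (rule integral_Im[OF sq_integrable_inner[OF assms(1,2)], symmetric])
  also have "0 \<le> \<dots>" by (rule integral_nonneg_AE, rule AE_I2, rule assms(3))
  finally show ?thesis .
qed

text \<open>By \<open>nl_mult_cnj\<close> the integrand is \<open>cmod (f x) powr (m + 1)\<close>,
  so this inner product is the dissipation up to the factor \<open>Im a\<close>.\<close>

lemma l2inner_nl_self:
  assumes "sq_integrable M (\<lambda>x. nl m (f x))" "sq_integrable M f"
  shows "l2inner M (\<lambda>x. nl m (f x)) f = of_real (Re (l2inner M (\<lambda>x. nl m (f x)) f))"
    and "0 \<le> Re (l2inner M (\<lambda>x. nl m (f x)) f)"
    and "(\<integral>\<^sup>+x. ennreal (cmod (f x) powr (m + 1)) \<partial>M) = ennreal (Re (l2inner M (\<lambda>x. nl m (f x)) f))"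
proof -
  have e: "l2inner M (\<lambda>x. nl m (f x)) f = of_real (LINT x|M. cmod (f x) powr (m + 1))"
    unfolding l2inner_def nl_mult_cnj by (rule integral_complex_of_real)
  have i: "integrable M (\<lambda>x. cmod (f x) powr (m + 1))"
    using sq_integrable_inner[OF assms] unfolding nl_mult_cnj by (rule integrable_Re[THEN Bochner_Integration.integrable_cong[THEN iffD1, rotated 2]]) auto
  show "l2inner M (\<lambda>x. nl m (f x)) f = of_real (Re (l2inner M (\<lambda>x. nl m (f x)) f))" unfolding e by simp
  show "0 \<le> Re (l2inner M (\<lambda>x. nl m (f x)) f)" unfolding e by (simp add: integral_nonneg_AE)
  show "(\<integral>\<^sup>+x. ennreal (cmod (f x) powr (m + 1)) \<partial>M) = ennreal (Re (l2inner M (\<lambda>x. nl m (f x)) f))"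
    unfolding e using nn_integral_eq_integral[OF i] by simp
qed

text \<open>The partial integrals from 1 converge to the full one. Starting at 1 keeps
  \<open>T\<close> positive, as the estimates for solutions require.\<close>

lemma tail_integral_small:
  fixes \<gamma> :: "real \<Rightarrow> real"
  assumes \<gamma>: "set_integrable lborel {1..} \<gamma>" "\<And>s. 0 \<le> \<gamma> s" and \<epsilon>: "0 < \<epsilon>"
  obtains T where "1 \<le> T" "\<And>b. T \<le> b \<Longrightarrow> (LINT s:{T..b}|lborel. \<gamma> s) \<le> \<epsilon>"
proof -
  have "((\<lambda>b. LINT s:{1..b}|lborel. \<gamma> s) \<longlongrightarrow> (LINT s:{1..}|lborel. \<gamma> s)) at_top"
    by (rule tendsto_set_lebesgue_integral_at_top[OF _ \<gamma>(1)]) simp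
  from order_tendstoD(1)[OF this, of "(LINT s:{1..}|lborel. \<gamma> s) - \<epsilon>"] \<epsilon>
  have "eventually (\<lambda>b. (LINT s:{1..}|lborel. \<gamma> s) - \<epsilon> < (LINT s:{1..b}|lborel. \<gamma> s)) at_top" by simp
  then have "eventually (\<lambda>b. 1 \<le> b \<and> (LINT s:{1..}|lborel. \<gamma> s) - \<epsilon> < (LINT s:{1..b}|lborel. \<gamma> s)) at_top"
    using eventually_ge_at_top[of 1] by eventually_elim simp
  then obtain T where T: "1 \<le> T" "(LINT s:{1..}|lborel. \<gamma> s) - \<epsilon> < (LINT s:{1..T}|lborel. \<gamma> s)"
    by (auto simp: eventually_at_top_linorder)
  show thesis
  proof (rule that[OF T(1)])
    fix b assume b: "T \<le> b"
    have "set_integrable lborel {1..b} \<gamma>" by (rule set_integrable_subset[OF \<gamma>(1)]) auto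
    from set_integral_combine_Icc[OF this T(1) b]
    show "(LINT s:{T..b}|lborel. \<gamma> s) \<le> \<epsilon>"
      using set_integral_mono_subset[OF \<gamma>, of "{1..b}"] T(2) by auto
  qed
qed

context
  fixes \<Omega> :: "'a::euclidean_space set" and m :: real and a :: complex
  assumes \<Omega>: "open \<Omega>" and m: "0 < m" "m \<le> 1" and fin: "m < 1 \<Longrightarrow> emeasure lborel \<Omega> < \<infinity>"
    and a: "0 < Im a" and cond: "(1 - m) * \<bar>Re a\<bar> \<le> 2 * sqrt m * Im a"
begin

section \<open>A priori bounds for solutions of the damped equation\<close>

lemma damped_solution_continuous:
  assumes "damped_solution m a \<Omega> w g"
  shows "l2_continuous_on {0<..} w" "l2_continuous_on {0<..} (\<lambda>t x. nl m (w t x))"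
    "l2_continuous_on {0<..} (\<lambda>t x. a * nl m (w t x))"
proof -
  show w: "l2_continuous_on {0<..} w" using assms linear_solutionD(2) unfolding damped_solution_def by blast
  show "l2_continuous_on {0<..} (\<lambda>t x. nl m (w t x))"
    by (rule l2_continuous_on_nl[OF m fin \<Omega> w]) (use assms in \<open>auto simp: damped_solution_def\<close>)
  then show "l2_continuous_on {0<..} (\<lambda>t x. a * nl m (w t x))" by (rule l2_continuous_on_scale)
qed

lemma damped_solution_sq:
  assumes "damped_solution m a \<Omega> w g" "0 < t"
  shows "sq_integrable lborel (w t)" "sq_integrable lborel (\<lambda>x. nl m (w t x))"
  using damped_solution_continuous(1,2)[OF assms(1), THEN l2_continuous_on_sq, of t] assms(2) by simp_all

lemma damped_solution_dissipation:
  assumes "damped_solution m a \<Omega> w g" "0 < t"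
  shows "Im (l2inner lborel (\<lambda>x. a * nl m (w t x)) (w t)) = Im a * Re (l2inner lborel (\<lambda>x. nl m (w t x)) (w t))"
proof -
  note s = damped_solution_sq[OF assms]
  show ?thesis unfolding l2inner_scale_left by (subst l2inner_nl_self(1)[OF s(2,1)]) simp
qed

text \<open>Dropping the terminal norm from the energy inequality leaves a bound on the total
  dissipation that does not grow with the length of \<open>{s..t}\<close>, as long as the norms stay
  below \<open>M\<close> and the forcing has bounded integral.\<close>

lemma damped_solution_energy:
  assumes w: "damped_solution m a \<Omega> w g" and s: "0 < s" and st: "s \<le> t"
    and M: "\<And>\<tau>. \<tau> \<in> {s..t} \<Longrightarrow> l2norm lborel (w \<tau>) \<le> M"
  shows "2 * Im a * (LINT \<tau>:{s..t}|lborel. Re (l2inner lborel (\<lambda>x. nl m (w \<tau> x)) (w \<tau>)))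
    \<le> M\<^sup>2 + 2 * M * (LINT \<tau>:{s..t + 1}|lborel. l2norm lborel (g \<tau>))"
proof -
  obtain G where lin: "linear_solution \<Omega> w G (\<lambda>t x. a * nl m (w t x) - g t x)"
    using w unfolding damped_solution_def by blast
  have g: "l2_integrable_on {\<alpha>..\<beta>} g" if "0 < \<alpha>" for \<alpha> \<beta> using w that by (simp add: damped_solution_def)
  have "(l2norm lborel (w t))\<^sup>2 + 2 * (LINT \<tau>:{s..t}|lborel. Im (l2inner lborel (\<lambda>x. a * nl m (w \<tau> x)) (w \<tau>)))
    \<le> (l2norm lborel (w s))\<^sup>2 + 2 * M * (LINT \<tau>:{s..t + 1}|lborel. l2norm lborel (g \<tau>))"
    by (rule energy_inequality[OF lin damped_solution_continuous(3)[OF w] g s st zero_less_one M])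
  moreover have "(LINT \<tau>:{s..t}|lborel. Im (l2inner lborel (\<lambda>x. a * nl m (w \<tau> x)) (w \<tau>)))
      = (LINT \<tau>:{s..t}|lborel. Im a * Re (l2inner lborel (\<lambda>x. nl m (w \<tau> x)) (w \<tau>)))"
    unfolding set_lebesgue_integral_def
  proof (intro Bochner_Integration.integral_cong refl)
    fix \<tau> show "indicat_real {s..t} \<tau> *\<^sub>R Im (l2inner lborel (\<lambda>x. a * nl m (w \<tau> x)) (w \<tau>))
        = indicat_real {s..t} \<tau> *\<^sub>R (Im a * Re (l2inner lborel (\<lambda>x. nl m (w \<tau> x)) (w \<tau>)))"
      using damped_solution_dissipation[OF w, of \<tau>] s by (cases "\<tau> \<in> {s..t}") auto
  qed
  moreover have "(l2norm lborel (w s))\<^sup>2 \<le> M\<^sup>2" by (intro power_mono M) (use st in auto)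
  ultimately show ?thesis using zero_le_power2[of "l2norm lborel (w t)"]
    unfolding set_integral_mult_right by linarith
qed

text \<open>Comparison with the zero solution: the dissipation is nonnegative by
  \<open>l2inner_nl_self\<close>.\<close>

lemma damped_solution_bound:
  assumes w: "damped_solution m a \<Omega> w g" and s: "0 < s" and st: "s \<le> t"
  shows "l2norm lborel (w t) \<le> l2norm lborel (w s) + 2 * (LINT \<tau>:{s..t + 1}|lborel. l2norm lborel (g \<tau>))"
proof -
  obtain G where lin: "linear_solution \<Omega> w G (\<lambda>t x. a * nl m (w t x) - g t x)"
    using w unfolding damped_solution_def by blast
  have g: "l2_integrable_on {\<alpha>..\<beta>} g" if "0 < \<alpha>" for \<alpha> \<beta> using w that by (simp add: damped_solution_def)
  show ?thesis
  proof (rule l2norm_le_of_dissipative[OF lin damped_solution_continuous(3)[OF w] g s st zero_less_one])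
    fix \<tau> :: real assume "0 < \<tau>"
    then show "0 \<le> Im (l2inner lborel (\<lambda>x. a * nl m (w \<tau> x)) (w \<tau>))"
      using damped_solution_dissipation[OF w] l2inner_nl_self(2)[OF damped_solution_sq(2,1)[OF w]] a by simp
  qed
qed

text \<open>The difference of the time shift and \<open>w\<close> solves the linear equation with
  the difference of the nonlinear terms, which \<open>nl_monotone\<close> makes dissipative. The
  factor 4 is the 2 of \<open>l2norm_le_of_dissipative\<close>, doubled because the forcing enters
  at two times.\<close>

lemma damped_solution_increment:
  assumes w: "damped_solution m a \<Omega> w g" and s: "0 < s" and st: "s \<le> t" and h: "0 \<le> h"
  shows "l2norm lborel (\<lambda>x. w (t + h) x - w t x)
    \<le> l2norm lborel (\<lambda>x. w (s + h) x - w s x) + 4 * (LINT \<tau>:{s..t + h + 1}|lborel. l2norm lborel (g \<tau>))"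
proof -
  obtain G where lin: "linear_solution \<Omega> w G (\<lambda>t x. a * nl m (w t x) - g t x)"
    using w unfolding damped_solution_def by blast
  have g: "l2_integrable_on {\<alpha>..\<beta>} g" if "0 < \<alpha>" for \<alpha> \<beta> using w that by (simp add: damped_solution_def)
  have gh: "l2_integrable_on {\<alpha>..\<beta>} (\<lambda>t. g (t + h))" if "0 < \<alpha>" for \<alpha> \<beta>
    by (rule l2_integrable_on_shift[OF g]) (use that h in simp)
  have gd: "l2_integrable_on {\<alpha>..\<beta>} (\<lambda>t x. g (t + h) x - g t x)" if "0 < \<alpha>" for \<alpha> \<beta>
    by (rule l2_integrable_on_diff[OF gh[OF that] g[OF that]]) simp
  note N = damped_solution_continuous(3)[OF w]
  note Nd = l2_continuous_on_diff[OF l2_continuous_on_shift[OF N h] N]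
  have eq: "(\<lambda>t x. (a * nl m (w (t + h) x) - g (t + h) x) - (a * nl m (w t x) - g t x))
      = (\<lambda>t x. (a * nl m (w (t + h) x) - a * nl m (w t x)) - (g (t + h) x - g t x))"
    by (simp add: fun_eq_iff)
  note lind = linear_solution_diff[OF linear_solution_shift[OF lin h] lin, unfolded eq]
  have "l2norm lborel (\<lambda>x. w (t + h) x - w t x) \<le> l2norm lborel (\<lambda>x. w (s + h) x - w s x)
      + 2 * (LINT \<tau>:{s..t + 1}|lborel. l2norm lborel (\<lambda>x. g (\<tau> + h) x - g \<tau> x))"
  proof (rule l2norm_le_of_dissipative[OF lind Nd gd s st zero_less_one])
    fix \<tau> :: real assume \<tau>: "0 < \<tau>"
    then have \<tau>h: "0 < \<tau> + h" using h by simp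
    show "0 \<le> Im (l2inner lborel (\<lambda>x. a * nl m (w (\<tau> + h) x) - a * nl m (w \<tau> x)) (\<lambda>x. w (\<tau> + h) x - w \<tau> x))"
    proof (rule Im_l2inner_nonneg)
      show "sq_integrable lborel (\<lambda>x. a * nl m (w (\<tau> + h) x) - a * nl m (w \<tau> x))"
        by (rule sq_integrable_diff[OF sq_integrable_scale[OF damped_solution_sq(2)[OF w \<tau>h]] sq_integrable_scale[OF damped_solution_sq(2)[OF w \<tau>]]])
      show "sq_integrable lborel (\<lambda>x. w (\<tau> + h) x - w \<tau> x)"
        by (rule sq_integrable_diff[OF damped_solution_sq(1)[OF w \<tau>h] damped_solution_sq(1)[OF w \<tau>]])
      fix x
      show "0 \<le> Im ((a * nl m (w (\<tau> + h) x) - a * nl m (w \<tau> x)) * cnj (w (\<tau> + h) x - w \<tau> x))"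
        using nl_monotone[OF m less_imp_le[OF a] cond, of "w (\<tau> + h) x" "w \<tau> x"]
        unfolding right_diff_distrib[symmetric] mult.assoc .
    qed
  qed
  also have "(LINT \<tau>:{s..t + 1}|lborel. l2norm lborel (\<lambda>x. g (\<tau> + h) x - g \<tau> x))
      \<le> 2 * (LINT \<tau>:{s..t + h + 1}|lborel. l2norm lborel (g \<tau>))"
  proof -
    have i: "set_integrable lborel {\<alpha>..\<beta>} (\<lambda>\<tau>. l2norm lborel (g \<tau>))" if "0 < \<alpha>" for \<alpha> \<beta>
      using g[OF that] by (simp add: l2_integrable_on_def)
    have ih: "set_integrable lborel {s..t + 1} (\<lambda>\<tau>. l2norm lborel (g (\<tau> + h)))"
      using gh[OF s] by (simp add: l2_integrable_on_def)
    have le: "AE \<tau> in lborel. \<tau> \<in> {s..t + 1} \<longrightarrow> norm (complex_of_real (l2norm lborel (\<lambda>x. g (\<tau> + h) x - g \<tau> x)))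
        \<le> l2norm lborel (g (\<tau> + h)) + l2norm lborel (g \<tau>)"
      using gh[OF s, of "t + 1", unfolded l2_integrable_on_def, THEN conjunct2, THEN conjunct1]
        g[OF s, of "t + 1", unfolded l2_integrable_on_def, THEN conjunct2, THEN conjunct1]
      by eventually_elim (auto intro: l2norm_triangle_diff)
    have "(LINT \<tau>:{s..t + 1}|lborel. l2norm lborel (\<lambda>x. g (\<tau> + h) x - g \<tau> x))
        \<le> (LINT \<tau>:{s..t + 1}|lborel. l2norm lborel (g (\<tau> + h)) + l2norm lborel (g \<tau>))"
      unfolding set_lebesgue_integral_def
    proof (rule integral_mono_AE)
      show "integrable lborel (\<lambda>\<tau>. indicat_real {s..t + 1} \<tau> *\<^sub>R l2norm lborel (\<lambda>x. g (\<tau> + h) x - g \<tau> x))"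
        using gd[OF s, of "t + 1"] by (simp add: l2_integrable_on_def set_integrable_def)
      show "integrable lborel (\<lambda>\<tau>. indicat_real {s..t + 1} \<tau> *\<^sub>R (l2norm lborel (g (\<tau> + h)) + l2norm lborel (g \<tau>)))"
        using set_integral_add(1)[OF ih i[OF s]] by (simp add: set_integrable_def)
      show "AE \<tau> in lborel. indicat_real {s..t + 1} \<tau> *\<^sub>R l2norm lborel (\<lambda>x. g (\<tau> + h) x - g \<tau> x)
          \<le> indicat_real {s..t + 1} \<tau> *\<^sub>R (l2norm lborel (g (\<tau> + h)) + l2norm lborel (g \<tau>))"
        using le by eventually_elim (auto simp: indicator_def)
    qed
    also have "\<dots> = (LINT \<tau>:{s..t + 1}|lborel. l2norm lborel (g (\<tau> + h))) + (LINT \<tau>:{s..t + 1}|lborel. l2norm lborel (g \<tau>))"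
      by (rule set_integral_add(2)[OF ih i[OF s]])
    also have "(LINT \<tau>:{s..t + 1}|lborel. l2norm lborel (g (\<tau> + h))) = (LINT \<tau>:{s + h..t + 1 + h}|lborel. l2norm lborel (g \<tau>))"
      by (rule set_integral_shift_Icc(2)[OF i]) (use s h in simp)
    also have "\<dots> \<le> (LINT \<tau>:{s..t + h + 1}|lborel. l2norm lborel (g \<tau>))"
      by (rule set_integral_mono_subset[OF i[OF s]]) (use h in auto)
    also have "(LINT \<tau>:{s..t + 1}|lborel. l2norm lborel (g \<tau>)) \<le> (LINT \<tau>:{s..t + h + 1}|lborel. l2norm lborel (g \<tau>))"
      by (rule set_integral_mono_subset[OF i[OF s]]) (use h in auto)
    finally show ?thesis by simp
  qed
  finally show ?thesis by simp
qed

text \<open>The \<open>L^1\<close> norm of an average is at most the average of the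
  \<open>L^1\<close> norms, and \<open>cmod (w \<sigma> x)\<close> is at most a constant on
  \<open>\<Omega>\<close> plus a multiple of the dissipation density. Averaging leaves the constant
  part as it is and divides the dissipation by \<open>h\<close>.\<close>

lemma time_avg_L1_le:
  assumes w: "damped_solution m a \<Omega> w g" and \<tau>: "0 < \<tau>" and h: "0 < h" and fin': "emeasure lborel \<Omega> < \<infinity>"
    and C: "0 \<le> C" "\<And>x. 0 \<le> x \<Longrightarrow> x powr 1 \<le> \<eta> + C * x powr (m + 1)" and \<eta>: "0 \<le> \<eta>"
  shows "(\<integral>\<^sup>+x. ennreal (cmod (time_avg h w \<tau> x)) \<partial>lborel)
    \<le> ennreal (\<eta> * measure lborel \<Omega> + C / h * (LINT \<sigma>:{\<tau>..\<tau> + h}|lborel. Re (l2inner lborel (\<lambda>x. nl m (w \<sigma> x)) (w \<sigma>))))"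
proof -
  let ?A = "{\<tau>..\<tau> + h}"
  define P where "P \<sigma> = Re (l2inner lborel (\<lambda>x. nl m (w \<sigma> x)) (w \<sigma>))" for \<sigma>
  have jw: "jmeas w" using w linear_solutionD(1) unfolding damped_solution_def by blast
  have out: "x \<notin> \<Omega> \<Longrightarrow> w \<sigma> x = 0" for \<sigma> x using w by (simp add: damped_solution_def)
  have j [measurable]: "(\<lambda>(\<sigma>, x). w \<sigma> x) \<in> borel_measurable (lborel \<Otimes>\<^sub>M lborel)"
    using jw by (simp add: jmeas_def lborel_prod split_beta')
  have [measurable]: "\<Omega> \<in> sets borel" using \<Omega> by simp
  have Pc: "continuous_on ?A P"
    unfolding P_def
    by (intro continuous_on_Re continuous_on_subset[OF l2_continuous_on_continuous_inner[OF damped_solution_continuous(2,1)[OF w]]])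
       (use \<tau> in auto)
  have iP: "set_integrable lborel ?A P" unfolding set_integrable_def by (rule borel_integrable_compact[OF compact_Icc Pc])
  have P0: "0 \<le> P \<sigma>" if "0 < \<sigma>" for \<sigma> unfolding P_def by (rule l2inner_nl_self(2)[OF damped_solution_sq(2,1)[OF w that]])
  have iK: "set_integrable lborel ?A (\<lambda>\<sigma>. \<eta> * measure lborel \<Omega>)" by (rule set_integrable_const_Icc)
  have iCP: "set_integrable lborel ?A (\<lambda>\<sigma>. C * P \<sigma>)" by (rule set_integrable_mult_right) (rule iP)
  have sect: "(\<integral>\<^sup>+x. ennreal (cmod (w \<sigma> x)) \<partial>lborel) \<le> ennreal (\<eta> * measure lborel \<Omega> + C * P \<sigma>)" if \<sigma>: "0 < \<sigma>" for \<sigma>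
  proof -
    note s = damped_solution_sq[OF w \<sigma>]
    have mw [measurable]: "w \<sigma> \<in> borel_measurable borel" using s(1) by (simp add: sq_integrable_def)
    have "(\<integral>\<^sup>+x. ennreal (cmod (w \<sigma> x)) \<partial>lborel)
        \<le> (\<integral>\<^sup>+x. ennreal \<eta> * indicator \<Omega> x + ennreal C * ennreal (cmod (w \<sigma> x) powr (m + 1)) \<partial>lborel)"
    proof (rule nn_integral_mono)
      fix x
      show "ennreal (cmod (w \<sigma> x)) \<le> ennreal \<eta> * indicator \<Omega> x + ennreal C * ennreal (cmod (w \<sigma> x) powr (m + 1))"
      proof (cases "x \<in> \<Omega>")
        case True
        have "ennreal (cmod (w \<sigma> x)) \<le> ennreal (\<eta> + C * cmod (w \<sigma> x) powr (m + 1))"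
          using C(2)[of "cmod (w \<sigma> x)"] by (intro ennreal_leI) simp
        also have "\<dots> = ennreal \<eta> + ennreal C * ennreal (cmod (w \<sigma> x) powr (m + 1))"
          using \<eta> C(1) by (simp add: ennreal_plus ennreal_mult)
        finally show ?thesis using True by simp
      qed (simp add: out)
    qed
    also have "\<dots> = (\<integral>\<^sup>+x. ennreal \<eta> * indicator \<Omega> x \<partial>lborel) + (\<integral>\<^sup>+x. ennreal C * ennreal (cmod (w \<sigma> x) powr (m + 1)) \<partial>lborel)"
      by (rule nn_integral_add) measurable
    also have "(\<integral>\<^sup>+x. ennreal \<eta> * indicator \<Omega> x \<partial>lborel) = ennreal (\<eta> * measure lborel \<Omega>)"
      using fin' \<eta> by (simp add: nn_integral_cmult_indicator emeasure_eq_ennreal_measure less_top ennreal_mult)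
    also have "(\<integral>\<^sup>+x. ennreal C * ennreal (cmod (w \<sigma> x) powr (m + 1)) \<partial>lborel) = ennreal C * ennreal (P \<sigma>)"
      unfolding P_def l2inner_nl_self(3)[OF s(2,1), symmetric] by (rule nn_integral_cmult) measurable
    also have "ennreal (\<eta> * measure lborel \<Omega>) + ennreal C * ennreal (P \<sigma>) = ennreal (\<eta> * measure lborel \<Omega> + C * P \<sigma>)"
      using \<eta> C(1) P0[OF \<sigma>] by (simp add: ennreal_plus ennreal_mult)
    finally show ?thesis .
  qed
  have "(\<integral>\<^sup>+x. ennreal (cmod (time_avg h w \<tau> x)) \<partial>lborel)
      \<le> (\<integral>\<^sup>+x. ennreal (1 / h) * (\<integral>\<^sup>+\<sigma>. indicator ?A \<sigma> * ennreal (cmod (w \<sigma> x)) \<partial>lborel) \<partial>lborel)"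
  proof (rule nn_integral_mono)
    fix x
    have "ennreal (norm (LINT \<sigma>:?A|lborel. w \<sigma> x)) \<le> (\<integral>\<^sup>+\<sigma>. indicator ?A \<sigma> * ennreal (cmod (w \<sigma> x)) \<partial>lborel)"
    proof (cases "set_integrable lborel ?A (\<lambda>\<sigma>. w \<sigma> x)")
      case True
      then have "ennreal (norm (LINT \<sigma>:?A|lborel. w \<sigma> x)) \<le> (\<integral>\<^sup>+\<sigma>. ennreal (norm (indicat_real ?A \<sigma> *\<^sub>R w \<sigma> x)) \<partial>lborel)"
        unfolding set_integrable_def set_lebesgue_integral_def by (rule integral_norm_bound_ennreal)
      also have "\<dots> = (\<integral>\<^sup>+\<sigma>. indicator ?A \<sigma> * ennreal (cmod (w \<sigma> x)) \<partial>lborel)"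
        by (intro nn_integral_cong) (auto simp: indicator_def)
      finally show ?thesis .
    next
      \<comment> \<open>A non-integrable section has Bochner integral 0, so the bound holds at every
        \<open>x\<close> and no exceptional set arises.\<close>
      case False
      then show ?thesis by (simp add: set_integrable_def set_lebesgue_integral_def not_integrable_integral_eq)
    qed
    then have "ennreal (1 / h) * ennreal (norm (LINT \<sigma>:?A|lborel. w \<sigma> x)) \<le> ennreal (1 / h) * (\<integral>\<^sup>+\<sigma>. indicator ?A \<sigma> * ennreal (cmod (w \<sigma> x)) \<partial>lborel)"
      by (rule mult_left_mono) simp
    moreover have "ennreal (cmod (time_avg h w \<tau> x)) = ennreal (1 / h) * ennreal (norm (LINT \<sigma>:?A|lborel. w \<sigma> x))"
      using h by (simp add: time_avg_def norm_divide flip: ennreal_mult)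
    ultimately show "ennreal (cmod (time_avg h w \<tau> x)) \<le> ennreal (1 / h) * (\<integral>\<^sup>+\<sigma>. indicator ?A \<sigma> * ennreal (cmod (w \<sigma> x)) \<partial>lborel)" by simp
  qed
  also have "\<dots> = ennreal (1 / h) * (\<integral>\<^sup>+x. (\<integral>\<^sup>+\<sigma>. indicator ?A \<sigma> * ennreal (cmod (w \<sigma> x)) \<partial>lborel) \<partial>lborel)"
    by (rule nn_integral_cmult) measurable
  also have "(\<integral>\<^sup>+x. (\<integral>\<^sup>+\<sigma>. indicator ?A \<sigma> * ennreal (cmod (w \<sigma> x)) \<partial>lborel) \<partial>lborel)
      = (\<integral>\<^sup>+\<sigma>. (\<integral>\<^sup>+x. indicator ?A \<sigma> * ennreal (cmod (w \<sigma> x)) \<partial>lborel) \<partial>lborel)"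
    by (rule lborel_pair.Fubini') measurable
  also have "\<dots> \<le> (\<integral>\<^sup>+\<sigma>. ennreal (indicat_real ?A \<sigma> *\<^sub>R (\<eta> * measure lborel \<Omega> + C * P \<sigma>)) \<partial>lborel)"
    by (intro nn_integral_mono) (use sect \<tau> in \<open>auto simp: indicator_def\<close>)
  also have "\<dots> = ennreal (LINT \<sigma>:?A|lborel. \<eta> * measure lborel \<Omega> + C * P \<sigma>)"
    unfolding set_lebesgue_integral_def
  proof (rule nn_integral_eq_integral)
    show "integrable lborel (\<lambda>\<sigma>. indicat_real ?A \<sigma> *\<^sub>R (\<eta> * measure lborel \<Omega> + C * P \<sigma>))"
      using set_integral_add(1)[OF iK iCP] by (simp add: set_integrable_def)
    show "AE \<sigma> in lborel. 0 \<le> indicat_real ?A \<sigma> *\<^sub>R (\<eta> * measure lborel \<Omega> + C * P \<sigma>)"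
      by (rule AE_I2) (use \<tau> P0 \<eta> C(1) in \<open>auto simp: indicator_def\<close>)
  qed
  also have "(LINT \<sigma>:?A|lborel. \<eta> * measure lborel \<Omega> + C * P \<sigma>) = h * (\<eta> * measure lborel \<Omega>) + C * (LINT \<sigma>:?A|lborel. P \<sigma>)"
    unfolding set_integral_add(2)[OF iK iCP] set_integral_mult_right using h by (simp add: set_integral_const_Icc)
  finally have "(\<integral>\<^sup>+x. ennreal (cmod (time_avg h w \<tau> x)) \<partial>lborel)
      \<le> ennreal (1 / h) * ennreal (h * (\<eta> * measure lborel \<Omega>) + C * (LINT \<sigma>:?A|lborel. P \<sigma>))" by (simp add: mult_left_mono)
  also have "\<dots> = ennreal ((1 / h) * (h * (\<eta> * measure lborel \<Omega>) + C * (LINT \<sigma>:?A|lborel. P \<sigma>)))"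
    by (rule ennreal_mult'[symmetric]) (use h in simp)
  also have "(1 / h) * (h * (\<eta> * measure lborel \<Omega>) + C * (LINT \<sigma>:?A|lborel. P \<sigma>)) = \<eta> * measure lborel \<Omega> + C / h * (LINT \<sigma>:?A|lborel. P \<sigma>)"
    using h by (simp add: distrib_left)
  finally show ?thesis by (simp add: P_def)
qed

text \<open>The bound \<open>\<kappa>\<close> depends neither on the solution nor on the position of
  the window. For \<open>m < 1\<close> the average \<open>z\<close> is within \<open>e0\<close> of
  \<open>w \<tau>\<close>, so its norm exceeds \<open>\<epsilon>\<close>; its gradient is bounded
  through the averaged equation; hence its \<open>L^1\<close> norm cannot be small, and the
  dissipation controls that norm. For \<open>m = 1\<close> the dissipation density in time is the
  squared norm, which stays above the square of \<open>\<epsilon>\<close> throughout the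
  window.\<close>

lemma damped_solution_window:
  assumes h: "0 < h" and M: "0 \<le> M" and \<epsilon>: "0 < \<epsilon>" and e0: "0 \<le> e0"
  obtains \<kappa> where "0 < \<kappa>"
    "\<And>w g \<tau>. damped_solution m a \<Omega> w g \<Longrightarrow> 0 < \<tau> \<Longrightarrow>
      (\<And>\<sigma>. \<sigma> \<in> {\<tau>..\<tau> + h} \<Longrightarrow> l2norm lborel (w \<sigma>) \<le> M) \<Longrightarrow>
      (\<And>\<sigma>. \<sigma> \<in> {\<tau>..\<tau> + h} \<Longrightarrow> l2norm lborel (\<lambda>x. w \<sigma> x - w \<tau> x) \<le> e0) \<Longrightarrow>
      (LINT \<sigma>:{\<tau>..\<tau> + h}|lborel. l2norm lborel (g \<sigma>)) \<le> 2 \<Longrightarrow>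
      e0 + \<epsilon> < l2norm lborel (w \<tau>) \<Longrightarrow>
      \<kappa> \<le> (LINT \<sigma>:{\<tau>..\<tau> + h}|lborel. Re (l2inner lborel (\<lambda>x. nl m (w \<sigma> x)) (w \<sigma>)))"
proof (cases "m < 1")
  case False
  then have m1: "m = 1" using m by simp
  show thesis
  proof (rule that[of "h * \<epsilon>\<^sup>2"])
    show "0 < h * \<epsilon>\<^sup>2" using h \<epsilon> by simp
    fix w g \<tau>
    assume w: "damped_solution m a \<Omega> w g" and \<tau>: "0 < \<tau>"
      and near: "\<And>\<sigma>. \<sigma> \<in> {\<tau>..\<tau> + h} \<Longrightarrow> l2norm lborel (\<lambda>x. w \<sigma> x - w \<tau> x) \<le> e0"
      and big: "e0 + \<epsilon> < l2norm lborel (w \<tau>)"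
    note cw = damped_solution_continuous(1)[OF w]
    have e: "Re (l2inner lborel (\<lambda>x. nl m (w \<sigma> x)) (w \<sigma>)) = (l2norm lborel (w \<sigma>))\<^sup>2" for \<sigma>
      by (simp add: m1 nl_one Re_l2inner_self)
    have "h * \<epsilon>\<^sup>2 = (LINT \<sigma>:{\<tau>..\<tau> + h}|lborel. \<epsilon>\<^sup>2)" using h by (simp add: set_integral_const_Icc)
    also have "\<dots> \<le> (LINT \<sigma>:{\<tau>..\<tau> + h}|lborel. (l2norm lborel (w \<sigma>))\<^sup>2)"
    proof (rule set_integral_mono[OF set_integrable_const_Icc])
      have "continuous_on {\<tau>..\<tau> + h} (\<lambda>\<sigma>. (l2norm lborel (w \<sigma>))\<^sup>2)"
        by (intro continuous_on_power continuous_on_subset[OF l2_continuous_on_continuous_norm[OF cw]]) (use \<tau> in auto)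
      then show "set_integrable lborel {\<tau>..\<tau> + h} (\<lambda>\<sigma>. (l2norm lborel (w \<sigma>))\<^sup>2)"
        unfolding set_integrable_def by (rule borel_integrable_compact[OF compact_Icc])
      fix \<sigma> assume \<sigma>: "\<sigma> \<in> {\<tau>..\<tau> + h}"
      then have p: "0 < \<sigma>" using \<tau> by auto
      have "l2norm lborel (w \<tau>) \<le> l2norm lborel (w \<sigma>) + l2norm lborel (\<lambda>x. w \<tau> x - w \<sigma> x)"
        by (rule l2norm_le_add_diff[OF damped_solution_sq(1)[OF w \<tau>] damped_solution_sq(1)[OF w p]])
      also have "l2norm lborel (\<lambda>x. w \<tau> x - w \<sigma> x) \<le> e0"
        using near[OF \<sigma>] by (simp add: l2norm_minus_commute[of lborel "w \<tau>"])
      finally show "\<epsilon>\<^sup>2 \<le> (l2norm lborel (w \<sigma>))\<^sup>2" using big \<epsilon> by (intro power_mono) auto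
    qed
    finally show "h * \<epsilon>\<^sup>2 \<le> (LINT \<sigma>:{\<tau>..\<tau> + h}|lborel. Re (l2inner lborel (\<lambda>x. nl m (w \<sigma> x)) (w \<sigma>)))"
      by (simp only: e)
  qed
next
  case True
  note fin' = fin[OF True]
  obtain C1 where C1: "0 \<le> C1" "\<And>f h. sq_integrable lborel f \<Longrightarrow> sq_integrable lborel h \<Longrightarrow>
     (\<And>x. x \<notin> \<Omega> \<Longrightarrow> f x = 0) \<Longrightarrow> (\<And>x. x \<notin> \<Omega> \<Longrightarrow> h x = 0) \<Longrightarrow>
     sq_integrable lborel (\<lambda>x. nl m (f x)) \<and>
     (l2norm lborel (\<lambda>x. nl m (f x) - nl m (h x)))\<^sup>2 \<le> 1 + C1 * (l2norm lborel (\<lambda>x. f x - h x))\<^sup>2"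
    by (rule nl_l2_modulus[OF m fin \<Omega>, of 1]) auto
  \<comment> \<open>\<open>K1\<close> bounds the nonlinearity and \<open>R0\<close> bounds
    \<open>l\<close>, with one summand each for the difference quotient, the nonlinear term, and the
    forcing, whose integral is at most 2. \<open>R\<close> bounds the increments of \<open>z\<close>
    per unit of translation, with one square root for each coordinate direction.\<close>
  define K1 where "K1 = sqrt (1 + C1 * M\<^sup>2)"
  define R0 where "R0 = 2 * M / h + cmod a * K1 + 2 / h"
  define R where "R = DIM('a) * sqrt (R0 * M)"
  \<comment> \<open>The cube is so small that its translations change \<open>z\<close> by at most
    \<open>\<epsilon>\<close>; this accounts for half of \<open>\<epsilon>\<^sup>2\<close> in the
    Nash inequality.\<close>
  define r where "r = \<epsilon> / (R + 1)"
  have K1: "0 \<le> K1" using C1(1) by (simp add: K1_def)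
  have R0: "0 \<le> R0" using M h K1 by (simp add: R0_def)
  have R: "0 \<le> R" using R0 M by (simp add: R_def)
  have r: "0 < r" using \<epsilon> R by (simp add: r_def)
  have rR: "r * R \<le> \<epsilon>"
  proof -
    have "r * R \<le> r * (R + 1)" using r by simp
    also have "\<dots> = \<epsilon>" using R by (simp add: r_def)
    finally show ?thesis .
  qed
  \<comment> \<open>Chosen so that \<open>I0\<^sup>2 / r ^ DIM('a)\<close> is the other half of
    \<open>\<epsilon>\<^sup>2\<close>; an \<open>L^1\<close> norm below \<open>I0\<close> would
    contradict the size of \<open>z\<close>.\<close>
  define I0 where "I0 = sqrt (\<epsilon>\<^sup>2 * r ^ DIM('a) / 2)"
  have I0: "0 < I0" using \<epsilon> r by (simp add: I0_def)
  define \<mu> where "\<mu> = measure lborel \<Omega>"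
  \<comment> \<open>Half of \<open>I0\<close> may come from the additive constant integrated over
    \<open>\<Omega>\<close>; the dissipation must then account for the other half.\<close>
  define \<eta> where "\<eta> = I0 / 2 / (\<mu> + 1)"
  have \<mu>: "0 \<le> \<mu>" by (simp add: \<mu>_def)
  have \<eta>: "0 < \<eta>" using I0 \<mu> by (simp add: \<eta>_def)
  have \<eta>\<mu>: "\<eta> * \<mu> \<le> I0 / 2"
  proof -
    have "\<eta> * \<mu> \<le> \<eta> * (\<mu> + 1)" using \<eta> by simp
    also have "\<dots> = I0 / 2"
      unfolding \<eta>_def by (rule nonzero_eq_divide_eq[THEN iffD1, OF _ refl]) (use \<mu> in simp)
    finally show ?thesis .
  qed
  obtain C where C: "0 \<le> C" "\<And>x. 0 \<le> x \<Longrightarrow> x powr 1 \<le> \<eta> + C * x powr (m + 1)"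
    using powr_le_add_powr[of 1 "m + 1" \<eta>] m \<eta> by auto
  \<comment> \<open>The witness solves \<open>I0 / 2 \<le> C / h * P\<close> for the dissipation
    \<open>P\<close>, with \<open>C + 1\<close> in place of \<open>C\<close> to exclude division by
    0.\<close>
  show thesis
  proof (rule that[of "I0 * h / (2 * (C + 1))"])
    show "0 < I0 * h / (2 * (C + 1))" using I0 h C(1) by simp
    fix w g \<tau>
    assume w: "damped_solution m a \<Omega> w g" and \<tau>: "0 < \<tau>"
      and bd: "\<And>\<sigma>. \<sigma> \<in> {\<tau>..\<tau> + h} \<Longrightarrow> l2norm lborel (w \<sigma>) \<le> M"
      and near: "\<And>\<sigma>. \<sigma> \<in> {\<tau>..\<tau> + h} \<Longrightarrow> l2norm lborel (\<lambda>x. w \<sigma> x - w \<tau> x) \<le> e0"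
      and gi: "(LINT \<sigma>:{\<tau>..\<tau> + h}|lborel. l2norm lborel (g \<sigma>)) \<le> 2"
      and big: "e0 + \<epsilon> < l2norm lborel (w \<tau>)"
    let ?A = "{\<tau>..\<tau> + h}"
    obtain G where lin: "linear_solution \<Omega> w G (\<lambda>t x. a * nl m (w t x) - g t x)"
      using w unfolding damped_solution_def by blast
    have ig: "l2_integrable_on ?A g" using w \<tau> by (simp add: damped_solution_def)
    have out: "x \<notin> \<Omega> \<Longrightarrow> w \<sigma> x = 0" for \<sigma> x using w by (simp add: damped_solution_def)
    have th: "0 < \<tau> + h" using \<tau> h by simp
    note iw = linear_solutionD(8)[OF lin \<tau>, of "\<tau> + h"]
    define z where "z = time_avg h w \<tau>"
    define D where "D i = time_avg h (\<lambda>s x. G s x i) \<tau>" for i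
    define F where "F = (\<lambda>t x. a * nl m (w t x) - g t x)"
    define l where "l x = \<i> * (of_real (1 / h) * (w (\<tau> + h) x - w \<tau> x)) + time_avg h F \<tau> x" for x
    note avg = linear_solution_avg[OF lin \<tau> h, folded z_def F_def, folded D_def l_def]
    have zs: "sq_integrable lborel z" unfolding z_def by (rule sq_integrable_time_avg[OF iw])
    have Ds: "sq_integrable lborel (D i)" if "i \<in> Basis" for i
      unfolding D_def by (rule sq_integrable_time_avg[OF linear_solutionD(3)[OF lin that \<tau>]])
    have iF: "l2_integrable_on ?A F" unfolding F_def by (rule linear_solutionD(4)[OF lin \<tau>])
    note sF = sq_integrable_time_avg[OF iF]
    note wt = damped_solution_sq(1)[OF w \<tau>] and wth = damped_solution_sq(1)[OF w th]
    have ls: "sq_integrable lborel l" unfolding l_def by (intro sq_integrable_add sq_integrable_scale sq_integrable_diff wt wth sF)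
    have zw: "l2norm lborel (\<lambda>x. z x - w \<tau> x) \<le> e0"
      unfolding z_def by (rule l2norm_time_avg_diff[OF iw h wt e0 near])
    have zM: "l2norm lborel z \<le> M"
    proof -
      have "l2norm lborel (\<lambda>x. z x - (\<lambda>_. 0) x) \<le> M"
        unfolding z_def by (rule l2norm_time_avg_diff[OF iw h sq_integrable_zero M]) (simp add: bd)
      then show ?thesis by simp
    qed
    have zbig: "\<epsilon> < l2norm lborel z"
      using l2norm_le_add_diff[OF wt zs] zw big by (simp add: l2norm_minus_commute[of lborel "w \<tau>"])
    have lR: "l2norm lborel l \<le> R0"
    proof -
      have "l2norm lborel l \<le> l2norm lborel (\<lambda>x. \<i> * (of_real (1 / h) * (w (\<tau> + h) x - w \<tau> x))) + l2norm lborel (time_avg h F \<tau>)"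
        unfolding l_def by (rule l2norm_triangle[OF sq_integrable_scale[OF sq_integrable_scale[OF sq_integrable_diff[OF wth wt]]] sF])
      also have "l2norm lborel (\<lambda>x. \<i> * (of_real (1 / h) * (w (\<tau> + h) x - w \<tau> x))) = (1 / h) * l2norm lborel (\<lambda>x. w (\<tau> + h) x - w \<tau> x)"
        unfolding l2norm_scale using h by (simp add: norm_divide)
      also have "l2norm lborel (\<lambda>x. w (\<tau> + h) x - w \<tau> x) \<le> 2 * M"
        using l2norm_triangle_diff[OF wth wt] bd[of "\<tau> + h"] bd[of \<tau>] h by simp
      also have "(1 / h) * (2 * M) = 2 * M / h" by simp
      also have "l2norm lborel (time_avg h F \<tau>) \<le> (1 / h) * (LINT \<sigma>:?A|lborel. l2norm lborel (F \<sigma>))"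
        by (rule l2norm_time_avg[OF iF h])
      also have "(LINT \<sigma>:?A|lborel. l2norm lborel (F \<sigma>)) \<le> (LINT \<sigma>:?A|lborel. cmod a * K1 + l2norm lborel (g \<sigma>))"
        unfolding set_lebesgue_integral_def
      proof (rule integral_mono_AE)
        show "integrable lborel (\<lambda>\<sigma>. indicat_real ?A \<sigma> *\<^sub>R l2norm lborel (F \<sigma>))"
          using iF by (simp add: l2_integrable_on_def set_integrable_def)
        have "set_integrable lborel ?A (\<lambda>\<sigma>. cmod a * K1 + l2norm lborel (g \<sigma>))"
          using ig by (intro set_integral_add(1) set_integrable_const_Icc) (simp add: l2_integrable_on_def)
        then show "integrable lborel (\<lambda>\<sigma>. indicat_real ?A \<sigma> *\<^sub>R (cmod a * K1 + l2norm lborel (g \<sigma>)))"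
          by (simp add: set_integrable_def)
        have "AE \<sigma> in lborel. \<sigma> \<in> ?A \<longrightarrow> sq_integrable lborel (g \<sigma>)" using ig by (simp add: l2_integrable_on_def)
        then show "AE \<sigma> in lborel. indicat_real ?A \<sigma> *\<^sub>R l2norm lborel (F \<sigma>) \<le> indicat_real ?A \<sigma> *\<^sub>R (cmod a * K1 + l2norm lborel (g \<sigma>))"
        proof eventually_elim
          case (elim \<sigma>)
          show ?case
          proof (cases "\<sigma> \<in> ?A")
            case True
            then have p: "0 < \<sigma>" using \<tau> by auto
            note s = damped_solution_sq[OF w p]
            have gs: "sq_integrable lborel (g \<sigma>)" using elim True by blast
            have "(l2norm lborel (\<lambda>x. nl m (w \<sigma> x)))\<^sup>2 \<le> 1 + C1 * (l2norm lborel (w \<sigma>))\<^sup>2"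
              using C1(2)[of "w \<sigma>" "\<lambda>_. 0"] s(1) out by simp
            also have "\<dots> \<le> 1 + C1 * M\<^sup>2"
              using mult_left_mono[OF power_mono[OF bd[OF True] l2norm_nonneg, of 2] C1(1)] by simp
            finally have nlK: "l2norm lborel (\<lambda>x. nl m (w \<sigma> x)) \<le> K1"
              unfolding K1_def by (rule real_le_rsqrt)
            have "l2norm lborel (F \<sigma>) \<le> l2norm lborel (\<lambda>x. a * nl m (w \<sigma> x)) + l2norm lborel (g \<sigma>)"
              unfolding F_def by (rule l2norm_triangle_diff[OF sq_integrable_scale[OF s(2)] gs])
            also have "l2norm lborel (\<lambda>x. a * nl m (w \<sigma> x)) \<le> cmod a * K1"
              unfolding l2norm_scale by (rule mult_left_mono[OF nlK]) simp
            finally show ?thesis using True by simp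
          qed simp
        qed
      qed
      also have "(LINT \<sigma>:?A|lborel. cmod a * K1 + l2norm lborel (g \<sigma>)) = h * (cmod a * K1) + (LINT \<sigma>:?A|lborel. l2norm lborel (g \<sigma>))"
        using set_integral_add(2)[OF set_integrable_const_Icc, of \<tau> "\<tau> + h" "\<lambda>\<sigma>. l2norm lborel (g \<sigma>)" "cmod a * K1"] ig h
        by (simp add: l2_integrable_on_def set_integral_const_Icc)
      finally have "l2norm lborel l \<le> 2 * M / h + (1 / h) * (h * (cmod a * K1) + (LINT \<sigma>:?A|lborel. l2norm lborel (g \<sigma>)))"
        using h by (simp add: divide_right_mono)
      also have "\<dots> \<le> 2 * M / h + (1 / h) * (h * (cmod a * K1) + 2)"
        using gi h by (intro add_left_mono mult_left_mono) auto
      also have "\<dots> = R0" using h by (simp add: R0_def distrib_left)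
      finally show ?thesis .
    qed
    \<comment> \<open>The real part of the Green identity for \<open>z\<close>, bounded by the norms
      of \<open>l\<close> and \<open>z\<close>.\<close>
    have sumD: "(\<Sum>i\<in>Basis. (l2norm lborel (D i))\<^sup>2) \<le> R0 * M"
    proof -
      have "of_real (\<Sum>i\<in>Basis. (l2norm lborel (D i))\<^sup>2) = l2inner lborel l z" using avg(1) by simp
      then have "(\<Sum>i\<in>Basis. (l2norm lborel (D i))\<^sup>2) = Re (l2inner lborel l z)" by (metis Re_complex_of_real)
      also have "\<dots> \<le> cmod (l2inner lborel l z)" by (rule complex_Re_le_cmod)
      also have "\<dots> \<le> l2norm lborel l * l2norm lborel z" by (rule l2_Cauchy_Schwarz[OF ls zs])
      also have "\<dots> \<le> R0 * M" by (rule mult_mono[OF lR zM R0]) simp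
      finally show ?thesis .
    qed
    have DR: "l2norm lborel (D i) \<le> sqrt (R0 * M)" if i: "i \<in> Basis" for i
    proof (rule real_le_rsqrt)
      have "(l2norm lborel (D i))\<^sup>2 \<le> (\<Sum>i\<in>Basis. (l2norm lborel (D i))\<^sup>2)"
        by (rule member_le_sum[OF i]) auto
      then show "(l2norm lborel (D i))\<^sup>2 \<le> R0 * M" using sumD by simp
    qed
    have shift: "l2norm lborel (\<lambda>x. z (x + e) - z x) \<le> r * R" if e: "e \<in> cbox 0 (r *\<^sub>R One)" for e
    proof -
      have ei: "0 \<le> e \<bullet> i" "e \<bullet> i \<le> r" if "i \<in> Basis" for i
        using e that by (auto simp: mem_box inner_Basis)
      have "l2norm lborel (\<lambda>x. z (x + (\<Sum>i\<in>Basis. (e \<bullet> i) *\<^sub>R i)) - z x) \<le> (\<Sum>i\<in>(Basis::'a set). r * sqrt (R0 * M))"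
      proof (rule l2norm_shift_sum_le[OF zs finite_Basis])
        fix i :: 'a assume i: "i \<in> Basis"
        have "l2norm lborel (\<lambda>x. z (x + (e \<bullet> i) *\<^sub>R i) - z x) \<le> (e \<bullet> i) * l2norm lborel (D i)"
          by (rule weak_increments_l2norm_le[OF avg(2)[OF i] zs Ds[OF i] ei(1)[OF i]])
        also have "\<dots> \<le> r * sqrt (R0 * M)"
          by (rule mult_mono[OF ei(2)[OF i] DR[OF i]]) (use r in auto)
        finally show "l2norm lborel (\<lambda>x. z (x + (e \<bullet> i) *\<^sub>R i) - z x) \<le> r * sqrt (R0 * M)" .
      qed
      then show ?thesis by (simp add: mult.left_commute[of r] euclidean_representation R_def)
    qed
    define P where "P = (LINT \<sigma>:?A|lborel. Re (l2inner lborel (\<lambda>x. nl m (w \<sigma> x)) (w \<sigma>)))"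
    have P0: "0 \<le> P"
      unfolding P_def set_lebesgue_integral_def
    proof (rule integral_nonneg_AE, rule AE_I2)
      fix \<sigma> show "0 \<le> indicat_real ?A \<sigma> *\<^sub>R Re (l2inner lborel (\<lambda>x. nl m (w \<sigma> x)) (w \<sigma>))"
        using l2inner_nl_self(2)[OF damped_solution_sq(2,1)[OF w], of \<sigma>] \<tau> by (cases "\<sigma> \<in> ?A") auto
    qed
    define I where "I = \<eta> * \<mu> + C / h * P"
    have I: "0 \<le> I" unfolding I_def using \<eta> \<mu> C(1) h P0 by simp
    have "(\<integral>\<^sup>+x. ennreal (cmod (z x)) \<partial>lborel) \<le> ennreal I"
      unfolding z_def I_def P_def \<mu>_def by (rule time_avg_L1_le[OF w \<tau> h fin' C less_imp_le[OF \<eta>]])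
    from l2norm_le_shift_plus_L1[OF zs r shift this I]
    have "(l2norm lborel z)\<^sup>2 \<le> (r * R)\<^sup>2 / 2 + I\<^sup>2 / r ^ DIM('a)" .
    moreover have "\<epsilon>\<^sup>2 < (l2norm lborel z)\<^sup>2" using zbig \<epsilon> by (intro power_strict_mono) auto
    moreover have "(r * R)\<^sup>2 \<le> \<epsilon>\<^sup>2" using rR r R by (intro power_mono) auto
    ultimately have "\<epsilon>\<^sup>2 / 2 \<le> I\<^sup>2 / r ^ DIM('a)" by linarith
    then have "\<epsilon>\<^sup>2 / 2 * r ^ DIM('a) \<le> I\<^sup>2" using r by (simp add: pos_le_divide_eq)
    then have "I0 \<le> I" unfolding I0_def using I by (intro real_le_lsqrt) auto
    then have "I0 / 2 \<le> C / h * P" using \<eta>\<mu> unfolding I_def by linarith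
    also have "\<dots> \<le> (C + 1) / h * P" using h P0 by (intro mult_right_mono divide_right_mono) auto
    finally have "I0 / 2 * h \<le> (C + 1) * P" unfolding times_divide_eq_left[of "C + 1" h P] pos_le_divide_eq[OF h] .
    then have "I0 * h / 2 \<le> P * (C + 1)" by (simp add: mult.commute)
    then have "I0 * h / 2 / (C + 1) \<le> P" using C(1) by (simp only: pos_divide_le_eq add_nonneg_pos zero_less_one)
    then show "I0 * h / (2 * (C + 1)) \<le> (LINT \<sigma>:?A|lborel. Re (l2inner lborel (\<lambda>x. nl m (w \<sigma> x)) (w \<sigma>)))"
      unfolding P_def divide_divide_eq_left .
  qed
qed

text \<open>Otherwise \<open>L\<close> consecutive windows would each dissipate at least
  \<open>\<kappa>\<close>, against the energy bound on the total. This finds one good time within a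
  stretch of fixed length; it says nothing yet about later times.\<close>

lemma damped_solution_becomes_small:
  fixes h M \<epsilon> e0 :: real
  assumes h: "0 < h" and M: "0 \<le> M" and \<epsilon>: "0 < \<epsilon>" and e0: "0 \<le> e0"
  obtains L :: nat where
    "\<And>w g T. damped_solution m a \<Omega> w g \<Longrightarrow> 0 < T \<Longrightarrow>
      (\<And>\<sigma>. \<sigma> \<in> {T..T + L * h} \<Longrightarrow> l2norm lborel (w \<sigma>) \<le> M) \<Longrightarrow>
      (\<And>\<tau> \<sigma>. T \<le> \<tau> \<Longrightarrow> \<sigma> \<in> {\<tau>..\<tau> + h} \<Longrightarrow> \<sigma> \<le> T + L * h \<Longrightarrow>
        l2norm lborel (\<lambda>x. w \<sigma> x - w \<tau> x) \<le> e0) \<Longrightarrow>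
      (LINT \<sigma>:{T..T + L * h + 1}|lborel. l2norm lborel (g \<sigma>)) \<le> 2 \<Longrightarrow>
      \<exists>\<tau>\<in>{T..T + L * h}. l2norm lborel (w \<tau>) \<le> e0 + \<epsilon>"
proof -
  obtain \<kappa> where \<kappa>: "0 < \<kappa>"
    "\<And>w g \<tau>. damped_solution m a \<Omega> w g \<Longrightarrow> 0 < \<tau> \<Longrightarrow>
      (\<And>\<sigma>. \<sigma> \<in> {\<tau>..\<tau> + h} \<Longrightarrow> l2norm lborel (w \<sigma>) \<le> M) \<Longrightarrow>
      (\<And>\<sigma>. \<sigma> \<in> {\<tau>..\<tau> + h} \<Longrightarrow> l2norm lborel (\<lambda>x. w \<sigma> x - w \<tau> x) \<le> e0) \<Longrightarrow>
      (LINT \<sigma>:{\<tau>..\<tau> + h}|lborel. l2norm lborel (g \<sigma>)) \<le> 2 \<Longrightarrow>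
      e0 + \<epsilon> < l2norm lborel (w \<tau>) \<Longrightarrow>
      \<kappa> \<le> (LINT \<sigma>:{\<tau>..\<tau> + h}|lborel. Re (l2inner lborel (\<lambda>x. nl m (w \<sigma> x)) (w \<sigma>)))"
    by (rule damped_solution_window[OF h M \<epsilon> e0]) auto
  \<comment> \<open>The numerator bounds \<open>2 * Im a\<close> times the total dissipation when
    the forcing has integral at most 2, so \<open>L\<close> windows exceed the budget.\<close>
  obtain L :: nat where L: "(M\<^sup>2 + 4 * M) / (2 * Im a * \<kappa>) < L" using reals_Archimedean2 by blast
  show thesis
  proof (rule that[of L], rule ccontr)
    fix w g T
    assume w: "damped_solution m a \<Omega> w g" and T: "0 < T"
      and bd: "\<And>\<sigma>. \<sigma> \<in> {T..T + L * h} \<Longrightarrow> l2norm lborel (w \<sigma>) \<le> M"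
      and inc: "\<And>\<tau> \<sigma>. T \<le> \<tau> \<Longrightarrow> \<sigma> \<in> {\<tau>..\<tau> + h} \<Longrightarrow> \<sigma> \<le> T + L * h \<Longrightarrow>
        l2norm lborel (\<lambda>x. w \<sigma> x - w \<tau> x) \<le> e0"
      and gi: "(LINT \<sigma>:{T..T + L * h + 1}|lborel. l2norm lborel (g \<sigma>)) \<le> 2"
      and neg: "\<not> (\<exists>\<tau>\<in>{T..T + L * h}. l2norm lborel (w \<tau>) \<le> e0 + \<epsilon>)"
    define P where "P \<sigma> = Re (l2inner lborel (\<lambda>x. nl m (w \<sigma> x)) (w \<sigma>))" for \<sigma>
    have Pc: "continuous_on {T..b} P" for b
      unfolding P_def
      by (intro continuous_on_Re continuous_on_subset[OF l2_continuous_on_continuous_inner[OF damped_solution_continuous(2,1)[OF w]]])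
         (use T in auto)
    have iP: "set_integrable lborel {T..b} P" for b unfolding set_integrable_def by (rule borel_integrable_compact[OF compact_Icc Pc])
    have ig: "set_integrable lborel {T..T + L * h + 1} (\<lambda>\<sigma>. l2norm lborel (g \<sigma>))"
      using w T by (simp add: damped_solution_def l2_integrable_on_def)
    have sum: "k \<le> L \<Longrightarrow> k * \<kappa> \<le> (LINT \<sigma>:{T..T + k * h}|lborel. P \<sigma>)" for k :: nat
    proof (induction k)
      case 0
      have "0 \<le> (LINT \<sigma>:{T..T}|lborel. P \<sigma>)"
        unfolding set_lebesgue_integral_def P_def
        by (intro Bochner_Integration.integral_nonneg) (use l2inner_nl_self(2)[OF damped_solution_sq(2,1)[OF w T]] in \<open>auto simp: indicator_def\<close>)
      then show ?case by simp
    next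
      case (Suc k)
      define \<tau> where "\<tau> = T + k * h"
      have \<tau>: "T \<le> \<tau>" "\<tau> + h = T + Suc k * h" using h by (auto simp: \<tau>_def algebra_simps)
      have le: "\<tau> + h \<le> T + L * h" unfolding \<tau>(2) using Suc(2) h by (intro add_left_mono mult_right_mono) auto
      have "(LINT \<sigma>:{\<tau>..\<tau> + h}|lborel. l2norm lborel (g \<sigma>)) \<le> (LINT \<sigma>:{T..T + L * h + 1}|lborel. l2norm lborel (g \<sigma>))"
        by (rule set_integral_mono_subset[OF ig l2norm_nonneg]) (use \<tau>(1) le in auto)
      then have "\<kappa> \<le> (LINT \<sigma>:{\<tau>..\<tau> + h}|lborel. P \<sigma>)"
        unfolding P_def
      proof (intro \<kappa>(2)[OF w])
        fix \<sigma> assume \<sigma>: "\<sigma> \<in> {\<tau>..\<tau> + h}"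
        then show "l2norm lborel (w \<sigma>) \<le> M" using bd \<tau>(1) le by auto
        show "l2norm lborel (\<lambda>x. w \<sigma> x - w \<tau> x) \<le> e0" using inc[OF \<tau>(1) \<sigma>] \<sigma> le by auto
      next
        have "\<tau> \<in> {T..T + L * h}" using \<tau>(1) le h by auto
        then show "e0 + \<epsilon> < l2norm lborel (w \<tau>)" using neg not_le by blast
      qed (use T \<tau>(1) gi in auto)
      moreover have "(LINT \<sigma>:{T..\<tau>}|lborel. P \<sigma>) + (LINT \<sigma>:{\<tau>..\<tau> + h}|lborel. P \<sigma>) = (LINT \<sigma>:{T..\<tau> + h}|lborel. P \<sigma>)"
        by (rule set_integral_combine_Icc[OF iP]) (use \<tau>(1) h in auto)
      moreover have "k * \<kappa> \<le> (LINT \<sigma>:{T..\<tau>}|lborel. P \<sigma>)" using Suc by (simp add: \<tau>_def)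
      ultimately show ?case unfolding \<tau>(2) by (simp add: distrib_right)
    qed
    have "2 * Im a * (LINT \<sigma>:{T..T + L * h}|lborel. P \<sigma>)
        \<le> M\<^sup>2 + 2 * M * (LINT \<sigma>:{T..T + L * h + 1}|lborel. l2norm lborel (g \<sigma>))"
      unfolding P_def
      by (rule damped_solution_energy[OF w T _ bd]) (use h in auto)
    also have "\<dots> \<le> M\<^sup>2 + 2 * M * 2" using M gi by (intro add_left_mono mult_left_mono) auto
    finally have "2 * Im a * (LINT \<sigma>:{T..T + L * h}|lborel. P \<sigma>) \<le> M\<^sup>2 + 4 * M" by simp
    moreover have "2 * Im a * (L * \<kappa>) \<le> 2 * Im a * (LINT \<sigma>:{T..T + L * h}|lborel. P \<sigma>)"
      using sum[of L] a by (intro mult_left_mono) auto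
    moreover have "M\<^sup>2 + 4 * M < 2 * Im a * (L * \<kappa>)"
      using L \<kappa>(1) a by (simp add: pos_divide_less_eq mult.commute mult.left_commute)
    ultimately show False by linarith
  qed
qed

text \<open>Once a norm is small, \<open>damped_solution_bound\<close> keeps it small, since the
  remaining forcing is at most \<open>\<epsilon>\<close>. Constants: increments at later times are
  at most \<open>\<epsilon> + 4 * \<epsilon>\<close>, so some norm is at most
  \<open>6 * \<epsilon>\<close>, and the forcing adds \<open>2 * \<epsilon>\<close> afterwards. On
  the searched stretch the norms stay below \<open>M + 2\<close> because
  \<open>\<epsilon> \<le> 1\<close>.\<close>

lemma damped_solution_stays_small:
  fixes h M \<epsilon> :: real
  assumes h: "0 < h" "h \<le> 1" and M: "0 \<le> M" and \<epsilon>: "0 < \<epsilon>" "\<epsilon> \<le> 1"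
  obtains L :: nat where
    "\<And>w g T t. damped_solution m a \<Omega> w g \<Longrightarrow> 0 < T \<Longrightarrow> l2norm lborel (w T) \<le> M \<Longrightarrow>
      (\<And>\<delta>. 0 \<le> \<delta> \<Longrightarrow> \<delta> \<le> h \<Longrightarrow> l2norm lborel (\<lambda>x. w (T + \<delta>) x - w T x) \<le> \<epsilon>) \<Longrightarrow>
      T + L * h \<le> t \<Longrightarrow> (LINT \<sigma>:{T..t + 2}|lborel. l2norm lborel (g \<sigma>)) \<le> \<epsilon> \<Longrightarrow>
      l2norm lborel (w t) \<le> 8 * \<epsilon>"
proof -
  have M': "0 \<le> M + 2" and e0: "0 \<le> 5 * \<epsilon>" using M \<epsilon> by auto
  obtain L :: nat where L: "\<And>w g T. damped_solution m a \<Omega> w g \<Longrightarrow> 0 < T \<Longrightarrow>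
      (\<And>\<sigma>. \<sigma> \<in> {T..T + L * h} \<Longrightarrow> l2norm lborel (w \<sigma>) \<le> M + 2) \<Longrightarrow>
      (\<And>\<tau> \<sigma>. T \<le> \<tau> \<Longrightarrow> \<sigma> \<in> {\<tau>..\<tau> + h} \<Longrightarrow> \<sigma> \<le> T + L * h \<Longrightarrow>
        l2norm lborel (\<lambda>x. w \<sigma> x - w \<tau> x) \<le> 5 * \<epsilon>) \<Longrightarrow>
      (LINT \<sigma>:{T..T + L * h + 1}|lborel. l2norm lborel (g \<sigma>)) \<le> 2 \<Longrightarrow>
      \<exists>\<tau>\<in>{T..T + L * h}. l2norm lborel (w \<tau>) \<le> 5 * \<epsilon> + \<epsilon>"
    by (rule damped_solution_becomes_small[OF h(1) M' \<epsilon>(1) e0]) auto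
  show thesis
  proof (rule that[of L])
    fix w g T t
    assume w: "damped_solution m a \<Omega> w g" and T: "0 < T" and wM: "l2norm lborel (w T) \<le> M"
      and inc: "\<And>\<delta>. 0 \<le> \<delta> \<Longrightarrow> \<delta> \<le> h \<Longrightarrow> l2norm lborel (\<lambda>x. w (T + \<delta>) x - w T x) \<le> \<epsilon>"
      and t: "T + L * h \<le> t" and gi: "(LINT \<sigma>:{T..t + 2}|lborel. l2norm lborel (g \<sigma>)) \<le> \<epsilon>"
    have ig: "set_integrable lborel {T..t + 2} (\<lambda>\<sigma>. l2norm lborel (g \<sigma>))"
      using w T by (simp add: damped_solution_def l2_integrable_on_def)
    have g: "(LINT \<sigma>:{\<alpha>..\<beta>}|lborel. l2norm lborel (g \<sigma>)) \<le> \<epsilon>" if "T \<le> \<alpha>" "\<beta> \<le> t + 2" for \<alpha> \<beta>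
      using set_integral_mono_subset[OF ig l2norm_nonneg, of "{\<alpha>..\<beta>}"] gi that by auto
    have "\<exists>\<tau>\<in>{T..T + L * h}. l2norm lborel (w \<tau>) \<le> 5 * \<epsilon> + \<epsilon>"
    proof (rule L[OF w T])
      fix \<sigma> assume "\<sigma> \<in> {T..T + L * h}"
      then show "l2norm lborel (w \<sigma>) \<le> M + 2"
        using damped_solution_bound[OF w T, of \<sigma>] g[of T "\<sigma> + 1"] wM \<epsilon>(2) t by auto
    next
      fix \<tau> \<sigma> assume \<tau>: "T \<le> \<tau>" "\<sigma> \<in> {\<tau>..\<tau> + h}" "\<sigma> \<le> T + L * h"
      have "0 \<le> \<sigma> - \<tau>" using \<tau> by auto
      from damped_solution_increment[OF w T \<tau>(1) this]
      show "l2norm lborel (\<lambda>x. w \<sigma> x - w \<tau> x) \<le> 5 * \<epsilon>"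
        using inc[of "\<sigma> - \<tau>"] g[of T "\<sigma> + 1"] \<tau> t by auto
    next
      show "(LINT \<sigma>:{T..T + L * h + 1}|lborel. l2norm lborel (g \<sigma>)) \<le> 2"
        using g[of T "T + L * h + 1"] t \<epsilon>(2) by simp
    qed
    then obtain \<tau> where \<tau>: "T \<le> \<tau>" "\<tau> \<le> T + L * h" "l2norm lborel (w \<tau>) \<le> 6 * \<epsilon>" by auto
    have "0 < \<tau>" "\<tau> \<le> t" using \<tau> T t by auto
    from damped_solution_bound[OF w this] show "l2norm lborel (w t) \<le> 8 * \<epsilon>"
      using g[of \<tau> "t + 1"] \<tau> by simp
  qed
qed

text \<open>The order of choices matters. \<open>T\<close> makes the tail of \<open>\<gamma>\<close>
  small; one approximation \<open>n0\<close> supplies a length \<open>h\<close> over which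
  \<open>U\<close> changes little after \<open>T\<close>; \<open>h\<close> and the norm of
  \<open>U T\<close> determine \<open>L\<close>. Only then, for each \<open>t\<close> separately, an
  index \<open>n\<close> accurate up to a time beyond \<open>t\<close> is taken, which is harmless
  since \<open>L\<close> is the same for all of them.\<close>

lemma damped_limit_tendsto_0:
  assumes w: "\<And>n. damped_solution m a \<Omega> (w n) (g n)"
    and U: "\<And>t. 0 \<le> t \<Longrightarrow> sq_integrable lebesgue (U t)"
    and conv: "\<And>T \<epsilon>. 0 < T \<Longrightarrow> 0 < \<epsilon> \<Longrightarrow>
      eventually (\<lambda>n. \<forall>t\<in>{0..T}. l2norm lebesgue (\<lambda>x. w n t x - U t x) \<le> \<epsilon>) sequentially"
    and gconv: "\<And>T \<epsilon>. 0 < T \<Longrightarrow> 0 < \<epsilon> \<Longrightarrow> eventually (\<lambda>n. \<forall>s b. 0 < s \<longrightarrow> b < T \<longrightarrow>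
      (LINT \<sigma>:{s..b}|lborel. l2norm lborel (g n \<sigma>)) \<le> \<epsilon> + (LINT \<sigma>:{s..b}|lborel. \<gamma> \<sigma>)) sequentially"
    and \<gamma>: "set_integrable lborel {1..} \<gamma>" "\<And>s. 0 \<le> \<gamma> s"
  shows "((\<lambda>t. l2norm lebesgue (U t)) \<longlongrightarrow> 0) at_top"
proof (rule tendstoI)
  fix e :: real assume e: "0 < e"
  \<comment> \<open>The bound \<open>1 / 5\<close> serves the hypothesis
    \<open>5 * \<epsilon> \<le> 1\<close> of \<open>damped_solution_stays_small\<close>. The final
    error is \<open>8 * (5 * \<epsilon>)\<close> plus another \<open>\<epsilon>\<close>, which is
    below \<open>50 * \<epsilon>\<close>.\<close>
  define \<epsilon> where "\<epsilon> = min (1/5) (e/50)"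
  have \<epsilon>: "0 < \<epsilon>" "5 * \<epsilon> \<le> 1" "50 * \<epsilon> \<le> e" using e by (auto simp: \<epsilon>_def)
  obtain T where T: "1 \<le> T" "\<And>b. T \<le> b \<Longrightarrow> (LINT s:{T..b}|lborel. \<gamma> s) \<le> \<epsilon>"
    by (rule tail_integral_small[OF \<gamma> \<epsilon>(1)]) auto
  have T0: "0 < T" using T(1) by simp
  have wb: "w n t \<in> borel_measurable borel" "sq_integrable lebesgue (w n t)" "l2norm lebesgue (w n t) = l2norm lborel (w n t)" if "0 < t" for n t
  proof -
    have s: "sq_integrable lborel (w n t)" by (rule damped_solution_sq(1)[OF w that])
    then show b: "w n t \<in> borel_measurable borel" by (simp add: sq_integrable_def)
    show "sq_integrable lebesgue (w n t)" "l2norm lebesgue (w n t) = l2norm lborel (w n t)"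
      using s sq_integrable_lebesgue_iff[OF b] l2norm_lebesgue_eq[OF b] by auto
  qed
  have close: "eventually (\<lambda>n. \<forall>t\<in>{0..H}. l2norm lebesgue (\<lambda>x. w n t x - U t x) \<le> \<epsilon>) sequentially" if "0 < H" for H
    by (rule conv[OF that \<epsilon>(1)])
  obtain n0 where n0: "\<And>t. t \<in> {0..T + 3} \<Longrightarrow> l2norm lebesgue (\<lambda>x. w n0 t x - U t x) \<le> \<epsilon>"
    using eventually_happens'[OF sequentially_bot close[of "T + 3"]] T0 by (metis add_pos_pos zero_less_numeral)
  have "((\<lambda>s. l2norm lborel (\<lambda>x. w n0 s x - w n0 T x)) \<longlongrightarrow> 0) (at T within {0<..})"
    by (rule l2_continuous_on_tendsto[OF damped_solution_continuous(1)[OF w]]) (use T0 in auto)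
  from order_tendstoD(2)[OF this \<epsilon>(1)]
  obtain d where d: "0 < d" "\<And>s. s \<in> {0<..} \<Longrightarrow> s \<noteq> T \<Longrightarrow> dist s T < d \<Longrightarrow> l2norm lborel (\<lambda>x. w n0 s x - w n0 T x) < \<epsilon>"
    unfolding eventually_at by blast
  define h where "h = min 1 (d / 2)"
  have h: "0 < h" "h \<le> 1" "h < d" using d(1) by (auto simp: h_def)
  \<comment> \<open>Through \<open>w n0\<close>: two approximation errors and one increment.
    Returning to \<open>w n\<close> adds two more errors, whence the \<open>5 * \<epsilon>\<close>
    below.\<close>
  have Udiff: "l2norm lebesgue (\<lambda>x. U (T + \<delta>) x - U T x) \<le> 3 * \<epsilon>" if \<delta>: "0 \<le> \<delta>" "\<delta> \<le> h" for \<delta>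
  proof (cases "\<delta> = 0")
    case True then show ?thesis using \<epsilon>(1) by (simp add: l2norm_def)
  next
    case False
    have p: "0 < T + \<delta>" using T0 \<delta> by simp
    have "l2norm lebesgue (\<lambda>x. w n0 (T + \<delta>) x - w n0 T x) = l2norm lborel (\<lambda>x. w n0 (T + \<delta>) x - w n0 T x)"
      by (rule l2norm_lebesgue_eq, rule borel_measurable_diff[OF wb(1)[OF p] wb(1)[OF T0]])
    also have "\<dots> \<le> \<epsilon>" using d(2)[of "T + \<delta>"] False \<delta> h p by (auto simp: dist_real_def)
    finally have 1: "l2norm lebesgue (\<lambda>x. w n0 (T + \<delta>) x - w n0 T x) \<le> \<epsilon>" .
    have 2: "l2norm lebesgue (\<lambda>x. U (T + \<delta>) x - w n0 (T + \<delta>) x) \<le> \<epsilon>"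
      using n0[of "T + \<delta>"] T0 \<delta> h(2) by (subst l2norm_minus_commute) auto
    have 3: "l2norm lebesgue (\<lambda>x. w n0 T x - U T x) \<le> \<epsilon>" using n0[of T] T0 by auto
    have UT: "sq_integrable lebesgue (U T)" "sq_integrable lebesgue (U (T + \<delta>))" using U T0 p by auto
    show ?thesis
      using l2norm_triangle3[OF UT(2) wb(2)[OF p, of n0] UT(1)] l2norm_triangle3[OF wb(2)[OF p, of n0] wb(2)[OF T0, of n0] UT(1)] 1 2 3 by linarith
  qed
  \<comment> \<open>The summand 1 leaves room for the approximation error at
    \<open>T\<close>.\<close>
  define M where "M = l2norm lebesgue (U T) + 1"
  have M: "0 \<le> M" by (simp add: M_def l2norm_nonneg)
  have \<epsilon>5: "0 < 5 * \<epsilon>" using \<epsilon> by simp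
  obtain L :: nat where L: "\<And>w g T t. damped_solution m a \<Omega> w g \<Longrightarrow> 0 < T \<Longrightarrow> l2norm lborel (w T) \<le> M \<Longrightarrow>
      (\<And>\<delta>. 0 \<le> \<delta> \<Longrightarrow> \<delta> \<le> h \<Longrightarrow> l2norm lborel (\<lambda>x. w (T + \<delta>) x - w T x) \<le> 5 * \<epsilon>) \<Longrightarrow>
      T + L * h \<le> t \<Longrightarrow> (LINT \<sigma>:{T..t + 2}|lborel. l2norm lborel (g \<sigma>)) \<le> 5 * \<epsilon> \<Longrightarrow>
      l2norm lborel (w t) \<le> 8 * (5 * \<epsilon>)"
    by (rule damped_solution_stays_small[OF h(1,2) M \<epsilon>5 \<epsilon>(2)]) auto
  have "l2norm lebesgue (U t) < e" if t: "T + L * h \<le> t" for t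
  proof -
    have "0 \<le> L * h" using h by simp
    then have Tt: "T \<le> t" "0 < t" "0 < t + 3" using t T0 by linarith+
    obtain n where n: "\<And>\<sigma>. \<sigma> \<in> {0..t + 3} \<Longrightarrow> l2norm lebesgue (\<lambda>x. w n \<sigma> x - U \<sigma> x) \<le> \<epsilon>"
        "\<And>s b. 0 < s \<Longrightarrow> b < t + 3 \<Longrightarrow> (LINT \<sigma>:{s..b}|lborel. l2norm lborel (g n \<sigma>)) \<le> \<epsilon> + (LINT \<sigma>:{s..b}|lborel. \<gamma> \<sigma>)"
      using eventually_happens'[OF sequentially_bot eventually_conj[OF close[OF Tt(3)] gconv[OF Tt(3) \<epsilon>(1)]]] by blast
    have nT: "l2norm lebesgue (\<lambda>x. w n T x - U T x) \<le> \<epsilon>" using n(1)[of T] T0 Tt by auto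
    have UT: "sq_integrable lebesgue (U T)" using U T0 by auto
    have "l2norm lborel (w n t) \<le> 8 * (5 * \<epsilon>)"
    proof (rule L[OF w T0 _ _ t])
      show "l2norm lborel (w n T) \<le> M"
        using l2norm_le_add_diff[OF wb(2)[OF T0, of n] UT] nT \<epsilon> unfolding wb(3)[OF T0] M_def by linarith
      have "(LINT \<sigma>:{T..t + 2}|lborel. l2norm lborel (g n \<sigma>)) \<le> \<epsilon> + (LINT \<sigma>:{T..t + 2}|lborel. \<gamma> \<sigma>)"
        by (rule n(2)[OF T0]) simp
      then show "(LINT \<sigma>:{T..t + 2}|lborel. l2norm lborel (g n \<sigma>)) \<le> 5 * \<epsilon>"
        using T(2)[of "t + 2"] Tt \<epsilon> by simp
      fix \<delta> assume \<delta>: "0 \<le> \<delta>" "\<delta> \<le> h"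
      have p: "0 < T + \<delta>" using T0 \<delta> by simp
      have U\<delta>: "sq_integrable lebesgue (U (T + \<delta>))" using U p by auto
      have 1: "l2norm lebesgue (\<lambda>x. w n (T + \<delta>) x - U (T + \<delta>) x) \<le> \<epsilon>"
        using n(1)[of "T + \<delta>"] p \<delta> h Tt by auto
      have 2: "l2norm lebesgue (\<lambda>x. U T x - w n T x) \<le> \<epsilon>" using nT by (subst l2norm_minus_commute)
      have "l2norm lborel (\<lambda>x. w n (T + \<delta>) x - w n T x) = l2norm lebesgue (\<lambda>x. w n (T + \<delta>) x - w n T x)"
        by (rule l2norm_lebesgue_eq[symmetric], rule borel_measurable_diff[OF wb(1)[OF p] wb(1)[OF T0]])
      then show "l2norm lborel (\<lambda>x. w n (T + \<delta>) x - w n T x) \<le> 5 * \<epsilon>"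
        using l2norm_triangle3[OF wb(2)[OF p, of n] U\<delta> wb(2)[OF T0, of n]] l2norm_triangle3[OF U\<delta> UT wb(2)[OF T0, of n]]
          1 2 Udiff[OF \<delta>] by linarith
    qed
    moreover have "l2norm lebesgue (\<lambda>x. U t x - w n t x) \<le> \<epsilon>"
      using n(1)[of t] Tt by (subst l2norm_minus_commute) auto
    ultimately show ?thesis
      using l2norm_le_add_diff[OF U[OF less_imp_le[OF Tt(2)]] wb(2)[OF Tt(2), of n]] \<epsilon> unfolding wb(3)[OF Tt(2)] by linarith
  qed
  then show "eventually (\<lambda>t. dist (l2norm lebesgue (U t)) 0 < e) at_top"
    unfolding eventually_at_top_linorder by (intro exI[of _ "T + L * h"]) (auto simp: l2norm_nonneg)
qed

end

text \<open>The p-th power is pointwise at most a small constant plus a multiple of the square;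
  finite measure makes the constant integrable, and its integral is made small before time is sent
  to infinity.\<close>

lemma Lnorm_tendsto_0_of_L2:
  fixes \<Omega> :: "'a::euclidean_space set"
  assumes \<Omega>: "open \<Omega>" and fin: "emeasure lebesgue \<Omega> < \<infinity>" and p: "0 < p" "p \<le> 2"
    and sq: "\<And>t. 0 \<le> t \<Longrightarrow> sq_integrable lebesgue (zext \<Omega> (u t))"
    and lim: "((\<lambda>t::real. l2norm lebesgue (zext \<Omega> (u t))) \<longlongrightarrow> 0) at_top"
  shows "((\<lambda>t. Lnorm \<Omega> p (u t)) \<longlongrightarrow> 0) at_top"
proof (rule order_tendstoI)
  fix c :: ennreal assume "0 < c"
  then obtain c' where c': "0 < c'" "c' < c" using dense by blast
  obtain r where r: "0 < r" "ennreal r < c" using c' by (cases c') auto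
  define \<mu> where "\<mu> = measure lebesgue \<Omega>"
  have \<mu>: "0 \<le> \<mu>" by (simp add: \<mu>_def)
  \<comment> \<open>Half of \<open>r powr p\<close> is spent on the constant integrated over
    \<open>\<Omega>\<close>, the other half on the \<open>L^2\<close> norm.\<close>
  define \<eta> where "\<eta> = r powr p / 2 / (\<mu> + 1)"
  have rp: "0 < r powr p" using r by simp
  have \<eta>: "0 < \<eta>" using rp \<mu> by (simp add: \<eta>_def)
  have \<eta>\<mu>: "\<eta> * \<mu> \<le> r powr p / 2"
  proof -
    have "\<eta> * \<mu> \<le> \<eta> * (\<mu> + 1)" using \<eta> by simp
    also have "\<dots> = r powr p / 2"
      unfolding \<eta>_def by (rule nonzero_eq_divide_eq[THEN iffD1, OF _ refl]) (use \<mu> in simp)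
    finally show ?thesis .
  qed
  obtain C where C: "0 \<le> C" "\<And>x. 0 \<le> x \<Longrightarrow> x powr p \<le> \<eta> + C * x powr 2"
    using powr_le_add_powr[OF p \<eta>] by auto
  have "((\<lambda>t. C * (l2norm lebesgue (zext \<Omega> (u t)))\<^sup>2) \<longlongrightarrow> C * 0\<^sup>2) at_top" by (intro tendsto_intros lim)
  then have "eventually (\<lambda>t. C * (l2norm lebesgue (zext \<Omega> (u t)))\<^sup>2 < r powr p / 2) at_top"
    by (rule order_tendstoD(2)) (use r in simp)
  then show "eventually (\<lambda>t. Lnorm \<Omega> p (u t) < c) at_top"
    using eventually_ge_at_top[of 0]
  proof eventually_elim
    case (elim t)
    note s = sq[OF elim(2)]
    have [measurable]: "zext \<Omega> (u t) \<in> borel_measurable lebesgue" using s by (simp add: sq_integrable_def)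
    have O [measurable]: "\<Omega> \<in> sets lebesgue" using \<Omega> by (auto simp: borel_open)
    have "Lpow \<Omega> p (u t) \<le> (\<integral>\<^sup>+x. ennreal \<eta> * indicator \<Omega> x + ennreal C * ennreal ((cmod (zext \<Omega> (u t) x))\<^sup>2) \<partial>lebesgue)"
      unfolding Lpow_def
    proof (rule nn_integral_mono)
      fix x
      show "ennreal (cmod (u t x) powr p) * indicator \<Omega> x
          \<le> ennreal \<eta> * indicator \<Omega> x + ennreal C * ennreal ((cmod (zext \<Omega> (u t) x))\<^sup>2)"
      proof (cases "x \<in> \<Omega>")
        case True
        have "ennreal (cmod (u t x) powr p) \<le> ennreal (\<eta> + C * cmod (u t x) powr 2)"
          using C(2)[of "cmod (u t x)"] by (intro ennreal_leI) simp
        also have "\<dots> = ennreal \<eta> + ennreal C * ennreal ((cmod (u t x))\<^sup>2)"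
          using \<eta> C(1) by (simp add: ennreal_plus ennreal_mult)
        finally show ?thesis using True by (simp add: zext_def)
      qed simp
    qed
    also have "\<dots> = (\<integral>\<^sup>+x. ennreal \<eta> * indicator \<Omega> x \<partial>lebesgue)
        + (\<integral>\<^sup>+x. ennreal C * ennreal ((cmod (zext \<Omega> (u t) x))\<^sup>2) \<partial>lebesgue)"
      by (rule nn_integral_add) measurable
    also have "(\<integral>\<^sup>+x. ennreal \<eta> * indicator \<Omega> x \<partial>lebesgue) = ennreal (\<eta> * \<mu>)"
      using fin \<eta> O by (simp add: nn_integral_cmult_indicator emeasure_eq_ennreal_measure less_top ennreal_mult \<mu>_def)
    also have "(\<integral>\<^sup>+x. ennreal C * ennreal ((cmod (zext \<Omega> (u t) x))\<^sup>2) \<partial>lebesgue)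
        = ennreal C * (\<integral>\<^sup>+x. ennreal ((cmod (zext \<Omega> (u t) x))\<^sup>2) \<partial>lebesgue)"
      by (rule nn_integral_cmult) measurable
    also have "(\<integral>\<^sup>+x. ennreal ((cmod (zext \<Omega> (u t) x))\<^sup>2) \<partial>lebesgue) = ennreal ((l2norm lebesgue (zext \<Omega> (u t)))\<^sup>2)"
      by (rule sq_integrable_nn[OF s])
    also have "ennreal (\<eta> * \<mu>) + ennreal C * ennreal ((l2norm lebesgue (zext \<Omega> (u t)))\<^sup>2)
        = ennreal (\<eta> * \<mu> + C * (l2norm lebesgue (zext \<Omega> (u t)))\<^sup>2)"
      using \<eta> \<mu> C(1) by (simp add: ennreal_plus ennreal_mult)
    also have "\<dots> \<le> ennreal (r powr p)" using \<eta>\<mu> elim(1) by (intro ennreal_leI) simp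
    finally have "Lnorm \<Omega> p (u t) \<le> epow (ennreal (r powr p)) (1 / p)"
      unfolding Lnorm_def using p by (intro epow_mono) auto
    also have "\<dots> = ennreal r" using r p by (simp add: epow_def powr_powr)
    finally show ?case using r(2) by (rule le_less_trans)
  qed
qed simp

section \<open>Transfer of the decay from the approximating solutions to the weak solution\<close>

theorem theorem3p6:
  fixes \<Omega> :: "'a::euclidean_space set"
    and m :: real and a :: complex
    and u0 :: "'a \<Rightarrow> complex"
    and f u :: "real \<Rightarrow> 'a \<Rightarrow> complex"
  assumes "open \<Omega>" and "\<Omega> \<noteq> {}"
    and "0 < m" and "m \<le> 1"
    and "Im a > 0"
    and "m < 1 \<Longrightarrow> 2 * sqrt m * Im a \<ge> (1 - m) * \<bar>Re a\<bar> \<and> emeasure lebesgue \<Omega> < \<infinity>"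
    and "memL \<Omega> 2 u0"
    and "L1_L2 \<Omega> f"
    and "weak_solution m a \<Omega> f u0 u"
  shows "\<forall>p. 0 < p \<and> p \<le> 2 \<and> (p = 2 \<or> m < 1 \<or> emeasure lebesgue \<Omega> < \<infinity>) \<longrightarrow>
           ((\<lambda>t. Lnorm \<Omega> p (u t)) \<longlongrightarrow> 0) at_top"
proof -
  note \<Omega> = \<open>open \<Omega>\<close>
  have leb: "emeasure lebesgue \<Omega> = emeasure lborel \<Omega>" using \<Omega> by (simp add: borel_open)
  have fin: "emeasure lborel \<Omega> < \<infinity>" if "m < 1" using assms(6)[OF that] leb by simp
  \<comment> \<open>For \<open>m = 1\<close> the left side is 0, so the inequality is available in
    both cases.\<close>
  have cond: "(1 - m) * \<bar>Re a\<bar> \<le> 2 * sqrt m * Im a"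
  proof (cases "m < 1")
    case True then show ?thesis using assms(6) by blast
  next
    case False then show ?thesis using assms(4,5) by simp
  qed
  obtain fn un where sol: "\<And>n. L1loc_L2 \<Omega> (fn n)" "\<And>n. C_L2 \<Omega> (un n)" "\<And>n. H2_solution m a \<Omega> (fn n) (un n)"
    and fn: "\<And>T. 0 < T \<Longrightarrow> (\<lambda>n. \<integral>\<^sup>+ t\<in>{0<..<T}. Lnorm \<Omega> 2 (\<lambda>x. fn n t x - f t x) \<partial>lborel) \<longlonglongrightarrow> 0"
    and un: "\<And>T. 0 < T \<Longrightarrow> (\<lambda>n. SUP t\<in>{0..T}. Lnorm \<Omega> 2 (\<lambda>x. un n t x - u t x)) \<longlonglongrightarrow> 0"
    using assms(9) unfolding weak_solution_def by blast
  have um: "u t \<in> borel_measurable lebesgue" if "0 \<le> t" for t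
    using assms(9) that unfolding weak_solution_def by blast
  have jf: "jmeas f" and ff: "(\<integral>\<^sup>+ t\<in>{0<..}. Lnorm \<Omega> 2 (f t) \<partial>lborel) < \<infinity>"
    using assms(8) by (auto simp: L1_L2_def)
  have ju: "jmeas (un n)" and jfn: "jmeas (fn n)" for n
    using sol(1,3)[of n] by (auto simp: H2_solution_def L1loc_L2_def)
  define U where "U t = zext \<Omega> (u t)" for t
  define w where "w n t = zext \<Omega> (un n t)" for n t
  define g where "g n t = zext \<Omega> (fn n t)" for n t
  define \<gamma> where "\<gamma> t = l2norm lborel (zext \<Omega> (f t))" for t
  have damped: "damped_solution m a \<Omega> (w n) (g n)" for n
    unfolding damped_solution_def
  proof (intro conjI allI impI)
    show "\<exists>G. linear_solution \<Omega> (w n) G (\<lambda>t x. a * nl m (w n t x) - g n t x)"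
      unfolding w_def g_def by (rule H2_solution_imp_linear_solution[OF \<Omega> assms(3,4) fin sol(3,2,1)])
    show "x \<notin> \<Omega> \<Longrightarrow> w n t x = 0" for t x unfolding w_def by (rule zext_outside)
    show "l2_integrable_on {\<alpha>..\<beta>} (g n)" if "0 < \<alpha>" for \<alpha> \<beta>
      unfolding g_def by (rule L1loc_L2_integrable[OF \<Omega> sol(1) that])
  qed
  have w: "w n t \<in> borel_measurable lebesgue" "0 \<le> t \<Longrightarrow> sq_integrable lebesgue (w n t)" for n t
  proof -
    have b: "w n t \<in> borel_measurable borel" unfolding w_def by (rule zext_borel[OF \<Omega> jmeas_section[OF ju]])
    then show "w n t \<in> borel_measurable lebesgue" by (intro measurable_completion) simp
    show "sq_integrable lebesgue (w n t)" if "0 \<le> t"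
      using l2_continuous_on_sq[OF C_L2_l2_continuous[OF \<Omega> ju sol(2)], of t] that
      unfolding sq_integrable_lebesgue_iff[OF b] by (simp add: w_def)
  qed
  \<comment> \<open>The extended-real \<open>Lnorm\<close> is converted to the real
    \<open>l2norm\<close> only where it is finite. The \<open>lebesgue\<close> version appears
    because \<open>u t\<close> is only assumed Lebesgue measurable.\<close>
  have diff: "sq_integrable lebesgue (\<lambda>x. w n t x - U t x)"
      "Lnorm \<Omega> 2 (\<lambda>x. un n t x - u t x) = ennreal (l2norm lebesgue (\<lambda>x. w n t x - U t x))"
    if "0 \<le> t" "Lnorm \<Omega> 2 (\<lambda>x. un n t x - u t x) < \<infinity>" for n t
  proof -
    have e: "zext \<Omega> (\<lambda>x. un n t x - u t x) = (\<lambda>x. w n t x - U t x)" by (simp add: zext_diff w_def U_def)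
    have "sq_integrable lebesgue (zext \<Omega> (\<lambda>x. un n t x - u t x))"
    proof (rule sq_integrable_zextI[OF _ that(2)])
      show "zext \<Omega> (\<lambda>x. un n t x - u t x) \<in> borel_measurable lebesgue"
        unfolding e U_def by (rule borel_measurable_diff[OF w(1) zext_lebesgue[OF \<Omega> um[OF that(1)]]])
    qed
    from this Lnorm_2_eq[OF this] show "sq_integrable lebesgue (\<lambda>x. w n t x - U t x)"
      "Lnorm \<Omega> 2 (\<lambda>x. un n t x - u t x) = ennreal (l2norm lebesgue (\<lambda>x. w n t x - U t x))"
      unfolding e by auto
  qed
  have close: "eventually (\<lambda>n. \<forall>t\<in>{0..T}. Lnorm \<Omega> 2 (\<lambda>x. un n t x - u t x) \<le> ennreal \<epsilon>) sequentially"
    if T: "0 < T" and \<epsilon>: "0 < \<epsilon>" for T \<epsilon>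
    using order_tendstoD(2)[OF un[OF T], of "ennreal \<epsilon>"] \<epsilon>
  proof (simp, elim eventually_mono)
    fix n assume n: "(SUP t\<in>{0..T}. Lnorm \<Omega> 2 (\<lambda>x. un n t x - u t x)) < ennreal \<epsilon>"
    show "\<forall>t\<in>{0..T}. Lnorm \<Omega> 2 (\<lambda>x. un n t x - u t x) \<le> ennreal \<epsilon>"
      using order_trans[OF SUP_upper less_imp_le[OF n]] by blast
  qed
  \<comment> \<open>\<open>u t\<close> differs from some \<open>un n t\<close> by a function of
    finite norm.\<close>
  have Usq: "sq_integrable lebesgue (U t)" if t: "0 \<le> t" for t
  proof -
    obtain n where "\<forall>s\<in>{0..t + 1}. Lnorm \<Omega> 2 (\<lambda>x. un n s x - u s x) \<le> ennreal 1"
      using eventually_happens'[OF sequentially_bot close[of "t + 1" 1]] t by auto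
    then have "Lnorm \<Omega> 2 (\<lambda>x. un n t x - u t x) \<le> ennreal 1" using t by simp
    then have "Lnorm \<Omega> 2 (\<lambda>x. un n t x - u t x) < \<infinity>" by (rule le_less_trans) simp
    from sq_integrable_diff[OF w(2)[OF t, of n] diff(1)[OF t this]] show ?thesis by simp
  qed
  have \<gamma>: "set_integrable lborel {1..} \<gamma>" "0 \<le> \<gamma> s" for s
  proof -
    have "l2_integrable_on {0<..} (\<lambda>t. zext \<Omega> (f t))" by (rule l2_integrable_on_zext(1)[OF \<Omega> jf _ ff]) simp
    then have "set_integrable lborel {0<..} \<gamma>" by (simp add: l2_integrable_on_def \<gamma>_def[abs_def])
    then show "set_integrable lborel {1..} \<gamma>" by (rule set_integrable_subset) auto
    show "0 \<le> \<gamma> s" by (simp add: \<gamma>_def l2norm_nonneg)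
  qed
  have lim: "((\<lambda>t. l2norm lebesgue (U t)) \<longlongrightarrow> 0) at_top"
  proof (rule damped_limit_tendsto_0[where \<Omega>=\<Omega> and m=m and a=a and w=w and g=g and U=U and \<gamma>=\<gamma>])
    fix T \<epsilon> :: real assume T: "0 < T" and \<epsilon>: "0 < \<epsilon>"
    show "eventually (\<lambda>n. \<forall>t\<in>{0..T}. l2norm lebesgue (\<lambda>x. w n t x - U t x) \<le> \<epsilon>) sequentially"
      using close[OF T \<epsilon>]
    proof (elim eventually_mono, intro ballI)
      fix n t assume n: "\<forall>t\<in>{0..T}. Lnorm \<Omega> 2 (\<lambda>x. un n t x - u t x) \<le> ennreal \<epsilon>" and t: "t \<in> {0..T}"
      then have le: "Lnorm \<Omega> 2 (\<lambda>x. un n t x - u t x) \<le> ennreal \<epsilon>" by blast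
      then have "Lnorm \<Omega> 2 (\<lambda>x. un n t x - u t x) < \<infinity>" by (rule le_less_trans) simp
      from diff(2)[OF _ this] t le show "l2norm lebesgue (\<lambda>x. w n t x - U t x) \<le> \<epsilon>" using \<epsilon> by simp
    qed
    have "eventually (\<lambda>n. (\<integral>\<^sup>+ t\<in>{0<..<T}. Lnorm \<Omega> 2 (\<lambda>x. fn n t x - f t x) \<partial>lborel) < ennreal \<epsilon>) sequentially"
      by (rule order_tendstoD(2)[OF fn[OF T]]) (use \<epsilon> in simp)
    then show "eventually (\<lambda>n. \<forall>s b. 0 < s \<longrightarrow> b < T \<longrightarrow>
      (LINT \<sigma>:{s..b}|lborel. l2norm lborel (g n \<sigma>)) \<le> \<epsilon> + (LINT \<sigma>:{s..b}|lborel. \<gamma> \<sigma>)) sequentially"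
    proof (elim eventually_mono, intro allI impI)
      fix n and s b :: real
      assume n: "(\<integral>\<^sup>+ t\<in>{0<..<T}. Lnorm \<Omega> 2 (\<lambda>x. fn n t x - f t x) \<partial>lborel) < ennreal \<epsilon>" and s: "0 < s" and b: "b < T"
      \<comment> \<open>The norm of the approximating forcing exceeds that of \<open>f\<close> by at
        most the norm of the error \<open>d\<close>, whose integral over \<open>{0<..<T}\<close> is
        at most \<open>\<epsilon>\<close>.\<close>
      define d where "d t = zext \<Omega> (\<lambda>x. fn n t x - f t x)" for t
      have jd: "jmeas (\<lambda>t x. fn n t x - f t x)"
        by (rule jmeas_diff[OF jfn jf])
      have nT: "(\<integral>\<^sup>+ t\<in>{0<..<T}. Lnorm \<Omega> 2 (\<lambda>x. fn n t x - f t x) \<partial>lborel) < \<infinity>"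
        using n by (rule less_trans) simp
      have id: "l2_integrable_on {0<..<T} d"
        unfolding d_def by (rule l2_integrable_on_zext(1)[OF \<Omega> jd _ nT]) simp
      have "ennreal (LINT t:{0<..<T}|lborel. l2norm lborel (d t)) < ennreal \<epsilon>"
        unfolding d_def by (subst l2_integrable_on_zext(2)[OF \<Omega> jd _ nT]) (use n in simp_all)
      then have d\<epsilon>: "(LINT t:{0<..<T}|lborel. l2norm lborel (d t)) \<le> \<epsilon>"
        using ennreal_le_iff[OF less_imp_le[OF \<epsilon>]] less_imp_le by blast
      have iT: "set_integrable lborel {0<..<T} (\<lambda>t. l2norm lborel (d t))" using id by (simp add: l2_integrable_on_def)
      have idI: "set_integrable lborel {s..b} (\<lambda>t. l2norm lborel (d t))"
        by (rule set_integrable_subset[OF iT]) (use s b in auto)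
      have "l2_integrable_on {0<..} (\<lambda>t. zext \<Omega> (f t))" by (rule l2_integrable_on_zext(1)[OF \<Omega> jf _ ff]) simp
      then have f1: "l2_integrable_on {s..b} (\<lambda>t. zext \<Omega> (f t))" by (rule l2_integrable_on_subset) (use s in auto)
      then have iI: "set_integrable lborel {s..b} \<gamma>" by (simp add: l2_integrable_on_def \<gamma>_def[abs_def])
      have g1: "l2_integrable_on {s..b} (g n)" using damped[of n] s by (simp add: damped_solution_def)
      have "(LINT \<sigma>:{s..b}|lborel. l2norm lborel (g n \<sigma>)) \<le> (LINT \<sigma>:{s..b}|lborel. l2norm lborel (d \<sigma>) + \<gamma> \<sigma>)"
        unfolding set_lebesgue_integral_def
      proof (rule integral_mono_AE)
        show "integrable lborel (\<lambda>\<sigma>. indicat_real {s..b} \<sigma> *\<^sub>R l2norm lborel (g n \<sigma>))"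
          using g1 by (simp add: l2_integrable_on_def set_integrable_def)
        show "integrable lborel (\<lambda>\<sigma>. indicat_real {s..b} \<sigma> *\<^sub>R (l2norm lborel (d \<sigma>) + \<gamma> \<sigma>))"
          using set_integral_add(1)[OF idI iI] by (simp add: set_integrable_def)
        show "AE \<sigma> in lborel. indicat_real {s..b} \<sigma> *\<^sub>R l2norm lborel (g n \<sigma>)
            \<le> indicat_real {s..b} \<sigma> *\<^sub>R (l2norm lborel (d \<sigma>) + \<gamma> \<sigma>)"
          using f1[unfolded l2_integrable_on_def, THEN conjunct2, THEN conjunct1]
            g1[unfolded l2_integrable_on_def, THEN conjunct2, THEN conjunct1]
        proof eventually_elim
          case (elim \<sigma>)
          show ?case
          proof (cases "\<sigma> \<in> {s..b}")
            case True
            then have "sq_integrable lborel (zext \<Omega> (f \<sigma>))" "sq_integrable lborel (g n \<sigma>)" using elim by blast+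
            from l2norm_le_add_diff[OF this(2,1)] True show ?thesis
              by (simp add: \<gamma>_def d_def g_def zext_diff)
          qed simp
        qed
      qed
      also have "\<dots> = (LINT \<sigma>:{s..b}|lborel. l2norm lborel (d \<sigma>)) + (LINT \<sigma>:{s..b}|lborel. \<gamma> \<sigma>)"
        by (rule set_integral_add(2)[OF idI iI])
      also have "(LINT \<sigma>:{s..b}|lborel. l2norm lborel (d \<sigma>)) \<le> (LINT \<sigma>:{0<..<T}|lborel. l2norm lborel (d \<sigma>))"
        by (rule set_integral_mono_subset[OF iT l2norm_nonneg]) (use s b in auto)
      also note d\<epsilon>
      finally show "(LINT \<sigma>:{s..b}|lborel. l2norm lborel (g n \<sigma>)) \<le> \<epsilon> + (LINT \<sigma>:{s..b}|lborel. \<gamma> \<sigma>)" by simp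
    qed
  qed (use \<Omega> assms(3-5) fin cond damped Usq \<gamma> in auto)
  show ?thesis
  proof (intro allI impI)
    fix p :: real assume p: "0 < p \<and> p \<le> 2 \<and> (p = 2 \<or> m < 1 \<or> emeasure lebesgue \<Omega> < \<infinity>)"
    show "((\<lambda>t. Lnorm \<Omega> p (u t)) \<longlongrightarrow> 0) at_top"
    proof (cases "p = 2")
      case True
      have "((\<lambda>t. ennreal (l2norm lebesgue (U t))) \<longlongrightarrow> ennreal 0) at_top" by (rule tendsto_ennrealI[OF lim])
      moreover have "eventually (\<lambda>t. ennreal (l2norm lebesgue (U t)) = Lnorm \<Omega> p (u t)) at_top"
        using eventually_ge_at_top[of 0]
      proof eventually_elim
        case (elim t)
        show ?case unfolding U_def True by (rule Lnorm_2_eq[OF Usq[OF elim, unfolded U_def], symmetric])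
      qed
      ultimately have "((\<lambda>t. Lnorm \<Omega> p (u t)) \<longlongrightarrow> ennreal 0) at_top" by (rule Lim_transform_eventually)
      then show ?thesis by simp
    next
      case False
      then have "emeasure lebesgue \<Omega> < \<infinity>" using p fin leb by auto
      then show ?thesis
        using Lnorm_tendsto_0_of_L2[OF \<Omega> _ _ _ Usq[unfolded U_def] lim[unfolded U_def]] p by blast
    qed
  qed
qed

end
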